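(* Assume there is an algorithm $\mathcal{A}$ which, given any real matrix $M$ (with any number $m$ of rows and $d$ columns) and a rank $k$, returns $Z \in \mathbb{R}^{m \times k}$ with orthonormal columns such that $\|MM^T - ZZ^TMM^T\|_F^2 \le \Delta_1\|MM^T - (MM^T)_k\|_F^2$, in time $T(M,k)$, for some approximation factor $\Delta_1$. For any $A \in \mathbb{R}^{n \times d}$ and $C \in \mathbb{R}^{d \times k}$, each with integer entries in $[-\Delta_2,\Delta_2]$, let $B = [A^T, wC]^T$ where $w = 3\sqrt{\Delta_1}\,\Delta_2^2\, nd$. Then it is possible to compute the product $AC$ in time $T(B,2k) + \tilde O((n+d)k^{\omega-1})$.
   Context: $\|\cdot\|_F$ is the Frobenius norm, $X_k$ a best rank-$k$ approximation of $X$ in Frobenius norm, $\omega < 2.373$ the exponent of fast matrix multiplication, and $\tilde O$ hides polylogarithmic factors. Computation is in the real RAM model. *)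

theory Defs
  imports Complex_Main "Jordan_Normal_Form.Matrix" "Jordan_Normal_Form.DL_Rank"
begin

section \<open>Frobenius norm and best low-rank approximation\<close>

definition frob_norm :: "real mat \<Rightarrow> real" where
  "frob_norm X = sqrt (\<Sum>i<dim_row X. \<Sum>j<dim_col X. (X $$ (i, j))\<^sup>2)"

definition mat_rank :: "real mat \<Rightarrow> nat" where
  "mat_rank X = vec_space.rank (dim_row X) X"

definition best_rank_approx :: "nat \<Rightarrow> real mat \<Rightarrow> real mat \<Rightarrow> bool" where
  "best_rank_approx k X Y \<longleftrightarrow>
     Y \<in> carrier_mat (dim_row X) (dim_col X) \<and> mat_rank Y \<le> k \<and>
     (\<forall>Y' \<in> carrier_mat (dim_row X) (dim_col X). mat_rank Y' \<le> k \<longrightarrow>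
        frob_norm (X - Y) \<le> frob_norm (X - Y'))"

definition append_cols :: "real mat \<Rightarrow> real mat \<Rightarrow> real mat" where
  "append_cols X Y = four_block_mat X Y (0\<^sub>m 0 (dim_col X)) (0\<^sub>m 0 (dim_col Y))"


section \<open>The real RAM\<close>

text \<open>
  A program works on integer variables and on arrays.  Every array name owns a two-dimensional
  integer array and a two-dimensional real array.  Integers serve as addresses and counters: they
  can be added, subtracted and halved, but not multiplied.  On reals there are
  exact arithmetic, square roots, comparisons and arbitrary machine constants.  There is no floor
  operation, nor any other direct conversion from reals to integers.  (Division by zero and
  square roots of negative numbers take the values that HOL gives them.)
\<close>

record store =
  ivar :: "nat \<Rightarrow> int"
  iarr :: "nat \<Rightarrow> int \<Rightarrow> int \<Rightarrow> int"
  rarr :: "nat \<Rightarrow> int \<Rightarrow> int \<Rightarrow> real"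

datatype iexp =
    IConst int
  | IVar nat
  | ICell nat iexp iexp
  | IAdd iexp iexp
  | ISub iexp iexp
  | IHalf iexp

datatype rexp =
    RConst real
  | RInt iexp
  | RCell nat iexp iexp
  | RAdd rexp rexp
  | RSub rexp rexp
  | RMul rexp rexp
  | RDiv rexp rexp
  | RSqrt rexp

datatype bexp =
    ILe iexp iexp
  | RLe rexp rexp
  | BNot bexp
  | BAnd bexp bexp

primrec ival :: "iexp \<Rightarrow> store \<Rightarrow> int" where
  "ival (IConst c) s = c"
| "ival (IVar x) s = ivar s x"
| "ival (ICell a e f) s = iarr s a (ival e s) (ival f s)"
| "ival (IAdd e f) s = ival e s + ival f s"
| "ival (ISub e f) s = ival e s - ival f s"
| "ival (IHalf e) s = ival e s div 2"

primrec rval :: "rexp \<Rightarrow> store \<Rightarrow> real" where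
  "rval (RConst c) s = c"
| "rval (RInt e) s = of_int (ival e s)"
| "rval (RCell a e f) s = rarr s a (ival e s) (ival f s)"
| "rval (RAdd u v) s = rval u s + rval v s"
| "rval (RSub u v) s = rval u s - rval v s"
| "rval (RMul u v) s = rval u s * rval v s"
| "rval (RDiv u v) s = rval u s / rval v s"
| "rval (RSqrt u) s = sqrt (rval u s)"

primrec bval :: "bexp \<Rightarrow> store \<Rightarrow> bool" where
  "bval (ILe e f) s \<longleftrightarrow> ival e s \<le> ival f s"
| "bval (RLe u v) s \<longleftrightarrow> rval u s \<le> rval v s"
| "bval (BNot b) s \<longleftrightarrow> \<not> bval b s"
| "bval (BAnd b c) s \<longleftrightarrow> bval b s \<and> bval c s"

text \<open>Evaluating an expression costs one step per node.\<close>

primrec icost :: "iexp \<Rightarrow> nat" where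
  "icost (IConst c) = 1"
| "icost (IVar x) = 1"
| "icost (ICell a e f) = 1 + icost e + icost f"
| "icost (IAdd e f) = 1 + icost e + icost f"
| "icost (ISub e f) = 1 + icost e + icost f"
| "icost (IHalf e) = 1 + icost e"

primrec rcost :: "rexp \<Rightarrow> nat" where
  "rcost (RConst c) = 1"
| "rcost (RInt e) = 1 + icost e"
| "rcost (RCell a e f) = 1 + icost e + icost f"
| "rcost (RAdd u v) = 1 + rcost u + rcost v"
| "rcost (RSub u v) = 1 + rcost u + rcost v"
| "rcost (RMul u v) = 1 + rcost u + rcost v"
| "rcost (RDiv u v) = 1 + rcost u + rcost v"
| "rcost (RSqrt u) = 1 + rcost u"

primrec bcost :: "bexp \<Rightarrow> nat" where
  "bcost (ILe e f) = 1 + icost e + icost f"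
| "bcost (RLe u v) = 1 + rcost u + rcost v"
| "bcost (BNot b) = 1 + bcost b"
| "bcost (BAnd b c) = 1 + bcost b + bcost c"

text \<open>
  \<open>Call p es xs\<close> runs the closed program \<open>p\<close> as a procedure: the integers \<open>es\<close> are passed by value
  and become the variables \<open>0, 1, \<dots>\<close> of \<open>p\<close>, the (distinct) arrays \<open>xs\<close> are passed by reference
  and become its arrays \<open>0, 1, \<dots>\<close>; all other variables and arrays of \<open>p\<close> are fresh and zero.
  \<open>Recurse es xs\<close> calls, in the same manner, the procedure in whose body it occurs.
\<close>

datatype com =
    Skip
  | IAssign nat iexp
  | IStore nat iexp iexp iexp
  | RStore nat iexp iexp rexp
  | Seq com com
  | If bexp com com
  | While bexp com
  | Call com "iexp list" "nat list"
  | Recurse "iexp list" "nat list"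

definition enter :: "iexp list \<Rightarrow> nat list \<Rightarrow> store \<Rightarrow> store" where
  "enter es xs s =
    \<lparr> ivar = (\<lambda>i. if i < length es then ival (es ! i) s else 0),
      iarr = (\<lambda>j. if j < length xs then iarr s (xs ! j) else (\<lambda>_ _. 0)),
      rarr = (\<lambda>j. if j < length xs then rarr s (xs ! j) else (\<lambda>_ _. 0)) \<rparr>"

text \<open>\<open>leave xs s s'\<close>: the caller's store after the call, if the callee was entered from \<open>s\<close>
  and ended in \<open>s'\<close>.\<close>

definition leave :: "nat list \<Rightarrow> store \<Rightarrow> store \<Rightarrow> store" where
  "leave xs s s' =
    \<lparr> ivar = ivar s,
      iarr = (\<lambda>a. case map_of (zip xs [0..<length xs]) a of
                None \<Rightarrow> iarr s a | Some j \<Rightarrow> iarr s' j),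
      rarr = (\<lambda>a. case map_of (zip xs [0..<length xs]) a of
                None \<Rightarrow> rarr s a | Some j \<Rightarrow> rarr s' j) \<rparr>"

definition call_cost :: "iexp list \<Rightarrow> nat list \<Rightarrow> nat" where
  "call_cost es xs = 1 + (\<Sum>e\<leftarrow>es. icost e) + length xs"

text \<open>\<open>exec p c s t s'\<close>: within a procedure with body \<open>p\<close>, the command \<open>c\<close> leads from \<open>s\<close> to \<open>s'\<close>
  in exactly \<open>t\<close> steps.\<close>

inductive exec :: "com \<Rightarrow> com \<Rightarrow> store \<Rightarrow> nat \<Rightarrow> store \<Rightarrow> bool" where
  Skip: "exec p Skip s 1 s"
| IAssign: "exec p (IAssign x e) s (1 + icost e) (s\<lparr>ivar := (ivar s)(x := ival e s)\<rparr>)"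
| IStore: "exec p (IStore a e f g) s (1 + icost e + icost f + icost g)
     (s\<lparr>iarr := (iarr s)(a := (iarr s a)(ival e s := (iarr s a (ival e s))(ival f s := ival g s)))\<rparr>)"
| RStore: "exec p (RStore a e f u) s (1 + icost e + icost f + rcost u)
     (s\<lparr>rarr := (rarr s)(a := (rarr s a)(ival e s := (rarr s a (ival e s))(ival f s := rval u s)))\<rparr>)"
| Seq: "exec p c s t s' \<Longrightarrow> exec p d s' t' s'' \<Longrightarrow> exec p (Seq c d) s (t + t') s''"
| IfTrue: "bval b s \<Longrightarrow> exec p c s t s' \<Longrightarrow> exec p (If b c d) s (1 + bcost b + t) s'"
| IfFalse: "\<not> bval b s \<Longrightarrow> exec p d s t s' \<Longrightarrow> exec p (If b c d) s (1 + bcost b + t) s'"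
| WhileFalse: "\<not> bval b s \<Longrightarrow> exec p (While b c) s (1 + bcost b) s"
| WhileTrue: "bval b s \<Longrightarrow> exec p c s t s' \<Longrightarrow> exec p (While b c) s' t' s'' \<Longrightarrow>
     exec p (While b c) s (1 + bcost b + t + t') s''"
| Call: "distinct xs \<Longrightarrow> exec q q (enter es xs s) t s' \<Longrightarrow>
     exec p (Call q es xs) s (call_cost es xs + t) (leave xs s s')"
| Recurse: "distinct xs \<Longrightarrow> exec p p (enter es xs s) t s' \<Longrightarrow>
     exec p (Recurse es xs) s (call_cost es xs + t) (leave xs s s')"

lemma exec_deterministic:
  assumes "exec p c s t s'" and "exec p c s u s''"
  shows "u = t \<and> s'' = s'"
  using assms
proof (induction arbitrary: u s'' rule: exec.induct)
  case (Skip p s)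
  from Skip.prems show ?case by cases simp
next
  case (IAssign p x e s)
  from IAssign.prems show ?case by cases simp
next
  case (IStore p a e f g s)
  from IStore.prems show ?case by cases simp
next
  case (RStore p a e f v s)
  from RStore.prems show ?case by cases simp
next
  case (Seq p c s t s' d t' s1)
  from Seq.prems show ?case by cases (blast dest: Seq.IH)
next
  case (IfTrue b s p c t s' d)
  from IfTrue.prems show ?case by cases (use IfTrue.hyps in \<open>auto dest: IfTrue.IH\<close>)
next
  case (IfFalse b s p d t s' c)
  from IfFalse.prems show ?case by cases (use IfFalse.hyps in \<open>auto dest: IfFalse.IH\<close>)
next
  case (WhileFalse b s p c)
  from WhileFalse.prems show ?case by cases (use WhileFalse.hyps in auto)
next
  case (WhileTrue b s p c t s' t' s1)
  from WhileTrue.prems show ?case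
  proof cases
    case WhileFalse
    then show ?thesis using WhileTrue.hyps by simp
  next
    case (WhileTrue t2 s2 t2')
    then show ?thesis by (blast dest: WhileTrue.IH)
  qed
next
  case (Call xs q es s t s' p)
  from Call.prems show ?case by cases (auto dest: Call.IH)
next
  case (Recurse xs p es s t s')
  from Recurse.prems show ?case by cases (auto dest: Recurse.IH)
qed


section \<open>Programs that compute matrices\<close>

definition input_store :: "nat list \<Rightarrow> real mat list \<Rightarrow> store" where
  "input_store ns Ms =
    \<lparr> ivar = (\<lambda>i. if i < length ns then int (ns ! i) else 0),
      iarr = (\<lambda>_ _ _. 0),
      rarr = (\<lambda>a x y. if a < length Ms \<and> 0 \<le> x \<and> x < int (dim_row (Ms ! a)) \<and>
                         0 \<le> y \<and> y < int (dim_col (Ms ! a))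
                      then (Ms ! a) $$ (nat x, nat y) else 0) \<rparr>"

definition holds_mat :: "store \<Rightarrow> nat \<Rightarrow> real mat \<Rightarrow> bool" where
  "holds_mat s a X \<longleftrightarrow>
     (\<forall>i<dim_row X. \<forall>j<dim_col X. rarr s a (int i) (int j) = X $$ (i, j))"

text \<open>The inputs are read-only in the sense that their entries have to be intact at the end; the
  result is delivered in the first array after the inputs.\<close>

definition computes :: "com \<Rightarrow> nat list \<Rightarrow> real mat list \<Rightarrow> nat \<Rightarrow> real mat \<Rightarrow> bool" where
  "computes p ns Ms t X \<longleftrightarrow>
     (\<exists>s'. exec p p (input_store ns Ms) t s' \<and>
        (\<forall>a<length Ms. holds_mat s' a (Ms ! a)) \<and> holds_mat s' (length Ms) X)"

text \<open>The exponents \<open>\<omega>\<close> for which square matrices can be multiplied in time \<open>O(n powr \<omega>)\<close>.  The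
  bound \<open>2 \<le> \<omega>\<close> only states the obvious lower bound given by the number of entries.\<close>

definition matmul_exponent :: "real \<Rightarrow> bool" where
  "matmul_exponent \<omega> \<longleftrightarrow> 2 \<le> \<omega> \<and>
     (\<exists>p (c::real). \<forall>n\<ge>1. \<forall>X \<in> carrier_mat n n. \<forall>Y \<in> carrier_mat n n.
        \<exists>t. computes p [n] [X, Y] t (X * Y) \<and> real t \<le> c * real n powr \<omega>)"

text \<open>Orthonormality of the columns of \<open>Z\<close> forces \<open>k \<le> m\<close>, so only such ranks are admissible.\<close>

definition low_rank_algorithm ::
    "com \<Rightarrow> (real mat \<Rightarrow> nat \<Rightarrow> nat) \<Rightarrow> real \<Rightarrow> bool" where
  "low_rank_algorithm \<A> T \<Delta>\<^sub>1 \<longleftrightarrow>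
     (\<forall>m d k M. 1 \<le> d \<and> 1 \<le> k \<and> k \<le> m \<and> M \<in> carrier_mat m d \<longrightarrow>
       (\<exists>t Z. computes \<A> [m, d, k] [M] t Z \<and> t \<le> T M k \<and>
          Z \<in> carrier_mat m k \<and> transpose_mat Z * Z = 1\<^sub>m k \<and>
          (\<exists>X\<^sub>k. best_rank_approx k (M * transpose_mat M) X\<^sub>k \<and>
             (frob_norm (M * transpose_mat M - Z * transpose_mat Z * M * transpose_mat M))\<^sup>2
               \<le> \<Delta>\<^sub>1 * (frob_norm (M * transpose_mat M - X\<^sub>k))\<^sup>2)))"

end

theory Submission
  imports Defs "Jordan_Normal_Form.Determinant"
begin

text \<open>
  Appending the rows \<open>w C\<^sup>T\<close> to \<open>A\<close> puts the block \<open>w A C\<close> into \<open>B B\<^sup>T\<close>, whose rank-\<open>2k\<close> error is at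
  most that of the block \<open>A A\<^sup>T\<close> and hence small compared with \<open>w\<close>.  So every column of \<open>A C\<close> is within
  distance \<open>1/3\<close> of a combination of the columns of \<open>Z\<close> with bounded but unknown coefficients, while the
  entries of \<open>A C\<close> are integers.

  The rows of \<open>A C\<close> are produced one after the other.  Let \<open>\<zeta>\<close> run over the scaled and rounded rows of \<open>Z\<close>
  and let \<open>M\<close> be the identity plus the sum of \<open>\<zeta> \<zeta>\<^sup>T\<close> over the rows selected so far, for which the
  product is known exactly.  If \<open>\<zeta>\<^sup>T M\<inverse> \<zeta>\<close> is small for the next row \<open>\<zeta>\<close>, then \<open>\<zeta>\<close> is nearly a
  combination of selected rows with small coefficients, and rounding the same combination of known products
  gives the new row of \<open>A C\<close>.  Otherwise that row is computed directly and selected; this multiplies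
  \<open>det M\<close> by at least \<open>3/2\<close>, so only \<open>O(k log Q)\<close> rows are ever selected.  The combination is
  found by Gram--Schmidt orthogonalisation against an almost orthogonal basis of integer vectors, applied twice
  to control the rounding errors.

  Fast matrix multiplication is not needed, only \<open>\<omega> \<ge> 2\<close>: exact real arithmetic allows a vector of integers to be
  packed into the single real \<open>\<Sum>l. v\<^sub>l X\<^sup>l\<close>, so that a linear combination of \<open>r\<close> integer vectors of length
  \<open>L\<close> takes about \<open>r + L\<close> steps, up to logarithmic factors for extracting the digits.
\<close>

section \<open>Running times of commands\<close>

text \<open>The form z^T M^-1 z is the squared distance of (z, 0) from the span of the vectors
  (\<zeta>_p, -e_p), that is, the minimum over x of |z - sum x_p \<zeta>_p|^2 + |x|^2. One residual
  thus tells both how well z is approximated and how large the coefficients are. A residual of norm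
  at most 1 suffices: the error of a column of A C, in total 1/3, is amplified by at most sqrt 2,
  and sqrt 2 / 3 is below 1/2. Hence the factor 3 in w; the narrow gap left is what the rounding of
  Z may use up.

  Packing demands integer digits of bounded size, so the Gram--Schmidt vectors are known only after
  scaling and rounding, and the difficulty is to keep their orthogonality from decaying as more of
  them are added. A direct row costs about d + k, a predicted one about k, up to logarithms; as
  direct rows are bounded only in total, the cost is amortised.

  The given algorithm is specified solely on its exact initial store. Therefore B is built in place
  in the array of A, and every other cell that the algorithm sees must still be zero.\<close>

definition runs :: "com \<Rightarrow> com \<Rightarrow> store \<Rightarrow> nat \<Rightarrow> (store \<Rightarrow> bool) \<Rightarrow> bool" where
  "runs p c s K R \<longleftrightarrow> (\<exists>t s'. exec p c s t s' \<and> t \<le> K \<and> R s')"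

lemma runsI: "exec p c s t s' \<Longrightarrow> t \<le> K \<Longrightarrow> R s' \<Longrightarrow> runs p c s K R"
  by (auto simp: runs_def)

lemma runs_mono:
  assumes "runs p c s K R" "K \<le> K'" "\<And>s'. R s' \<Longrightarrow> R' s'"
  shows "runs p c s K' R'"
  using assms unfolding runs_def by (meson order_trans)

lemma runs_Skip: "R s \<Longrightarrow> 1 \<le> K \<Longrightarrow> runs p Skip s K R"
  by (rule runsI[OF exec.Skip])

lemma runs_IAssign:
  "R (s\<lparr>ivar := (ivar s)(x := ival e s)\<rparr>) \<Longrightarrow> 1 + icost e \<le> K \<Longrightarrow> runs p (IAssign x e) s K R"
  by (rule runsI[OF exec.IAssign])

definition upd2 :: "('i \<Rightarrow> 'j \<Rightarrow> 'v) \<Rightarrow> 'i \<Rightarrow> 'j \<Rightarrow> 'v \<Rightarrow> ('i \<Rightarrow> 'j \<Rightarrow> 'v)" where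
  "upd2 g i j v = g(i := (g i)(j := v))"

lemma upd2_apply: "upd2 g i j v y z = (if y = i \<and> z = j then v else g y z)"
  by (simp add: upd2_def)

lemma runs_RStore:
  "R (s\<lparr>rarr := (rarr s)(a := upd2 (rarr s a) (ival e s) (ival f s) (rval u s))\<rparr>) \<Longrightarrow>
   1 + icost e + icost f + rcost u \<le> K \<Longrightarrow> runs p (RStore a e f u) s K R"
  unfolding upd2_def by (rule runsI[OF exec.RStore])

lemma runs_Seq:
  assumes "runs p c s K1 (\<lambda>s'. runs p d s' K2 R)" and "K1 + K2 \<le> K"
  shows "runs p (Seq c d) s K R"
proof -
  obtain t s' t' s'' where e: "exec p c s t s'" "t \<le> K1" "exec p d s' t' s''" "t' \<le> K2" "R s''"
    using assms(1) by (auto simp: runs_def)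
  then show ?thesis using assms(2) by (intro runsI[OF exec.Seq[OF e(1,3)]]) auto
qed

lemma runs_If:
  assumes "bval b s \<Longrightarrow> runs p c s K' R" "\<not> bval b s \<Longrightarrow> runs p d s K' R" "1 + bcost b + K' \<le> K"
  shows "runs p (If b c d) s K R"
proof (cases "bval b s")
  case True
  obtain t s' where e: "exec p c s t s'" "t \<le> K'" "R s'"
    using assms(1)[OF True] by (auto simp: runs_def)
  then show ?thesis using assms(3) by (intro runsI[OF exec.IfTrue[OF True e(1)]]) auto
next
  case False
  obtain t s' where e: "exec p d s t s'" "t \<le> K'" "R s'"
    using assms(2)[OF False] by (auto simp: runs_def)
  then show ?thesis using assms(3) by (intro runsI[OF exec.IfFalse[OF False e(1)]]) auto
qed

lemma runs_While:
  assumes "\<And>i s. i < n \<Longrightarrow> I i s \<Longrightarrow> bval b s \<and> runs p c s K (I (Suc i))"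
    and "\<And>s. I n s \<Longrightarrow> \<not> bval b s \<and> R s"
    and "I 0 s" and "n * (K + 1 + bcost b) + (1 + bcost b) \<le> K'"
  shows "runs p (While b c) s K' R"
proof -
  have "runs p (While b c) s ((n - i) * (K + 1 + bcost b) + (1 + bcost b)) R"
    if "i \<le> n" "I i s" for i s
    using that
  proof (induction "n - i" arbitrary: i s)
    case 0
    then show ?case using assms(2) by (auto intro!: runsI[OF exec.WhileFalse])
  next
    case (Suc r)
    then have lt: "i < n" by simp
    from assms(1)[OF lt Suc.prems(2)] obtain t s' where
      b: "bval b s" and e: "exec p c s t s'" "t \<le> K" "I (Suc i) s'" by (auto simp: runs_def)
    have "runs p (While b c) s' ((n - Suc i) * (K + 1 + bcost b) + (1 + bcost b)) R"
      using Suc lt e by (intro Suc.hyps(1)) auto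
    then obtain t' s'' where e': "exec p (While b c) s' t' s''"
      "t' \<le> (n - Suc i) * (K + 1 + bcost b) + (1 + bcost b)" "R s''" by (auto simp: runs_def)
    have "n - i = Suc (n - Suc i)" using lt by simp
    then show ?case using e e' by (intro runsI[OF exec.WhileTrue[OF b e(1) e'(1)]]) auto
  qed
  from this[of 0 s] assms(3,4) show ?thesis by (auto intro: runs_mono)
qed

text \<open>The bound \<open>e\<close> is evaluated anew before every round, hence the demand in the
  loop rules that its value stay \<open>n\<close> throughout.\<close>

definition For :: "nat \<Rightarrow> iexp \<Rightarrow> com \<Rightarrow> com" where
  "For x e c = Seq (IAssign x (IConst 0))
     (While (ILe (IAdd (IVar x) (IConst 1)) e) (Seq c (IAssign x (IAdd (IVar x) (IConst 1)))))"

text \<open>The growth of the potential \<open>\<Phi>\<close> pays for the steps of the body in excess of \<open>K\<close>.\<close>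

lemma runs_For_amortized:
  fixes \<Phi> :: "store \<Rightarrow> nat"
  assumes body: "\<And>i s. i < n \<Longrightarrow> I i s \<Longrightarrow> ivar s x = int i \<Longrightarrow>
      \<exists>t s'. exec p c s t s' \<and> t + \<Phi> s \<le> K + \<Phi> s' \<and> ivar s' x = int i \<and>
             I (Suc i) (s'\<lparr>ivar := (ivar s')(x := int (Suc i))\<rparr>)"
    and \<Phi>: "\<And>s v. \<Phi> (s\<lparr>ivar := (ivar s)(x := v)\<rparr>) = \<Phi> s"
    and e: "\<And>i s. i \<le> n \<Longrightarrow> I i s \<Longrightarrow> ivar s x = int i \<Longrightarrow> ival e s = int n"
    and start: "I 0 (s\<lparr>ivar := (ivar s)(x := 0)\<rparr>)"
    and fin: "\<And>s. I n s \<Longrightarrow> ivar s x = int n \<Longrightarrow> R s \<and> \<Phi> s \<le> F"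
    and K': "n * (K + 9 + icost e) + F + 8 + icost e \<le> K'"
  shows "runs p (For x e c) s K' R"
proof -
  let ?w = "While (ILe (IAdd (IVar x) (IConst 1)) e) (Seq c (IAssign x (IAdd (IVar x) (IConst 1))))"
  have "\<exists>t s'. exec p ?w s t s' \<and> t + \<Phi> s \<le> (n - i) * (K + 9 + icost e) + 5 + icost e + F \<and> R s'"
    if "i \<le> n" "I i s" "ivar s x = int i" for i s
    using that
  proof (induction "n - i" arbitrary: i s)
    case 0
    then have "i = n" by simp
    then have "ival e s = int n" "R s" "\<Phi> s \<le> F" using 0 e[of i s] fin[of s] by auto
    then show ?case using 0 \<open>i = n\<close>
      by (intro exI conjI) (rule exec.WhileFalse, auto)
  next
    case (Suc r)
    then have lt: "i < n" by simp
    from body[OF lt Suc.prems(2,3)] obtain t s' where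
      ex: "exec p c s t s'" "t + \<Phi> s \<le> K + \<Phi> s'" "ivar s' x = int i"
        "I (Suc i) (s'\<lparr>ivar := (ivar s')(x := int (Suc i))\<rparr>)" by blast
    let ?s = "s'\<lparr>ivar := (ivar s')(x := int (Suc i))\<rparr>"
    have "ival (IAdd (IVar x) (IConst 1)) s' = int (Suc i)" using ex(3) by simp
    then have ea: "exec p (IAssign x (IAdd (IVar x) (IConst 1))) s' 4 ?s"
      using exec.IAssign[of p x "IAdd (IVar x) (IConst 1)" s'] ex(3) by (simp add: numeral_eq_Suc add.commute)
    have b: "bval (ILe (IAdd (IVar x) (IConst 1)) e) s"
      using e[of i s] Suc.prems lt by simp
    have "\<exists>t' s''. exec p ?w ?s t' s'' \<and>
        t' + \<Phi> ?s \<le> (n - Suc i) * (K + 9 + icost e) + 5 + icost e + F \<and> R s''"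
      using Suc lt ex by (intro Suc.hyps(1)) auto
    then obtain t' s'' where e': "exec p ?w ?s t' s''"
        "t' + \<Phi> ?s \<le> (n - Suc i) * (K + 9 + icost e) + 5 + icost e + F" "R s''" by blast
    have "n - i = Suc (n - Suc i)" using lt by simp
    then have "1 + bcost (ILe (IAdd (IVar x) (IConst 1)) e) + (t + 4) + t' + \<Phi> s
        \<le> (n - i) * (K + 9 + icost e) + 5 + icost e + F"
      using ex(2) e'(2) \<Phi>[of s' "int (Suc i)"] by simp
    with exec.WhileTrue[OF b exec.Seq[OF ex(1) ea] e'(1)] e'(3) show ?case by blast
  qed
  from this[of 0 "s\<lparr>ivar := (ivar s)(x := 0)\<rparr>"] start obtain t s' where
    w: "exec p ?w (s\<lparr>ivar := (ivar s)(x := 0)\<rparr>) t s'" "t \<le> n * (K + 9 + icost e) + 5 + icost e + F" "R s'"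
    by auto
  have "exec p (IAssign x (IConst 0)) s 2 (s\<lparr>ivar := (ivar s)(x := 0)\<rparr>)"
    using exec.IAssign[of p x "IConst 0" s] by (simp add: numeral_2_eq_2)
  then show ?thesis unfolding For_def
    using w K' by (intro runsI[OF exec.Seq]) (assumption, assumption, auto)
qed

lemma runs_For:
  assumes body: "\<And>i s. i < n \<Longrightarrow> I i s \<Longrightarrow> ivar s x = int i \<Longrightarrow>
      runs p c s K (\<lambda>s'. ivar s' x = int i \<and> I (Suc i) (s'\<lparr>ivar := (ivar s')(x := int (Suc i))\<rparr>))"
    and e: "\<And>i s. i \<le> n \<Longrightarrow> I i s \<Longrightarrow> ivar s x = int i \<Longrightarrow> ival e s = int n"
    and start: "I 0 (s\<lparr>ivar := (ivar s)(x := 0)\<rparr>)"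
    and fin: "\<And>s. I n s \<Longrightarrow> ivar s x = int n \<Longrightarrow> R s"
    and K': "n * (K + 9 + icost e) + 8 + icost e \<le> K'"
  shows "runs p (For x e c) s K' R"
proof (rule runs_For_amortized[where \<Phi> = "\<lambda>_. 0" and F = 0 and K = K and I = I and n = n])
  show "\<exists>t s'. exec p c s t s' \<and> t + 0 \<le> K + 0 \<and> ivar s' x = int i \<and>
      I (Suc i) (s'\<lparr>ivar := (ivar s')(x := int (Suc i))\<rparr>)"
    if "i < n" "I i s" "ivar s x = int i" for i s
    using body[OF that] by (auto simp: runs_def)
qed (use assms in auto)

definition upd_row :: "(int \<Rightarrow> int \<Rightarrow> real) \<Rightarrow> int \<Rightarrow> int \<Rightarrow> nat \<Rightarrow> (nat \<Rightarrow> real) \<Rightarrow> int \<Rightarrow> int \<Rightarrow> real" where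
  "upd_row A y z n g = (\<lambda>i j. if i = y \<and> z \<le> j \<and> j < z + int n then g (nat (j - z)) else A i j)"

text \<open>The value stored at step \<open>i\<close> may depend on the old entry of the array at
  that position.\<close>

lemma runs_map:
  assumes x: "\<And>v. ival r (s\<lparr>ivar := (ivar s)(x := v)\<rparr>) = y"
      "\<And>v. ival l (s\<lparr>ivar := (ivar s)(x := v)\<rparr>) = z + v"
    and rarr_indep: "\<And>v g. ival r (s\<lparr>ivar := (ivar s)(x := v), rarr := g\<rparr>) = ival r (s\<lparr>ivar := (ivar s)(x := v)\<rparr>)"
      "\<And>v g. ival l (s\<lparr>ivar := (ivar s)(x := v), rarr := g\<rparr>) = ival l (s\<lparr>ivar := (ivar s)(x := v)\<rparr>)"
    and e: "\<And>v g. ival e (s\<lparr>ivar := (ivar s)(x := v), rarr := g\<rparr>) = int n"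
    and u: "\<And>i A. i < n \<Longrightarrow> (\<And>j. i \<le> j \<Longrightarrow> A y (z + int j) = rarr s a y (z + int j)) \<Longrightarrow>
        rval u (s\<lparr>ivar := (ivar s)(x := int i), rarr := (rarr s)(a := A)\<rparr>) = g i"
    and R: "R (s\<lparr>ivar := (ivar s)(x := int n),
               rarr := (rarr s)(a := upd_row (rarr s a) y z n g)\<rparr>)"
    and K: "n * (10 + icost r + icost l + rcost u + icost e) + 8 + icost e \<le> K"
  shows "runs p (For x e (RStore a r l u)) s K R"
proof -
  define st where "st i = upd_row (rarr s a) y z i g" for i
  note st_def = st_def[unfolded upd_row_def]
  define I where "I i s' \<longleftrightarrow> s' = s\<lparr>ivar := (ivar s)(x := int i), rarr := (rarr s)(a := st i)\<rparr>" for i s'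
  show ?thesis
  proof (rule runs_For[where I = I and n = n and K = "1 + icost r + icost l + rcost u"])
    fix i s' assume "i < n" "I i s'"
    then have s': "s' = s\<lparr>ivar := (ivar s)(x := int i), rarr := (rarr s)(a := st i)\<rparr>"
      by (simp add: I_def)
    have 1: "ival r s' = y" "ival l s' = z + int i"
      unfolding s' using x rarr_indep by simp_all
    have 2: "rval u s' = g i"
      unfolding s' by (rule u) (use \<open>i < n\<close> in \<open>auto simp: st_def\<close>)
    have 3: "upd2 (st i) y (z + int i) (g i) = st (Suc i)"
      by (auto simp: st_def upd2_apply fun_eq_iff)
    show "runs p (RStore a r l u) s' (1 + icost r + icost l + rcost u)
        (\<lambda>s'. ivar s' x = int i \<and> I (Suc i) (s'\<lparr>ivar := (ivar s')(x := int (Suc i))\<rparr>))"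
      by (rule runs_RStore, simp_all only: 1 2) (simp_all add: s' 3 I_def)
  next
    show "ival e s' = int n" if "I i s'" for i s'
      using that e by (simp add: I_def)
  next
    have "st 0 = rarr s a" by (auto simp: st_def fun_eq_iff)
    then show "I 0 (s\<lparr>ivar := (ivar s)(x := 0)\<rparr>)" by (simp add: I_def)
  next
    show "R s'" if "I n s'" for s'
      using that R by (simp add: I_def st_def upd_row_def)
  qed (use K in \<open>auto simp: algebra_simps\<close>)
qed

text \<open>The summand must not depend on the accumulator: \<open>u\<close> is evaluated with an
  arbitrary \<open>w\<close> in that cell.\<close>

lemma runs_accum:
  assumes e: "\<And>v g. ival e (s\<lparr>ivar := (ivar s)(x := v), rarr := g\<rparr>) = int n"
    and u: "\<And>i w. i < n \<Longrightarrow> rval u (s\<lparr>ivar := (ivar s)(x := int i),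
            rarr := (rarr s)(a := upd2 (rarr s a) y z w)\<rparr>) = g i"
    and R: "R (s\<lparr>ivar := (ivar s)(x := int n),
               rarr := (rarr s)(a := upd2 (rarr s a) y z (rarr s a y z + (\<Sum>i<n. g i)))\<rparr>)"
    and K: "n * (17 + rcost u + icost e) + 8 + icost e \<le> K"
  shows "runs p (For x e (RStore a (IConst y) (IConst z) (RAdd (RCell a (IConst y) (IConst z)) u))) s K R"
proof -
  define st where "st i = upd2 (rarr s a) y z (rarr s a y z + (\<Sum>j<i. g j))" for i
  define I where "I i s' \<longleftrightarrow> s' = s\<lparr>ivar := (ivar s)(x := int i), rarr := (rarr s)(a := st i)\<rparr>" for i s'
  let ?u = "RAdd (RCell a (IConst y) (IConst z)) u"
  show ?thesis
  proof (rule runs_For[where I = I and n = n and K = "3 + rcost ?u"])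
    fix i s' assume "i < n" "I i s'"
    then have s': "s' = s\<lparr>ivar := (ivar s)(x := int i), rarr := (rarr s)(a := st i)\<rparr>"
      by (simp add: I_def)
    have 2: "rval u s' = g i"
      unfolding s' st_def by (rule u) (use \<open>i < n\<close> in auto)
    have 3: "upd2 (st i) y z (st i y z + g i) = st (Suc i)"
      by (auto simp: st_def upd2_apply fun_eq_iff)
    show "runs p (RStore a (IConst y) (IConst z) ?u) s' (3 + rcost ?u)
        (\<lambda>s'. ivar s' x = int i \<and> I (Suc i) (s'\<lparr>ivar := (ivar s')(x := int (Suc i))\<rparr>))"
      by (rule runs_RStore, simp_all only: ival.simps rval.simps 2) (simp_all add: s' 3 I_def)
  next
    show "ival e s' = int n" if "I i s'" for i s'
      using that e by (simp add: I_def)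
  next
    have "st 0 = rarr s a" by (auto simp: st_def upd2_apply fun_eq_iff)
    then show "I 0 (s\<lparr>ivar := (ivar s)(x := 0)\<rparr>)" by (simp add: I_def)
  next
    show "R s'" if "I n s'" for s'
      using that R by (simp add: I_def st_def[abs_def])
  qed (use K in \<open>auto simp: algebra_simps\<close>)
qed

section \<open>Procedure calls\<close>

lemma runs_Call:
  assumes "distinct xs" "runs q q (enter es xs s) K (\<lambda>s'. R (leave xs s s'))" "call_cost es xs + K \<le> K'"
  shows "runs p (Call q es xs) s K' R"
proof -
  obtain t s' where e: "exec q q (enter es xs s) t s'" "t \<le> K" "R (leave xs s s')"
    using assms(2) by (auto simp: runs_def)
  then show ?thesis using assms(1,3) by (intro runsI[OF exec.Call[OF assms(1) e(1)]]) auto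
qed

text \<open>For distinct names the lookup in \<open>leave\<close> inverts the indexing of
  \<open>xs\<close>. As the variables of the callee are discarded, a callee that leaves its integer
  arrays alone acts on the caller by a single update of \<open>rarr\<close>.\<close>

lemma leave_rarr_only:
  assumes "distinct xs" "iarr s' = iarr (enter es xs s)"
    and "\<And>j. j < length xs \<Longrightarrow> A (xs ! j) = rarr s' j"
    and "\<And>a. a \<notin> set xs \<Longrightarrow> A a = rarr s a"
  shows "leave xs s s' = s\<lparr>rarr := A\<rparr>"
proof -
  have m: "(case map_of (zip xs [0..<length xs]) a of None \<Rightarrow> f a | Some j \<Rightarrow> h j) =
      (if a \<in> set xs then h (THE j. j < length xs \<and> xs ! j = a) else f a)" for a and f h :: "nat \<Rightarrow> 'v"
  proof (cases "a \<in> set xs")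
    case True
    then obtain j where j: "j < length xs" "xs ! j = a" by (auto simp: in_set_conv_nth)
    have "(THE j. j < length xs \<and> xs ! j = a) = j"
      using j assms(1) by (auto simp: nth_eq_iff_index_eq)
    moreover have "map_of (zip xs [0..<length xs]) a = Some j"
      using j assms(1) map_of_zip_nth[of xs "[0..<length xs]" j] by auto
    ultimately show ?thesis using True by simp
  next
    case False
    then have "map_of (zip xs [0..<length xs]) a = None"
      by (auto simp: map_of_eq_None_iff dest: set_zip_leftD)
    then show ?thesis using False by (simp only: if_False option.case)
  qed
  have the: "\<exists>j<length xs. (THE j. j < length xs \<and> xs ! j = a) = j \<and> xs ! j = a" if a: "a \<in> set xs" for a
  proof -
    obtain j where j: "j < length xs" "xs ! j = a" using a by (auto simp: in_set_conv_nth)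
    then have "(THE j. j < length xs \<and> xs ! j = a) = j"
      using assms(1) by (auto simp: nth_eq_iff_index_eq)
    with j show ?thesis by auto
  qed
  have "(\<lambda>a. case map_of (zip xs [0..<length xs]) a of None \<Rightarrow> iarr s a | Some j \<Rightarrow> iarr s' j) = iarr s"
    unfolding m using the assms(2) by (fastforce simp: fun_eq_iff enter_def)
  moreover have "(\<lambda>a. case map_of (zip xs [0..<length xs]) a of None \<Rightarrow> rarr s a | Some j \<Rightarrow> rarr s' j) = A"
    unfolding m using the assms(3,4) by (fastforce simp: fun_eq_iff)
  ultimately show ?thesis by (simp add: leave_def)
qed

section \<open>Almost orthogonal integer vectors\<close>

definition dot :: "nat \<Rightarrow> (nat \<Rightarrow> real) \<Rightarrow> (nat \<Rightarrow> real) \<Rightarrow> real" where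
  "dot M u v = (\<Sum>i<M. u i * v i)"

lemma dot_commute: "dot M u v = dot M v u"
  by (simp add: dot_def mult.commute)

lemma dot_lincomb:
  "dot M (\<lambda>i. u i - (\<Sum>q\<in>A. c q * w q i) + (\<Sum>p\<in>B. r p * z p i)) v =
   dot M u v - (\<Sum>q\<in>A. c q * dot M (w q) v) + (\<Sum>p\<in>B. r p * dot M (z p) v)"
proof -
  have *: "(\<Sum>q\<in>A. c q * dot M (w q) v) = (\<Sum>i<M. (\<Sum>q\<in>A. c q * w q i) * v i)"
    for A :: "'c set" and c and w :: "'c \<Rightarrow> nat \<Rightarrow> real"
    unfolding dot_def sum_distrib_left sum_distrib_right
    by (subst sum.swap) (simp add: mult.assoc)
  show ?thesis unfolding * by (simp add: dot_def algebra_simps sum.distrib sum_subtractf)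
qed

lemma dot_cong: "(\<And>i. i < M \<Longrightarrow> u i = u' i) \<Longrightarrow> (\<And>i. i < M \<Longrightarrow> v i = v' i) \<Longrightarrow> dot M u v = dot M u' v'"
  by (simp add: dot_def)

lemma dot_mono_neutral:
  assumes "M \<le> M'" "\<And>i. M \<le> i \<Longrightarrow> i < M' \<Longrightarrow> u i * v i = 0"
  shows "dot M' u v = dot M u v"
  unfolding dot_def by (rule sum.mono_neutral_right) (use assms in auto)

lemma dot_self_nonneg: "0 \<le> dot M u u"
  by (simp add: dot_def sum_nonneg)

lemma coord_le_dot: "i < M \<Longrightarrow> (u i)\<^sup>2 \<le> dot M u u"
  unfolding dot_def power2_eq_square
  by (rule member_le_sum[of i "{..<M}" "\<lambda>i. u i * u i"]) auto

lemma dot_scale: "dot M (\<lambda>i. a * u i) v = a * dot M u v"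
  by (simp add: dot_def sum_distrib_left mult.assoc)

lemma dot_scale_right: "dot M u (\<lambda>i. a * v i) = a * dot M u v"
  by (simp add: dot_def sum_distrib_left mult.left_commute)

text \<open>The arithmetic-geometric mean inequality in each coordinate replaces Cauchy--Schwarz, so
  that only squared norms ever occur.\<close>

lemma abs_dot_le: "2 * \<bar>dot M u v\<bar> \<le> dot M u u + dot M v v"
proof -
  have "\<bar>dot M u v\<bar> \<le> (\<Sum>i<M. \<bar>u i * v i\<bar>)" by (simp add: dot_def)
  then have "2 * \<bar>dot M u v\<bar> \<le> (\<Sum>i<M. 2 * \<bar>u i * v i\<bar>)" by (simp add: sum_distrib_left[symmetric])
  also have "\<dots> \<le> (\<Sum>i<M. u i * u i + v i * v i)"
  proof (rule sum_mono)
    fix i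
    show "2 * \<bar>u i * v i\<bar> \<le> u i * u i + v i * v i"
      using sum_squares_bound[of "\<bar>u i\<bar>" "\<bar>v i\<bar>"] by (simp add: abs_mult power2_eq_square)
  qed
  finally show ?thesis by (simp add: dot_def sum.distrib)
qed

lemma abs_sum_le_card:
  assumes "\<And>i. i < (s::nat) \<Longrightarrow> \<bar>f i\<bar> \<le> (K::real)"
  shows "\<bar>\<Sum>i<s. f i\<bar> \<le> real s * K"
  using sum_bounded_above[of "{..<s}" "\<lambda>i. \<bar>f i\<bar>" K] assms
  by (auto intro: order_trans[OF sum_abs])

text \<open>The first assumption allows a sum over at most \<open>n\<close> terms to be charged to
  one power of \<open>Q\<close>, with a factor 100 to spare. The second bounds the squared norm of a
  vector of \<open>m\<close> entries of size \<open>Q\<close> by \<open>Q ^ 3\<close>.\<close>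

locale gram =
  fixes m n :: nat and Q :: real
  assumes Q_n: "100 * (real n + 2) \<le> Q" and Q_m: "real m + 1 \<le> Q"
begin

text \<open>Gram--Schmidt coefficients are kept as multiples of \<open>1 / N\<close>. The resulting
  errors in \<open>pass_step\<close> have size about \<open>Q ^ 4 / N\<close>; the exponent 12
  pushes them down to Q^-8, below the Q^-7 that the second pass has to reach.\<close>

definition N :: real where "N = Q ^ 12"

text \<open>The unit coordinate of \<open>zhat \<zeta> q\<close> is shared by no earlier vector. It
  survives the orthogonalisation as the entry \<open>- N\<close> of \<open>b q\<close> and so keeps
  the norm of \<open>b q\<close> from becoming small, however dependent the \<open>\<zeta> p\<close>
  are.\<close>

definition zhat :: "(nat \<Rightarrow> nat \<Rightarrow> real) \<Rightarrow> nat \<Rightarrow> nat \<Rightarrow> real" where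
  "zhat \<zeta> p i = (if i < m then \<zeta> p i else if i = m + p then -1 else 0)"

abbreviation ip :: "(nat \<Rightarrow> real) \<Rightarrow> (nat \<Rightarrow> real) \<Rightarrow> real" where "ip \<equiv> dot (m + n)"

text \<open>\<open>b q\<close> is an integer approximation of \<open>N\<close> times the Gram--Schmidt vector of \<open>zhat \<zeta> q = (\<zeta> q, -e\<^sub>q)\<close>.
  Its last \<open>s\<close> coordinates are, up to sign, the coefficients by which it is composed of the \<open>zhat \<zeta> p\<close>, so they determine it.
  The last clause is the triangular relation back, with a rounding error \<open>r\<close>.\<close>

definition near_orth :: "nat \<Rightarrow> (nat \<Rightarrow> nat \<Rightarrow> real) \<Rightarrow> (nat \<Rightarrow> nat \<Rightarrow> real) \<Rightarrow> bool" where
  "near_orth s \<zeta> b \<longleftrightarrow> s \<le> n \<and>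
    (\<forall>p<s. \<forall>l<m. \<bar>\<zeta> p l\<bar> \<le> Q) \<and>
    (\<forall>q<s. b q (m + q) = - N \<and> (\<forall>i>m + q. b q i = 0) \<and>
       (\<forall>i<m. b q i = - (\<Sum>p<s. b q (m + p) * \<zeta> p i))) \<and>
    (\<forall>q<s. ip (b q) (b q) \<le> 4 * Q ^ 3 * N\<^sup>2) \<and>
    (\<forall>q<s. \<forall>q'<s. q \<noteq> q' \<longrightarrow> \<bar>ip (b q) (b q')\<bar> \<le> N\<^sup>2 / Q ^ 6) \<and>
    (\<forall>p<s. \<exists>c r. (\<forall>q<p. \<bar>c q\<bar> \<le> 4 * Q ^ 3) \<and> (\<forall>q<p. \<bar>r q\<bar> \<le> 1) \<and>
       (\<forall>i. N * zhat \<zeta> p i = b p i + (\<Sum>q<p. c q * b q i) + (\<Sum>q<p. r q * zhat \<zeta> q i)))"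

text \<open>This says f = N (z, 0) - sum over p < s of f (m + p) \<open>zhat \<zeta> p\<close>. All
  information sits in the last coordinates; rounding these keeps the whole vector integral when
  \<open>z\<close> and \<open>\<zeta>\<close> are.\<close>

definition coherent :: "nat \<Rightarrow> (nat \<Rightarrow> nat \<Rightarrow> real) \<Rightarrow> (nat \<Rightarrow> real) \<Rightarrow> (nat \<Rightarrow> real) \<Rightarrow> bool" where
  "coherent s \<zeta> z f \<longleftrightarrow> (\<forall>i<m. f i = N * z i - (\<Sum>p<s. f (m + p) * \<zeta> p i)) \<and> (\<forall>i\<ge>m + s. f i = 0)"

text \<open>\<open>N\<close> times the Gram--Schmidt coefficient, so that an integer represents the
  coefficient to precision \<open>1 / (2 * N)\<close>.\<close>

definition tau :: "(nat \<Rightarrow> nat \<Rightarrow> real) \<Rightarrow> (nat \<Rightarrow> real) \<Rightarrow> nat \<Rightarrow> real" where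
  "tau b f q = of_int (round (ip f (b q) * (N / ip (b q) (b q))))"

text \<open>The change of coordinate \<open>m + p\<close> when all projections are subtracted at
  once; division by \<open>N\<close> undoes the scaling of \<open>tau\<close>.\<close>

definition corr :: "nat \<Rightarrow> (nat \<Rightarrow> nat \<Rightarrow> real) \<Rightarrow> (nat \<Rightarrow> real) \<Rightarrow> nat \<Rightarrow> real" where
  "corr s b f p = of_int (round ((\<Sum>q<s. tau b f q * b q (m + p)) * (1 / N)))"

text \<open>Only last coordinates are ever rounded. The first \<open>m\<close> are recomputed from
  them, which makes \<open>coherent\<close> an exact statement after every pass and confines the
  rounding errors to multiples of the \<open>zhat \<zeta> p\<close>.\<close>

definition assemble :: "nat \<Rightarrow> (nat \<Rightarrow> nat \<Rightarrow> real) \<Rightarrow> (nat \<Rightarrow> real) \<Rightarrow> (nat \<Rightarrow> real) \<Rightarrow> (nat \<Rightarrow> real)" where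
  "assemble s \<zeta> z x i = (if i < m then N * z i - (\<Sum>p<s. x p * \<zeta> p i)
     else if i < m + s then x (i - m) else 0)"

definition pass :: "nat \<Rightarrow> (nat \<Rightarrow> nat \<Rightarrow> real) \<Rightarrow> (nat \<Rightarrow> nat \<Rightarrow> real) \<Rightarrow> (nat \<Rightarrow> real) \<Rightarrow> (nat \<Rightarrow> real) \<Rightarrow> (nat \<Rightarrow> real)" where
  "pass s \<zeta> b z f = assemble s \<zeta> z (\<lambda>p. f (m + p) - corr s b f p)"

lemma Q_ge: "200 \<le> Q" using Q_n by simp
lemma Q_pos: "0 < Q" using Q_ge by simp
lemma N_pos: "0 < N" using Q_pos by (simp add: N_def)
lemma N_ge: "Q \<le> N" using Q_ge unfolding N_def by (intro self_le_power) auto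
lemma Q_pow_mono: "a \<le> b \<Longrightarrow> Q ^ a \<le> Q ^ b" using Q_ge by (intro power_increasing) auto
lemma s_le: "s \<le> n \<Longrightarrow> real s \<le> Q / 100 - 2" using Q_n by simp

text \<open>The slack 1 is spent twice: on the coordinate -1 in \<open>zhat_norm\<close>, and on the
  orthogonality errors in \<open>pass2_norm\<close>.\<close>

lemma norm_z:
  assumes "\<forall>l<m. \<bar>z l\<bar> \<le> Q"
  shows "(\<Sum>l<m. z l * z l) \<le> Q ^ 3 - 1"
proof -
  have "(\<Sum>l<m. z l * z l) \<le> (\<Sum>l<m. Q\<^sup>2)"
  proof (rule sum_mono)
    fix l assume "l \<in> {..<m}"
    then have "(z l)\<^sup>2 \<le> Q\<^sup>2" using assms by (intro abs_le_square_iff[THEN iffD1]) (use Q_pos in auto)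
    then show "z l * z l \<le> Q\<^sup>2" by (simp add: power2_eq_square)
  qed
  also have "\<dots> \<le> (Q - 1) * Q\<^sup>2" using Q_m by (simp add: mult_right_mono)
  also have "\<dots> = Q ^ 3 - Q\<^sup>2" by (simp add: algebra_simps power3_eq_cube power2_eq_square)
  also have "\<dots> \<le> Q ^ 3 - 1" using Q_ge by (simp add: one_le_power)
  finally show ?thesis .
qed

lemma zhat_norm:
  assumes "p < n" "\<And>l. l < m \<Longrightarrow> \<bar>\<zeta> p l\<bar> \<le> Q"
  shows "ip (zhat \<zeta> p) (zhat \<zeta> p) \<le> Q ^ 3"
proof -
  have "ip (zhat \<zeta> p) (zhat \<zeta> p) = (\<Sum>l<m. \<zeta> p l * \<zeta> p l) + (\<Sum>i\<in>{m..<m+n}. zhat \<zeta> p i * zhat \<zeta> p i)"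
    unfolding dot_def
    by (subst sum.atLeastLessThan_concat[of 0 m "m+n", symmetric, unfolded atLeast0LessThan])
       (auto simp: zhat_def)
  also have "(\<Sum>i\<in>{m..<m+n}. zhat \<zeta> p i * zhat \<zeta> p i) = (\<Sum>i\<in>{m..<m+n}. if i = m + p then 1 else 0)"
    by (rule sum.cong) (auto simp: zhat_def)
  also have "\<dots> = 1" using assms(1) by (simp add: sum.delta)
  finally show ?thesis using norm_z[of "\<zeta> p"] assms by simp
qed

lemma near_orth_b_coord:
  assumes "near_orth s \<zeta> b" "q < s"
  shows "\<bar>b q i\<bar> \<le> 2 * Q\<^sup>2 * N"
proof (cases "i < m + n")
  case True
  have "(b q i)\<^sup>2 \<le> ip (b q) (b q)" using coord_le_dot[OF True] .
  also have "\<dots> \<le> 4 * Q ^ 3 * N\<^sup>2" using assms by (simp add: near_orth_def)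
  also have "\<dots> \<le> 4 * Q ^ 4 * N\<^sup>2" using Q_pow_mono[of 3 4] by (intro mult_right_mono) auto
  also have "\<dots> = (2 * Q\<^sup>2 * N)\<^sup>2" by (simp add: power_mult_distrib flip: power_mult)
  finally have "\<bar>b q i\<bar> \<le> \<bar>2 * Q\<^sup>2 * N\<bar>" by (simp only: abs_le_square_iff)
  then show ?thesis using Q_pos N_pos by simp
next
  case False
  then have "b q i = 0" using assms by (auto simp: near_orth_def)
  then show ?thesis using Q_pos N_pos by simp
qed

lemma near_orth_b_norm:
  assumes "near_orth s \<zeta> b" "q < s"
  shows "N\<^sup>2 \<le> ip (b q) (b q)" "ip (b q) (b q) \<le> 4 * Q ^ 3 * N\<^sup>2"
proof -
  have "(b q (m + q))\<^sup>2 \<le> ip (b q) (b q)" using assms by (intro coord_le_dot) (auto simp: near_orth_def)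
  then show "N\<^sup>2 \<le> ip (b q) (b q)" using assms by (simp add: near_orth_def)
qed (use assms in \<open>auto simp: near_orth_def\<close>)

lemma near_orth_orthogonal:
  "near_orth s \<zeta> b \<Longrightarrow> q < s \<Longrightarrow> q' < s \<Longrightarrow> q \<noteq> q' \<Longrightarrow> \<bar>ip (b q) (b q')\<bar> \<le> N\<^sup>2 / Q ^ 6"
  by (simp add: near_orth_def)

lemma zhat_sum:
  assumes "m \<le> i" "i < m + s"
  shows "(\<Sum>p<s. r p * zhat \<zeta> p i) = - r (i - m)"
proof -
  have "(\<Sum>p<s. r p * zhat \<zeta> p i) = (\<Sum>p<s. if p = i - m then - r p else 0)"
    using assms by (intro sum.cong) (auto simp: zhat_def)
  moreover have "i - m < s" using assms by linarith
  ultimately show ?thesis by (simp add: sum.delta)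
qed

lemma pass_coherent: "coherent s \<zeta> z (pass s \<zeta> b z f)"
  by (auto simp: coherent_def pass_def assemble_def)

lemma tau_bound:
  assumes "near_orth s \<zeta> b" "q < s" "\<bar>ip f (b q)\<bar> \<le> \<nu> * N\<^sup>2"
  shows "\<bar>tau b f q / N\<bar> \<le> \<nu> + 1 / (2 * N)"
    "\<bar>ip f (b q) - tau b f q / N * ip (b q) (b q)\<bar> \<le> 2 * Q ^ 3 * N"
proof -
  let ?\<beta> = "ip (b q) (b q)"
  have \<beta>: "N\<^sup>2 \<le> ?\<beta>" "?\<beta> \<le> 4 * Q ^ 3 * N\<^sup>2" "0 < ?\<beta>"
    using near_orth_b_norm[OF assms(1,2)] N_pos by (auto intro: less_le_trans[of 0 "N\<^sup>2"])
  have r: "\<bar>tau b f q - ip f (b q) * (N / ?\<beta>)\<bar> \<le> 1/2"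
    unfolding tau_def by (rule of_int_round_abs_le)
  have "tau b f q / N - ip f (b q) / ?\<beta> = (tau b f q - ip f (b q) * (N / ?\<beta>)) / N"
    using N_pos by (simp add: field_simps)
  then have r': "\<bar>tau b f q / N - ip f (b q) / ?\<beta>\<bar> \<le> 1 / (2 * N)"
    using r N_pos by (simp add: abs_divide divide_le_cancel field_simps)
  have "0 \<le> \<nu>" using assms(3) N_pos by (smt (verit) zero_less_power mult_neg_pos)
  have "\<bar>ip f (b q) / ?\<beta>\<bar> \<le> \<nu> * N\<^sup>2 / N\<^sup>2"
    unfolding abs_divide using assms(3) \<beta> N_pos by (intro frac_le) auto
  then have "\<bar>ip f (b q) / ?\<beta>\<bar> \<le> \<nu>" using N_pos by simp
  then show "\<bar>tau b f q / N\<bar> \<le> \<nu> + 1 / (2 * N)" using r' by linarith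
  have "ip f (b q) - tau b f q / N * ?\<beta> = - (tau b f q / N - ip f (b q) / ?\<beta>) * ?\<beta>"
    using \<beta> by (simp add: field_simps)
  then have "\<bar>ip f (b q) - tau b f q / N * ?\<beta>\<bar> = \<bar>tau b f q / N - ip f (b q) / ?\<beta>\<bar> * ?\<beta>"
    using \<beta> by (simp add: abs_mult)
  also have "\<dots> \<le> 1 / (2 * N) * (4 * Q ^ 3 * N\<^sup>2)"
    using r' \<beta> N_pos by (intro mult_mono) auto
  also have "\<dots> = 2 * Q ^ 3 * N" using N_pos by (simp add: power2_eq_square)
  finally show "\<bar>ip f (b q) - tau b f q / N * ?\<beta>\<bar> \<le> 2 * Q ^ 3 * N" .
qed

text \<open>Sizes of the intermediate integers, which later have to fit into the digits of packed
  vectors.\<close>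

lemma corr_bound:
  assumes "near_orth s \<zeta> b" "\<And>q. q < s \<Longrightarrow> \<bar>ip f (b q)\<bar> \<le> 3 * Q ^ 3 * N\<^sup>2"
  shows "q < s \<Longrightarrow> \<bar>tau b f q\<bar> \<le> 4 * Q ^ 3 * N"
    "\<bar>\<Sum>q<s. tau b f q * b q (m + p)\<bar> \<le> Q ^ 6 * N\<^sup>2"
    "\<bar>corr s b f p\<bar> \<le> Q ^ 6 * N + 1"
proof -
  have t: "\<bar>tau b f q\<bar> \<le> 4 * Q ^ 3 * N" if "q < s" for q
  proof -
    have "\<bar>tau b f q / N\<bar> \<le> 3 * Q ^ 3 + 1 / (2 * N)"
      using tau_bound(1)[OF assms(1) that] assms(2)[OF that] by blast
    moreover have "1 / (2 * N) \<le> 1" using N_ge Q_ge by (simp add: field_simps)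
    moreover have "1 \<le> Q ^ 3" using Q_ge by (simp add: one_le_power)
    ultimately have "\<bar>tau b f q / N\<bar> \<le> 4 * Q ^ 3" by linarith
    then show ?thesis using N_pos by (simp add: abs_divide field_simps)
  qed
  then show "q < s \<Longrightarrow> \<bar>tau b f q\<bar> \<le> 4 * Q ^ 3 * N" by blast
  have "\<bar>\<Sum>q<s. tau b f q * b q (m + p)\<bar> \<le> real s * ((4 * Q ^ 3 * N) * (2 * Q\<^sup>2 * N))"
  proof (rule abs_sum_le_card)
    fix q assume "q < s"
    then show "\<bar>tau b f q * b q (m + p)\<bar> \<le> (4 * Q ^ 3 * N) * (2 * Q\<^sup>2 * N)"
      unfolding abs_mult using t near_orth_b_coord[OF assms(1)] Q_pos N_pos by (intro mult_mono) auto
  qed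
  also have "\<dots> = (8 * real s) * ((Q ^ 3 * Q\<^sup>2) * N\<^sup>2)"
    by (simp add: power2_eq_square[of N] mult_ac del: power_add_numeral power_add_numeral2)
  also have "Q ^ 3 * Q\<^sup>2 = Q ^ 5" by (simp flip: power_add)
  also have "(8 * real s) * (Q ^ 5 * N\<^sup>2) \<le> Q * (Q ^ 5 * N\<^sup>2)"
    using s_le[of s] assms(1) Q_ge by (intro mult_right_mono) (auto simp: near_orth_def)
  also have "\<dots> = Q ^ 6 * N\<^sup>2" by (simp add: numeral_eq_Suc)
  finally show D: "\<bar>\<Sum>q<s. tau b f q * b q (m + p)\<bar> \<le> Q ^ 6 * N\<^sup>2" .
  have "\<bar>(\<Sum>q<s. tau b f q * b q (m + p)) * (1 / N)\<bar> \<le> Q ^ 6 * N\<^sup>2 * (1 / N)"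
    unfolding abs_mult using D N_pos by (intro mult_mono) auto
  also have "\<dots> = Q ^ 6 * N" using N_pos by (simp add: power2_eq_square)
  finally have "\<bar>(\<Sum>q<s. tau b f q * b q (m + p)) * (1 / N)\<bar> \<le> Q ^ 6 * N" .
  with of_int_round_abs_le[of "(\<Sum>q<s. tau b f q * b q (m + p)) * (1 / N)"]
  show "\<bar>corr s b f p\<bar> \<le> Q ^ 6 * N + 1" unfolding corr_def by linarith
qed

text \<open>A pass is an ordinary projection step followed by the error sum of
  \<open>r p * zhat \<zeta> p\<close> from rounding the last coordinates. In the inner product with
  \<open>b q\<close>, the term of \<open>b q\<close> itself cancels up to the rounding of
  \<open>tau\<close>; the other basis vectors contribute about \<open>\<nu>\<close> times their
  defect of orthogonality, at most \<open>1 / Q ^ 6\<close>; the vectors \<open>zhat\<close>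
  contribute the rest of the first summand.\<close>

lemma pass_step:
  assumes I: "near_orth s \<zeta> b" and f: "coherent s \<zeta> z f"
    and \<nu>: "\<forall>q<s. \<bar>ip f (b q)\<bar> \<le> \<nu> * N\<^sup>2" "0 \<le> \<nu>"
  obtains r where "\<forall>p<s. \<bar>r p\<bar> \<le> 1/2"
    "\<forall>i. pass s \<zeta> b z f i = f i - (\<Sum>q<s. tau b f q / N * b q i) + (\<Sum>p<s. r p * zhat \<zeta> p i)"
    "\<forall>q<s. \<bar>ip (pass s \<zeta> b z f) (b q)\<bar> \<le>
        ((2 + 2 * real s) * Q ^ 3 / N + real s * (\<nu> + 1 / (2 * N)) / Q ^ 6) * N\<^sup>2"
proof -
  let ?D = "\<lambda>p. \<Sum>q<s. tau b f q * b q (m + p)"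
  define r where "r p = corr s b f p - ?D p / N" for p
  have r: "\<bar>r p\<bar> \<le> 1/2" for p
    using of_int_round_abs_le[of "?D p * (1 / N)"] by (simp add: r_def corr_def)
  have sn: "s \<le> n" using I by (simp add: near_orth_def)
  have eq: "pass s \<zeta> b z f i = f i - (\<Sum>q<s. tau b f q / N * b q i) + (\<Sum>p<s. r p * zhat \<zeta> p i)" for i
  proof -
    consider "i < m" | "m \<le> i" "i < m + s" | "m + s \<le> i" by linarith
    then show ?thesis
    proof cases
      case 1
      have "(\<Sum>q<s. tau b f q / N * b q i) = (\<Sum>q<s. - (\<Sum>p<s. tau b f q / N * (b q (m + p) * \<zeta> p i)))"
      proof (rule sum.cong)
        fix q assume "q \<in> {..<s}"
        then have "b q i = - (\<Sum>p<s. b q (m + p) * \<zeta> p i)" using I 1 by (simp add: near_orth_def)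
        then show "tau b f q / N * b q i = - (\<Sum>p<s. tau b f q / N * (b q (m + p) * \<zeta> p i))"
          by (simp add: sum_distrib_left)
      qed simp
      also have "\<dots> = - (\<Sum>q<s. \<Sum>p<s. tau b f q / N * (b q (m + p) * \<zeta> p i))"
        by (rule sum_negf)
      also have "\<dots> = - (\<Sum>p<s. ?D p / N * \<zeta> p i)"
        by (subst sum.swap) (simp add: sum_distrib_right sum_divide_distrib mult.assoc)
      finally have b: "(\<Sum>q<s. tau b f q / N * b q i) = - (\<Sum>p<s. ?D p / N * \<zeta> p i)" .
      have "pass s \<zeta> b z f i = N * z i - (\<Sum>p<s. (f (m + p) - corr s b f p) * \<zeta> p i)"
        using 1 by (simp add: pass_def assemble_def)
      also have "\<dots> = f i + (\<Sum>p<s. corr s b f p * \<zeta> p i)"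
        using f 1 by (simp add: coherent_def left_diff_distrib sum_subtractf)
      also have "(\<Sum>p<s. corr s b f p * \<zeta> p i) = (\<Sum>p<s. ?D p / N * \<zeta> p i) + (\<Sum>p<s. r p * zhat \<zeta> p i)"
        unfolding sum.distrib[symmetric] using 1
        by (intro sum.cong) (auto simp: r_def zhat_def algebra_simps)
      finally show ?thesis using b by simp
    next
      case 2
      then have "(\<Sum>p<s. r p * zhat \<zeta> p i) = - r (i - m)" by (rule zhat_sum)
      moreover have "(\<Sum>q<s. tau b f q / N * b q i) = ?D (i - m) / N"
        using 2 by (simp add: sum_divide_distrib)
      ultimately show ?thesis using 2 by (simp add: pass_def assemble_def r_def)
    next
      case 3
      have "(\<Sum>p<s. r p * zhat \<zeta> p i) = 0" "(\<Sum>q<s. tau b f q / N * b q i) = 0"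
        using 3 I by (auto intro!: sum.neutral simp: zhat_def near_orth_def)
      then show ?thesis using 3 f by (simp add: pass_def assemble_def coherent_def)
    qed
  qed
  have "\<bar>ip (pass s \<zeta> b z f) (b q)\<bar> \<le>
        ((2 + 2 * real s) * Q ^ 3 / N + real s * (\<nu> + 1 / (2 * N)) / Q ^ 6) * N\<^sup>2" if q: "q < s" for q
  proof -
    let ?t = "\<lambda>q. tau b f q / N"
    have "ip (pass s \<zeta> b z f) (b q) =
        ip f (b q) - (\<Sum>q'<s. ?t q' * ip (b q') (b q)) + (\<Sum>p<s. r p * ip (zhat \<zeta> p) (b q))"
      unfolding dot_lincomb[symmetric] by (rule dot_cong) (simp_all add: eq)
    also have "(\<Sum>q'<s. ?t q' * ip (b q') (b q)) = ?t q * ip (b q) (b q) +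
        (\<Sum>q'<s. if q' = q then 0 else ?t q' * ip (b q') (b q))"
      using q by (simp add: sum.remove[of "{..<s}" q] sum.If_cases
        cong: if_cong) (auto intro!: sum.cong)
    finally have *: "ip (pass s \<zeta> b z f) (b q) = (ip f (b q) - ?t q * ip (b q) (b q))
        - (\<Sum>q'<s. if q' = q then 0 else ?t q' * ip (b q') (b q)) + (\<Sum>p<s. r p * ip (zhat \<zeta> p) (b q))"
      by simp
    have 1: "\<bar>ip f (b q) - ?t q * ip (b q) (b q)\<bar> \<le> 2 * Q ^ 3 * N"
      using tau_bound(2)[OF I q \<nu>(1)[rule_format, OF q]] .
    have 2: "\<bar>\<Sum>q'<s. if q' = q then 0 else ?t q' * ip (b q') (b q)\<bar> \<le>
        real s * ((\<nu> + 1 / (2 * N)) * (N\<^sup>2 / Q ^ 6))"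
    proof (rule abs_sum_le_card)
      fix q' assume q': "q' < s"
      show "\<bar>if q' = q then 0 else ?t q' * ip (b q') (b q)\<bar> \<le> (\<nu> + 1 / (2 * N)) * (N\<^sup>2 / Q ^ 6)"
      proof (cases "q' = q")
        case False
        then have "\<bar>ip (b q') (b q)\<bar> \<le> N\<^sup>2 / Q ^ 6" using I q q' by (simp add: near_orth_def)
        moreover have "\<bar>?t q'\<bar> \<le> \<nu> + 1 / (2 * N)" using tau_bound(1)[OF I q' \<nu>(1)[rule_format, OF q']] .
        ultimately show ?thesis using False \<nu>(2) N_pos by (simp only: abs_mult if_False) (rule mult_mono, auto)
      qed (use \<nu>(2) Q_pos N_pos in simp)
    qed
    have 3: "\<bar>\<Sum>p<s. r p * ip (zhat \<zeta> p) (b q)\<bar> \<le> real s * (1/2 * (4 * Q ^ 3 * N))"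
    proof (rule abs_sum_le_card)
      fix p assume p: "p < s"
      \<comment> \<open>\<open>abs_dot_le\<close> loses much for vectors of very different length;
        the factor \<open>N\<close> brings \<open>zhat \<zeta> p\<close> to the scale of
        \<open>b q\<close>.\<close>
      have "2 * \<bar>ip (\<lambda>i. N * zhat \<zeta> p i) (b q)\<bar> \<le>
          ip (\<lambda>i. N * zhat \<zeta> p i) (\<lambda>i. N * zhat \<zeta> p i) + ip (b q) (b q)" by (rule abs_dot_le)
      also have "ip (\<lambda>i. N * zhat \<zeta> p i) (\<lambda>i. N * zhat \<zeta> p i) = N\<^sup>2 * ip (zhat \<zeta> p) (zhat \<zeta> p)"
        by (simp add: dot_scale dot_scale_right power2_eq_square)
      also have "ip (zhat \<zeta> p) (zhat \<zeta> p) \<le> Q ^ 3"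
        using I p sn by (intro zhat_norm) (auto simp: near_orth_def)
      also have "ip (b q) (b q) \<le> 4 * Q ^ 3 * N\<^sup>2" using near_orth_b_norm[OF I q] by blast
      finally have "2 * (N * \<bar>ip (zhat \<zeta> p) (b q)\<bar>) \<le> N\<^sup>2 * Q ^ 3 + 4 * Q ^ 3 * N\<^sup>2"
        using N_pos by (simp add: dot_scale abs_mult mult_left_mono)
      also have "\<dots> = 2 * (N * (5/2 * Q ^ 3 * N))" by (simp add: power2_eq_square)
      finally have "\<bar>ip (zhat \<zeta> p) (b q)\<bar> \<le> 5/2 * Q ^ 3 * N" using N_pos by (simp add: mult.commute)
      also have "\<dots> \<le> 4 * Q ^ 3 * N" using N_pos Q_pos by simp
      finally show "\<bar>r p * ip (zhat \<zeta> p) (b q)\<bar> \<le> 1/2 * (4 * Q ^ 3 * N)"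
        unfolding abs_mult using r[of p] by (intro mult_mono) auto
    qed
    have "\<bar>ip (pass s \<zeta> b z f) (b q)\<bar> \<le> 2 * Q ^ 3 * N +
        real s * ((\<nu> + 1 / (2 * N)) * (N\<^sup>2 / Q ^ 6)) + real s * (1/2 * (4 * Q ^ 3 * N))"
      using * 1 2 3 by linarith
    also have "\<dots> = ((2 + 2 * real s) * Q ^ 3 / N + real s * (\<nu> + 1 / (2 * N)) / Q ^ 6) * N\<^sup>2"
      using N_pos by (simp add: field_simps power2_eq_square)
    finally show ?thesis .
  qed
  then show thesis using r eq by (intro that[of r]) simp_all
qed

lemma ip_split:
  assumes "s \<le> n" "\<And>i. m + s \<le> i \<Longrightarrow> u i * v i = 0"
  shows "ip u v = (\<Sum>l<m. u l * v l) + (\<Sum>p<s. u (m + p) * v (m + p))"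
proof -
  have "ip u v = dot (m + s) u v" by (rule dot_mono_neutral) (use assms in auto)
  also have "\<dots> = (\<Sum>l<m. u l * v l) + (\<Sum>p<s. u (m + p) * v (m + p))"
    unfolding dot_def by (induction s) auto
  finally show ?thesis .
qed

definition start :: "nat \<Rightarrow> (nat \<Rightarrow> nat \<Rightarrow> real) \<Rightarrow> (nat \<Rightarrow> real) \<Rightarrow> (nat \<Rightarrow> real)" where
  "start s \<zeta> z = assemble s \<zeta> z (\<lambda>_. 0)"

definition pass2 :: "nat \<Rightarrow> (nat \<Rightarrow> nat \<Rightarrow> real) \<Rightarrow> (nat \<Rightarrow> nat \<Rightarrow> real) \<Rightarrow> (nat \<Rightarrow> real) \<Rightarrow> (nat \<Rightarrow> real)" where
  "pass2 s \<zeta> b z = pass s \<zeta> b z (pass s \<zeta> b z (start s \<zeta> z))"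

lemma start_apply: "start s \<zeta> z i = (if i < m then N * z i else 0)"
  by (simp add: start_def assemble_def)

lemma start_coherent: "coherent s \<zeta> z (start s \<zeta> z)"
  by (auto simp: coherent_def start_apply)

lemma start_norm:
  assumes "\<forall>l<m. \<bar>z l\<bar> \<le> Q"
  shows "ip (start s \<zeta> z) (start s \<zeta> z) \<le> N\<^sup>2 * (Q ^ 3 - 1)"
proof -
  have "ip (start s \<zeta> z) (start s \<zeta> z) = N\<^sup>2 * (\<Sum>l<m. z l * z l)"
    by (subst ip_split[of 0]) (auto simp: start_apply sum_distrib_left power2_eq_square intro!: sum.cong)
  then show ?thesis using norm_z[of z] assms by (simp add: mult_left_mono)
qed

lemma start_ip:
  assumes "near_orth s \<zeta> b" "q < s" "\<forall>l<m. \<bar>z l\<bar> \<le> Q"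
  shows "\<bar>ip (start s \<zeta> z) (b q)\<bar> \<le> 3 * Q ^ 3 * N\<^sup>2"
proof -
  have "2 * \<bar>ip (start s \<zeta> z) (b q)\<bar> \<le> N\<^sup>2 * (Q ^ 3 - 1) + 4 * Q ^ 3 * N\<^sup>2"
    using abs_dot_le[of "m + n" "start s \<zeta> z" "b q"] start_norm[of z s \<zeta>, OF assms(3)] near_orth_b_norm(2)[OF assms(1,2)]
    by linarith
  also have "\<dots> \<le> 2 * (3 * Q ^ 3 * N\<^sup>2)" using Q_pos by (simp add: algebra_simps)
  finally show ?thesis by simp
qed

lemma nonneg_3: "0 \<le> 3 * Q ^ 3" using Q_pos by simp
lemma nonneg_tenth: "0 \<le> 1 / (10 * Q\<^sup>2)" using Q_pos by simp

lemma Q_quot: "a + b = c \<Longrightarrow> Q ^ a / Q ^ c = 1 / Q ^ b"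
  using Q_pos by (auto simp: power_add)

lemma Q_mult: "Q * Q ^ a = Q ^ Suc a" by simp

lemma N_half: "1 / (2 * N) \<le> 1 / (10 * Q\<^sup>2)"
proof -
  have "5 * Q\<^sup>2 \<le> Q * Q\<^sup>2" using Q_ge by (intro mult_right_mono) auto
  also have "\<dots> = Q ^ 3" by (simp add: numeral_eq_Suc)
  also have "\<dots> \<le> N" unfolding N_def by (rule Q_pow_mono) simp
  finally show ?thesis using Q_pos N_pos by (simp add: field_simps)
qed

lemma round_err:
  assumes "s \<le> n"
  shows "(2 + 2 * real s) * Q ^ 3 / N \<le> 1 / (50 * Q ^ 8)"
proof -
  have "2 + 2 * real s \<le> Q / 50" using s_le[OF assms] by linarith
  then have "(2 + 2 * real s) * Q ^ 3 / N \<le> Q / 50 * Q ^ 3 / N"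
    using Q_pos N_pos by (intro divide_right_mono mult_right_mono) (simp_all add: less_imp_le)
  also have "Q / 50 * Q ^ 3 = Q ^ 4 / 50" by (simp add: eval_nat_numeral)
  also have "Q ^ 4 / 50 / N = (Q ^ 4 / Q ^ 12) / 50" by (simp only: N_def divide_divide_eq_left mult.commute)
  also have "Q ^ 4 / Q ^ 12 = 1 / Q ^ 8" by (rule Q_quot) simp
  also have "1 / Q ^ 8 / 50 = 1 / (50 * Q ^ 8)" by (simp only: divide_divide_eq_left mult.commute)
  finally show ?thesis .
qed

text \<open>The start vector may have inner products up to \<open>3 * Q ^ 3 * N\<^sup>2\<close> with
  the basis. Multiplied by the defect Q^-6 and by fewer than Q / 100 terms, they leave about Q^-2.
  This is too much for a new basis vector, of which \<open>near_orth\<close> demands Q^-6.\<close>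

lemma first_pass:
  assumes I: "near_orth s \<zeta> b" and z: "\<forall>l<m. \<bar>z l\<bar> \<le> Q" and q: "q < s"
  shows "\<bar>ip (pass s \<zeta> b z (start s \<zeta> z)) (b q)\<bar> \<le> 1 / (10 * Q\<^sup>2) * N\<^sup>2"
proof -
  have sn: "s \<le> n" using I by (simp add: near_orth_def)
  have st: "\<forall>q<s. \<bar>ip (start s \<zeta> z) (b q)\<bar> \<le> 3 * Q ^ 3 * N\<^sup>2" using start_ip[OF I _ z] by blast
  have "\<bar>ip (pass s \<zeta> b z (start s \<zeta> z)) (b q)\<bar> \<le>
        ((2 + 2 * real s) * Q ^ 3 / N + real s * (3 * Q ^ 3 + 1 / (2 * N)) / Q ^ 6) * N\<^sup>2"
    by (rule pass_step[OF I start_coherent st nonneg_3]) (use q in blast)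
  also have "(2 + 2 * real s) * Q ^ 3 / N + real s * (3 * Q ^ 3 + 1 / (2 * N)) / Q ^ 6 \<le> 1 / (10 * Q\<^sup>2)"
  proof -
    have "real s * (3 * Q ^ 3 + 1 / (2 * N)) / Q ^ 6 \<le> Q / 100 * (4 * Q ^ 3) / Q ^ 6"
    proof (intro divide_right_mono mult_mono)
      have "1 / (10 * Q\<^sup>2) \<le> 1 / 10" using Q_ge by (simp add: field_simps one_le_power)
      moreover have "1 \<le> Q ^ 3" using Q_ge by (simp add: one_le_power)
      ultimately show "3 * Q ^ 3 + 1 / (2 * N) \<le> 4 * Q ^ 3" using N_half by linarith
    qed (use s_le[OF sn] Q_pos N_pos in auto)
    also have "\<dots> = (Q ^ 4 / Q ^ 6) / 25" using Q_mult[of 3] by simp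
    also have "\<dots> = 1 / (25 * Q\<^sup>2)" by (subst Q_quot[of 4 2]) auto
    finally have "real s * (3 * Q ^ 3 + 1 / (2 * N)) / Q ^ 6 \<le> 1 / (25 * Q\<^sup>2)" .
    moreover have "1 / (50 * Q ^ 8) \<le> 1 / (50 * Q\<^sup>2)"
      using Q_pos Q_pow_mono[of 2 8] by (intro divide_left_mono) auto
    moreover have "1 / (25 * Q\<^sup>2) + 1 / (50 * Q\<^sup>2) \<le> 1 / (10 * Q\<^sup>2)" using Q_pos by (simp add: field_simps)
    ultimately show ?thesis using round_err[OF sn] by linarith
  qed
  finally show ?thesis by (simp add: mult_right_mono)
qed

text \<open>With the result of the first pass as input, the defect of the basis contributes only Q *
  Q^-2 * Q^-6 = Q^-7, up to a constant. The new vector is thus at least as orthogonal as the old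
  ones were, and the quality of the basis does not decay with its length.\<close>

lemma second_pass:
  assumes I: "near_orth s \<zeta> b" and z: "\<forall>l<m. \<bar>z l\<bar> \<le> Q" and q: "q < s"
  shows "\<bar>ip (pass2 s \<zeta> b z) (b q)\<bar> \<le> 1 / Q ^ 7 * N\<^sup>2"
proof -
  have sn: "s \<le> n" using I by (simp add: near_orth_def)
  have st: "\<forall>q<s. \<bar>ip (pass s \<zeta> b z (start s \<zeta> z)) (b q)\<bar> \<le> 1 / (10 * Q\<^sup>2) * N\<^sup>2"
    using first_pass[OF I z] by blast
  have "\<bar>ip (pass2 s \<zeta> b z) (b q)\<bar> \<le>
        ((2 + 2 * real s) * Q ^ 3 / N + real s * (1 / (10 * Q\<^sup>2) + 1 / (2 * N)) / Q ^ 6) * N\<^sup>2"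
    unfolding pass2_def by (rule pass_step[OF I pass_coherent st nonneg_tenth]) (use q in blast)
  also have "(2 + 2 * real s) * Q ^ 3 / N + real s * (1 / (10 * Q\<^sup>2) + 1 / (2 * N)) / Q ^ 6 \<le> 1 / Q ^ 7"
  proof -
    have "real s * (1 / (10 * Q\<^sup>2) + 1 / (2 * N)) / Q ^ 6 \<le> Q / 100 * (1 / (5 * Q\<^sup>2)) / Q ^ 6"
    proof (intro divide_right_mono mult_mono)
      have "1 / (10 * Q\<^sup>2) + 1 / (10 * Q\<^sup>2) = 1 / (5 * Q\<^sup>2)" by simp
      then show "1 / (10 * Q\<^sup>2) + 1 / (2 * N) \<le> 1 / (5 * Q\<^sup>2)" using N_half by linarith
    qed (use s_le[OF sn] Q_pos N_pos in auto)
    also have "\<dots> = (Q ^ 1 / Q ^ 8) / 500" by (simp flip: power_add)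
    also have "\<dots> = 1 / (500 * Q ^ 7)" by (subst Q_quot[of 1 7]) auto
    finally have "real s * (1 / (10 * Q\<^sup>2) + 1 / (2 * N)) / Q ^ 6 \<le> 1 / (500 * Q ^ 7)" .
    moreover have "1 / (50 * Q ^ 8) \<le> 1 / (50 * Q ^ 7)"
      using Q_pos Q_pow_mono[of 7 8] by (intro divide_left_mono) auto
    moreover have "1 / (500 * Q ^ 7) + 1 / (50 * Q ^ 7) \<le> 1 / Q ^ 7" using Q_pos by (simp add: field_simps)
    ultimately show ?thesis using round_err[OF sn] by linarith
  qed
  finally show ?thesis by (simp add: mult_right_mono)
qed

text \<open>The two passes added up. For the next basis vector this becomes the triangular relation
  recorded in \<open>near_orth\<close>.\<close>

lemma pass2_decomposition:
  assumes I: "near_orth s \<zeta> b" and z: "\<forall>l<m. \<bar>z l\<bar> \<le> Q"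
  obtains c r where "\<forall>q<s. \<bar>c q\<bar> \<le> 4 * Q ^ 3" "\<forall>p<s. \<bar>r p\<bar> \<le> 1"
    "\<forall>i. start s \<zeta> z i = pass2 s \<zeta> b z i + (\<Sum>q<s. c q * b q i) + (\<Sum>p<s. r p * zhat \<zeta> p i)"
proof -
  let ?f0 = "start s \<zeta> z" and ?f1 = "pass s \<zeta> b z (start s \<zeta> z)"
  have st0: "\<forall>q<s. \<bar>ip ?f0 (b q)\<bar> \<le> 3 * Q ^ 3 * N\<^sup>2" using start_ip[OF I _ z] by blast
  have st1: "\<forall>q<s. \<bar>ip ?f1 (b q)\<bar> \<le> 1 / (10 * Q\<^sup>2) * N\<^sup>2" using first_pass[OF I z] by blast
  obtain r0 where r0: "\<forall>p<s. \<bar>r0 p\<bar> \<le> 1/2"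
    "\<forall>i. ?f1 i = ?f0 i - (\<Sum>q<s. tau b ?f0 q / N * b q i) + (\<Sum>p<s. r0 p * zhat \<zeta> p i)"
    by (rule pass_step[OF I start_coherent st0 nonneg_3])
  obtain r1 where r1: "\<forall>p<s. \<bar>r1 p\<bar> \<le> 1/2"
    "\<forall>i. pass2 s \<zeta> b z i = ?f1 i - (\<Sum>q<s. tau b ?f1 q / N * b q i) + (\<Sum>p<s. r1 p * zhat \<zeta> p i)"
    unfolding pass2_def by (rule pass_step[OF I pass_coherent st1 nonneg_tenth])
  show thesis
  proof (rule that[of "\<lambda>q. tau b ?f0 q / N + tau b ?f1 q / N" "\<lambda>p. - r0 p - r1 p"])
    show "\<forall>p<s. \<bar>- r0 p - r1 p\<bar> \<le> 1"
    proof (intro allI impI)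
      fix p assume "p < s"
      then have "\<bar>r0 p\<bar> \<le> 1/2" "\<bar>r1 p\<bar> \<le> 1/2" using r0(1) r1(1) by blast+
      then show "\<bar>- r0 p - r1 p\<bar> \<le> 1" by linarith
    qed
    show "\<forall>q<s. \<bar>tau b ?f0 q / N + tau b ?f1 q / N\<bar> \<le> 4 * Q ^ 3"
    proof (intro allI impI)
      fix q assume q: "q < s"
      have "1 / (10 * Q\<^sup>2) \<le> 1 / 10" using Q_ge by (simp add: field_simps one_le_power)
      moreover have "1 \<le> Q ^ 3" using Q_ge by (simp add: one_le_power)
      moreover note tau_bound(1)[OF I q start_ip[OF I q z]] tau_bound(1)[OF I q first_pass[OF I z q]]
      ultimately show "\<bar>tau b ?f0 q / N + tau b ?f1 q / N\<bar> \<le> 4 * Q ^ 3" using N_half by linarith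
    qed
    show "\<forall>i. ?f0 i = pass2 s \<zeta> b z i + (\<Sum>q<s. (tau b ?f0 q / N + tau b ?f1 q / N) * b q i) +
        (\<Sum>p<s. (- r0 p - r1 p) * zhat \<zeta> p i)"
    proof
      fix i
      show "?f0 i = pass2 s \<zeta> b z i + (\<Sum>q<s. (tau b ?f0 q / N + tau b ?f1 q / N) * b q i) +
          (\<Sum>p<s. (- r0 p - r1 p) * zhat \<zeta> p i)"
      using r0(2)[rule_format, of i] r1(2)[rule_format, of i]
      by (simp only: distrib_right left_diff_distrib minus_mult_left[symmetric] sum.distrib sum_subtractf sum_negf)
    qed
  qed
qed

lemma pass2_coherent: "coherent s \<zeta> z (pass2 s \<zeta> b z)"
  unfolding pass2_def by (rule pass_coherent)

lemma near_orth_decomposition: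
  assumes "near_orth s \<zeta> b" "p < s"
  obtains c r where "\<forall>q<p. \<bar>c q\<bar> \<le> 4 * Q ^ 3" "\<forall>q<p. \<bar>r q\<bar> \<le> 1"
    "\<forall>i. N * zhat \<zeta> p i = b p i + (\<Sum>q<p. c q * b q i) + (\<Sum>q<p. r q * zhat \<zeta> q i)"
proof -
  have "\<exists>c r. (\<forall>q<p. \<bar>c q\<bar> \<le> 4 * Q ^ 3) \<and> (\<forall>q<p. \<bar>r q\<bar> \<le> 1) \<and>
       (\<forall>i. N * zhat \<zeta> p i = b p i + (\<Sum>q<p. c q * b q i) + (\<Sum>q<p. r q * zhat \<zeta> q i))"
    using assms by (simp add: near_orth_def)
  then show thesis by (elim exE conjE) (rule that)
qed

text \<open>Orthogonality to the \<open>b q\<close> passes to the \<open>zhat \<zeta> p\<close> by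
  induction along the triangular relation. Earlier \<open>zhat\<close> enter it with coefficients at
  most 1 while the left-hand side carries the factor \<open>N\<close>, so their errors do not
  accumulate.\<close>

lemma pass2_zhat:
  assumes I: "near_orth s \<zeta> b" and z: "\<forall>l<m. \<bar>z l\<bar> \<le> Q" and "p < s"
  shows "\<bar>ip (pass2 s \<zeta> b z) (zhat \<zeta> p)\<bar> \<le> N / Q\<^sup>2"
  using \<open>p < s\<close>
proof (induction p rule: less_induct)
  case (less p)
  let ?f = "pass2 s \<zeta> b z"
  have sn: "s \<le> n" using I by (simp add: near_orth_def)
  have pn: "real p \<le> Q / 100 - 2" using s_le[of p] less.prems sn by simp
  obtain c r where cr: "\<forall>q<p. \<bar>c q\<bar> \<le> 4 * Q ^ 3" "\<forall>q<p. \<bar>r q\<bar> \<le> 1"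
    "\<forall>i. N * zhat \<zeta> p i = b p i + (\<Sum>q<p. c q * b q i) + (\<Sum>q<p. r q * zhat \<zeta> q i)"
    by (rule near_orth_decomposition[OF I less.prems])
  have "ip ?f (\<lambda>i. N * zhat \<zeta> p i) = ip (\<lambda>i. b p i - (\<Sum>q<p. (- c q) * b q i) + (\<Sum>q<p. r q * zhat \<zeta> q i)) ?f"
    by (subst dot_commute, rule dot_cong) (simp_all add: cr(3) sum_negf)
  also have "\<dots> = ip ?f (b p) + (\<Sum>q<p. c q * ip ?f (b q)) + (\<Sum>q<p. r q * ip ?f (zhat \<zeta> q))"
    unfolding dot_lincomb by (simp add: sum_negf dot_commute[of _ ?f])
  finally have eq: "N * ip ?f (zhat \<zeta> p) = ip ?f (b p) + (\<Sum>q<p. c q * ip ?f (b q)) + (\<Sum>q<p. r q * ip ?f (zhat \<zeta> q))"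
    by (simp only: dot_scale_right)
  have "\<bar>\<Sum>q<p. c q * ip ?f (b q)\<bar> \<le> real p * (4 * Q ^ 3 * (1 / Q ^ 7 * N\<^sup>2))"
  proof (rule abs_sum_le_card)
    fix q assume "q < p"
    then show "\<bar>c q * ip ?f (b q)\<bar> \<le> 4 * Q ^ 3 * (1 / Q ^ 7 * N\<^sup>2)"
      unfolding abs_mult using cr(1) less.prems Q_pos
      by (intro mult_mono second_pass[OF I z]) auto
  qed
  also have "\<dots> \<le> (Q / 100) * (4 * Q ^ 3 * (1 / Q ^ 7 * N\<^sup>2))"
    using pn Q_pos by (intro mult_right_mono) auto
  also have "\<dots> = (Q * Q ^ 3) / Q ^ 7 * N\<^sup>2 / 25" by simp
  also have "Q * Q ^ 3 = Q ^ 4" by (simp add: eval_nat_numeral)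
  also have "Q ^ 4 / Q ^ 7 = 1 / Q ^ 3" by (rule Q_quot) simp
  also have "1 / Q ^ 3 * N\<^sup>2 / 25 = N\<^sup>2 / (25 * Q ^ 3)" by simp
  also have "\<dots> \<le> N\<^sup>2 / (25 * Q\<^sup>2)" using Q_pow_mono[of 2 3] Q_pos by (intro divide_left_mono) auto
  finally have 1: "\<bar>\<Sum>q<p. c q * ip ?f (b q)\<bar> \<le> N\<^sup>2 / (25 * Q\<^sup>2)" .
  have "\<bar>\<Sum>q<p. r q * ip ?f (zhat \<zeta> q)\<bar> \<le> real p * (1 * (N / Q\<^sup>2))"
  proof (rule abs_sum_le_card)
    fix q assume "q < p"
    then show "\<bar>r q * ip ?f (zhat \<zeta> q)\<bar> \<le> 1 * (N / Q\<^sup>2)"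
      unfolding abs_mult using cr(2) less.IH[of q] less.prems by (intro mult_mono) auto
  qed
  also have "\<dots> \<le> N / 100 * (1 * (N / Q\<^sup>2))"
    using pn N_ge N_pos by (intro mult_right_mono) auto
  also have "\<dots> = N\<^sup>2 / (100 * Q\<^sup>2)" by (simp add: power2_eq_square)
  finally have 2: "\<bar>\<Sum>q<p. r q * ip ?f (zhat \<zeta> q)\<bar> \<le> N\<^sup>2 / (100 * Q\<^sup>2)" .
  have "1 / Q ^ 7 \<le> 1 / (25 * Q\<^sup>2)"
  proof -
    have "25 * Q\<^sup>2 \<le> Q * Q\<^sup>2" using Q_ge by (intro mult_right_mono) auto
    also have "\<dots> = Q ^ 3" by (simp add: numeral_eq_Suc)
    also have "\<dots> \<le> Q ^ 7" by (rule Q_pow_mono) simp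
    finally show ?thesis using Q_pos by (intro divide_left_mono) auto
  qed
  from mult_right_mono[OF this zero_le_power2[of N]]
  have 3: "\<bar>ip ?f (b p)\<bar> \<le> N\<^sup>2 / (25 * Q\<^sup>2)" using second_pass[OF I z less.prems] by simp
  have "N\<^sup>2 / (25 * Q\<^sup>2) + N\<^sup>2 / (25 * Q\<^sup>2) + N\<^sup>2 / (100 * Q\<^sup>2) \<le> N * (N / Q\<^sup>2)"
    using N_pos Q_pos by (simp add: field_simps power2_eq_square)
  then have "\<bar>N * ip ?f (zhat \<zeta> p)\<bar> \<le> N * (N / Q\<^sup>2)" unfolding eq using 1 2 3 by linarith
  then have "N * \<bar>ip ?f (zhat \<zeta> p)\<bar> \<le> N * (N / Q\<^sup>2)" using N_pos by (simp only: abs_mult abs_of_pos)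
  then show ?case using N_pos by (simp only: mult_le_cancel_left_pos)
qed

text \<open>The residual f is almost orthogonal to all that was subtracted from the start vector.
  Hence |f|^2 is nearly the inner product of f with the start vector, thus at most about half of the
  sum of both squared norms, and |f| hardly exceeds the norm of the start vector. This bound does
  not grow with \<open>s\<close>.\<close>

lemma pass2_norm:
  assumes I: "near_orth s \<zeta> b" and z: "\<forall>l<m. \<bar>z l\<bar> \<le> Q"
  shows "ip (pass2 s \<zeta> b z) (pass2 s \<zeta> b z) \<le> 2 * Q ^ 3 * N\<^sup>2"
proof -
  let ?f = "pass2 s \<zeta> b z" and ?st = "start s \<zeta> z"
  have sn: "s \<le> n" using I by (simp add: near_orth_def)
  have pn: "real s \<le> Q / 100 - 2" using s_le[of s] sn by simp
  obtain c r where cr: "\<forall>q<s. \<bar>c q\<bar> \<le> 4 * Q ^ 3" "\<forall>p<s. \<bar>r p\<bar> \<le> 1"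
    "\<forall>i. ?st i = ?f i + (\<Sum>q<s. c q * b q i) + (\<Sum>p<s. r p * zhat \<zeta> p i)"
    by (rule pass2_decomposition[OF I z])
  have "ip ?f ?f = ip (\<lambda>i. ?st i - (\<Sum>q<s. c q * b q i) + (\<Sum>q<s. (- r q) * zhat \<zeta> q i)) ?f"
    by (rule dot_cong) (simp_all add: cr(3) sum_negf)
  also have "\<dots> = ip ?st ?f - (\<Sum>q<s. c q * ip ?f (b q)) - (\<Sum>q<s. r q * ip ?f (zhat \<zeta> q))"
    unfolding dot_lincomb by (simp add: sum_negf dot_commute[of _ ?f])
  finally have eq: "ip ?f ?f = ip ?st ?f - (\<Sum>q<s. c q * ip ?f (b q)) - (\<Sum>q<s. r q * ip ?f (zhat \<zeta> q))" .
  have "\<bar>\<Sum>q<s. c q * ip ?f (b q)\<bar> \<le> real s * (4 * Q ^ 3 * (1 / Q ^ 7 * N\<^sup>2))"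
  proof (rule abs_sum_le_card)
    fix q assume "q < s"
    then show "\<bar>c q * ip ?f (b q)\<bar> \<le> 4 * Q ^ 3 * (1 / Q ^ 7 * N\<^sup>2)"
      unfolding abs_mult using cr(1) Q_pos
      by (intro mult_mono second_pass[OF I z]) auto
  qed
  also have "\<dots> \<le> (Q / 100) * (4 * Q ^ 3 * (1 / Q ^ 7 * N\<^sup>2))"
    using pn Q_pos by (intro mult_right_mono) auto
  also have "\<dots> = (Q * Q ^ 3) / Q ^ 7 * N\<^sup>2 / 25" by simp
  also have "Q * Q ^ 3 = Q ^ 4" by (simp add: eval_nat_numeral)
  also have "Q ^ 4 / Q ^ 7 = 1 / Q ^ 3" by (rule Q_quot) simp
  also have "1 / Q ^ 3 * N\<^sup>2 / 25 = N\<^sup>2 / (25 * Q ^ 3)" by simp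
  also have "\<dots> \<le> N\<^sup>2 / 25" using Q_ge by (intro divide_left_mono) (auto simp: one_le_power)
  finally have 1: "\<bar>\<Sum>q<s. c q * ip ?f (b q)\<bar> \<le> N\<^sup>2 / 25" .
  have "\<bar>\<Sum>q<s. r q * ip ?f (zhat \<zeta> q)\<bar> \<le> real s * (1 * (N / Q\<^sup>2))"
  proof (rule abs_sum_le_card)
    fix q assume "q < s"
    then show "\<bar>r q * ip ?f (zhat \<zeta> q)\<bar> \<le> 1 * (N / Q\<^sup>2)"
      unfolding abs_mult using cr(2) pass2_zhat[OF I z] by (intro mult_mono) auto
  qed
  also have "\<dots> \<le> N / 100 * (1 * (N / 1))"
    using pn N_ge N_pos Q_ge by (intro mult_mono divide_left_mono) (auto simp: one_le_power)
  also have "\<dots> = N\<^sup>2 / 100" by (simp add: power2_eq_square)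
  finally have 2: "\<bar>\<Sum>q<s. r q * ip ?f (zhat \<zeta> q)\<bar> \<le> N\<^sup>2 / 100" .
  have aux: "2 * x \<le> w + x + 2 * (e + g)"
    if "2 * u \<le> w + x" "x = u - a - r" "\<bar>a\<bar> \<le> e" "\<bar>r\<bar> \<le> g" for x u w e g a r :: real
    using that by (smt (verit))
  have aux2: "x \<le> w + e" if "2 * x \<le> w + x + 2 * (e / 25 + e / 100)" "0 \<le> e" for x w e :: real
    using that by (simp add: field_simps)
  have "2 * ip ?st ?f \<le> N\<^sup>2 * (Q ^ 3 - 1) + ip ?f ?f"
    using abs_dot_le[of "m + n" ?st ?f] start_norm[of z s \<zeta>, OF z] by linarith
  then have "2 * ip ?f ?f \<le> N\<^sup>2 * (Q ^ 3 - 1) + ip ?f ?f + 2 * (N\<^sup>2 / 25 + N\<^sup>2 / 100)"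
    by (rule aux[OF _ eq 1 2])
  then have "ip ?f ?f \<le> N\<^sup>2 * (Q ^ 3 - 1) + N\<^sup>2"
    by (rule aux2) simp
  also have "\<dots> = N\<^sup>2 * Q ^ 3" by (simp add: algebra_simps)
  also have "\<dots> \<le> 2 * Q ^ 3 * N\<^sup>2" using Q_pos by simp
  finally show ?thesis .
qed

text \<open>In exact arithmetic the first coordinates of f / N form M^-1 z, the maximiser of the
  expression, and the maximum is |f|^2 / N^2. The numbers \<open>\<omega> p\<close> measure how far
  f is from orthogonal to \<open>zhat \<zeta> p\<close>; they lower the value by exactly the sum of
  their squares, which is at most 1/2.\<close>

lemma pass2_witness:
  assumes I: "near_orth s \<zeta> b" and z: "\<forall>l<m. \<bar>z l\<bar> \<le> Q"
    and big: "N\<^sup>2 < ip (pass2 s \<zeta> b z) (pass2 s \<zeta> b z)"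
  shows "\<exists>v. 1/2 \<le> 2 * (\<Sum>l<m. z l * v l) - (\<Sum>l<m. v l * v l) - (\<Sum>p<s. (\<Sum>l<m. \<zeta> p l * v l)\<^sup>2)"
proof
  let ?f = "pass2 s \<zeta> b z"
  define v where "v l = ?f l / N" for l
  define x where "x p = ?f (m + p) / N" for p
  define \<omega> where "\<omega> p = ip ?f (zhat \<zeta> p) / N" for p
  have sn: "s \<le> n" using I by (simp add: near_orth_def)
  have coh: "?f i = N * z i - (\<Sum>p<s. ?f (m + p) * \<zeta> p i)" if "i < m" for i
    using pass2_coherent that by (simp add: coherent_def)
  have zero: "?f i = 0" if "m + s \<le> i" for i
    using pass2_coherent that by (simp add: coherent_def)
  have zv: "(\<Sum>l<m. \<zeta> p l * v l) = \<omega> p + x p" if "p < s" for p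
  proof -
    have "ip ?f (zhat \<zeta> p) = (\<Sum>l<m. ?f l * zhat \<zeta> p l) + (\<Sum>q<s. ?f (m + q) * zhat \<zeta> p (m + q))"
      by (rule ip_split) (use sn zero in auto)
    also have "(\<Sum>q<s. ?f (m + q) * zhat \<zeta> p (m + q)) = (\<Sum>q<s. if q = p then - ?f (m + q) else 0)"
      by (rule sum.cong) (auto simp: zhat_def)
    also have "\<dots> = - ?f (m + p)" using that by (simp add: sum.delta)
    also have "(\<Sum>l<m. ?f l * zhat \<zeta> p l) = (\<Sum>l<m. ?f l * \<zeta> p l)" by (simp add: zhat_def)
    finally have "ip ?f (zhat \<zeta> p) = (\<Sum>l<m. ?f l * \<zeta> p l) - ?f (m + p)" by simp
    moreover have "(\<Sum>l<m. \<zeta> p l * v l) = (\<Sum>l<m. ?f l * \<zeta> p l) / N"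
      by (simp add: v_def sum_divide_distrib mult.commute)
    ultimately show ?thesis by (simp add: \<omega>_def x_def diff_divide_distrib)
  qed
  have zl: "z l = v l + (\<Sum>p<s. x p * \<zeta> p l)" if "l < m" for l
  proof -
    have "(\<Sum>p<s. x p * \<zeta> p l) = (\<Sum>p<s. ?f (m + p) * \<zeta> p l) / N"
      by (simp add: x_def sum_divide_distrib)
    then show ?thesis using coh[OF that] N_pos by (simp add: v_def field_simps)
  qed
  have "(\<Sum>l<m. z l * v l) = (\<Sum>l<m. v l * v l) + (\<Sum>l<m. \<Sum>p<s. x p * (\<zeta> p l * v l))"
    unfolding sum.distrib[symmetric]
    by (rule sum.cong) (simp_all add: zl distrib_right sum_distrib_right mult.assoc)
  also have "(\<Sum>l<m. \<Sum>p<s. x p * (\<zeta> p l * v l)) = (\<Sum>p<s. x p * (\<omega> p + x p))"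
    by (subst sum.swap) (simp add: sum_distrib_left[symmetric] zv)
  finally have "2 * (\<Sum>l<m. z l * v l) - (\<Sum>l<m. v l * v l) - (\<Sum>p<s. (\<Sum>l<m. \<zeta> p l * v l)\<^sup>2) =
     (\<Sum>l<m. v l * v l) + (\<Sum>p<s. 2 * (x p * (\<omega> p + x p)) - (\<omega> p + x p)\<^sup>2)"
    by (simp add: zv sum_subtractf sum_distrib_left)
  \<comment> \<open>Termwise, 2 x (\<omega> + x) - (\<omega> + x)^2 = x^2 - \<omega>^2.\<close>
  also have "\<dots> = (\<Sum>l<m. v l * v l) + (\<Sum>p<s. x p * x p) - (\<Sum>p<s. (\<omega> p)\<^sup>2)"
    unfolding add_diff_eq[symmetric] sum_subtractf[symmetric]
    by (intro arg_cong2[of _ _ _ _ "(+)"] refl sum.cong) (simp add: algebra_simps power2_eq_square)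
  also have "(\<Sum>l<m. v l * v l) + (\<Sum>p<s. x p * x p) = ip ?f ?f / N\<^sup>2"
    by (subst ip_split[OF sn]) (auto simp: zero v_def x_def add_divide_distrib sum_divide_distrib power2_eq_square)
  finally have eq: "2 * (\<Sum>l<m. z l * v l) - (\<Sum>l<m. v l * v l) - (\<Sum>p<s. (\<Sum>l<m. \<zeta> p l * v l)\<^sup>2) =
     ip ?f ?f / N\<^sup>2 - (\<Sum>p<s. (\<omega> p)\<^sup>2)" .
  have "\<bar>\<Sum>p<s. (\<omega> p)\<^sup>2\<bar> \<le> real s * (1 / Q)"
  proof (rule abs_sum_le_card)
    fix p assume "p < s"
    have "\<bar>\<omega> p\<bar> \<le> (N / Q\<^sup>2) / N"
      unfolding \<omega>_def abs_divide using divide_right_mono[OF pass2_zhat[OF I z \<open>p < s\<close>], of N] N_pos by simp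
    also have "\<dots> = 1 / Q\<^sup>2" using N_pos by simp
    finally have "\<bar>\<omega> p\<bar>\<^sup>2 \<le> (1 / Q\<^sup>2)\<^sup>2" by (intro power_mono) auto
    also have "\<dots> \<le> 1 / Q" using Q_pow_mono[of 1 4] Q_pos by (simp add: power_divide divide_left_mono)
    finally show "\<bar>(\<omega> p)\<^sup>2\<bar> \<le> 1 / Q" by simp
  qed
  also have "real s * (1 / Q) \<le> 1/2" using s_le[OF sn] Q_pos by (simp add: field_simps)
  finally have "(\<Sum>p<s. (\<omega> p)\<^sup>2) \<le> 1/2" by linarith
  moreover have "1 < ip ?f ?f / N\<^sup>2" using big N_pos by simp
  ultimately show "1/2 \<le> 2 * (\<Sum>l<m. z l * v l) - (\<Sum>l<m. v l * v l) - (\<Sum>p<s. (\<Sum>l<m. \<zeta> p l * v l)\<^sup>2)"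
    unfolding eq by linarith
qed

lemma near_orth_0: "near_orth 0 \<zeta> b"
  by (simp add: near_orth_def)

end

context gram begin
text \<open>The old basis vectors vanish at coordinate \<open>m + s\<close>. Writing
  \<open>- N\<close> there turns the residual of (z, 0) into that of (z, -e_s) without touching its
  inner products with the old vectors, and adds exactly \<open>N\<^sup>2\<close> to the squared
  norm.\<close>

lemma near_orth_extend:
  assumes I: "near_orth s \<zeta> b" and z: "\<forall>l<m. \<bar>z l\<bar> \<le> Q" and sn: "s < n"
  defines "\<zeta>' \<equiv> \<zeta>(s := z)" and "b' \<equiv> b(s := (pass2 s \<zeta> b z)(m + s := - N))"
  shows "near_orth (Suc s) \<zeta>' b'"
    "ip (b' s) (b' s) = ip (pass2 s \<zeta> b z) (pass2 s \<zeta> b z) + N\<^sup>2"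
proof -
  let ?f = "pass2 s \<zeta> b z"
  have coh: "?f i = N * z i - (\<Sum>p<s. ?f (m + p) * \<zeta> p i)" if "i < m" for i
    using pass2_coherent that by (simp add: coherent_def)
  have zero: "?f i = 0" if "m + s \<le> i" for i
    using pass2_coherent that by (simp add: coherent_def)
  have bs: "b' s i = (if i = m + s then - N else ?f i)" for i by (simp add: b'_def)
  have zs: "zhat \<zeta>' p i = zhat \<zeta> p i" if "p < s" for p i using that by (simp add: \<zeta>'_def zhat_def)
  have bq: "b' q = b q" if "q < s" for q using that by (simp add: b'_def)
  have b0: "b q i = 0" if "q < s" "m + q < i" for q i using I that by (simp add: near_orth_def)
  show nn: "ip (b' s) (b' s) = ip ?f ?f + N\<^sup>2"
  proof -
    have "ip (b' s) (b' s) = (\<Sum>l<m. b' s l * b' s l) + (\<Sum>p<Suc s. b' s (m + p) * b' s (m + p))"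
      by (rule ip_split) (use sn zero in \<open>auto simp: bs\<close>)
    also have "\<dots> = (\<Sum>l<m. ?f l * ?f l) + (\<Sum>p<s. ?f (m + p) * ?f (m + p)) + N\<^sup>2"
      by (simp add: bs power2_eq_square)
    also have "(\<Sum>l<m. ?f l * ?f l) + (\<Sum>p<s. ?f (m + p) * ?f (m + p)) = ip ?f ?f"
      by (rule ip_split[symmetric]) (use sn zero in auto)
    finally show ?thesis .
  qed
  have off: "\<bar>ip (b' s) (b q)\<bar> \<le> N\<^sup>2 / Q ^ 6" if "q < s" for q
  proof -
    have "ip (b' s) (b q) = ip ?f (b q)"
      unfolding dot_def by (rule sum.cong) (use that b0 in \<open>auto simp: bs\<close>)
    moreover have "1 / Q ^ 7 * N\<^sup>2 \<le> N\<^sup>2 / Q ^ 6"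
      using Q_pow_mono[of 6 7] Q_pos by (simp add: divide_left_mono)
    ultimately show ?thesis using second_pass[OF I z that] by linarith
  qed
  obtain c r where cr: "\<forall>q<s. \<bar>c q\<bar> \<le> 4 * Q ^ 3" "\<forall>p<s. \<bar>r p\<bar> \<le> 1"
    "\<forall>i. start s \<zeta> z i = ?f i + (\<Sum>q<s. c q * b q i) + (\<Sum>p<s. r p * zhat \<zeta> p i)"
    by (rule pass2_decomposition[OF I z])
  have new: "N * zhat \<zeta>' s i = b' s i + (\<Sum>q<s. c q * b' q i) + (\<Sum>q<s. r q * zhat \<zeta>' q i)" for i
  proof -
    have "N * zhat \<zeta>' s i = start s \<zeta> z i + (if i = m + s then - N else 0)"
      by (simp add: zhat_def \<zeta>'_def start_apply)
    also have "\<dots> = (?f i + (if i = m + s then - N else 0)) + (\<Sum>q<s. c q * b q i) + (\<Sum>p<s. r p * zhat \<zeta> p i)"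
      by (simp add: cr(3))
    also have "?f i + (if i = m + s then - N else 0) = b' s i" using zero[of i] by (auto simp: bs)
    finally show ?thesis by (simp add: bq zs)
  qed
  show "near_orth (Suc s) \<zeta>' b'"
    unfolding near_orth_def
  proof (intro conjI allI impI)
    fix p l assume "p < Suc s" "l < m"
    then show "\<bar>\<zeta>' p l\<bar> \<le> Q" using I z by (auto simp: \<zeta>'_def near_orth_def less_Suc_eq)
  next
    fix q assume "q < Suc s"
    then show "b' q (m + q) = - N" using I by (auto simp: b'_def near_orth_def less_Suc_eq)
  next
    fix q i assume "q < Suc s" "m + q < i"
    then show "b' q i = 0" using I zero by (auto simp: b'_def near_orth_def less_Suc_eq)
  next
    fix q i assume q: "q < Suc s" and i: "i < m"
    show "b' q i = - (\<Sum>p<Suc s. b' q (m + p) * \<zeta>' p i)"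
    proof (cases "q = s")
      case True
      then show ?thesis using i coh[OF i] by (simp add: bs \<zeta>'_def)
    next
      case False
      then have "q < s" using q by simp
      then have "b q i = - (\<Sum>p<s. b q (m + p) * \<zeta> p i)" using I i by (simp add: near_orth_def)
      then show ?thesis using \<open>q < s\<close> b0 by (simp add: bq \<zeta>'_def)
    qed
  next
    fix q assume q: "q < Suc s"
    have "ip ?f ?f + N\<^sup>2 \<le> 4 * Q ^ 3 * N\<^sup>2"
    proof -
      have "1 \<le> Q ^ 3" using Q_ge by (intro one_le_power) auto
      then have "1 \<le> 2 * Q ^ 3" by simp
      from mult_right_mono[OF this zero_le_power2[of N]]
      have "N\<^sup>2 \<le> 2 * Q ^ 3 * N\<^sup>2" by simp
      then show ?thesis using pass2_norm[OF I z] by linarith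
    qed
    then show "ip (b' q) (b' q) \<le> 4 * Q ^ 3 * N\<^sup>2"
      using q nn near_orth_b_norm(2)[OF I, of q] by (cases "q = s") (simp_all add: bq)
  next
    fix q q' assume "q < Suc s" "q' < Suc s" "q \<noteq> q'"
    then consider "q < s" "q' < s" | "q = s" "q' < s" | "q < s" "q' = s" by linarith
    then show "\<bar>ip (b' q) (b' q')\<bar> \<le> N\<^sup>2 / Q ^ 6"
    proof cases
      case 1
      then show ?thesis using near_orth_orthogonal[OF I 1 \<open>q \<noteq> q'\<close>] by (simp only: bq)
    next
      case 2
      then show ?thesis using off[of q'] by (simp only: bq)
    next
      case 3
      then show ?thesis using off[of q] by (simp only: bq dot_commute[of _ "b q"])
    qed
  next
    fix p assume p: "p < Suc s"
    show "\<exists>c r. (\<forall>q<p. \<bar>c q\<bar> \<le> 4 * Q ^ 3) \<and> (\<forall>q<p. \<bar>r q\<bar> \<le> 1) \<and>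
       (\<forall>i. N * zhat \<zeta>' p i = b' p i + (\<Sum>q<p. c q * b' q i) + (\<Sum>q<p. r q * zhat \<zeta>' q i))"
    proof (cases "p = s")
      case True
      then show ?thesis using cr(1,2) new by (intro exI[of _ c] exI[of _ r] conjI allI impI) simp_all
    next
      case False
      then have "p < s" using p by simp
      obtain c r where cr: "\<forall>q<p. \<bar>c q\<bar> \<le> 4 * Q ^ 3" "\<forall>q<p. \<bar>r q\<bar> \<le> 1"
        "\<forall>i. N * zhat \<zeta> p i = b p i + (\<Sum>q<p. c q * b q i) + (\<Sum>q<p. r q * zhat \<zeta> q i)"
        by (rule near_orth_decomposition[OF I \<open>p < s\<close>])
      have "N * zhat \<zeta>' p i = b' p i + (\<Sum>q<p. c q * b' q i) + (\<Sum>q<p. r q * zhat \<zeta>' q i)" for i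
        using cr(3)[rule_format, of i] \<open>p < s\<close> by (simp add: bq zs)
      then show ?thesis using cr(1,2) by (intro exI[of _ c] exI[of _ r] conjI allI impI) simp_all
    qed
  qed (use sn in simp)
qed

end

section \<open>Determinants and the number of selected rows\<close>

text \<open>The matrix determinant lemma. The block matrix with identity blocks on the diagonal, y
  below and -z^T above is factored in two ways, by eliminating either off-diagonal block; one
  factorisation exhibits the matrix, the other the scalar.\<close>

lemma det_id_plus_outer:
  fixes y z :: "nat \<Rightarrow> real"
  shows "det (mat m m (\<lambda>(i, j). (if i = j then 1 else 0) + y i * z j)) = 1 + (\<Sum>l<m. z l * y l)"
proof -
  define Y where "Y = mat m 1 (\<lambda>(i, _). y i)"
  define W where "W = mat 1 m (\<lambda>(_, j). - z j)"
  define D where "D = mat m m (\<lambda>(i, j). (if i = j then 1 else 0) + y i * z j)"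
  define E where "E = mat 1 1 (\<lambda>_. 1 + (\<Sum>l<m. z l * y l))"
  have carr: "Y \<in> carrier_mat m 1" "W \<in> carrier_mat 1 m" "D \<in> carrier_mat m m" "E \<in> carrier_mat 1 1"
    by (simp_all add: Y_def W_def D_def E_def)
  have "four_block_mat (1\<^sub>m 1) (0\<^sub>m 1 m) Y (1\<^sub>m m) * four_block_mat (1\<^sub>m 1) W (0\<^sub>m m 1) D =
    four_block_mat (1\<^sub>m 1) W Y (Y * W + D)"
    by (subst mult_four_block_mat[where ?n1.0 = 1 and ?n2.0 = m])
      (use carr in \<open>auto simp: left_mult_zero_mat[of _ m] right_mult_zero_mat[of Y]
        left_add_zero_mat right_add_zero_mat[of _ 1 1] right_add_zero_mat[of _ m 1]
        right_add_zero_mat[of _ 1 m] left_add_zero_mat[of _ m 1]\<close>)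
  also have "Y * W + D = 1\<^sub>m m"
    by (rule eq_matI) (auto simp: Y_def W_def D_def scalar_prod_def)
  finally have 1: "four_block_mat (1\<^sub>m 1) (0\<^sub>m 1 m) Y (1\<^sub>m m) * four_block_mat (1\<^sub>m 1) W (0\<^sub>m m 1) D =
    four_block_mat (1\<^sub>m 1) W Y (1\<^sub>m m)" .
  have "four_block_mat E W (0\<^sub>m m 1) (1\<^sub>m m) * four_block_mat (1\<^sub>m 1) (0\<^sub>m 1 m) Y (1\<^sub>m m) =
    four_block_mat (E + W * Y) W Y (1\<^sub>m m)"
    by (subst mult_four_block_mat[where ?n1.0 = 1 and ?n2.0 = m])
      (use carr in \<open>auto simp: left_mult_zero_mat[of _ m] right_mult_zero_mat[of E 1 1]
        left_add_zero_mat[of _ m 1] left_add_zero_mat[of _ 1 m] left_add_zero_mat[of _ m m]\<close>)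
  also have "E + W * Y = 1\<^sub>m 1"
    by (rule eq_matI) (auto simp: Y_def W_def E_def scalar_prod_def sum_negf atLeast0LessThan)
  finally have 2: "four_block_mat E W (0\<^sub>m m 1) (1\<^sub>m m) * four_block_mat (1\<^sub>m 1) (0\<^sub>m 1 m) Y (1\<^sub>m m) =
    four_block_mat (1\<^sub>m 1) W Y (1\<^sub>m m)" .
  let ?L = "four_block_mat (1\<^sub>m 1) (0\<^sub>m 1 m) Y (1\<^sub>m m)"
  have L: "det ?L = 1"
    by (subst det_four_block_mat_upper_right_zero[of _ 1 _ m]) (use carr in auto)
  have U: "det (four_block_mat (1\<^sub>m 1) W (0\<^sub>m m 1) D) = det D"
    by (subst det_four_block_mat_lower_left_zero[of _ 1 _ m]) (use carr in auto)
  have V: "det (four_block_mat E W (0\<^sub>m m 1) (1\<^sub>m m)) = det E"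
    by (subst det_four_block_mat_lower_left_zero[of _ 1 _ m]) (use carr in auto)
  have c: "?L \<in> carrier_mat (1 + m) (1 + m)" "four_block_mat (1\<^sub>m 1) W (0\<^sub>m m 1) D \<in> carrier_mat (1 + m) (1 + m)"
    "four_block_mat E W (0\<^sub>m m 1) (1\<^sub>m m) \<in> carrier_mat (1 + m) (1 + m)"
    using carr by auto
  have "det D = det (four_block_mat (1\<^sub>m 1) W Y (1\<^sub>m m))"
    unfolding 1[symmetric] det_mult[OF c(1,2)] L U by simp
  also have "\<dots> = det E"
    unfolding 2[symmetric] det_mult[OF c(3,1)] L V by simp
  also have "\<dots> = 1 + (\<Sum>l<m. z l * y l)" by (simp add: det_single E_def)
  finally show ?thesis by (simp add: D_def)
qed

definition gram_mat :: "nat \<Rightarrow> nat \<Rightarrow> (nat \<Rightarrow> nat \<Rightarrow> real) \<Rightarrow> real mat" where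
  "gram_mat m s \<zeta> = mat m m (\<lambda>(i, j). (if i = j then 1 else 0) + (\<Sum>p<s. \<zeta> p i * \<zeta> p j))"

text \<open>With y = M^-1 \<zeta>_s, obtained from the adjugate, the next matrix is M (I + y
  \<zeta>_s^T), so the matrix determinant lemma applies to the second factor.\<close>

lemma det_gram_mat_step:
  assumes d: "det (gram_mat m s \<zeta>) \<noteq> 0"
  obtains y where "\<And>i. i < m \<Longrightarrow> \<zeta> s i = y i + (\<Sum>p<s. \<zeta> p i * (\<Sum>l<m. \<zeta> p l * y l))"
    "det (gram_mat m (Suc s) \<zeta>) = det (gram_mat m s \<zeta>) * (1 + (\<Sum>l<m. \<zeta> s l * y l))"
proof -
  let ?M = "gram_mat m s \<zeta>"
  have M: "?M \<in> carrier_mat m m" by (simp add: gram_mat_def)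
  define v where "v = vec m (\<zeta> s)"
  define w where "w = (1 / det ?M) \<cdot>\<^sub>v (adj_mat ?M *\<^sub>v v)"
  define y where "y i = w $ i" for i
  have v: "v \<in> carrier_vec m" and w: "w \<in> carrier_vec m"
    using adj_mat(1)[OF M] by (auto simp: v_def w_def)
  have "?M *\<^sub>v w = (1 / det ?M) \<cdot>\<^sub>v ((?M * adj_mat ?M) *\<^sub>v v)"
    unfolding w_def using M adj_mat(1)[OF M] v by (simp add: mult_mat_vec)
  also have "(?M * adj_mat ?M) *\<^sub>v v = det ?M \<cdot>\<^sub>v v"
  proof -
    have e: "(\<Sum>j = 0..<m. det ?M * (if j = i then 1 else 0) * \<zeta> s j) = det ?M * \<zeta> s i" if "i < m" for i
    proof -
      have "(\<Sum>j = 0..<m. det ?M * (if j = i then 1 else 0) * \<zeta> s j) =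
          (\<Sum>j = 0..<m. if j = i then det ?M * \<zeta> s i else 0)"
        by (rule sum.cong) auto
      then show ?thesis using that by (simp add: sum.delta)
    qed
    show ?thesis unfolding adj_mat(2)[OF M] using v
      by (intro eq_vecI) (auto simp: v_def scalar_prod_def e)
  qed
  also have "(1 / det ?M) \<cdot>\<^sub>v (det ?M \<cdot>\<^sub>v v) = v" using d by (simp add: smult_smult_assoc)
  finally have Mw: "?M *\<^sub>v w = v" .
  have row: "\<zeta> s i = (\<Sum>j<m. ?M $$ (i, j) * y j)" if "i < m" for i
  proof -
    have "\<zeta> s i = (?M *\<^sub>v w) $ i" using that Mw by (simp add: v_def)
    also have "\<dots> = (\<Sum>j<m. ?M $$ (i, j) * y j)"
      using that M w by (simp add: scalar_prod_def y_def atLeast0LessThan)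
    finally show ?thesis .
  qed
  have 1: "\<zeta> s i = y i + (\<Sum>p<s. \<zeta> p i * (\<Sum>l<m. \<zeta> p l * y l))" if "i < m" for i
  proof -
    have "\<zeta> s i = (\<Sum>j<m. (if i = j then y j else 0) + (\<Sum>p<s. \<zeta> p i * (\<zeta> p j * y j)))"
      unfolding row[OF that] using that
      by (intro sum.cong) (auto simp: gram_mat_def distrib_right sum_distrib_right mult.assoc)
    also have "\<dots> = y i + (\<Sum>j<m. \<Sum>p<s. \<zeta> p i * (\<zeta> p j * y j))"
      using that by (simp add: sum.distrib sum.delta')
    also have "(\<Sum>j<m. \<Sum>p<s. \<zeta> p i * (\<zeta> p j * y j)) = (\<Sum>p<s. \<zeta> p i * (\<Sum>l<m. \<zeta> p l * y l))"
      by (subst sum.swap) (simp add: sum_distrib_left)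
    finally show ?thesis .
  qed
  let ?I = "mat m m (\<lambda>(i, j). (if i = j then 1 else 0) + y i * \<zeta> s j)"
  have "gram_mat m (Suc s) \<zeta> = ?M * ?I"
  proof (rule eq_matI)
    fix i j assume "i < dim_row (?M * ?I)" "j < dim_col (?M * ?I)"
    then have ij: "i < m" "j < m" by (simp_all add: gram_mat_def)
    have "(?M * ?I) $$ (i, j) = (\<Sum>l<m. ?M $$ (i, l) * ((if l = j then 1 else 0) + y l * \<zeta> s j))"
      using ij M by (simp add: scalar_prod_def atLeast0LessThan)
    also have "\<dots> = (\<Sum>l<m. (if l = j then ?M $$ (i, l) else 0) + ?M $$ (i, l) * y l * \<zeta> s j)"
      by (rule sum.cong) (auto simp: algebra_simps)
    also have "\<dots> = ?M $$ (i, j) + (\<Sum>l<m. ?M $$ (i, l) * y l) * \<zeta> s j"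
      using ij by (simp add: sum.distrib sum.delta sum_distrib_right)
    also have "(\<Sum>l<m. ?M $$ (i, l) * y l) = \<zeta> s i" using row[OF ij(1)] by simp
    finally show "gram_mat m (Suc s) \<zeta> $$ (i, j) = (?M * ?I) $$ (i, j)"
      using ij by (simp add: gram_mat_def)
  qed (simp_all add: gram_mat_def)
  then have "det (gram_mat m (Suc s) \<zeta>) = det ?M * (1 + (\<Sum>l<m. \<zeta> s l * y l))"
    using det_mult[OF M, of ?I] by (simp add: det_id_plus_outer)
  with 1 show thesis by (intro that[of y])
qed

text \<open>By completing the square, any test vector \<open>v\<close> bounds \<open>z\<^sup>T M\<inverse> z\<close> from below by
  \<open>2 z\<^sup>T v - v\<^sup>T M v\<close>.\<close>

lemma det_gram_mat_ge:
  assumes "\<And>q. q < s \<Longrightarrow> \<exists>v. 1/2 \<le> 2 * (\<Sum>l<m. \<zeta> q l * v l) - (\<Sum>l<m. v l * v l) -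
      (\<Sum>p<q. (\<Sum>l<m. \<zeta> p l * v l)\<^sup>2)"
  shows "(3/2) ^ s \<le> det (gram_mat m s \<zeta>)"
  using assms
proof (induction s)
  case 0
  have "gram_mat m 0 \<zeta> = 1\<^sub>m m" by (rule eq_matI) (auto simp: gram_mat_def)
  then show ?case by simp
next
  case (Suc s)
  have IH: "(3/2) ^ s \<le> det (gram_mat m s \<zeta>)" by (rule Suc.IH) (use Suc.prems in auto)
  moreover have "(0::real) < (3/2) ^ s" by simp
  ultimately have "det (gram_mat m s \<zeta>) \<noteq> 0" by linarith
  then obtain y where y: "\<And>i. i < m \<Longrightarrow> \<zeta> s i = y i + (\<Sum>p<s. \<zeta> p i * (\<Sum>l<m. \<zeta> p l * y l))"
    "det (gram_mat m (Suc s) \<zeta>) = det (gram_mat m s \<zeta>) * (1 + (\<Sum>l<m. \<zeta> s l * y l))"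
    by (rule det_gram_mat_step) blast
  obtain v where v: "1/2 \<le> 2 * (\<Sum>l<m. \<zeta> s l * v l) - (\<Sum>l<m. v l * v l) -
      (\<Sum>p<s. (\<Sum>l<m. \<zeta> p l * v l)\<^sup>2)" using Suc.prems[of s] by auto
  let ?a = "\<lambda>p. \<Sum>l<m. \<zeta> p l * y l" and ?c = "\<lambda>p. \<Sum>l<m. \<zeta> p l * v l"
  have zu: "(\<Sum>l<m. \<zeta> s l * u l) = (\<Sum>l<m. y l * u l) + (\<Sum>p<s. ?a p * (\<Sum>l<m. \<zeta> p l * u l))" for u
  proof -
    have "(\<Sum>l<m. \<zeta> s l * u l) = (\<Sum>l<m. y l * u l + (\<Sum>p<s. ?a p * (\<zeta> p l * u l)))"
    proof (rule sum.cong)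
      fix l assume "l \<in> {..<m}"
      then have "\<zeta> s l * u l = (y l + (\<Sum>p<s. \<zeta> p l * ?a p)) * u l" using y(1)[of l] by simp
      also have "\<dots> = y l * u l + (\<Sum>p<s. \<zeta> p l * ?a p * u l)" by (simp only: distrib_right sum_distrib_right)
      also have "(\<Sum>p<s. \<zeta> p l * ?a p * u l) = (\<Sum>p<s. ?a p * (\<zeta> p l * u l))"
        by (simp only: mult_ac)
      finally show "\<zeta> s l * u l = y l * u l + (\<Sum>p<s. ?a p * (\<zeta> p l * u l))" .
    qed simp
    also have "\<dots> = (\<Sum>l<m. y l * u l) + (\<Sum>p<s. ?a p * (\<Sum>l<m. \<zeta> p l * u l))"
      unfolding sum.distrib by (subst sum.swap) (simp add: sum_distrib_left)
    finally show ?thesis .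
  qed
  have square: "(\<Sum>l<m. (y l - v l)\<^sup>2) + (\<Sum>p<s. (a p - c p)\<^sup>2) =
      ((\<Sum>l<m. y l * y l) + (\<Sum>p<s. a p * a p)) - 2 * ((\<Sum>l<m. y l * v l) + (\<Sum>p<s. a p * c p)) +
      (\<Sum>l<m. v l * v l) + (\<Sum>p<s. (c p)\<^sup>2)" for a c :: "nat \<Rightarrow> real"
    by (simp add: algebra_simps sum.distrib sum_subtractf sum_distrib_left power2_eq_square)
  \<comment> \<open>This sum of squares is (y - v)^T M (y - v).\<close>
  have "0 \<le> (\<Sum>l<m. (y l - v l)\<^sup>2) + (\<Sum>p<s. (?a p - ?c p)\<^sup>2)"
    by (intro add_nonneg_nonneg sum_nonneg) auto
  also have "\<dots> = (\<Sum>l<m. \<zeta> s l * y l) - 2 * (\<Sum>l<m. \<zeta> s l * v l) + (\<Sum>l<m. v l * v l) + (\<Sum>p<s. (?c p)\<^sup>2)"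
    unfolding zu square ..
  finally have "1/2 \<le> (\<Sum>l<m. \<zeta> s l * y l)" using v by linarith
  then have "(3/2) ^ s * (3/2) \<le> det (gram_mat m s \<zeta>) * (1 + (\<Sum>l<m. \<zeta> s l * y l))"
    using IH by (intro mult_mono) (auto intro: order_trans[of 0 "(3/2) ^ s"])
  then show ?case by (simp add: y(2) mult.commute)
qed

lemma det_entries_le:
  fixes M :: "real mat"
  assumes M: "M \<in> carrier_mat m m" and K: "\<And>i j. i < m \<Longrightarrow> j < m \<Longrightarrow> \<bar>M $$ (i, j)\<bar> \<le> K"
  shows "\<bar>det M\<bar> \<le> fact m * K ^ m"
proof -
  let ?P = "{p. p permutes {0..<m}}"
  have "\<bar>det M\<bar> \<le> (\<Sum>p\<in>?P. \<bar>signof p * (\<Prod>i = 0..<m. M $$ (i, p i))\<bar>)"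
    unfolding det_def'[OF M] by (rule sum_abs)
  also have "\<dots> \<le> (\<Sum>p\<in>?P. K ^ m)"
  proof (rule sum_mono)
    fix p assume "p \<in> ?P"
    then have p: "i < m \<Longrightarrow> p i < m" for i using permutes_in_image[of p "{0..<m}" i] by auto
    have "\<bar>signof p * (\<Prod>i = 0..<m. M $$ (i, p i))\<bar> = (\<Prod>i = 0..<m. \<bar>M $$ (i, p i)\<bar>)"
      by (simp add: abs_mult abs_prod sign_def)
    also have "\<dots> \<le> (\<Prod>i = 0..<m. K)" by (rule prod_mono) (use K p in auto)
    finally show "\<bar>signof p * (\<Prod>i = 0..<m. M $$ (i, p i))\<bar> \<le> K ^ m" by simp
  qed
  also have "\<dots> = fact m * K ^ m" by (simp add: card_permutations)
  finally show ?thesis .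
qed

text \<open>The determinant grows by 3/2 with every selected row, yet the entries of M stay below
  \<open>Q ^ 3\<close>, so the Leibniz expansion bounds it by m! Q^(3 m), at most Q^(4 m).\<close>

lemma witness_count:
  assumes w: "\<And>q. q < s \<Longrightarrow> \<exists>v. 1/2 \<le> 2 * (\<Sum>l<m. \<zeta> q l * v l) - (\<Sum>l<m. v l * v l) -
      (\<Sum>p<q. (\<Sum>l<m. \<zeta> p l * v l)\<^sup>2)"
    and \<zeta>: "\<And>p l. p < s \<Longrightarrow> l < m \<Longrightarrow> \<bar>\<zeta> p l\<bar> \<le> Q"
    and Q: "real s + 1 \<le> Q" "real m \<le> Q" "Q = 2 ^ b"
  shows "s \<le> 8 * b * m"
proof -
  have Q1: "1 \<le> Q" using Q(3) by simp
  have "\<bar>gram_mat m s \<zeta> $$ (i, j)\<bar> \<le> Q ^ 3" if "i < m" "j < m" for i j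
  proof -
    have "\<bar>\<Sum>p<s. \<zeta> p i * \<zeta> p j\<bar> \<le> (\<Sum>p<s. Q\<^sup>2)"
      by (rule order_trans[OF sum_abs sum_mono])
        (use \<zeta> that Q1 in \<open>auto simp: abs_mult power2_eq_square intro!: mult_mono\<close>)
    then have "\<bar>\<Sum>p<s. \<zeta> p i * \<zeta> p j\<bar> \<le> real s * Q\<^sup>2" by simp
    moreover have "1 \<le> Q\<^sup>2" using Q1 by (simp add: one_le_power)
    ultimately have "\<bar>gram_mat m s \<zeta> $$ (i, j)\<bar> \<le> (real s + 1) * Q\<^sup>2"
      using that by (auto simp: gram_mat_def algebra_simps)
    also have "\<dots> \<le> Q * Q\<^sup>2" using Q(1) by (intro mult_right_mono) auto
    finally show ?thesis by (simp add: power3_eq_cube power2_eq_square)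
  qed
  then have "\<bar>det (gram_mat m s \<zeta>)\<bar> \<le> fact m * (Q ^ 3) ^ m"
    by (intro det_entries_le) (auto simp: gram_mat_def)
  also have "\<dots> \<le> Q ^ m * (Q ^ 3) ^ m"
  proof (intro mult_right_mono)
    have "(fact m :: real) \<le> real m ^ m" using fact_le_power[of m] by simp
    also have "\<dots> \<le> Q ^ m" using Q(2) by (intro power_mono) auto
    finally show "fact m \<le> Q ^ m" .
  qed (use Q1 in auto)
  also have "\<dots> = (2::real) ^ (4 * b * m)"
    unfolding Q(3) by (simp add: power_mult[symmetric] power_add[symmetric] algebra_simps)
  finally have "(3/2) ^ s \<le> (2::real) ^ (4 * b * m)" using det_gram_mat_ge[OF w] by (smt (verit))
  \<comment> \<open>Squaring makes the base 9/4, which exceeds 2; this doubles the exponent 4 to the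
    8 in the claim.\<close>
  then have "((3/2) ^ s)\<^sup>2 \<le> ((2::real) ^ (4 * b * m))\<^sup>2" by (intro power_mono) auto
  have sq: "((3/2::real) ^ s)\<^sup>2 = (9/4) ^ s"
  proof -
    have "((3/2::real) ^ s)\<^sup>2 = ((3/2)\<^sup>2) ^ s" by (simp only: power_mult[symmetric] mult.commute)
    then show ?thesis by (simp add: power2_eq_square)
  qed
  have exp2: "((2::real) ^ (4 * b * m))\<^sup>2 = 2 ^ (8 * b * m)" by (simp flip: power_mult)
  from \<open>((3/2) ^ s)\<^sup>2 \<le> ((2::real) ^ (4 * b * m))\<^sup>2\<close> have "(9/4) ^ s \<le> (2::real) ^ (8 * b * m)"
    by (simp only: sq exp2)
  moreover have "(2::real) ^ s \<le> (9/4) ^ s" by (intro power_mono) auto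
  ultimately have "(2::real) ^ s \<le> 2 ^ (8 * b * m)" by linarith
  then show ?thesis by simp
qed

section \<open>The rank-2k approximation\<close>

lemma frob_norm_sq: "(frob_norm X)\<^sup>2 = (\<Sum>i<dim_row X. \<Sum>j<dim_col X. (X $$ (i, j))\<^sup>2)"
  by (simp add: frob_norm_def sum_nonneg)

text \<open>On the identity of size 2 with rank 1 no orthonormal Z can be exact, since Z Z^T has
  rank one. A factor that is not positive would demand error 0.\<close>

lemma low_rank_factor_pos:
  assumes "low_rank_algorithm \<A> T \<Delta>\<^sub>1"
  shows "0 < \<Delta>\<^sub>1"
proof (rule ccontr)
  assume "\<not> 0 < \<Delta>\<^sub>1"
  have "1\<^sub>m 2 \<in> carrier_mat 2 (2::nat)" by simp
  then obtain Z :: "real mat" and X where Z: "Z \<in> carrier_mat 2 1" and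
    le: "(frob_norm (1\<^sub>m 2 * transpose_mat (1\<^sub>m 2) - Z * transpose_mat Z * 1\<^sub>m 2 * transpose_mat (1\<^sub>m 2)))\<^sup>2
        \<le> \<Delta>\<^sub>1 * (frob_norm (1\<^sub>m 2 * transpose_mat (1\<^sub>m 2) - X))\<^sup>2"
    using assms unfolding low_rank_algorithm_def
    by (metis one_le_numeral order_refl)
  define R where "R = 1\<^sub>m 2 * transpose_mat (1\<^sub>m 2) - Z * transpose_mat Z * 1\<^sub>m 2 * transpose_mat (1\<^sub>m 2)"
  have R: "R = 1\<^sub>m 2 - Z * transpose_mat Z" "R \<in> carrier_mat 2 2"
    using Z by (auto simp: R_def transpose_one)
  have "(frob_norm R)\<^sup>2 \<le> 0"
    using le \<open>\<not> 0 < \<Delta>\<^sub>1\<close> unfolding R_def by (meson linorder_not_less mult_nonpos_nonneg order_trans zero_le_power2)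
  moreover have "(frob_norm R)\<^sup>2 = (\<Sum>i<2. \<Sum>j<2. (R $$ (i, j))\<^sup>2)"
    using carrier_matD[OF R(2)] by (simp only: frob_norm_sq)
  ultimately have "(\<Sum>i<2. \<Sum>j<2. (R $$ (i, j))\<^sup>2) = 0"
    by (intro antisym sum_nonneg) auto
  then have z: "R $$ (i, j) = 0" if "i < 2" "j < 2" for i j
    using that by (simp add: sum_nonneg_eq_0_iff sum_nonneg del: sum.lessThan_Suc)
  have ent: "R $$ (i, j) = (if i = j then 1 else 0) - Z $$ (i, 0) * Z $$ (j, 0)" if "i < 2" "j < 2" for i j
    unfolding R(1) using Z that by (simp add: scalar_prod_def)
  have "Z $$ (0, 0) * Z $$ (0, 0) = 1" "Z $$ (1, 0) * Z $$ (1, 0) = 1" "Z $$ (0, 0) * Z $$ (1, 0) = 0"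
    using z[of 0 0] z[of 1 1] z[of 0 1] ent[of 0 0] ent[of 1 1] ent[of 0 1] by simp_all
  then show False by (metis mult_eq_0_iff zero_neq_one)
qed

lemma rank_sum_outer:
  fixes f g :: "nat \<Rightarrow> nat \<Rightarrow> real"
  shows "mat_rank (mat N N' (\<lambda>(i, j). \<Sum>t<r. f t i * g t j)) \<le> r"
proof (induction r)
  case 0
  have "mat N N' (\<lambda>(i, j). \<Sum>t<0::nat. f t i * g t j) = 0\<^sub>m N N'" by (rule eq_matI) auto
  then show ?case using vec_space.rank_0I[of N N'] by (simp only: mat_rank_def) simp
next
  case (Suc r)
  let ?M = "\<lambda>r. mat N N' (\<lambda>(i, j). \<Sum>t<r. f t i * g t j)"
  let ?E = "mat N N' (\<lambda>(i, j). f r i * g r j)"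
  have "?M (Suc r) = ?M r + ?E" by (rule eq_matI) auto
  then have "vec_space.rank N (?M (Suc r)) \<le> vec_space.rank N (?M r) + vec_space.rank N ?E"
    using vec_space.rank_subadditive[of "?M r" N N' ?E] by simp
  moreover have "vec_space.rank N ?E \<le> 1"
    by (rule vec_space.rank_le_1_product_entries[of _ _ N' "f r" "g r"]) auto
  ultimately show ?case using Suc.IH by (simp add: mat_rank_def)
qed

lemma index_mult_mat_sum:
  "A \<in> carrier_mat n d \<Longrightarrow> C \<in> carrier_mat d k \<Longrightarrow> i < n \<Longrightarrow> j < k \<Longrightarrow>
   (A * C) $$ (i, j) = (\<Sum>l<d. A $$ (i, l) * C $$ (l, j))"
  by (simp add: scalar_prod_def atLeast0LessThan)

definition stack :: "nat \<Rightarrow> nat \<Rightarrow> nat \<Rightarrow> real mat \<Rightarrow> real \<Rightarrow> real mat \<Rightarrow> real mat" where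
  "stack n d k A w C = mat (n + k) d (\<lambda>(i, l). if i < n then A $$ (i, l) else w * C $$ (l, i - n))"

lemma stack_eq:
  assumes "A \<in> carrier_mat n d" "C \<in> carrier_mat d k"
  shows "transpose_mat (append_cols (transpose_mat A) (w \<cdot>\<^sub>m C)) = stack n d k A w C"
  using assms by (intro eq_matI) (auto simp: append_cols_def stack_def)

lemma orthonormal_entry_le:
  fixes Z :: "real mat"
  assumes Z: "Z \<in> carrier_mat N r" "transpose_mat Z * Z = 1\<^sub>m r" and "i < N" "l < r"
  shows "\<bar>Z $$ (i, l)\<bar> \<le> 1"
proof -
  have "1 = (transpose_mat Z * Z) $$ (l, l)" using assms by simp
  also have "\<dots> = (\<Sum>i<N. Z $$ (i, l) * Z $$ (i, l))"
    using assms(1,3,4) by (simp add: scalar_prod_def atLeast0LessThan)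
  also have "\<dots> \<ge> Z $$ (i, l) * Z $$ (i, l)"
    using \<open>i < N\<close> by (intro member_le_sum) auto
  finally have "(Z $$ (i, l))\<^sup>2 \<le> 1" by (simp add: power2_eq_square)
  then show ?thesis by (simp only: abs_square_le_1)
qed

text \<open>The coefficients are those of the orthogonal projection onto the columns of Z, that is,
  Z^T B B^T, divided by \<open>w\<close>. The error is bounded for a whole column and not just
  entrywise, because a prediction combines many entries of one column. The size of the coefficients
  follows from the entries of Z being at most 1.\<close>

lemma approx_coefficients:
  fixes A C Z :: "real mat"
  assumes n: "1 \<le> n" "1 \<le> d" and \<Delta>: "0 < \<Delta>\<^sub>1" "0 \<le> \<Delta>\<^sub>2"
    and A: "A \<in> carrier_mat n d" and C: "C \<in> carrier_mat d k"
    and bA: "\<And>i j. i < n \<Longrightarrow> j < d \<Longrightarrow> \<bar>A $$ (i, j)\<bar> \<le> \<Delta>\<^sub>2"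
    and bC: "\<And>i j. i < d \<Longrightarrow> j < k \<Longrightarrow> \<bar>C $$ (i, j)\<bar> \<le> \<Delta>\<^sub>2"
    and w: "w = 3 * sqrt \<Delta>\<^sub>1 * \<Delta>\<^sub>2\<^sup>2 * real n * real d"
    and B: "B = stack n d k A w C"
    and Z: "Z \<in> carrier_mat (n + k) (2 * k)" "transpose_mat Z * Z = 1\<^sub>m (2 * k)"
    and X: "best_rank_approx (2 * k) (B * transpose_mat B) X"
      "(frob_norm (B * transpose_mat B - Z * transpose_mat Z * B * transpose_mat B))\<^sup>2
        \<le> \<Delta>\<^sub>1 * (frob_norm (B * transpose_mat B - X))\<^sup>2"
  obtains \<alpha> where "\<And>c. c < k \<Longrightarrow> (\<Sum>j<n. ((A * C) $$ (j, c) - (\<Sum>l<2*k. Z $$ (j, l) * \<alpha> l c))\<^sup>2) \<le> 1/9"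
    "\<And>l c. l < 2 * k \<Longrightarrow> c < k \<Longrightarrow> \<bar>\<alpha> l c\<bar> \<le> (real n + real k * w) * (real d * \<Delta>\<^sub>2\<^sup>2)"
proof (cases "\<Delta>\<^sub>2 = 0")
  \<comment> \<open>Here \<open>w\<close> vanishes and cannot be divided by, but A C vanishes as
    well.\<close>
  case True
  have "(A * C) $$ (j, c) = 0" if "j < n" "c < k" for j c
    using index_mult_mat_sum[OF A C that] bA[OF that(1)] True by (auto intro!: sum.neutral)
  then show thesis using \<Delta> by (intro that[of "\<lambda>_ _. 0"]) (auto simp: w)
next
  case False
  have wpos: "0 < w" using False n \<Delta> by (simp add: w)
  define G where "G = B * transpose_mat B"
  have Bc: "B \<in> carrier_mat (n + k) d" by (simp add: B stack_def)
  have Gc: "G \<in> carrier_mat (n + k) (n + k)" using Bc by (simp add: G_def)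
  have Gi: "G $$ (i, j) = (\<Sum>l<d. B $$ (i, l) * B $$ (j, l))" if "i < n + k" "j < n + k" for i j
    using that Bc by (simp add: G_def scalar_prod_def atLeast0LessThan)
  have Bt: "\<bar>B $$ (i, l)\<bar> \<le> \<Delta>\<^sub>2" if "i < n" "l < d" for i l using that bA by (simp add: B stack_def)
  have Bb: "\<bar>B $$ (n + e, l)\<bar> \<le> w * \<Delta>\<^sub>2" if "e < k" "l < d" for e l
    using that bC wpos by (simp add: B stack_def abs_mult)
  have G11: "\<bar>G $$ (i, j)\<bar> \<le> real d * (\<Delta>\<^sub>2 * \<Delta>\<^sub>2)" if "i < n" "j < n" for i j
    unfolding Gi[OF trans_less_add1[OF that(1)] trans_less_add1[OF that(2)]]
  proof (rule abs_sum_le_card)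
    fix l assume "l < d"
    then show "\<bar>B $$ (i, l) * B $$ (j, l)\<bar> \<le> \<Delta>\<^sub>2 * \<Delta>\<^sub>2"
      unfolding abs_mult using that Bt \<Delta> by (intro mult_mono) auto
  qed
  have G12: "\<bar>G $$ (i, n + c)\<bar> \<le> real d * (\<Delta>\<^sub>2 * (w * \<Delta>\<^sub>2))" if "i < n" "c < k" for i c
    unfolding Gi[OF trans_less_add1[OF that(1)] add_strict_left_mono[OF that(2)]]
  proof (rule abs_sum_le_card)
    fix l assume "l < d"
    then show "\<bar>B $$ (i, l) * B $$ (n + c, l)\<bar> \<le> \<Delta>\<^sub>2 * (w * \<Delta>\<^sub>2)"
      unfolding abs_mult using that Bt Bb \<Delta> by (intro mult_mono) auto
  qed
  have G22: "\<bar>G $$ (n + e, n + c)\<bar> \<le> real d * ((w * \<Delta>\<^sub>2) * (w * \<Delta>\<^sub>2))" if "e < k" "c < k" for e c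
    unfolding Gi[OF add_strict_left_mono[OF that(1)] add_strict_left_mono[OF that(2)]]
  proof (rule abs_sum_le_card)
    fix l assume "l < d"
    then show "\<bar>B $$ (n + e, l) * B $$ (n + c, l)\<bar> \<le> (w * \<Delta>\<^sub>2) * (w * \<Delta>\<^sub>2)"
      unfolding abs_mult using that Bb \<Delta> wpos by (intro mult_mono) auto
  qed
  have Gw: "G $$ (j, n + c) = w * (A * C) $$ (j, c)" if "j < n" "c < k" for j c
    using that Gi[of j "n + c"] index_mult_mat_sum[OF A C that]
    by (simp add: B stack_def sum_distrib_left mult_ac)
  \<comment> \<open>The first \<open>k\<close> products reproduce the last \<open>k\<close> columns
    of \<open>G\<close>, the other \<open>k\<close> products its last \<open>k\<close> rows left of
    these columns. Only the block A A^T is lost, with \<open>2 * k\<close> products in all.\<close>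
  define Y where "Y = mat (n + k) (n + k) (\<lambda>(i, j). \<Sum>t<2*k.
    (if t < k then G $$ (i, n + t) else if i = n + (t - k) then 1 else 0) *
    (if t < k then (if j = n + t then 1 else 0) else if j < n then G $$ (n + (t - k), j) else 0))"
  have Yr: "mat_rank Y \<le> 2 * k" unfolding Y_def by (rule rank_sum_outer)
  have Yi: "Y $$ (i, j) = (if i < n \<and> j < n then 0 else G $$ (i, j))" if "i < n + k" "j < n + k" for i j
  proof -
    have split: "(\<Sum>t<2*k. h t) = (\<Sum>t<k. h t) + (\<Sum>t<k. h (k + t))" for h :: "nat \<Rightarrow> real"
    proof -
      have "(\<Sum>t<k + r. h t) = (\<Sum>t<k. h t) + (\<Sum>t<r. h (k + t))" for r by (induction r) auto
      then show ?thesis by (simp add: mult_2)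
    qed
    have "Y $$ (i, j) = (\<Sum>t<k. if j = n + t then G $$ (i, n + t) else 0) +
        (\<Sum>t<k. if i = n + t then (if j < n then G $$ (n + t, j) else 0) else 0)"
      (is "_ = ?a + ?b")
    proof -
      let ?F = "\<lambda>t. (if t < k then G $$ (i, n + t) else if i = n + (t - k) then 1 else 0) *
        (if t < k then (if j = n + t then 1 else 0) else if j < n then G $$ (n + (t - k), j) else 0)"
      have "Y $$ (i, j) = (\<Sum>t<2*k. ?F t)" using that by (simp add: Y_def)
      also have "\<dots> = (\<Sum>t<k. ?F t) + (\<Sum>t<k. ?F (k + t))" by (rule split)
      also have "(\<Sum>t<k. ?F t) = ?a" by (rule sum.cong) auto
      also have "(\<Sum>t<k. ?F (k + t)) = ?b" by (rule sum.cong) auto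
      finally show ?thesis .
    qed
    also have "(\<Sum>t<k. if j = n + t then G $$ (i, n + t) else 0) = (if j < n then 0 else G $$ (i, j))"
    proof (cases "j < n")
      case False
      have "(\<Sum>t<k. if j = n + t then G $$ (i, n + t) else 0) = (\<Sum>t<k. if t = j - n then G $$ (i, j) else 0)"
        using False by (intro sum.cong) auto
      moreover have "j - n < k" using False that by linarith
      ultimately show ?thesis using False by (simp add: sum.delta)
    qed (auto intro!: sum.neutral)
    also have "(\<Sum>t<k. if i = n + t then (if j < n then G $$ (n + t, j) else 0) else 0) =
        (if i < n then 0 else if j < n then G $$ (i, j) else 0)"
    proof (cases "i < n")
      case False
      have "(\<Sum>t<k. if i = n + t then (if j < n then G $$ (n + t, j) else 0) else 0) =
          (\<Sum>t<k. if t = i - n then (if j < n then G $$ (i, j) else 0) else 0)"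
        using False by (intro sum.cong) auto
      moreover have "i - n < k" using False that by linarith
      ultimately show ?thesis using False by (simp add: sum.delta)
    qed (auto intro!: sum.neutral)
    finally show ?thesis by auto
  qed
  have Yc: "Y \<in> carrier_mat (n + k) (n + k)" by (simp add: Y_def)
  have "(frob_norm (G - Y))\<^sup>2 = (\<Sum>i<n+k. \<Sum>j<n+k. if i < n \<and> j < n then (G $$ (i, j))\<^sup>2 else 0)"
    unfolding frob_norm_sq using Gc Yc by (auto simp: Yi intro!: sum.cong)
  also have "\<dots> = (\<Sum>i<n. \<Sum>j<n. (G $$ (i, j))\<^sup>2)"
  proof -
    have "(\<Sum>i<n+k. \<Sum>j<n+k. if i < n \<and> j < n then (G $$ (i, j))\<^sup>2 else 0) =
       (\<Sum>i<n. \<Sum>j<n+k. if i < n \<and> j < n then (G $$ (i, j))\<^sup>2 else 0)"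
      by (rule sum.mono_neutral_right) auto
    also have "\<dots> = (\<Sum>i<n. \<Sum>j<n. if i < n \<and> j < n then (G $$ (i, j))\<^sup>2 else 0)"
      by (intro sum.cong sum.mono_neutral_right) auto
    finally show ?thesis by simp
  qed
  also have "\<dots> \<le> (\<Sum>i<n. \<Sum>j<n. (real d * (\<Delta>\<^sub>2 * \<Delta>\<^sub>2))\<^sup>2)"
  proof (intro sum_mono)
    fix i j assume "i \<in> {..<n}" "j \<in> {..<n}"
    then have "\<bar>G $$ (i, j)\<bar>\<^sup>2 \<le> (real d * (\<Delta>\<^sub>2 * \<Delta>\<^sub>2))\<^sup>2" using G11 by (intro power_mono) auto
    then show "(G $$ (i, j))\<^sup>2 \<le> (real d * (\<Delta>\<^sub>2 * \<Delta>\<^sub>2))\<^sup>2" by simp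
  qed
  finally have GY: "(frob_norm (G - Y))\<^sup>2 \<le> (real n * (real d * \<Delta>\<^sub>2\<^sup>2))\<^sup>2"
    by (simp add: power2_eq_square mult_ac)
  have "frob_norm (G - X) \<le> frob_norm (G - Y)"
    using X(1) Yc Yr Gc unfolding best_rank_approx_def G_def[symmetric] by auto
  moreover have "0 \<le> frob_norm (G - X)" by (simp add: frob_norm_def sum_nonneg)
  ultimately have "(frob_norm (G - X))\<^sup>2 \<le> (real n * (real d * \<Delta>\<^sub>2\<^sup>2))\<^sup>2"
    using GY power_mono order_trans by blast
  then have "\<Delta>\<^sub>1 * (frob_norm (G - X))\<^sup>2 \<le> \<Delta>\<^sub>1 * (real n * (real d * \<Delta>\<^sub>2\<^sup>2))\<^sup>2"
    using \<Delta> by (intro mult_left_mono) auto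
  \<comment> \<open>The weight was chosen for this: sqrt \<Delta>1 times n d
    \<open>\<Delta>\<^sub>2\<^sup>2\<close> is w / 3.\<close>
  also have "\<dots> = w\<^sup>2 / 9" using \<Delta> by (simp add: w power_mult_distrib)
  finally have F: "(frob_norm (G - Z * transpose_mat Z * B * transpose_mat B))\<^sup>2 \<le> w\<^sup>2 / 9"
    using X(2) unfolding G_def[symmetric] by linarith
  define H where "H = transpose_mat Z * G"
  have Hc: "H \<in> carrier_mat (2 * k) (n + k)" using Z Gc by (simp add: H_def)
  have assoc: "Z * transpose_mat Z * B * transpose_mat B = Z * H"
    unfolding H_def G_def using Z(1) Bc
    by (simp add: assoc_mult_mat[of _ "n + k" "2 * k" _ "n + k"] assoc_mult_mat[of _ "2 * k" "n + k" _ d]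
      assoc_mult_mat[of _ "n + k" "2 * k" _ d] assoc_mult_mat[of _ "n + k" "2 * k" _ "n+k"])
  define \<alpha> where "\<alpha> l c = H $$ (l, n + c) / w" for l c
  show thesis
  proof (rule that[of \<alpha>])
    fix c assume c: "c < k"
    have e: "(G - Z * H) $$ (j, n + c) = w * ((A * C) $$ (j, c) - (\<Sum>l<2*k. Z $$ (j, l) * \<alpha> l c))" if "j < n" for j
    proof -
      have "(Z * H) $$ (j, n + c) = (\<Sum>l<2*k. Z $$ (j, l) * H $$ (l, n + c))"
        by (rule index_mult_mat_sum[OF Z(1) Hc]) (use that c in auto)
      also have "\<dots> = w * (\<Sum>l<2*k. Z $$ (j, l) * \<alpha> l c)"
        using wpos by (simp add: \<alpha>_def sum_distrib_left)
      finally show ?thesis using that c Gc Z Hc Gw[OF that c] by (simp add: right_diff_distrib)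
    qed
    have "w\<^sup>2 * (\<Sum>j<n. ((A * C) $$ (j, c) - (\<Sum>l<2*k. Z $$ (j, l) * \<alpha> l c))\<^sup>2) =
      (\<Sum>j<n. ((G - Z * H) $$ (j, n + c))\<^sup>2)"
      by (simp add: e sum_distrib_left power_mult_distrib)
    also have "\<dots> \<le> (\<Sum>j<n. \<Sum>j'<n+k. ((G - Z * H) $$ (j, j'))\<^sup>2)"
      using c by (intro sum_mono member_le_sum[of "n + c" "{..<n+k}" "\<lambda>j'. ((G - Z * H) $$ (_, j'))\<^sup>2"]) auto
    also have "\<dots> \<le> (\<Sum>j<n+k. \<Sum>j'<n+k. ((G - Z * H) $$ (j, j'))\<^sup>2)"
      by (rule sum_mono2) (auto intro: sum_nonneg)
    also have "\<dots> = (frob_norm (G - Z * H))\<^sup>2"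
      using Gc Z Hc by (simp add: frob_norm_sq)
    also have "\<dots> \<le> w\<^sup>2 / 9" using F by (simp only: assoc)
    finally show "(\<Sum>j<n. ((A * C) $$ (j, c) - (\<Sum>l<2*k. Z $$ (j, l) * \<alpha> l c))\<^sup>2) \<le> 1/9"
      using wpos by (simp add: field_simps)
  next
    fix l c assume l: "l < 2 * k" and c: "c < k"
    have "H $$ (l, n + c) = (\<Sum>i<n+k. transpose_mat Z $$ (l, i) * G $$ (i, n + c))"
      unfolding H_def by (rule index_mult_mat_sum[OF _ Gc]) (use Z l c in auto)
    also have "\<dots> = (\<Sum>i<n+k. Z $$ (i, l) * G $$ (i, n + c))"
      using Z(1) l by (intro sum.cong) auto
    also have "\<dots> = (\<Sum>i<n. Z $$ (i, l) * G $$ (i, n + c)) + (\<Sum>e<k. Z $$ (n + e, l) * G $$ (n + e, n + c))"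
    proof -
      have "(\<Sum>t<n + r. h t) = (\<Sum>t<n. h t) + (\<Sum>t<r. h (n + t))" for r and h :: "nat \<Rightarrow> real"
        by (induction r) auto
      then show ?thesis .
    qed
    finally have Hs: "H $$ (l, n + c) = (\<Sum>i<n. Z $$ (i, l) * G $$ (i, n + c)) + (\<Sum>e<k. Z $$ (n + e, l) * G $$ (n + e, n + c))" .
    have z: "\<bar>Z $$ (i, l)\<bar> \<le> 1" if "i < n + k" for i
      by (rule orthonormal_entry_le[OF Z that l])
    have 1: "\<bar>\<Sum>i<n. Z $$ (i, l) * G $$ (i, n + c)\<bar> \<le> real n * (1 * (real d * (\<Delta>\<^sub>2 * (w * \<Delta>\<^sub>2))))"
    proof (rule abs_sum_le_card)
      fix i assume "i < n"
      then show "\<bar>Z $$ (i, l) * G $$ (i, n + c)\<bar> \<le> 1 * (real d * (\<Delta>\<^sub>2 * (w * \<Delta>\<^sub>2)))"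
        unfolding abs_mult using z G12 c by (intro mult_mono) auto
    qed
    have 2: "\<bar>\<Sum>e<k. Z $$ (n + e, l) * G $$ (n + e, n + c)\<bar> \<le> real k * (1 * (real d * ((w * \<Delta>\<^sub>2) * (w * \<Delta>\<^sub>2))))"
    proof (rule abs_sum_le_card)
      fix e assume "e < k"
      then show "\<bar>Z $$ (n + e, l) * G $$ (n + e, n + c)\<bar> \<le> 1 * (real d * ((w * \<Delta>\<^sub>2) * (w * \<Delta>\<^sub>2)))"
        unfolding abs_mult using z G22 c by (intro mult_mono) auto
    qed
    have "\<bar>H $$ (l, n + c)\<bar> \<le> real n * (1 * (real d * (\<Delta>\<^sub>2 * (w * \<Delta>\<^sub>2)))) + real k * (1 * (real d * ((w * \<Delta>\<^sub>2) * (w * \<Delta>\<^sub>2))))"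
      unfolding Hs using 1 2 by linarith
    also have "\<dots> = (real n + real k * w) * (real d * \<Delta>\<^sub>2\<^sup>2) * w"
      by (simp add: algebra_simps power2_eq_square)
    finally show "\<bar>\<alpha> l c\<bar> \<le> (real n + real k * w) * (real d * \<Delta>\<^sub>2\<^sup>2)"
      using wpos by (simp add: \<alpha>_def abs_divide pos_divide_le_eq)
  qed
qed

section \<open>Arithmetic on packed vectors\<close>

abbreviation cell :: "nat \<Rightarrow> int \<Rightarrow> rexp" where
  "cell a i \<equiv> RCell a (IConst 0) (IConst i)"

abbreviation set_cell :: "nat \<Rightarrow> int \<Rightarrow> rexp \<Rightarrow> com" where
  "set_cell a i u \<equiv> RStore a (IConst 0) (IConst i) u"

lemma runs_weaken: "runs p c s K R \<Longrightarrow> K \<le> K' \<Longrightarrow> runs p c s K' R"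
  by (rule runs_mono)

lemma runs_Seq': "runs p c s K1 (\<lambda>s'. runs p d s' K2 R) \<Longrightarrow> runs p (Seq c d) s (K1 + K2) R"
  by (rule runs_Seq) auto

text \<open>Rounding without a floor operation: the cell holds the argument at index 0 and a power of two
  bounding it at index 1.  Index 2 is the step of a binary search for the result at index 3.\<close>

definition round_proc :: com where
  "round_proc =
    Seq (set_cell 0 2 (cell 0 1))
   (Seq (set_cell 0 3 (RSub (RConst 0) (cell 0 1)))
   (Seq (While (RLe (RConst 1) (cell 0 2))
     (Seq (If (RLe (RAdd (cell 0 3) (cell 0 2)) (RAdd (cell 0 0) (RConst (1/2))))
            (set_cell 0 3 (RAdd (cell 0 3) (cell 0 2))) Skip)
        (set_cell 0 2 (RDiv (cell 0 2) (RConst 2)))))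
   (set_cell 0 0 (cell 0 3))))"

lemma runs_round_proc:
  assumes X: "rarr s 0 0 1 = 2 ^ b" and r: "\<bar>rarr s 0 0 0\<bar> \<le> 2 ^ b - 1"
  shows "runs p round_proc s (64 * (b + 1)) (\<lambda>s'. \<exists>g. s' = s\<lparr>rarr := (rarr s)(0 := g)\<rparr> \<and>
      g 0 0 = of_int (round (rarr s 0 0 0)) \<and>
      (\<forall>i j. (i, j) \<notin> {(0,0), (0,2), (0,3)} \<longrightarrow> g i j = rarr s 0 i j))"
proof -
  let ?r = "rarr s 0 0 0"
  \<comment> \<open>With step h, the candidate q satisfies q <= r + 1/2 < q + 2 h. The start -2^b
    with h = 2^b is valid by the assumed range of r. After the step h = 1 has been tried, h is 1/2
    and q is the rounded value.\<close>
  define I where "I i s' \<longleftrightarrow> (\<exists>g q. s' = s\<lparr>rarr := (rarr s)(0 := g)\<rparr> \<and> g 0 2 = 2 ^ b / 2 ^ i \<and>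
      g 0 3 = of_int q \<and> of_int q \<le> ?r + 1/2 \<and> ?r + 1/2 < of_int q + 2 * (2 ^ b / 2 ^ i) \<and>
      (\<forall>i j. (i, j) \<notin> {(0,2), (0,3)} \<longrightarrow> g i j = rarr s 0 i j))" for i :: nat and s'
  let ?c = "Seq (If (RLe (RAdd (cell 0 3) (cell 0 2)) (RAdd (cell 0 0) (RConst (1/2))))
            (set_cell 0 3 (RAdd (cell 0 3) (cell 0 2))) Skip)
        (set_cell 0 2 (RDiv (cell 0 2) (RConst 2)))"
  have body: "bval (RLe (RConst 1) (cell 0 2)) s' \<and> runs p ?c s' 32 (I (Suc i))"
    if i: "i < Suc b" and I: "I i s'" for i and s' :: store
  proof -
    obtain g q where s': "s' = s\<lparr>rarr := (rarr s)(0 := g)\<rparr>" and g: "g 0 2 = 2 ^ b / 2 ^ i"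
      "g 0 3 = of_int q" "of_int q \<le> ?r + 1/2" "?r + 1/2 < of_int q + 2 * (2 ^ b / 2 ^ i)"
      "\<forall>i j. (i, j) \<notin> {(0,2), (0,3)} \<longrightarrow> g i j = rarr s 0 i j"
      using I unfolding I_def by blast
    have h: "(2::real) ^ b / 2 ^ i = of_int (2 ^ (b - i))"
    proof -
      have "(2::real) ^ b = 2 ^ (b - i) * 2 ^ i" using i by (simp flip: power_add)
      then show ?thesis by simp
    qed
    have hs: "(2::real) ^ (b - i) = 2 ^ b / 2 ^ i" using h by simp
    have b1: "1 \<le> (2::real) ^ b / 2 ^ i" using h by (simp add: one_le_power)
    have g0: "g 0 0 = ?r" using g(5) by simp
    have "runs p ?c s' (24 + 8) (I (Suc i))"
    proof (rule runs_Seq', rule runs_If[where K' = 10])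
      assume "bval (RLe (RAdd (cell 0 3) (cell 0 2)) (RAdd (cell 0 0) (RConst (1 / 2)))) s'"
      then have le: "of_int q + 2 ^ b / 2 ^ i \<le> ?r + 1/2" by (simp add: s' g g0)
      show "runs p (set_cell 0 3 (RAdd (cell 0 3) (cell 0 2))) s' 10
        (\<lambda>s'. runs p (set_cell 0 2 (RDiv (cell 0 2) (RConst 2))) s' 8 (I (Suc i)))"
        by (rule runs_RStore, rule runs_RStore, unfold I_def,
            rule exI[of _ "upd2 (upd2 g 0 3 (of_int (q + 2 ^ (b - i)))) 0 2 (2 ^ b / (2 ^ i * 2))"],
            rule exI[of _ "q + 2 ^ (b - i)"])
          (use le g in \<open>auto simp: s' upd2_apply hs\<close>)
    next
      assume "\<not> bval (RLe (RAdd (cell 0 3) (cell 0 2)) (RAdd (cell 0 0) (RConst (1 / 2)))) s'"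
      then have le: "?r + 1/2 < of_int q + 2 ^ b / 2 ^ i" by (simp add: s' g g0)
      show "runs p Skip s' 10
        (\<lambda>s'. runs p (set_cell 0 2 (RDiv (cell 0 2) (RConst 2))) s' 8 (I (Suc i)))"
        by (rule runs_Skip, rule runs_RStore, unfold I_def,
            rule exI[of _ "upd2 g 0 2 (2 ^ b / (2 ^ i * 2))"], rule exI[of _ q])
          (use le g in \<open>auto simp: s' upd2_apply\<close>)
    qed simp
    then show ?thesis using b1 by (simp add: s' g)
  qed
  have "runs p round_proc s (6 + (8 + ((Suc b * (32 + 1 + 5) + (1 + 5)) + 6)))
    (\<lambda>s'. \<exists>g. s' = s\<lparr>rarr := (rarr s)(0 := g)\<rparr> \<and>
      g 0 0 = of_int (round (rarr s 0 0 0)) \<and>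
      (\<forall>i j. (i, j) \<notin> {(0,0), (0,2), (0,3)} \<longrightarrow> g i j = rarr s 0 i j))"
    unfolding round_proc_def
  proof (rule runs_Seq', rule runs_RStore, rule runs_Seq', rule runs_RStore, rule runs_Seq',
      rule runs_While[where I = I and n = "Suc b" and K = 32])
    fix i s' assume "i < Suc b" "I i s'"
    then show "bval (RLe (RConst 1) (cell 0 2)) s' \<and> runs p ?c s' 32 (I (Suc i))" by (rule body)
  next
    fix s' assume "I (Suc b) s'"
    then obtain g q where s': "s' = s\<lparr>rarr := (rarr s)(0 := g)\<rparr>" and g: "g 0 2 = 2 ^ b / 2 ^ Suc b"
      "g 0 3 = of_int q" "of_int q \<le> ?r + 1/2" "?r + 1/2 < of_int q + 2 * (2 ^ b / 2 ^ Suc b)"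
      "\<forall>i j. (i, j) \<notin> {(0,2), (0,3)} \<longrightarrow> g i j = rarr s 0 i j"
      unfolding I_def by blast
    have "round ?r = q" unfolding round_def using g(3,4) by (intro floor_unique) auto
    then show "\<not> bval (RLe (RConst 1) (cell 0 2)) s' \<and> runs p (set_cell 0 0 (cell 0 3)) s' 6
      (\<lambda>s'. \<exists>g. s' = s\<lparr>rarr := (rarr s)(0 := g)\<rparr> \<and> g 0 0 = of_int (round ?r) \<and>
        (\<forall>i j. (i, j) \<notin> {(0,0), (0,2), (0,3)} \<longrightarrow> g i j = rarr s 0 i j))"
      using g by (intro conjI runs_RStore exI[of _ "upd2 g 0 0 (of_int q)"])
        (auto simp: s' upd2_apply)
  next
    show "I 0 (s\<lparr>rarr := (rarr s)
              (0 := upd2 (rarr s 0) (ival (IConst 0) s) (ival (IConst 2) s) (rval (cell 0 1) s))\<rparr>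
        \<lparr>rarr := (rarr (s\<lparr>rarr := (rarr s)
              (0 := upd2 (rarr s 0) (ival (IConst 0) s) (ival (IConst 2) s) (rval (cell 0 1) s))\<rparr>))
           (0 := upd2 (rarr (s\<lparr>rarr := (rarr s)
              (0 := upd2 (rarr s 0) (ival (IConst 0) s) (ival (IConst 2) s) (rval (cell 0 1) s))\<rparr>) 0)
             (ival (IConst 0) (s\<lparr>rarr := (rarr s)
              (0 := upd2 (rarr s 0) (ival (IConst 0) s) (ival (IConst 2) s) (rval (cell 0 1) s))\<rparr>))
             (ival (IConst 3) (s\<lparr>rarr := (rarr s)
              (0 := upd2 (rarr s 0) (ival (IConst 0) s) (ival (IConst 2) s) (rval (cell 0 1) s))\<rparr>))
             (rval (RSub (RConst 0) (cell 0 1)) (s\<lparr>rarr := (rarr s)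
              (0 := upd2 (rarr s 0) (ival (IConst 0) s) (ival (IConst 2) s) (rval (cell 0 1) s))\<rparr>)))\<rparr>)"
      unfolding I_def using X r
      by (intro exI[of _ "upd2 (upd2 (rarr s 0) 0 2 (2 ^ b)) 0 3 (- (2 ^ b))"] exI[of _ "- (2 ^ b)"])
        (auto simp: upd2_apply)
  qed (simp_all add: X)
  then show ?thesis by (rule runs_weaken) simp
qed

lemma runs_round:
  assumes X: "rarr s a 0 1 = 2 ^ b" and r: "\<bar>rarr s a 0 0\<bar> \<le> 2 ^ b - 1"
    and R: "\<And>g. g 0 0 = of_int (round (rarr s a 0 0)) \<Longrightarrow>
      (\<And>i j. (i, j) \<notin> {(0,0), (0,2), (0,3)} \<Longrightarrow> g i j = rarr s a i j) \<Longrightarrow>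
      R (s\<lparr>rarr := (rarr s)(a := g)\<rparr>)"
  shows "runs p (Call round_proc [] [a]) s (66 * (b + 1)) R"
proof (rule runs_Call)
  let ?e = "enter [] [a] s"
  have e: "rarr ?e 0 = rarr s a" by (simp add: enter_def)
  have "runs round_proc round_proc ?e (64 * (b + 1)) (\<lambda>s'. \<exists>g. s' = ?e\<lparr>rarr := (rarr ?e)(0 := g)\<rparr> \<and>
      g 0 0 = of_int (round (rarr ?e 0 0 0)) \<and>
      (\<forall>i j. (i, j) \<notin> {(0,0), (0,2), (0,3)} \<longrightarrow> g i j = rarr ?e 0 i j))"
    by (rule runs_round_proc) (use X r e in simp_all)
  then show "runs round_proc round_proc ?e (64 * (b + 1)) (\<lambda>s'. R (leave [a] s s'))"
  proof (rule runs_mono)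
    fix s'
    assume "\<exists>g. s' = ?e\<lparr>rarr := (rarr ?e)(0 := g)\<rparr> \<and>
      g 0 0 = of_int (round (rarr ?e 0 0 0)) \<and>
      (\<forall>i j. (i, j) \<notin> {(0,0), (0,2), (0,3)} \<longrightarrow> g i j = rarr ?e 0 i j)"
    then obtain g where s': "s' = ?e\<lparr>rarr := (rarr ?e)(0 := g)\<rparr>" and
      g: "g 0 0 = of_int (round (rarr s a 0 0))"
      "\<forall>i j. (i, j) \<notin> {(0,0), (0,2), (0,3)} \<longrightarrow> g i j = rarr s a i j"
      unfolding e by blast
    have "leave [a] s s' = s\<lparr>rarr := (rarr s)(a := g)\<rparr>"
      by (rule leave_rarr_only) (auto simp: s')
    moreover have "R (s\<lparr>rarr := (rarr s)(a := g)\<rparr>)"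
      by (rule R) (use g in blast)+
    ultimately show "R (leave [a] s s')" by simp
  qed simp
qed (simp_all add: call_cost_def)

section \<open>Extracting the digits of packed vectors\<close>

text \<open>Signed digits of size at most X / 4 are dominated by a geometric series with sum below
  X^l / 3, so all lower digits together stay under half a unit of position \<open>l\<close>.\<close>

lemma digit_tail:
  fixes D :: "nat \<Rightarrow> real"
  assumes "4 \<le> X" "\<And>j. j < l \<Longrightarrow> \<bar>D j\<bar> * 4 \<le> X"
  shows "\<bar>\<Sum>j<l. D j * X ^ j\<bar> \<le> X ^ l / 3"
  using assms(2)
proof (induction l)
  case (Suc l)
  have "\<bar>D l * X ^ l\<bar> \<le> X / 4 * X ^ l"
    unfolding abs_mult using Suc.prems[of l] assms(1) by (intro mult_mono) auto
  moreover have "\<bar>\<Sum>j<l. D j * X ^ j\<bar> \<le> X ^ l / 3" using Suc by simp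
  moreover have "X / 4 * X ^ l + X ^ l / 3 \<le> X ^ Suc l / 3"
  proof -
    have "4 * X ^ l \<le> X * X ^ l" using assms(1) by (intro mult_right_mono) auto
    then show ?thesis by (simp add: field_simps)
  qed
  ultimately show ?case unfolding sum.lessThan_Suc by linarith
qed simp

text \<open>Consequently rounding the quotient by X^l isolates the top digit. The second claim is
  the range condition of the rounding procedure.\<close>

lemma leading_digit:
  fixes D :: "nat \<Rightarrow> real"
  assumes X: "4 \<le> X" and D: "\<And>j. j \<le> l \<Longrightarrow> \<bar>D j\<bar> * 4 \<le> X" and int: "D l \<in> \<int>"
  shows "of_int (round ((\<Sum>j<Suc l. D j * X ^ j) / X ^ l)) = D l"
    "\<bar>(\<Sum>j<Suc l. D j * X ^ j) / X ^ l\<bar> \<le> X - 1"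
proof -
  let ?t = "(\<Sum>j<l. D j * X ^ j) / X ^ l"
  have Xl: "0 < X ^ l" using X by simp
  have t: "\<bar>?t\<bar> \<le> 1 / 3"
    using digit_tail[OF X, of l D] D Xl by (simp add: abs_divide field_simps)
  have eq: "(\<Sum>j<Suc l. D j * X ^ j) / X ^ l = D l + ?t" using X by (simp add: add_divide_distrib)
  obtain q where q: "D l = of_int q" using int by (auto elim: Ints_cases)
  have "round (D l + ?t) = q" using t q by (intro round_unique') auto
  then show "of_int (round ((\<Sum>j<Suc l. D j * X ^ j) / X ^ l)) = D l" unfolding eq by (simp add: q)
  show "\<bar>(\<Sum>j<Suc l. D j * X ^ j) / X ^ l\<bar> \<le> X - 1" unfolding eq using t D[of l] X by linarith
qed

text \<open>Linear combination of packed vectors, followed by unpacking, scaling and rounding.  The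
  vectors are packed as \<open>\<Sum>l<L. v\<^sub>l X\<^sup>l\<close> with integers \<open>v\<^sub>l\<close>; as the arithmetic is exact, one
  multiplication scales a whole vector.  Arguments: \<open>r\<close>, \<open>L\<close>, row and offset of the coefficients, row of
  the scaling factors.  Arrays: coefficients, packed vectors, scaling factors, result, scratch cells.\<close>

definition lc_digit :: com where
  "lc_digit =
     Seq (set_cell 4 5 (RDiv (cell 4 5) (cell 4 1)))
     (Seq (set_cell 4 0 (RDiv (cell 4 4) (cell 4 5)))
     (Seq (Call round_proc [] [4])
     (Seq (set_cell 4 4 (RSub (cell 4 4) (RMul (cell 4 0) (cell 4 5))))
     (Seq (set_cell 4 0 (RMul (cell 4 0) (RCell 2 (IVar 4) (ISub (ISub (IVar 1) (IConst 1)) (IVar 5)))))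
     (Seq (Call round_proc [] [4])
     (RStore 3 (IConst 0) (ISub (ISub (IVar 1) (IConst 1)) (IVar 5)) (cell 4 0)))))))"

definition lc_proc :: com where
  "lc_proc =
    Seq (set_cell 4 4 (RConst 0))
   (Seq (set_cell 4 5 (RConst 1))
   (Seq (For 5 (IVar 0) (set_cell 4 4 (RAdd (cell 4 4)
       (RMul (RCell 0 (IVar 2) (IAdd (IVar 3) (IVar 5))) (RCell 1 (IConst 0) (IVar 5))))))
   (Seq (For 5 (IVar 1) (set_cell 4 5 (RMul (cell 4 5) (cell 4 1))))
   (For 5 (IVar 1) lc_digit))))"

text \<open>The cell with the packing base also serves as the bound of the binary search. Both
  roundings stay in range, since a digit is at most X / 4 and the scaling factor at most 1 in
  absolute value.\<close>

lemma runs_lc_digit: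
  fixes D :: "nat \<Rightarrow> real"
  defines "S s i A g \<equiv> s\<lparr>ivar := (ivar s)(5 := int i), rarr := (rarr s)(3 := A, 4 := g)\<rparr>"
  assumes iv: "ivar s 1 = int L" and i: "i < L" and l: "l = L - Suc i"
    and X: "X = 2 ^ b" "2 \<le> b"
    and g: "g 0 1 = X" "g 0 4 = (\<Sum>j<Suc l. D j * X ^ j)" "g 0 5 = X ^ Suc l"
    and D: "\<And>j. j \<le> l \<Longrightarrow> \<bar>D j\<bar> * 4 \<le> X" "D l \<in> \<int>" "\<bar>rarr s 2 (ivar s 4) (int l)\<bar> \<le> 1"
    and R: "\<And>g'. g' 0 1 = X \<Longrightarrow> g' 0 4 = (\<Sum>j<l. D j * X ^ j) \<Longrightarrow> g' 0 5 = X ^ l \<Longrightarrow>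
       R (S s i (upd2 A 0 (int l) (of_int (round (D l * rarr s 2 (ivar s 4) (int l))))) g')"
  shows "runs p lc_digit (S s i A g) (132 * (b + 1) + 64) R"
proof -
  have X4: "4 \<le> X" using power_increasing[of 2 b "2::real"] X by simp
  let ?sc = "rarr s 2 (ivar s 4) (int l)"
  let ?T = "\<Sum>j<l. D j * X ^ j"
  have li: "int L - 1 - int i = int l" using i l by auto
  have st: "runs p (set_cell 4 j u) (S s i A g) K R'"
    if "rval u (S s i A g) = v" "R' (S s i A (upd2 g 0 j v))" "3 + rcost u \<le> K" for j u v g K R'
    using that by (intro runs_RStore) (simp_all add: S_def)
  have rd: "runs p (Call round_proc [] [4]) (S s i A g) (66 * (b + 1)) R'"
    if "g 0 1 = X" "\<bar>g 0 0\<bar> \<le> X - 1"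
      "\<And>g'. g' 0 0 = of_int (round (g 0 0)) \<Longrightarrow>
        (\<And>i j. (i, j) \<notin> {(0,0), (0,2), (0,3)} \<Longrightarrow> g' i j = g i j) \<Longrightarrow> R' (S s i A g')" for g R'
  proof (rule runs_round)
    fix g' :: "int \<Rightarrow> int \<Rightarrow> real"
    assume *: "g' 0 0 = of_int (round (rarr (S s i A g) 4 0 0))"
      "\<And>i' j. (i', j) \<notin> {(0,0), (0,2), (0,3)} \<Longrightarrow> g' i' j = rarr (S s i A g) 4 i' j"
    have "R' (S s i A g')" by (rule that(3)) (use * in \<open>auto simp: S_def\<close>)
    then show "R' ((S s i A g)\<lparr>rarr := (rarr (S s i A g))(4 := g')\<rparr>)" by (simp add: S_def)
  qed (use that(1,2) in \<open>simp_all add: S_def X(1)\<close>)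
  have ld: "of_int (round ((\<Sum>j<Suc l. D j * X ^ j) / X ^ l)) = D l"
    "\<bar>(\<Sum>j<Suc l. D j * X ^ j) / X ^ l\<bar> \<le> X - 1"
    using leading_digit[OF X4, of l D] D by auto
  have sc: "\<bar>D l * ?sc\<bar> \<le> X - 1"
  proof -
    have "\<bar>D l * ?sc\<bar> \<le> \<bar>D l\<bar> * 1"
      unfolding abs_mult using D(3) by (intro mult_left_mono) auto
    then show ?thesis using D(1)[of l] X4 by linarith
  qed
  let ?c7 = "RStore 3 (IConst 0) (ISub (ISub (IVar 1) (IConst 1)) (IVar 5)) (cell 4 0)"
  let ?c6 = "Seq (Call round_proc [] [4]) ?c7"
  let ?c5 = "Seq (set_cell 4 0 (RMul (cell 4 0) (RCell 2 (IVar 4) (ISub (ISub (IVar 1) (IConst 1)) (IVar 5))))) ?c6"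
  let ?c4 = "Seq (set_cell 4 4 (RSub (cell 4 4) (RMul (cell 4 0) (cell 4 5)))) ?c5"
  let ?c3 = "Seq (Call round_proc [] [4]) ?c4"
  let ?c2 = "Seq (set_cell 4 0 (RDiv (cell 4 4) (cell 4 5))) ?c3"
  have 7: "runs p ?c7 (S s i A g) 10 R"
    if "g 0 0 = of_int (round (D l * ?sc))" "g 0 1 = X" "g 0 4 = ?T" "g 0 5 = X ^ l" for g
  proof (rule runs_RStore)
    have "R (S s i (upd2 A 0 (int l) (of_int (round (D l * ?sc)))) g)" by (rule R) (use that in auto)
    then show "R ((S s i A g)\<lparr>rarr := (rarr (S s i A g))(3 := upd2 (rarr (S s i A g) 3) (ival (IConst 0) (S s i A g))
        (ival (ISub (ISub (IVar 1) (IConst 1)) (IVar 5)) (S s i A g)) (rval (cell 4 0) (S s i A g)))\<rparr>)"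
      using that(1) by (simp add: S_def iv[simplified] li fun_upd_twist)
  qed simp
  have 6: "runs p ?c6 (S s i A g) (66 * (b + 1) + 10) R"
    if "g 0 0 = D l * ?sc" "g 0 1 = X" "g 0 4 = ?T" "g 0 5 = X ^ l" for g
    by (rule runs_Seq', rule rd, (use that sc in simp_all)[2], rule 7) (use that in auto)
  have 5: "runs p ?c5 (S s i A g) (14 + (66 * (b + 1) + 10)) R"
    if "g 0 0 = D l" "g 0 1 = X" "g 0 4 = ?T" "g 0 5 = X ^ l" for g
    by (rule runs_Seq', rule st[where v = "D l * ?sc"], use that in \<open>simp add: S_def iv[simplified] li\<close>, rule 6)
      (use that in \<open>auto simp: upd2_apply\<close>)
  have 4: "runs p ?c4 (S s i A g) (14 + (14 + (66 * (b + 1) + 10))) R"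
    if "g 0 0 = D l" "g 0 1 = X" "g 0 4 = (\<Sum>j<Suc l. D j * X ^ j)" "g 0 5 = X ^ l" for g
    by (rule runs_Seq', rule st[where v = "?T"], use that in \<open>simp add: S_def\<close>, rule 5)
      (use that in \<open>auto simp: upd2_apply\<close>)
  have 3: "runs p ?c3 (S s i A g) (66 * (b + 1) + (14 + (14 + (66 * (b + 1) + 10)))) R"
    if "g 0 0 = (\<Sum>j<Suc l. D j * X ^ j) / X ^ l" "g 0 1 = X" "g 0 4 = (\<Sum>j<Suc l. D j * X ^ j)" "g 0 5 = X ^ l" for g
    by (rule runs_Seq', rule rd, (use that ld(2) in \<open>simp_all del: sum.lessThan_Suc\<close>)[2], rule 4)
      (use that ld(1) in \<open>auto simp del: sum.lessThan_Suc\<close>)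
  have 2: "runs p ?c2 (S s i A g) (10 + (66 * (b + 1) + (14 + (14 + (66 * (b + 1) + 10))))) R"
    if "g 0 1 = X" "g 0 4 = (\<Sum>j<Suc l. D j * X ^ j)" "g 0 5 = X ^ l" for g
    by (rule runs_Seq', rule st[where v = "(\<Sum>j<Suc l. D j * X ^ j) / X ^ l"],
        use that in \<open>simp add: S_def del: sum.lessThan_Suc\<close>, rule 3)
      (use that in \<open>auto simp: upd2_apply simp del: sum.lessThan_Suc\<close>)
  have "runs p lc_digit (S s i A g) (10 + (10 + (66 * (b + 1) + (14 + (14 + (66 * (b + 1) + 10)))))) R"
    unfolding lc_digit_def
    by (rule runs_Seq', rule st[where v = "X ^ l"], use g X4 in \<open>simp add: S_def del: sum.lessThan_Suc\<close>, rule 2)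
      (use g in \<open>auto simp: upd2_apply simp del: sum.lessThan_Suc\<close>)
  then show ?thesis by (rule runs_weaken) simp
qed

text \<open>The cost is additive in \<open>r\<close> and \<open>L\<close> because each packed vector
  takes a single multiplication; only the digits of the final sum are extracted. Bounds on the
  digits \<open>D\<close> of the combination suffice: signed digits of this size produce no
  carries.\<close>

lemma runs_lc_proc:
  fixes D :: "nat \<Rightarrow> real"
  assumes iv: "ivar s 0 = int r" "ivar s 1 = int L"
    and X: "rarr s 4 0 1 = 2 ^ b" "2 \<le> b"
    and D: "(\<Sum>i<r. rarr s 0 (ivar s 2) (ivar s 3 + int i) * rarr s 1 0 (int i)) = (\<Sum>l<L. D l * (2 ^ b) ^ l)"
      "\<And>l. l < L \<Longrightarrow> D l \<in> \<int>" "\<And>l. l < L \<Longrightarrow> \<bar>D l\<bar> * 4 \<le> 2 ^ b"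
      "\<And>l. l < L \<Longrightarrow> \<bar>rarr s 2 (ivar s 4) (int l)\<bar> \<le> 1"
  shows "runs p lc_proc s (250 * (r + L + 1) * (b + 1)) (\<lambda>s'. iarr s' = iarr s \<and> (\<exists>g. g 0 1 = 2 ^ b \<and>
    rarr s' = (rarr s)(3 := upd_row (rarr s 3) 0 0 L
        (\<lambda>l. of_int (round (D l * rarr s 2 (ivar s 4) (int l)))), 4 := g)))"
proof -
  let ?X = "(2::real) ^ b"
  have X4: "4 \<le> ?X" using power_increasing[of 2 b "2::real"] X(2) by simp
  let ?out = "\<lambda>l. of_int (round (D l * rarr s 2 (ivar s 4) (int l)))"
  define S where "S v A g = s\<lparr>ivar := (ivar s)(5 := v), rarr := (rarr s)(3 := A, 4 := g)\<rparr>" for v A g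
  \<comment> \<open>Digits come off from the top, so after \<open>i\<close> rounds the positions
    from \<open>L - i\<close> on are filled.\<close>
  define Ao where "Ao i = (\<lambda>y j. if y = 0 \<and> int (L - i) \<le> j \<and> j < int L then ?out (nat j) else rarr s 3 y j)" for i
  define F where "F s' \<longleftrightarrow> iarr s' = iarr s \<and> (\<exists>g. g 0 1 = ?X \<and>
    rarr s' = (rarr s)(3 := upd_row (rarr s 3) 0 0 L ?out, 4 := g))" for s' :: store
  have main: "runs p (For 5 (IVar 1) lc_digit) (S v (rarr s 3) g) (L * (132 * (b + 1) + 74) + 9) F"
    if g: "g 0 1 = ?X" "g 0 4 = (\<Sum>l<L. D l * ?X ^ l)" "g 0 5 = ?X ^ L" for v g
  proof -
    define I where "I i s' \<longleftrightarrow> (\<exists>g. s' = S (int i) (Ao i) g \<and> g 0 1 = ?X \<and>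
        g 0 4 = (\<Sum>l<L - i. D l * ?X ^ l) \<and> g 0 5 = ?X ^ (L - i))" for i and s' :: store
    show ?thesis
    proof (rule runs_For[where I = I and n = L and K = "132 * (b + 1) + 64"])
      fix i s' assume i: "i < L" and "I i s'"
      then obtain g where s': "s' = S (int i) (Ao i) g" and g: "g 0 1 = ?X"
        "g 0 4 = (\<Sum>l<L - i. D l * ?X ^ l)" "g 0 5 = ?X ^ (L - i)" unfolding I_def by blast
      define l where "l = L - Suc i"
      have l: "L - i = Suc l" "l < L" "int L - 1 - int i = int l" using i by (auto simp: l_def)
      have Ao_Suc: "upd2 (Ao i) 0 (int l) (?out l) = Ao (Suc i)"
        using l by (auto simp: Ao_def upd2_apply fun_eq_iff l_def[symmetric])
      show "runs p lc_digit s' (132 * (b + 1) + 64)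
          (\<lambda>s'. ivar s' 5 = int i \<and> I (Suc i) (s'\<lparr>ivar := (ivar s')(5 := int (Suc i))\<rparr>))"
        unfolding s' S_def
      proof (rule runs_lc_digit[where l = l and X = ?X and D = D, OF iv(2) i l_def refl X(2)])
        fix g' :: "int \<Rightarrow> int \<Rightarrow> real"
        assume g': "g' 0 1 = ?X" "g' 0 4 = (\<Sum>j<l. D j * ?X ^ j)" "g' 0 5 = ?X ^ l"
        show "ivar (s\<lparr>ivar := (ivar s)(5 := int i), rarr := (rarr s)(3 := upd2 (Ao i) 0 (int l) (?out l), 4 := g')\<rparr>) 5 = int i \<and>
         I (Suc i) (s\<lparr>ivar := (ivar s)(5 := int i), rarr := (rarr s)(3 := upd2 (Ao i) 0 (int l) (?out l), 4 := g')\<rparr>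
           \<lparr>ivar := (ivar (s\<lparr>ivar := (ivar s)(5 := int i), rarr := (rarr s)(3 := upd2 (Ao i) 0 (int l) (?out l), 4 := g')\<rparr>))
              (5 := int (Suc i))\<rparr>)"
          unfolding I_def Ao_Suc using g' by (auto simp: S_def l_def[symmetric] intro!: exI[of _ g'])
      qed (use g l D in auto)
    next
      have "Ao 0 = rarr s 3" by (auto simp: Ao_def fun_eq_iff)
      then show "I 0 ((S v (rarr s 3) g)\<lparr>ivar := (ivar (S v (rarr s 3) g))(5 := 0)\<rparr>)"
        using g by (auto simp: I_def S_def intro!: exI[of _ g])
    next
      fix s' assume "I L s'"
      then obtain g where s': "s' = S (int L) (Ao L) g" and g: "g 0 1 = ?X" unfolding I_def by blast
      have "Ao L = upd_row (rarr s 3) 0 0 L ?out" by (auto simp: Ao_def upd_row_def fun_eq_iff)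
      then show "F s'" using g by (auto simp: F_def s' S_def intro!: exI[of _ g])
    qed (auto simp: I_def S_def iv[simplified] algebra_simps)
  qed
  have pow: "runs p (Seq (For 5 (IVar 1) (set_cell 4 5 (RMul (cell 4 5) (cell 4 1)))) (For 5 (IVar 1) lc_digit))
      (S v (rarr s 3) g) (L * 20 + 9 + (L * (132 * (b + 1) + 74) + 9)) F"
    if g: "g 0 1 = ?X" "g 0 4 = (\<Sum>l<L. D l * ?X ^ l)" "g 0 5 = 1" for v g
  proof (rule runs_Seq')
    define I where "I i s' \<longleftrightarrow> (\<exists>v g. s' = S v (rarr s 3) g \<and> g 0 1 = ?X \<and>
        g 0 4 = (\<Sum>l<L. D l * ?X ^ l) \<and> g 0 5 = ?X ^ i)" for i and s' :: store
    show "runs p (For 5 (IVar 1) (set_cell 4 5 (RMul (cell 4 5) (cell 4 1)))) (S v (rarr s 3) g) (L * 20 + 9)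
       (\<lambda>s'. runs p (For 5 (IVar 1) lc_digit) s' (L * (132 * (b + 1) + 74) + 9) F)"
    proof (rule runs_For[where I = I and n = L and K = 10])
      fix i s' assume i: "i < L" and "I i s'" and v5: "ivar s' 5 = int i"
      then obtain v g where s': "s' = S v (rarr s 3) g" and g: "g 0 1 = ?X"
        "g 0 4 = (\<Sum>l<L. D l * ?X ^ l)" "g 0 5 = ?X ^ i" unfolding I_def by blast
      show "runs p (set_cell 4 5 (RMul (cell 4 5) (cell 4 1))) s' 10
          (\<lambda>s'. ivar s' 5 = int i \<and> I (Suc i) (s'\<lparr>ivar := (ivar s')(5 := int (Suc i))\<rparr>))"
        by (rule runs_RStore) (use g v5 in \<open>auto simp: I_def s' S_def upd2_apply intro!:
            exI[of _ "int (Suc i)"] exI[of _ "upd2 g 0 5 (?X ^ i * ?X)"]\<close>)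
    next
      fix s' assume "I L s'"
      then show "runs p (For 5 (IVar 1) lc_digit) s' (L * (132 * (b + 1) + 74) + 9) F"
        unfolding I_def using main by blast
    next
      show "I 0 ((S v (rarr s 3) g)\<lparr>ivar := (ivar (S v (rarr s 3) g))(5 := 0)\<rparr>)"
        using g by (auto simp: I_def S_def intro!: exI[of _ 0] exI[of _ g])
    qed (auto simp: I_def S_def iv[simplified])
  qed
  have acc: "runs p (Seq (For 5 (IVar 0) (set_cell 4 4 (RAdd (cell 4 4)
       (RMul (RCell 0 (IVar 2) (IAdd (IVar 3) (IVar 5))) (RCell 1 (IConst 0) (IVar 5))))))
      (Seq (For 5 (IVar 1) (set_cell 4 5 (RMul (cell 4 5) (cell 4 1)))) (For 5 (IVar 1) lc_digit)))
      (S v (rarr s 3) g) (r * 27 + 9 + (L * 20 + 9 + (L * (132 * (b + 1) + 74) + 9))) F"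
    if g: "g 0 1 = ?X" "g 0 4 = 0" "g 0 5 = 1" for v g
  proof (rule runs_Seq', rule runs_accum[where n = r and
        g = "\<lambda>i. rarr s 0 (ivar s 2) (ivar s 3 + int i) * rarr s 1 0 (int i)"])
    let ?s = "S v (rarr s 3) g"
    let ?A = "upd2 (rarr ?s 4) 0 4 (rarr ?s 4 0 4 + (\<Sum>i<r. rarr s 0 (ivar s 2) (ivar s 3 + int i) * rarr s 1 0 (int i)))"
    have "?s\<lparr>ivar := (ivar ?s)(5 := int r), rarr := (rarr ?s)(4 := ?A)\<rparr> = S (int r) (rarr s 3) ?A"
      by (simp add: S_def)
    then show "runs p (Seq (For 5 (IVar 1) (set_cell 4 5 (RMul (cell 4 5) (cell 4 1)))) (For 5 (IVar 1) lc_digit))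
        (?s\<lparr>ivar := (ivar ?s)(5 := int r), rarr := (rarr ?s)(4 := ?A)\<rparr>) (L * 20 + 9 + (L * (132 * (b + 1) + 74) + 9)) F"
      using g by (simp only:) (rule pow, simp_all add: S_def upd2_apply D(1)[unfolded One_nat_def])
  qed (auto simp: S_def iv[simplified])
  have st: "runs p (set_cell 4 j u) (S v A g) K R'"
    if "rval u (S v A g) = c" "R' (S v A (upd2 g 0 j c))" "3 + rcost u \<le> K" for j u v A g c K R'
    using that by (intro runs_RStore) (simp_all add: S_def)
  have s0: "s = S (ivar s 5) (rarr s 3) (rarr s 4)" by (simp add: S_def)
  have "runs p lc_proc (S (ivar s 5) (rarr s 3) (rarr s 4))
      (4 + (4 + (r * 27 + 9 + (L * 20 + 9 + (L * (132 * (b + 1) + 74) + 9))))) F"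
    unfolding lc_proc_def
    by (rule runs_Seq', rule st[where ?c1 = 0], simp, rule runs_Seq', rule st[where ?c1 = 1], simp, rule acc)
      (simp_all add: upd2_apply X)
  note this[folded s0]
  then have "runs p lc_proc s (250 * (r + L + 1) * (b + 1)) F"
    by (rule runs_weaken) (simp add: algebra_simps)
  then show ?thesis by (simp only: F_def[abs_def])
qed

lemma runs_lc:
  fixes D :: "nat \<Rightarrow> real"
  assumes dist: "distinct [a, P, sc, out, cl]"
    and iv: "ival er s = int r" "ival eL s = int L" "ival erow s = rw" "ival eoff s = off" "ival esc s = scr"
    and X: "rarr s cl 0 1 = 2 ^ b" "2 \<le> b"
    and D: "(\<Sum>i<r. rarr s a rw (off + int i) * rarr s P 0 (int i)) = (\<Sum>l<L. D l * (2 ^ b) ^ l)"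
      "\<And>l. l < L \<Longrightarrow> D l \<in> \<int>" "\<And>l. l < L \<Longrightarrow> \<bar>D l\<bar> * 4 \<le> 2 ^ b"
      "\<And>l. l < L \<Longrightarrow> \<bar>rarr s sc scr (int l)\<bar> \<le> 1"
    and K: "icost er + icost eL + icost erow + icost eoff + icost esc \<le> 40"
    and R: "\<And>g. g 0 1 = 2 ^ b \<Longrightarrow> R (s\<lparr>rarr := (rarr s)(out := upd_row (rarr s out) 0 0 L
        (\<lambda>l. of_int (round (D l * rarr s sc scr (int l)))), cl := g)\<rparr>)"
  shows "runs p (Call lc_proc [er, eL, erow, eoff, esc] [a, P, sc, out, cl]) s (300 * (r + L + 1) * (b + 1)) R"
proof (rule runs_Call[OF dist])
  let ?es = "[er, eL, erow, eoff, esc]" and ?xs = "[a, P, sc, out, cl]"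
  let ?e = "enter ?es ?xs s"
  have e: "rarr ?e 0 = rarr s a" "rarr ?e 1 = rarr s P" "rarr ?e 2 = rarr s sc" "rarr ?e 3 = rarr s out"
    "rarr ?e 4 = rarr s cl" "ivar ?e 0 = int r" "ivar ?e 1 = int L" "ivar ?e 2 = rw" "ivar ?e 3 = off" "ivar ?e 4 = scr"
    using iv by (simp_all add: enter_def)
  have "runs lc_proc lc_proc ?e (250 * (r + L + 1) * (b + 1)) (\<lambda>s'. iarr s' = iarr ?e \<and> (\<exists>g. g 0 1 = 2 ^ b \<and>
    rarr s' = (rarr ?e)(3 := upd_row (rarr ?e 3) 0 0 L
        (\<lambda>l. of_int (round (D l * rarr ?e 2 (ivar ?e 4) (int l)))), 4 := g)))"
    by (rule runs_lc_proc) (use X D in \<open>simp_all only: e\<close>)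
  then show "runs lc_proc lc_proc ?e (250 * (r + L + 1) * (b + 1)) (\<lambda>s'. R (leave ?xs s s'))"
  proof (rule runs_mono)
    fix s' :: store assume *: "iarr s' = iarr ?e \<and> (\<exists>g. g 0 1 = 2 ^ b \<and>
      rarr s' = (rarr ?e)(3 := upd_row (rarr ?e 3) 0 0 L
        (\<lambda>l. of_int (round (D l * rarr ?e 2 (ivar ?e 4) (int l)))), 4 := g))"
    then obtain g where g: "g 0 1 = 2 ^ b" "rarr s' = (rarr ?e)(3 := upd_row (rarr s out) 0 0 L
        (\<lambda>l. of_int (round (D l * rarr s sc scr (int l)))), 4 := g)" unfolding e by blast
    have "leave ?xs s s' = s\<lparr>rarr := (rarr s)(out := upd_row (rarr s out) 0 0 L
        (\<lambda>l. of_int (round (D l * rarr s sc scr (int l)))), cl := g)\<rparr>"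
    proof (rule leave_rarr_only[OF dist])
      fix j assume "j < length ?xs"
      then have "j = 0 \<or> j = 1 \<or> j = 2 \<or> j = 3 \<or> j = 4" by auto
      then show "((rarr s)(out := upd_row (rarr s out) 0 0 L
        (\<lambda>l. of_int (round (D l * rarr s sc scr (int l)))), cl := g)) (?xs ! j) = rarr s' j"
        using dist by (elim disjE) (simp_all add: g(2) e[simplified])
    qed (use * in auto)
    then show "R (leave ?xs s s')" using R[of g, OF g(1)] by simp
  qed simp
  define M where "M = (r + L + 1) * (b + 1)"
  have "1 \<le> M" by (simp add: M_def)
  then have "call_cost ?es ?xs + 250 * M \<le> 300 * M"
    using K by (simp add: call_cost_def)
  then show "call_cost ?es ?xs + 250 * (r + L + 1) * (b + 1) \<le> 300 * (r + L + 1) * (b + 1)"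
    by (simp only: M_def mult.assoc)
qed

text \<open>Arguments: length, row and offset of the vector, index of the result.\<close>

definition pack_proc :: com where
  "pack_proc =
    Seq (set_cell 2 4 (RConst 0))
   (Seq (set_cell 2 5 (RConst 1))
   (Seq (For 4 (IVar 0) (Seq
       (set_cell 2 4 (RAdd (cell 2 4) (RMul (RCell 0 (IVar 1) (IAdd (IVar 2) (IVar 4))) (cell 2 5))))
       (set_cell 2 5 (RMul (cell 2 5) (cell 2 1)))))
   (RStore 1 (IConst 0) (IVar 3) (cell 2 4))))"

lemma runs_pack_proc:
  assumes iv: "ivar s 0 = int L" and X: "rarr s 2 0 1 = X"
  shows "runs p pack_proc s (40 * (L + 1)) (\<lambda>s'. iarr s' = iarr s \<and> (\<exists>g. g 0 1 = X \<and>
    rarr s' = (rarr s)(1 := upd2 (rarr s 1) 0 (ivar s 3)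
       (\<Sum>i<L. rarr s 0 (ivar s 1) (ivar s 2 + int i) * X ^ i), 2 := g)))"
proof -
  define S where "S v g = s\<lparr>ivar := (ivar s)(4 := v), rarr := (rarr s)(2 := g)\<rparr>" for v g
  let ?u = "\<lambda>i. rarr s 0 (ivar s 1) (ivar s 2 + int i)"
  let ?c1 = "set_cell 2 4 (RAdd (cell 2 4) (RMul (RCell 0 (IVar 1) (IAdd (IVar 2) (IVar 4))) (cell 2 5)))"
  let ?c2 = "set_cell 2 5 (RMul (cell 2 5) (cell 2 1))"
  let ?c3 = "RStore 1 (IConst 0) (IVar 3) (cell 2 4)"
  let ?F = "\<lambda>s'. iarr s' = iarr s \<and> (\<exists>g. g 0 1 = X \<and>
    rarr s' = (rarr s)(1 := upd2 (rarr s 1) 0 (ivar s 3) (\<Sum>i<L. ?u i * X ^ i), 2 := g))"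
  define I where "I i s' \<longleftrightarrow> (\<exists>v g. s' = S v g \<and> g 0 1 = X \<and>
      g 0 4 = (\<Sum>j<i. ?u j * X ^ j) \<and> g 0 5 = X ^ i)" for i and s' :: store
  have st: "runs p (set_cell 2 j u) (S v g) K R'"
    if "rval u (S v g) = c" "R' (S v (upd2 g 0 j c))" "3 + rcost u \<le> K" for j u v g c K R'
    using that by (intro runs_RStore) (simp_all add: S_def)
  have loop: "runs p (For 4 (IVar 0) (Seq ?c1 ?c2)) (S v g) (L * 36 + 9) (I L)"
    if g: "g 0 1 = X" "g 0 4 = 0" "g 0 5 = 1" for v g
  proof (rule runs_For[where I = I and n = L and K = 26])
    fix i s' assume i: "i < L" and "I i s'" and v4: "ivar s' 4 = int i"
    then obtain v g where s': "s' = S v g" and g: "g 0 1 = X"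
        "g 0 4 = (\<Sum>j<i. ?u j * X ^ j)" "g 0 5 = X ^ i" unfolding I_def by blast
    have v: "v = int i" using v4 by (simp add: s' S_def)
    have "runs p (Seq ?c1 ?c2) (S (int i) g) (16 + 10)
      (\<lambda>s'. ivar s' 4 = int i \<and> I (Suc i) (s'\<lparr>ivar := (ivar s')(4 := int (Suc i))\<rparr>))"
    proof (rule runs_Seq', rule st[where ?c1 = "\<Sum>j<Suc i. ?u j * X ^ j"])
      let ?g = "upd2 g 0 4 (\<Sum>j<Suc i. ?u j * X ^ j)"
      show "runs p ?c2 (S (int i) ?g) 10
         (\<lambda>s'. ivar s' 4 = int i \<and> I (Suc i) (s'\<lparr>ivar := (ivar s')(4 := int (Suc i))\<rparr>))"
      proof (rule st[where ?c1 = "X ^ Suc i"])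
        have "(S (int i) (upd2 ?g 0 5 (X ^ Suc i)))\<lparr>ivar := (ivar (S (int i) (upd2 ?g 0 5 (X ^ Suc i))))(4 := int (Suc i))\<rparr>
          = S (int (Suc i)) (upd2 ?g 0 5 (X ^ Suc i))" by (simp add: S_def)
        then show "ivar (S (int i) (upd2 ?g 0 5 (X ^ Suc i))) 4 = int i \<and>
          I (Suc i) ((S (int i) (upd2 ?g 0 5 (X ^ Suc i)))\<lparr>ivar := (ivar (S (int i) (upd2 ?g 0 5 (X ^ Suc i))))(4 := int (Suc i))\<rparr>)"
          unfolding I_def using g(1)
          by (intro conjI exI[of _ "int (Suc i)"] exI[of _ "upd2 ?g 0 5 (X ^ Suc i)"])
            (simp_all only:, simp_all add: upd2_apply S_def)
      qed (use g in \<open>simp_all add: S_def upd2_apply\<close>)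
    qed (use g in \<open>simp_all add: S_def\<close>)
    then show "runs p (Seq ?c1 ?c2) s' 26
      (\<lambda>s'. ivar s' 4 = int i \<and> I (Suc i) (s'\<lparr>ivar := (ivar s')(4 := int (Suc i))\<rparr>))"
      by (simp only: s' v) (erule runs_weaken, simp)
  next
    show "I 0 ((S v g)\<lparr>ivar := (ivar (S v g))(4 := 0)\<rparr>)"
      using g by (auto simp: I_def S_def intro!: exI[of _ 0] exI[of _ g])
  qed (auto simp: I_def S_def iv)
  have s0: "s = S (ivar s 4) (rarr s 2)" by (simp add: S_def)
  have "runs p pack_proc (S (ivar s 4) (rarr s 2)) (4 + (4 + ((L * 36 + 9) + 6))) ?F"
    unfolding pack_proc_def
  proof (rule runs_Seq', rule st[where ?c1 = 0], simp, rule runs_Seq', rule st[where ?c1 = 1], simp,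
      rule runs_Seq', rule runs_mono[OF loop])
    fix s' assume "I L s'"
    then obtain v g where s': "s' = S v g" and g: "g 0 1 = X" "g 0 4 = (\<Sum>j<L. ?u j * X ^ j)"
      unfolding I_def by blast
    show "runs p ?c3 s' 6 ?F"
      by (rule runs_RStore) (use g in \<open>auto simp: s' S_def fun_upd_twist intro!: exI[of _ g]\<close>)
  qed (simp_all add: upd2_apply X)
  then show ?thesis unfolding s0[symmetric] by (rule runs_weaken) simp
qed

lemma runs_pack:
  assumes dist: "distinct [v, dst, cl]"
    and iv: "ival eL s = int L" "ival erow s = rw" "ival eoff s = off" "ival edst s = di"
    and X: "rarr s cl 0 1 = X"
    and K: "icost eL + icost erow + icost eoff + icost edst \<le> 40"
    and R: "\<And>g. g 0 1 = X \<Longrightarrow> R (s\<lparr>rarr := (rarr s)(dst := upd2 (rarr s dst) 0 di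
        (\<Sum>i<L. rarr s v rw (off + int i) * X ^ i), cl := g)\<rparr>)"
  shows "runs p (Call pack_proc [eL, erow, eoff, edst] [v, dst, cl]) s (100 * (L + 1)) R"
proof (rule runs_Call[OF dist])
  let ?es = "[eL, erow, eoff, edst]" and ?xs = "[v, dst, cl]"
  let ?e = "enter ?es ?xs s"
  have e: "rarr ?e 0 = rarr s v" "rarr ?e 1 = rarr s dst" "rarr ?e 2 = rarr s cl"
    "ivar ?e 0 = int L" "ivar ?e 1 = rw" "ivar ?e 2 = off" "ivar ?e 3 = di"
    using iv by (simp_all add: enter_def)
  have "runs pack_proc pack_proc ?e (40 * (L + 1)) (\<lambda>s'. iarr s' = iarr ?e \<and> (\<exists>g. g 0 1 = X \<and>
    rarr s' = (rarr ?e)(1 := upd2 (rarr ?e 1) 0 (ivar ?e 3)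
       (\<Sum>i<L. rarr ?e 0 (ivar ?e 1) (ivar ?e 2 + int i) * X ^ i), 2 := g)))"
    by (rule runs_pack_proc) (use X in \<open>simp_all only: e\<close>)
  then show "runs pack_proc pack_proc ?e (40 * (L + 1)) (\<lambda>s'. R (leave ?xs s s'))"
  proof (rule runs_mono)
    fix s' :: store assume *: "iarr s' = iarr ?e \<and> (\<exists>g. g 0 1 = X \<and>
      rarr s' = (rarr ?e)(1 := upd2 (rarr ?e 1) 0 (ivar ?e 3)
       (\<Sum>i<L. rarr ?e 0 (ivar ?e 1) (ivar ?e 2 + int i) * X ^ i), 2 := g))"
    then obtain g where g: "g 0 1 = X" "rarr s' = (rarr ?e)(1 := upd2 (rarr s dst) 0 di
        (\<Sum>i<L. rarr s v rw (off + int i) * X ^ i), 2 := g)" unfolding e by blast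
    have "leave ?xs s s' = s\<lparr>rarr := (rarr s)(dst := upd2 (rarr s dst) 0 di
        (\<Sum>i<L. rarr s v rw (off + int i) * X ^ i), cl := g)\<rparr>"
    proof (rule leave_rarr_only[OF dist])
      fix j assume "j < length ?xs"
      then have "j = 0 \<or> j = 1 \<or> j = 2" by auto
      then show "((rarr s)(dst := upd2 (rarr s dst) 0 di
        (\<Sum>i<L. rarr s v rw (off + int i) * X ^ i), cl := g)) (?xs ! j) = rarr s' j"
        using dist by (elim disjE) (simp_all add: g(2) e[simplified])
    qed (use * in auto)
    then show "R (leave ?xs s s')" using R[of g, OF g(1)] by simp
  qed simp
  show "call_cost ?es ?xs + 40 * (L + 1) \<le> 100 * (L + 1)"
    using K by (simp add: call_cost_def)
qed

section \<open>The online algorithm\<close>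

text \<open>Cauchy--Schwarz for (1, -x) and (e, r) gives sqrt 2 / 3 = 0.4714..., just under 59/125 =
  0.472. The weight 59/250 in the proof is a rational number close to sqrt 2 / 6, which balances the
  arithmetic-geometric mean inequality.\<close>

lemma weighted_cauchy:
  fixes x r :: "nat \<Rightarrow> real"
  assumes "(\<Sum>p<s. (x p)\<^sup>2) \<le> 1" "e\<^sup>2 + (\<Sum>p<s. (r p)\<^sup>2) \<le> 1/9"
  shows "\<bar>e - (\<Sum>p<s. x p * r p)\<bar> \<le> 59/125"
proof -
  have t: "2 * \<bar>u * v\<bar> \<le> (59/250) * u\<^sup>2 + v\<^sup>2 / (59/250)" for u v :: real
  proof -
    have "0 \<le> ((59/250) * \<bar>u\<bar> - \<bar>v\<bar>)\<^sup>2" by simp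
    then show ?thesis by (simp add: power2_diff power_mult_distrib abs_mult field_simps power2_eq_square)
  qed
  have "2 * \<bar>\<Sum>p<s. x p * r p\<bar> \<le> (\<Sum>p<s. 2 * \<bar>x p * r p\<bar>)"
    by (simp add: sum_distrib_left[symmetric])
  also have "\<dots> \<le> (\<Sum>p<s. (59/250) * (x p)\<^sup>2 + (r p)\<^sup>2 / (59/250))" by (rule sum_mono) (rule t)
  also have "\<dots> = (59/250) * (\<Sum>p<s. (x p)\<^sup>2) + (\<Sum>p<s. (r p)\<^sup>2) / (59/250)"
    by (simp only: sum.distrib sum_distrib_left sum_divide_distrib)
  finally have 1: "2 * \<bar>\<Sum>p<s. x p * r p\<bar> \<le> (59/250) * (\<Sum>p<s. (x p)\<^sup>2) + (\<Sum>p<s. (r p)\<^sup>2) / (59/250)" .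
  have 2: "2 * \<bar>e\<bar> \<le> (59/250) + e\<^sup>2 / (59/250)" using t[of 1 e] by simp
  have comb: "\<bar>u - v\<bar> \<le> 59/125" if "2 * \<bar>v\<bar> \<le> (59/250) * x + y / (59/250)"
    "2 * \<bar>u\<bar> \<le> (59/250) + z / (59/250)" "z + y \<le> 1/9" "x \<le> 1" for u v x y z :: real
  proof -
    have "2 * \<bar>v\<bar> + 2 * \<bar>u\<bar> \<le> 59/250 + 59/250 * x + 250/59 * (z + y)"
      using that(1,2) by (simp add: algebra_simps add_divide_distrib)
    also have "\<dots> \<le> 59/250 + 59/250 * 1 + 250/59 * (1/9)"
      using that(3,4) by (intro add_mono mult_left_mono) auto
    also have "\<dots> \<le> 2 * (59/125)" by simp
    finally have "\<bar>v\<bar> + \<bar>u\<bar> \<le> 59/125" by simp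
    moreover have "\<bar>u - v\<bar> \<le> \<bar>v\<bar> + \<bar>u\<bar>" by simp
    ultimately show ?thesis by linarith
  qed
  show ?thesis by (rule comb[OF 1 2 assms(2,1)])
qed

text \<open>Besides the demands of \<open>gram\<close>, \<open>Q\<close> has to exceed the entries
  of A C and to be so fine that rounding the rows of Z, with coefficients up to \<open>a0\<close>,
  costs at most 1/50 in \<open>prediction\<close>.\<close>

locale product_setting = gram m n Q for m n :: nat and Q :: real +
  fixes d k b :: nat and A C Z :: "real mat" and \<alpha> :: "nat \<Rightarrow> nat \<Rightarrow> real" and a0 :: real
  assumes m: "m = 2 * k" and Q: "Q = 2 ^ b"
    and A: "A \<in> carrier_mat n d" and C: "C \<in> carrier_mat d k"
    and AC_int: "\<And>j c. j < n \<Longrightarrow> c < k \<Longrightarrow> (A * C) $$ (j, c) \<in> \<int>"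
    and AC_le: "\<And>j c. j < n \<Longrightarrow> c < k \<Longrightarrow> \<bar>(A * C) $$ (j, c)\<bar> \<le> Q"
    and Z_le: "\<And>j l. j < n \<Longrightarrow> l < m \<Longrightarrow> \<bar>Z $$ (j, l)\<bar> \<le> 1"
    and approx: "\<And>c. c < k \<Longrightarrow> (\<Sum>j<n. ((A * C) $$ (j, c) - (\<Sum>l<m. Z $$ (j, l) * \<alpha> l c))\<^sup>2) \<le> 1/9"
    and \<alpha>_le: "\<And>l c. l < m \<Longrightarrow> c < k \<Longrightarrow> \<bar>\<alpha> l c\<bar> \<le> a0"
    and a0: "50 * real m * (real n + 3) * a0 \<le> Q"
begin

definition grid :: "nat \<Rightarrow> nat \<Rightarrow> real" where
  "grid j l = of_int (round (Q * Z $$ (j, l)))"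

text \<open>The last clause says that the quadratic form \<open>z\<^sup>T M\<inverse> z\<close> of a newly selected row is at least \<open>1/2\<close>,
  in the variational form in which \<open>det_gram_mat_ge\<close> uses it.\<close>

definition selection :: "nat \<Rightarrow> nat \<Rightarrow> (nat \<Rightarrow> nat) \<Rightarrow> (nat \<Rightarrow> nat \<Rightarrow> real) \<Rightarrow> bool" where
  "selection j s sel b' \<longleftrightarrow> near_orth s (\<lambda>p. grid (sel p)) b' \<and> j \<le> n \<and>
    (\<forall>p<s. sel p < j) \<and> inj_on sel {..<s} \<and> (\<forall>q<s. \<forall>i. b' q i \<in> \<int>) \<and>
    (\<forall>q<s. \<exists>v. 1/2 \<le> 2 * (\<Sum>l<m. grid (sel q) l * v l) - (\<Sum>l<m. v l * v l) -
      (\<Sum>p<q. (\<Sum>l<m. grid (sel p) l * v l)\<^sup>2))"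

lemma grid_le: "j < n \<Longrightarrow> \<forall>l<m. \<bar>grid j l\<bar> \<le> Q"
proof (intro allI impI)
  fix l assume "j < n" "l < m"
  then have "\<bar>Q * Z $$ (j, l)\<bar> \<le> Q * 1" unfolding abs_mult using Z_le Q_pos by (intro mult_mono) auto
  moreover have "Q = of_int (2 ^ b)" by (simp add: Q)
  ultimately have "- of_int (2 ^ b) \<le> Q * Z $$ (j, l)" "Q * Z $$ (j, l) \<le> of_int (2 ^ b)" by linarith+
  then have "round (- real_of_int (2 ^ b)) \<le> round (Q * Z $$ (j, l))" "round (Q * Z $$ (j, l)) \<le> round (real_of_int (2 ^ b))"
    using round_mono by blast+
  then have "- (2 ^ b) \<le> round (Q * Z $$ (j, l))" "round (Q * Z $$ (j, l)) \<le> 2 ^ b"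
    using round_of_int[of "- (2 ^ b)", where ?'a = real] round_of_int[of "2 ^ b", where ?'a = real] by simp_all
  then have "of_int (- (2 ^ b)) \<le> grid j l" "grid j l \<le> of_int (2 ^ b)"
    unfolding grid_def by (simp_all only: of_int_le_iff)
  then show "\<bar>grid j l\<bar> \<le> Q" by (simp add: Q)
qed

lemma grid_int: "grid j l \<in> \<int>"
  by (simp add: grid_def)

lemma grid_close: "\<bar>grid j l - Q * Z $$ (j, l)\<bar> \<le> 1/2"
  unfolding grid_def by (rule of_int_round_abs_le)

lemma N_int: "N \<in> \<int>"
proof -
  have "Q \<in> \<int>" by (subst Q) simp
  then show ?thesis by (simp add: N_def)
qed

lemma corr_int: "corr s b' f p \<in> \<int>"
  by (simp add: corr_def)

lemma assemble_int:
  "(\<And>l. z l \<in> \<int>) \<Longrightarrow> (\<And>p. p < s \<Longrightarrow> x p \<in> \<int>) \<Longrightarrow> (\<And>p l. \<zeta> p l \<in> \<int>) \<Longrightarrow> assemble s \<zeta> z x i \<in> \<int>"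
  by (auto simp: assemble_def N_int intro!: Ints_diff Ints_mult Ints_sum)

lemma pass_int:
  "(\<And>l. z l \<in> \<int>) \<Longrightarrow> (\<And>i. f i \<in> \<int>) \<Longrightarrow> (\<And>p l. \<zeta> p l \<in> \<int>) \<Longrightarrow> pass s \<zeta> b' z f i \<in> \<int>"
  unfolding pass_def by (rule assemble_int) (auto simp: corr_int intro: Ints_diff)

lemma start_int: "(\<And>l. z l \<in> \<int>) \<Longrightarrow> start s \<zeta> z i \<in> \<int>"
  by (simp add: start_apply N_int)

lemma pass2_int:
  "(\<And>l. z l \<in> \<int>) \<Longrightarrow> (\<And>p l. \<zeta> p l \<in> \<int>) \<Longrightarrow> pass2 s \<zeta> b' z i \<in> \<int>"
  unfolding pass2_def by (intro pass_int start_int)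

lemma selection_near_orth: "selection j s sel b' \<Longrightarrow> near_orth s (\<lambda>p. grid (sel p)) b'"
  by (simp add: selection_def)

lemma selection_0: "selection 0 0 sel b'"
  by (simp add: selection_def near_orth_0)

lemma selection_le:
  assumes "selection j s sel b'"
  shows "s \<le> 8 * b * m" "s \<le> j" "j \<le> n"
proof -
  have "s = card (sel ` {..<s})" using assms by (simp add: selection_def card_image)
  also have "\<dots> \<le> card {..<j}" by (rule card_mono) (use assms in \<open>auto simp: selection_def\<close>)
  finally show "s \<le> j" by simp
  show jn: "j \<le> n" using assms by (simp add: selection_def)
  show "s \<le> 8 * b * m"
  proof (rule witness_count[where Q = Q and \<zeta> = "\<lambda>p. grid (sel p)"])
    show "real s + 1 \<le> Q" using \<open>s \<le> j\<close> jn Q_n by simp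
    fix p l assume "p < s" "l < m"
    then show "\<bar>grid (sel p) l\<bar> \<le> Q" using assms jn grid_le[of "sel p"]
      by (meson less_le_trans selection_def)
  next
    show "real m \<le> Q" using Q_m by simp
    show "Q = 2 ^ b" by (rule Q)
  qed (use assms in \<open>simp add: selection_def\<close>)
qed

lemma selection_skip: "selection j s sel b' \<Longrightarrow> j < n \<Longrightarrow> selection (Suc j) s sel b'"
  by (auto simp: selection_def less_SucI)

abbreviation residual :: "nat \<Rightarrow> nat \<Rightarrow> (nat \<Rightarrow> nat) \<Rightarrow> (nat \<Rightarrow> nat \<Rightarrow> real) \<Rightarrow> nat \<Rightarrow> real" where
  "residual j s sel b' \<equiv> pass2 s (\<lambda>p. grid (sel p)) b' (grid j)"

lemma selection_extend:
  assumes S: "selection j s sel b'" and j: "j < n"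
    and big: "N\<^sup>2 < ip (residual j s sel b') (residual j s sel b')"
  shows "selection (Suc j) (Suc s) (sel(s := j)) (b'(s := (residual j s sel b')(m + s := - N)))"
    (is "selection _ _ ?sel ?b")
proof -
  let ?\<zeta> = "\<lambda>p. grid (sel p)"
  have I: "near_orth s ?\<zeta> b'" using S by (simp add: selection_def)
  have sn: "s < n" using selection_le[OF S] j by linarith
  have \<zeta>: "(\<lambda>p. grid (?sel p)) = ?\<zeta>(s := grid j)" by (auto simp: fun_eq_iff)
  have "near_orth (Suc s) (\<lambda>p. grid (?sel p)) ?b"
    unfolding \<zeta> by (rule near_orth_extend[OF I grid_le[OF j] sn])
  moreover have "\<exists>v. 1/2 \<le> 2 * (\<Sum>l<m. grid (?sel q) l * v l) - (\<Sum>l<m. v l * v l) -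
      (\<Sum>p<q. (\<Sum>l<m. grid (?sel p) l * v l)\<^sup>2)" if "q < Suc s" for q
  proof (cases "q = s")
    case True
    then show ?thesis using pass2_witness[OF I grid_le[OF j] big] by simp
  next
    case False
    then have "q < s" using that by simp
    then have "\<exists>v. 1/2 \<le> 2 * (\<Sum>l<m. grid (sel q) l * v l) - (\<Sum>l<m. v l * v l) -
      (\<Sum>p<q. (\<Sum>l<m. grid (sel p) l * v l)\<^sup>2)" using S by (simp add: selection_def)
    then show ?thesis using \<open>q < s\<close> by simp
  qed
  moreover have "inj_on ?sel {..<Suc s}"
  proof -
    have "inj_on ?sel {..<s}" using S by (simp add: selection_def inj_on_def)
    moreover have "?sel s \<notin> ?sel ` {..<s}" using S by (auto simp: selection_def)
    ultimately show ?thesis by (simp add: lessThan_Suc)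
  qed
  moreover have "\<forall>q<Suc s. \<forall>i. ?b q i \<in> \<int>"
    using S pass2_int[of "grid j" ?\<zeta>] grid_int N_int by (auto simp: selection_def less_Suc_eq)
  ultimately show ?thesis using S j by (auto simp: selection_def less_Suc_eq)
qed

text \<open>The deviation from the combined known products has two parts: the approximation errors
  \<open>r\<close>, together at most 59/125, and the failure of the combination to reproduce row
  \<open>j\<close> of Z, weighted with \<open>\<alpha>\<close>, at most 1/50. Their sum is below 1/2
  and the true value is an integer.\<close>

lemma prediction:
  assumes S: "selection j s sel b'" and j: "j < n" and c: "c < k"
    and small: "ip (residual j s sel b') (residual j s sel b') \<le> N\<^sup>2"
  shows "of_int (round ((\<Sum>p<s. residual j s sel b' (m + p) * (A * C) $$ (sel p, c)) * (1 / N))) = (A * C) $$ (j, c)"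
proof -
  let ?f = "residual j s sel b'" and ?y = "\<lambda>i. (A * C) $$ (i, c)"
  define x where "x p = ?f (m + p) / N" for p
  define r where "r i = ?y i - (\<Sum>l<m. Z $$ (i, l) * \<alpha> l c)" for i
  have sj: "s \<le> j" "j \<le> n" and sm: "s \<le> n" using selection_le[OF S] by auto
  have sel: "sel p < j" if "p < s" for p using S that by (simp add: selection_def)
  have inj: "inj_on sel {..<s}" using S by (simp add: selection_def)
  have coh: "?f i = N * grid j i - (\<Sum>p<s. ?f (m + p) * grid (sel p) i)" if "i < m" for i
    using pass2_coherent that by (simp add: coherent_def)
  have zero: "?f i = 0" if "m + s \<le> i" for i
    using pass2_coherent that by (simp add: coherent_def)
  have split: "ip ?f ?f = (\<Sum>l<m. ?f l * ?f l) + (\<Sum>p<s. ?f (m + p) * ?f (m + p))"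
    by (rule ip_split[OF sm]) (simp add: zero)
  have xx: "(\<Sum>p<s. (x p)\<^sup>2) \<le> 1"
  proof -
    have "(\<Sum>p<s. ?f (m + p) * ?f (m + p)) \<le> N\<^sup>2"
      using small split sum_nonneg[of "{..<m}" "\<lambda>l. ?f l * ?f l"] by simp
    moreover have "(\<Sum>p<s. (x p)\<^sup>2) = (\<Sum>p<s. ?f (m + p) * ?f (m + p)) / N\<^sup>2"
      by (simp add: x_def sum_divide_distrib power2_eq_square)
    ultimately show ?thesis using N_pos by simp
  qed
  have fl: "\<bar>?f l / N\<bar> \<le> 1" if "l < m + n" for l
  proof -
    have "(?f l)\<^sup>2 \<le> N\<^sup>2" using coord_le_dot[OF that, of ?f] small by linarith
    then have "\<bar>?f l\<bar> \<le> \<bar>N\<bar>" by (simp only: abs_le_square_iff)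
    then show ?thesis using N_pos by simp
  qed
  \<comment> \<open>Row \<open>j\<close> and the selected rows are pairwise distinct, so their
    errors are part of one column sum, which is at most 1/9. This is where \<open>inj_on sel\<close>
    enters.\<close>
  have rr: "(r j)\<^sup>2 + (\<Sum>p<s. (r (sel p))\<^sup>2) \<le> 1/9"
  proof -
    have nj: "j \<notin> sel ` {..<s}" using sel by fastforce
    have "(r j)\<^sup>2 + (\<Sum>p<s. (r (sel p))\<^sup>2) = (\<Sum>i\<in>insert j (sel ` {..<s}). (r i)\<^sup>2)"
      using nj by (simp add: sum.reindex[OF inj])
    also have "\<dots> \<le> (\<Sum>i<n. (r i)\<^sup>2)"
      by (rule sum_mono2) (use j sel in fastforce)+
    also have "\<dots> \<le> 1/9" using approx[OF c] by (simp add: r_def)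
    finally show ?thesis .
  qed
  have 1: "\<bar>r j - (\<Sum>p<s. x p * r (sel p))\<bar> \<le> 59/125" by (rule weighted_cauchy[OF xx rr])
  \<comment> \<open>The small residual concerns the rows of \<open>grid\<close>. Passing to Z costs
    1/2 for row \<open>j\<close> and 1/2 for each selected row, coefficients being at most 1, and
    then everything is divided by \<open>Q\<close>.\<close>
  define w where "w l = Z $$ (j, l) - (\<Sum>p<s. x p * Z $$ (sel p, l))" for l
  have w: "\<bar>w l\<bar> \<le> (real n + 3) / Q" if l: "l < m" for l
  proof -
    have fN: "?f l / N = grid j l - (\<Sum>p<s. x p * grid (sel p) l)"
      using coh[OF l] N_pos by (simp add: x_def diff_divide_distrib sum_divide_distrib)
    have "Q * w l = ?f l / N - (grid j l - Q * Z $$ (j, l)) + (\<Sum>p<s. x p * (grid (sel p) l - Q * Z $$ (sel p, l)))"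
      unfolding fN w_def by (simp add: right_diff_distrib sum_subtractf sum_distrib_left mult.left_commute)
    moreover have "\<bar>\<Sum>p<s. x p * (grid (sel p) l - Q * Z $$ (sel p, l))\<bar> \<le> real s * (1 * (1/2))"
    proof (rule abs_sum_le_card)
      fix p assume "p < s"
      then show "\<bar>x p * (grid (sel p) l - Q * Z $$ (sel p, l))\<bar> \<le> 1 * (1/2)"
        unfolding abs_mult using fl[of "m + p"] sm grid_close by (intro mult_mono) (auto simp: x_def)
    qed
    ultimately have "\<bar>Q * w l\<bar> \<le> 1 + 1/2 + real s / 2"
      using fl[OF trans_less_add1[OF l]] grid_close[of j l] by linarith
    also have "\<dots> \<le> real n + 3" using sm by simp
    finally show ?thesis using Q_pos by (simp add: abs_mult field_simps)
  qed
  have 2: "\<bar>\<Sum>l<m. w l * \<alpha> l c\<bar> \<le> 1/50"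
  proof -
    have "\<bar>\<Sum>l<m. w l * \<alpha> l c\<bar> \<le> real m * ((real n + 3) / Q * a0)"
    proof (rule abs_sum_le_card)
      fix l assume "l < m"
      then show "\<bar>w l * \<alpha> l c\<bar> \<le> (real n + 3) / Q * a0"
        unfolding abs_mult using w \<alpha>_le c Q_pos by (intro mult_mono) auto
    qed
    also have "\<dots> = (50 * real m * (real n + 3) * a0) / Q / 50" by simp
    also have "\<dots> \<le> Q / Q / 50" using a0 Q_pos by (intro divide_right_mono) auto
    finally show ?thesis using Q_pos by simp
  qed
  have "?y j - (\<Sum>p<s. x p * ?y (sel p)) = (r j - (\<Sum>p<s. x p * r (sel p))) + (\<Sum>l<m. w l * \<alpha> l c)"
  proof -
    have "(\<Sum>l<m. w l * \<alpha> l c) = (\<Sum>l<m. Z $$ (j, l) * \<alpha> l c) - (\<Sum>p<s. x p * (\<Sum>l<m. Z $$ (sel p, l) * \<alpha> l c))"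
    proof -
      have "(\<Sum>l<m. (\<Sum>p<s. x p * Z $$ (sel p, l)) * \<alpha> l c) = (\<Sum>p<s. x p * (\<Sum>l<m. Z $$ (sel p, l) * \<alpha> l c))"
        unfolding sum_distrib_right sum_distrib_left by (subst sum.swap) (simp add: mult.assoc)
      then show ?thesis by (simp add: w_def left_diff_distrib sum_subtractf)
    qed
    then show ?thesis by (simp add: r_def right_diff_distrib sum_subtractf)
  qed
  then have close: "\<bar>?y j - (\<Sum>p<s. x p * ?y (sel p))\<bar> < 1/2" using 1 2 by linarith
  have "(\<Sum>p<s. ?f (m + p) * ?y (sel p)) * (1 / N) = (\<Sum>p<s. x p * ?y (sel p))"
    by (simp add: x_def sum_divide_distrib)
  moreover obtain q where q: "?y j = of_int q" using AC_int[OF j c] by (auto elim: Ints_cases)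
  moreover have "round (\<Sum>p<s. x p * ?y (sel p)) = q"
    using close q by (intro round_unique') (simp add: abs_minus_commute)
  ultimately show ?thesis by simp
qed

end

text \<open>The integer variables are \<open>n\<close>, \<open>d\<close>, \<open>k\<close>, the current row, the number \<open>s\<close> of selected rows and two loop
  counters.  Besides \<open>A\<close> (0, later extended to \<open>B\<close>), \<open>C\<close> (1), \<open>\<Delta>\<^sub>2\<close> (2), the result (3) and \<open>Z\<close> (4), the arrays are:
  5 scratch, with the packing base at index 1; 6 the parameters \<open>Q\<close>, \<open>N\<close>, \<open>w\<close> and the lower bound for \<open>Q\<close>;
  7 and 8 constant scaling factors \<open>1\<close> and \<open>1/N\<close>; 9 the packed rows of \<open>C\<close>; 10 the current \<open>\<zeta>\<close>; 11 the residual;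
  12 its rounded coefficients; 13 results of linear combinations; 14 the columns and 15 the coefficient rows of the
  basis, 16 the selected \<open>\<zeta>\<close> and 17 the known rows of \<open>A C\<close>, all packed; 18 scaling factors \<open>N / \<bar>b\<^sub>q\<bar>\<^sup>2\<close>;
  19 and 20 a constant vector \<open>Q\<close> and its packed form; 21 a squared norm; 22 the current power of the base.\<close>

abbreviation mE :: iexp where "mE \<equiv> IAdd (IVar 2) (IVar 2)"
abbreviation sE :: iexp where "sE \<equiv> IVar 4"
abbreviation zE :: iexp where "zE \<equiv> IConst 0"

text \<open>Rounding \<open>Q\<close> times a row of Z is cast as a linear combination with one
  summand: the packed constant vector is unpacked with the row of Z as scaling factors.\<close>

definition zeta_com :: com where
  "zeta_com = Call lc_proc [IConst 1, mE, zE, zE, IVar 3] [7, 20, 4, 10, 5]"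

definition clear_com :: com where
  "clear_com = For 5 sE (RStore 11 zE (IAdd mE (IVar 5)) (RConst 0))"

text \<open>The step from the last coordinates of the residual to the first ones, as in
  \<open>assemble\<close>.\<close>

definition head_com :: com where
  "head_com = Seq (Call lc_proc [sE, mE, zE, mE, zE] [11, 16, 7, 13, 5])
     (For 5 mE (RStore 11 zE (IVar 5)
        (RSub (RMul (cell 6 1) (RCell 10 zE (IVar 5))) (RCell 13 zE (IVar 5)))))"

text \<open>The new last coordinates of a pass. Packing the basis by columns yields the inner
  products with all basis vectors in one combination, hence \<open>tau\<close>; packing its
  coefficients by rows yields \<open>corr\<close> from these. This is why the basis is stored in
  both forms.\<close>

definition tail_com :: com where
  "tail_com = Seq (Call lc_proc [IAdd mE sE, sE, zE, zE, zE] [11, 14, 18, 12, 5])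
     (Seq (Call lc_proc [sE, sE, zE, zE, zE] [12, 15, 8, 13, 5])
     (For 5 sE (RStore 11 zE (IAdd mE (IVar 5))
        (RSub (RCell 11 zE (IAdd mE (IVar 5))) (RCell 13 zE (IVar 5))))))"

definition norm_com :: com where
  "norm_com = Seq (set_cell 21 0 (RConst 0)) (For 5 (IAdd mE sE)
     (set_cell 21 0 (RAdd (cell 21 0) (RMul (RCell 11 zE (IVar 5)) (RCell 11 zE (IVar 5))))))"

definition exact_com :: com where
  "exact_com = Call lc_proc [IVar 1, IVar 2, IVar 3, zE, zE] [0, 9, 7, 13, 5]"

definition predict_com :: com where
  "predict_com = Call lc_proc [sE, IVar 2, zE, mE, zE] [11, 17, 8, 13, 5]"

definition out_com :: com where
  "out_com = For 5 (IVar 2) (RStore 3 (IVar 3) (IVar 5) (RCell 13 zE (IVar 5)))"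

text \<open>In the packing by columns a new basis vector adds one digit to every cell, at the
  current power of the base. The denominator of the new scaling factor is the squared residual norm
  plus the square of the entry \<open>- N\<close> written into the vector.\<close>

definition append_com :: com where
  "append_com =
     Seq (Call pack_proc [IVar 2, zE, zE, sE] [13, 17, 5])
    (Seq (Call pack_proc [mE, zE, zE, sE] [10, 16, 5])
    (Seq (RStore 11 zE (IAdd mE sE) (RSub (RConst 0) (cell 6 1)))
    (Seq (Call pack_proc [IAdd sE (IConst 1), zE, mE, sE] [11, 15, 5])
    (Seq (For 5 (IAdd (IAdd mE sE) (IConst 1)) (RStore 14 zE (IVar 5)
       (RAdd (RCell 14 zE (IVar 5)) (RMul (RCell 11 zE (IVar 5)) (cell 22 0)))))
    (Seq (RStore 18 zE sE (RDiv (cell 6 1) (RAdd (cell 21 0) (RMul (cell 6 1) (cell 6 1)))))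
    (Seq (set_cell 22 0 (RMul (cell 22 0) (cell 5 1)))
    (IAssign 4 (IAdd sE (IConst 1)))))))))"

text \<open>With cleared last coordinates the first \<open>head_com\<close> produces
  \<open>start\<close>; each of the two pairs of \<open>tail_com\<close> and \<open>head_com\<close>
  is one \<open>pass\<close>.\<close>

definition row_com :: com where
  "row_com = Seq zeta_com (Seq clear_com (Seq head_com (Seq tail_com (Seq head_com (Seq tail_com (Seq head_com
    (Seq norm_com (Seq (If (RLe (cell 21 0) (RMul (cell 6 1) (cell 6 1))) predict_com (Seq exact_com append_com))
    out_com))))))))"

text \<open>\<open>same As s s'\<close>: only the arrays in \<open>As\<close>, the loop variable 5 and scratch cells have changed.\<close>

definition same :: "nat set \<Rightarrow> store \<Rightarrow> store \<Rightarrow> bool" where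
  "same As s s' \<longleftrightarrow> (\<forall>x. x \<noteq> 5 \<longrightarrow> ivar s' x = ivar s x) \<and>
    (\<forall>a. a \<notin> As \<longrightarrow> a \<noteq> 5 \<longrightarrow> rarr s' a = rarr s a) \<and> rarr s' 5 0 1 = rarr s 5 0 1 \<and> iarr s' = iarr s"

lemma same_trans: "same As s s' \<Longrightarrow> same Bs s' s'' \<Longrightarrow> same (As \<union> Bs) s s''"
  by (simp add: same_def)

lemma same_mono: "same As s s' \<Longrightarrow> As \<subseteq> Bs \<Longrightarrow> same Bs s s'"
  by (auto simp: same_def)

lemma sum_pack:
  fixes a :: "nat \<Rightarrow> real"
  shows "(\<Sum>i<r. a i * (\<Sum>l<L. v i l * X ^ l)) = (\<Sum>l<L. (\<Sum>i<r. a i * v i l) * X ^ l)"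
  unfolding sum_distrib_left sum_distrib_right by (subst sum.swap) (simp add: mult.assoc)

lemma of_int_round_Ints: "x \<in> \<int> \<Longrightarrow> of_int (round x) = (x :: real)"
  by (auto elim: Ints_cases)

lemma upd_row_apply: "j < n \<Longrightarrow> upd_row A y z n g y (z + int j) = g j"
  by (simp add: upd_row_def)

lemma upd_row_apply0: "j < n \<Longrightarrow> upd_row A y 0 n g y (int j) = g j"
  by (simp add: upd_row_def)

section \<open>Effect and cost of the commands for one row\<close>

context product_setting
begin

text \<open>The largest digits, the sums in \<open>corr_bound\<close>, have size Q^6 N^2 = Q^30. A
  base of Q^40 holds them with room for the factor 4 that signed digits require.\<close>

definition B :: nat where "B = 40 * b"

lemma pow_B: "(2::real) ^ B = Q ^ 40"
  by (simp add: B_def Q power_mult[symmetric] mult.commute)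

lemma B_ge: "2 \<le> B"
proof -
  have "b \<noteq> 0" using Q Q_ge by (intro notI) simp
  then show ?thesis by (simp add: B_def)
qed

lemma fits: "\<bar>x\<bar> \<le> Q ^ 39 \<Longrightarrow> \<bar>x\<bar> * 4 \<le> 2 ^ B"
proof -
  assume "\<bar>x\<bar> \<le> Q ^ 39"
  then have "\<bar>x\<bar> * 4 \<le> Q ^ 39 * Q" using Q_ge by (intro mult_mono) auto
  also have "\<dots> = Q ^ Suc 39" by (simp only: power_Suc2)
  finally show ?thesis by (simp add: pow_B)
qed

definition env :: "store \<Rightarrow> bool" where
  "env s \<longleftrightarrow> ivar s 0 = int n \<and> ivar s 1 = int d \<and> ivar s 2 = int k \<and>
     (\<forall>i<n. \<forall>l<d. rarr s 0 (int i) (int l) = A $$ (i, l)) \<and>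
     (\<forall>i<n. \<forall>l<m. rarr s 4 (int i) (int l) = Z $$ (i, l)) \<and>
     rarr s 5 0 1 = 2 ^ B \<and> rarr s 6 0 1 = N \<and>
     (\<forall>i<n+m. rarr s 7 0 (int i) = 1) \<and> (\<forall>i<n+m. rarr s 8 0 (int i) = 1 / N) \<and>
     (\<forall>l<d. rarr s 9 0 (int l) = (\<Sum>c<k. C $$ (l, c) * (2 ^ B) ^ c)) \<and>
     rarr s 20 0 0 = (\<Sum>l<m. Q * (2 ^ B) ^ l)"

text \<open>The zeros of array 14 from \<open>m + t\<close> on matter: appending a basis vector adds
  to the cell at \<open>m + t\<close>, where the earlier vectors have no digit.\<close>

definition dat :: "store \<Rightarrow> nat \<Rightarrow> (nat \<Rightarrow> nat) \<Rightarrow> (nat \<Rightarrow> nat \<Rightarrow> real) \<Rightarrow> bool" where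
  "dat s t sel b' \<longleftrightarrow> ivar s 4 = int t \<and> rarr s 22 0 0 = (2 ^ B) ^ t \<and>
     (\<forall>i<m+t. rarr s 14 0 (int i) = (\<Sum>q<t. b' q i * (2 ^ B) ^ q)) \<and>
     (\<forall>i\<ge>m+t. rarr s 14 0 (int i) = 0) \<and>
     (\<forall>q<t. rarr s 15 0 (int q) = (\<Sum>p<t. b' q (m + p) * (2 ^ B) ^ p)) \<and>
     (\<forall>p<t. rarr s 16 0 (int p) = (\<Sum>l<m. grid (sel p) l * (2 ^ B) ^ l)) \<and>
     (\<forall>p<t. rarr s 17 0 (int p) = (\<Sum>c<k. (A * C) $$ (sel p, c) * (2 ^ B) ^ c)) \<and>
     (\<forall>q<t. rarr s 18 0 (int q) = N / ip (b' q) (b' q))"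

lemma env_same: "env s \<Longrightarrow> same As s s' \<Longrightarrow> As \<inter> {0, 1, 2, 4, 6, 7, 8, 9, 20} = {} \<Longrightarrow> env s'"
proof -
  assume E: "env s" and S: "same As s s'" and As: "As \<inter> {0, 1, 2, 4, 6, 7, 8, 9, 20} = {}"
  have r: "rarr s' a = rarr s a" if "a \<in> {0, 1, 2, 4, 6, 7, 8, 9, 20}" for a
    using S As that by (auto simp: same_def)
  have "rarr s' 0 = rarr s 0" "rarr s' 4 = rarr s 4" "rarr s' 6 = rarr s 6" "rarr s' 7 = rarr s 7"
    "rarr s' 8 = rarr s 8" "rarr s' 9 = rarr s 9" "rarr s' 20 = rarr s 20" by (rule r; simp)+
  moreover have "rarr s' 5 0 1 = rarr s 5 0 1" "ivar s' 0 = ivar s 0" "ivar s' 1 = ivar s 1" "ivar s' 2 = ivar s 2"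
    using S by (simp_all add: same_def)
  ultimately have "env s' \<longleftrightarrow> env s" by (simp only: env_def)
  then show "env s'" using E by simp
qed

lemma dat_same: "dat s t sel b' \<Longrightarrow> same As s s' \<Longrightarrow> As \<inter> {14, 15, 16, 17, 18, 22} = {} \<Longrightarrow> dat s' t sel b'"
proof -
  assume F: "dat s t sel b'" and S: "same As s s'" and As: "As \<inter> {14, 15, 16, 17, 18, 22} = {}"
  have r: "rarr s' a = rarr s a" if "a \<in> {14, 15, 16, 17, 18, 22}" for a
    using S As that by (auto simp: same_def)
  have "rarr s' 14 = rarr s 14" "rarr s' 15 = rarr s 15" "rarr s' 16 = rarr s 16" "rarr s' 17 = rarr s 17"
    "rarr s' 18 = rarr s 18" "rarr s' 22 = rarr s 22" by (rule r; simp)+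
  moreover have "ivar s' 4 = ivar s 4" using S by (simp add: same_def)
  ultimately have "dat s' t sel b' \<longleftrightarrow> dat s t sel b'" by (simp only: dat_def)
  then show "dat s' t sel b'" using F by simp
qed

lemma mk: "int k + int k = int m"
  using m by simp

lemma env_ival:
  assumes "env s"
  shows "ival mE s = int m" "ival (IVar 0) s = int n" "ival (IVar 1) s = int d" "ival (IVar 2) s = int k"
  using assms by (simp_all add: env_def mk)

lemma N_ge1: "1 \<le> N" using N_ge Q_ge by simp

lemma env_scale:
  assumes "env s" "i < n + m"
  shows "rarr s 7 0 (int i) = 1" "rarr s 8 0 (int i) = 1 / N" "\<bar>1 / N\<bar> \<le> 1"
  using assms N_ge1 by (simp_all add: env_def)

lemma runs_zeta:
  assumes E: "env s" and j: "j < n" "ivar s 3 = int j"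
    and R: "\<And>s'. same {10} s s' \<Longrightarrow> (\<forall>l<m. rarr s' 10 0 (int l) = grid j l) \<Longrightarrow> R s'"
  shows "runs p zeta_com s (300 * (1 + m + 1) * (B + 1)) R"
  unfolding zeta_com_def
proof (rule runs_lc[where D = "\<lambda>_. Q" and rw = 0 and off = 0 and scr = "int j"])
  show "ival mE s = int m" using env_ival[OF E] by blast
  show "(\<Sum>i<1. rarr s 7 0 (0 + int i) * rarr s 20 0 (int i)) = (\<Sum>l<m. Q * (2 ^ B) ^ l)"
    using E j env_scale(1)[OF E, of 0] by (simp add: env_def)
  show "Q \<in> \<int>" by (subst Q) simp
  show "\<bar>Q\<bar> * 4 \<le> 2 ^ B" by (rule fits) (use Q_ge Q_pow_mono[of 1 39] in simp)
  show "\<bar>rarr s 4 (int j) (int l)\<bar> \<le> 1" if "l < m" for l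
    using E j that Z_le by (simp add: env_def)
  fix g :: "int \<Rightarrow> int \<Rightarrow> real" assume g: "g 0 1 = 2 ^ B"
  let ?s = "s\<lparr>rarr := (rarr s)(10 := upd_row (rarr s 10) 0 0 m
      (\<lambda>l. of_int (round (Q * rarr s 4 (int j) (int l)))), 5 := g)\<rparr>"
  show "R ?s"
  proof (rule R)
    show "same {10} s ?s" using E g by (simp add: same_def env_def)
    show "\<forall>l<m. rarr ?s 10 0 (int l) = grid j l"
      using E j by (simp add: upd_row_apply0 grid_def env_def)
  qed
qed (use E j B_ge in \<open>simp_all add: env_def\<close>)

lemma runs_clear:
  assumes E: "env s" and t: "ivar s 4 = int t"
    and R: "\<And>s'. same {11} s s' \<Longrightarrow> (\<forall>q<t. rarr s' 11 0 (int (m + q)) = 0) \<Longrightarrow> R s'"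
  shows "runs p clear_com s (20 * t + 9) R"
  unfolding clear_com_def
proof (rule runs_map[where y = 0 and z = "int m" and n = t and g = "\<lambda>_. 0"])
  let ?s = "s\<lparr>ivar := (ivar s)(5 := int t), rarr := (rarr s)(11 := upd_row (rarr s 11) 0 (int m) t (\<lambda>_. 0))\<rparr>"
  show "R ?s"
    by (rule R) (auto simp: same_def upd_row_apply)
qed (use env_ival[OF E] t in simp_all)

text \<open>The bound on \<open>x\<close> leaves room for the corrections of two passes, each at
  most \<open>Q ^ 6 * N + 1\<close>.\<close>

lemma runs_head:
  assumes E: "env s" and F: "dat s t sel b'" and S: "selection j t sel b'"
    and z: "\<forall>l<m. rarr s 10 0 (int l) = z l"
    and x: "\<forall>q<t. rarr s 11 0 (int (m + q)) = x q" "\<forall>q<t. x q \<in> \<int>" "\<forall>q<t. \<bar>x q\<bar> \<le> Q ^ 8 * N"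
    and R: "\<And>s'. same {11, 13} s s' \<Longrightarrow>
      (\<forall>i<m+t. rarr s' 11 0 (int i) = assemble t (\<lambda>q. grid (sel q)) z x i) \<Longrightarrow> R s'"
  shows "runs p head_com s (300 * (t + m + 1) * (B + 1) + (40 * m + 11)) R"
  unfolding head_com_def
proof (rule runs_Seq')
  let ?D = "\<lambda>l. \<Sum>q<t. x q * grid (sel q) l"
  have tn: "t \<le> n" using selection_le[OF S] by linarith
  have gr: "\<bar>grid (sel q) l\<bar> \<le> Q" if "q < t" "l < m" for q l
  proof -
    have "sel q < n" using S that selection_le(3)[OF S] by (auto simp: selection_def)
    then show ?thesis using grid_le that by blast
  qed
  have Dint: "?D l \<in> \<int>" for l by (intro Ints_sum Ints_mult grid_int) (use x in auto)
  have Dle: "\<bar>?D l\<bar> \<le> Q ^ 39" if l: "l < m" for l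
  proof -
    have "\<bar>?D l\<bar> \<le> real t * (Q ^ 8 * N * Q)"
    proof (rule abs_sum_le_card)
      fix q assume "q < t"
      then show "\<bar>x q * grid (sel q) l\<bar> \<le> Q ^ 8 * N * Q"
        unfolding abs_mult using x gr l Q_pos N_pos by (intro mult_mono) auto
    qed
    also have "\<dots> \<le> Q * (Q ^ 8 * N * Q)"
      using s_le[OF tn] Q_pos N_pos by (intro mult_right_mono) auto
    also have "\<dots> = Q ^ (1 + 8 + 12 + 1)" unfolding power_add N_def by simp
    also have "\<dots> \<le> Q ^ 39" by (rule Q_pow_mono) simp
    finally show ?thesis .
  qed
  show "runs p (Call lc_proc [sE, mE, zE, mE, zE] [11, 16, 7, 13, 5]) s (300 * (t + m + 1) * (B + 1))
     (\<lambda>s'. runs p (For 5 mE (RStore 11 zE (IVar 5)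
        (RSub (RMul (cell 6 1) (RCell 10 zE (IVar 5))) (RCell 13 zE (IVar 5))))) s' (40 * m + 11) R)"
  proof (rule runs_lc[where D = ?D and rw = 0 and off = "int m" and scr = 0])
    show "ival mE s = int m" "ival mE s = int m" using env_ival[OF E] by blast+
    show "(\<Sum>i<t. rarr s 11 0 (int m + int i) * rarr s 16 0 (int i)) = (\<Sum>l<m. ?D l * (2 ^ B) ^ l)"
      unfolding sum_pack[symmetric] by (rule sum.cong) (use F x(1) in \<open>simp_all add: dat_def\<close>)
    show "\<bar>?D l\<bar> * 4 \<le> 2 ^ B" if "l < m" for l by (rule fits[OF Dle[OF that]])
    fix g :: "int \<Rightarrow> int \<Rightarrow> real" assume g: "g 0 1 = 2 ^ B"
    let ?s1 = "s\<lparr>rarr := (rarr s)(13 := upd_row (rarr s 13) 0 0 m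
      (\<lambda>l. of_int (round (?D l * rarr s 7 0 (int l)))), 5 := g)\<rparr>"
    have s1: "rarr ?s1 13 0 (int l) = ?D l" if "l < m" for l
      using that env_scale(1)[OF E, of l] Dint by (simp add: upd_row_apply0 of_int_round_Ints)
    show "runs p (For 5 mE (RStore 11 zE (IVar 5)
        (RSub (RMul (cell 6 1) (RCell 10 zE (IVar 5))) (RCell 13 zE (IVar 5))))) ?s1 (40 * m + 11) R"
    proof (rule runs_map[where y = 0 and z = 0 and n = m and g = "\<lambda>l. N * z l - ?D l"])
      fix i :: nat and H :: "int \<Rightarrow> int \<Rightarrow> real" assume i: "i < m"
      show "rval (RSub (RMul (cell 6 1) (RCell 10 zE (IVar 5))) (RCell 13 zE (IVar 5)))
         (?s1\<lparr>ivar := (ivar ?s1)(5 := int i), rarr := (rarr ?s1)(11 := H)\<rparr>) = N * z i - ?D i"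
        using i s1[OF i] z E by (simp add: env_def)
    next
      let ?s2 = "?s1\<lparr>ivar := (ivar ?s1)(5 := int m), rarr := (rarr ?s1)(11 := upd_row (rarr ?s1 11) 0 0 m (\<lambda>l. N * z l - ?D l))\<rparr>"
      show "R ?s2"
      proof (rule R)
        show "same {11, 13} s ?s2" using E g by (simp add: same_def env_def)
        show "\<forall>i<m+t. rarr ?s2 11 0 (int i) = assemble t (\<lambda>q. grid (sel q)) z x i"
        proof (intro allI impI)
          fix i assume i: "i < m + t"
          show "rarr ?s2 11 0 (int i) = assemble t (\<lambda>q. grid (sel q)) z x i"
          proof (cases "i < m")
            case True
            then show ?thesis by (simp add: assemble_def upd_row_apply0)
          next
            case False
            then have "rarr s 11 0 (int (m + (i - m))) = x (i - m)" using x(1) i by (metis add_diff_inverse_nat less_diff_conv2 not_less add.commute)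
            then show ?thesis using False i by (simp add: assemble_def upd_row_def)
          qed
        qed
      qed
    qed (use env_ival[OF E] E in \<open>simp_all add: env_def mk\<close>)
  qed (use E F Dint B_ge env_scale[OF E] in \<open>simp_all add: env_def dat_def\<close>)
qed

lemma runs_tail:
  assumes E: "env s" and F: "dat s t sel b'" and S: "selection j t sel b'"
    and f: "\<forall>i<m+t. rarr s 11 0 (int i) = f i" "\<forall>i. f i \<in> \<int>" "\<forall>i\<ge>m+t. f i = 0"
      "\<forall>q<t. \<bar>ip f (b' q)\<bar> \<le> 3 * Q ^ 3 * N\<^sup>2"
    and R: "\<And>s'. same {11, 12, 13} s s' \<Longrightarrow>
      (\<forall>q<t. rarr s' 11 0 (int (m + q)) = f (m + q) - corr t b' f q) \<Longrightarrow> R s'"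
  shows "runs p tail_com s (300 * (m + t + t + 1) * (B + 1) + (300 * (t + t + 1) * (B + 1) + (40 * t + 9))) R"
  unfolding tail_com_def
proof (rule runs_Seq')
  note I = selection_near_orth[OF S]
  have tn: "t \<le> n" using selection_le[OF S] by linarith
  have bint: "b' q i \<in> \<int>" if "q < t" for q i using S that by (simp add: selection_def)
  have ipf: "(\<Sum>i<m+t. f i * b' q i) = ip f (b' q)" for q
    unfolding dot_def[symmetric] by (rule dot_mono_neutral[symmetric]) (use tn f(3) in auto)
  have D1int: "ip f (b' q) \<in> \<int>" if "q < t" for q
    unfolding dot_def by (intro Ints_sum Ints_mult) (use f(2) bint that in auto)
  have D1le: "\<bar>ip f (b' q)\<bar> \<le> Q ^ 39" if "q < t" for q
  proof -
    have "\<bar>ip f (b' q)\<bar> \<le> 3 * Q ^ 3 * N\<^sup>2" using f(4) that by blast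
    also have "\<dots> \<le> Q * Q ^ 3 * N\<^sup>2" using Q_ge by (intro mult_right_mono) auto
    also have "\<dots> = Q ^ (1 + 3 + 12 * 2)" unfolding power_add power_mult N_def by simp
    also have "\<dots> \<le> Q ^ 39" by (rule Q_pow_mono) simp
    finally show ?thesis .
  qed
  let ?D = "\<lambda>p. \<Sum>q<t. tau b' f q * b' q (m + p)"
  have D2int: "?D p \<in> \<int>" for p
    by (intro Ints_sum Ints_mult) (use bint in \<open>auto simp: tau_def\<close>)
  have D2le: "\<bar>?D p\<bar> \<le> Q ^ 39" for p
  proof -
    have "\<bar>?D p\<bar> \<le> Q ^ 6 * N\<^sup>2" using corr_bound(2)[OF I] f(4) by blast
    also have "\<dots> = Q ^ (6 + 12 * 2)" unfolding power_add power_mult N_def by simp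
    also have "\<dots> \<le> Q ^ 39" by (rule Q_pow_mono) simp
    finally show ?thesis .
  qed
  let ?c3 = "For 5 sE (RStore 11 zE (IAdd mE (IVar 5))
        (RSub (RCell 11 zE (IAdd mE (IVar 5))) (RCell 13 zE (IVar 5))))"
  let ?c2 = "Seq (Call lc_proc [sE, sE, zE, zE, zE] [12, 15, 8, 13, 5]) ?c3"
  show "runs p (Call lc_proc [IAdd mE sE, sE, zE, zE, zE] [11, 14, 18, 12, 5]) s (300 * (m + t + t + 1) * (B + 1))
     (\<lambda>s'. runs p ?c2 s' (300 * (t + t + 1) * (B + 1) + (40 * t + 9)) R)"
  proof (rule runs_lc[where D = "\<lambda>q. ip f (b' q)" and rw = 0 and off = 0 and scr = 0])
    show "(\<Sum>i<m+t. rarr s 11 0 (0 + int i) * rarr s 14 0 (int i)) = (\<Sum>q<t. ip f (b' q) * (2 ^ B) ^ q)"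
      unfolding ipf[symmetric] sum_pack[symmetric] by (rule sum.cong) (use F f(1) in \<open>simp_all add: dat_def\<close>)
    show "\<bar>ip f (b' q)\<bar> * 4 \<le> 2 ^ B" if "q < t" for q by (rule fits[OF D1le[OF that]])
    show "\<bar>rarr s 18 0 (int q)\<bar> \<le> 1" if "q < t" for q
    proof -
      have "N \<le> N\<^sup>2" using N_ge1 by (simp add: power2_eq_square)
      also have "\<dots> \<le> ip (b' q) (b' q)" using near_orth_b_norm(1)[OF I that] .
      finally have "N / ip (b' q) (b' q) \<le> 1" using N_pos by (simp add: divide_le_eq)
      moreover have "0 \<le> N / ip (b' q) (b' q)" using N_pos dot_self_nonneg by simp
      ultimately show ?thesis using F that by (simp add: dat_def)
    qed
    fix g :: "int \<Rightarrow> int \<Rightarrow> real" assume g: "g 0 1 = 2 ^ B"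
    let ?s1 = "s\<lparr>rarr := (rarr s)(12 := upd_row (rarr s 12) 0 0 t
      (\<lambda>q. of_int (round (ip f (b' q) * rarr s 18 0 (int q)))), 5 := g)\<rparr>"
    have s1: "rarr ?s1 12 0 (int q) = tau b' f q" if "q < t" for q
      using that F by (simp add: upd_row_apply0 tau_def dat_def)
    have sm1: "same {12} s ?s1" using E g by (simp add: same_def env_def)
    have E1: "env ?s1" by (rule env_same[OF E sm1]) simp
    have F1: "dat ?s1 t sel b'" by (rule dat_same[OF F sm1]) simp
    have f1: "rarr ?s1 11 = rarr s 11" by simp
    obtain s1 where s1_def: "s1 = ?s1" by simp
    note s1 = s1[folded s1_def] and sm1 = sm1[folded s1_def] and E1 = E1[folded s1_def] and F1 = F1[folded s1_def]
      and f1 = f1[folded s1_def]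
    have "runs p ?c2 s1 (300 * (t + t + 1) * (B + 1) + (40 * t + 9)) R"
    proof (rule runs_Seq', rule runs_lc[where D = ?D and rw = 0 and off = 0 and scr = 0])
      show "(\<Sum>i<t. rarr s1 12 0 (0 + int i) * rarr s1 15 0 (int i)) = (\<Sum>p<t. ?D p * (2 ^ B) ^ p)"
        unfolding sum_pack[symmetric] by (rule sum.cong) (use F1 s1 in \<open>simp_all add: dat_def\<close>)
      show "\<bar>?D l\<bar> * 4 \<le> 2 ^ B" for l by (rule fits[OF D2le])
      show "\<bar>rarr s1 8 0 (int l)\<bar> \<le> 1" if "l < t" for l
        using env_scale[OF E1, of l] that tn by simp
      fix g :: "int \<Rightarrow> int \<Rightarrow> real" assume g: "g 0 1 = 2 ^ B"
      let ?s2 = "s1\<lparr>rarr := (rarr s1)(13 := upd_row (rarr s1 13) 0 0 t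
        (\<lambda>l. of_int (round (?D l * rarr s1 8 0 (int l)))), 5 := g)\<rparr>"
      have s2: "rarr ?s2 13 0 (int l) = corr t b' f l" if "l < t" for l
        using that env_scale(2)[OF E1, of l] tn by (simp add: upd_row_apply0 corr_def)
      show "runs p ?c3 ?s2 (40 * t + 9) R"
      proof (rule runs_map[where y = 0 and z = "int m" and n = t and g = "\<lambda>q. f (m + q) - corr t b' f q"])
        fix i :: nat and H :: "int \<Rightarrow> int \<Rightarrow> real" assume i: "i < t"
          and H: "\<And>j. i \<le> j \<Longrightarrow> H 0 (int m + int j) = rarr ?s2 11 0 (int m + int j)"
        have "H 0 (int m + int i) = f (m + i)" using H[of i] f(1) i f1 by (simp flip: of_nat_add)
        then show "rval (RSub (RCell 11 zE (IAdd mE (IVar 5))) (RCell 13 zE (IVar 5)))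
         (?s2\<lparr>ivar := (ivar ?s2)(5 := int i), rarr := (rarr ?s2)(11 := H)\<rparr>) = f (m + i) - corr t b' f i"
          using i s2[OF i] env_ival[OF E1] by simp
      next
        let ?s3 = "?s2\<lparr>ivar := (ivar ?s2)(5 := int t), rarr := (rarr ?s2)(11 := upd_row (rarr ?s2 11) 0 (int m) t (\<lambda>q. f (m + q) - corr t b' f q))\<rparr>"
        show "R ?s3"
        proof (rule R)
          have "same {11, 13} s1 ?s3" using E1 g by (simp add: same_def env_def)
          from same_trans[OF sm1 this] show "same {11, 12, 13} s ?s3" by (rule same_mono) auto
          show "\<forall>q<t. rarr ?s3 11 0 (int (m + q)) = f (m + q) - corr t b' f q"
            by (simp add: upd_row_apply)
        qed
      qed (use env_ival[OF E1] E1 F1 in \<open>simp_all add: dat_def\<close>)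
    qed (use E1 F1 D2int B_ge in \<open>simp_all add: env_def dat_def\<close>)
    then show "runs p ?c2 ?s1 (300 * (t + t + 1) * (B + 1) + (40 * t + 9)) R" by (simp only: s1_def)
  qed (use E F D1int B_ge env_ival[OF E] in \<open>simp_all add: env_def dat_def\<close>)
qed

end

text \<open>Stated outside \<open>product_setting\<close>, since the branch for k > n, in which
  there is no Z, uses it too.\<close>

lemma runs_exact:
  assumes iv: "ivar s 1 = int d" "ivar s 2 = int k" "ivar s 3 = int j" and j: "j < n"
    and A: "A \<in> carrier_mat n d" and C: "C \<in> carrier_mat d k"
    and X: "rarr s 5 0 1 = 2 ^ B" "2 \<le> B"
    and rA: "\<forall>l<d. rarr s 0 (int j) (int l) = A $$ (j, l)"
    and r9: "\<forall>l<d. rarr s 9 0 (int l) = (\<Sum>c<k. C $$ (l, c) * (2 ^ B) ^ c)"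
    and r7: "\<forall>c<k. rarr s 7 0 (int c) = 1"
    and y: "\<And>c. c < k \<Longrightarrow> (A * C) $$ (j, c) \<in> \<int>" "\<And>c. c < k \<Longrightarrow> \<bar>(A * C) $$ (j, c)\<bar> * 4 \<le> 2 ^ B"
    and R: "\<And>s'. same {13} s s' \<Longrightarrow> (\<forall>c<k. rarr s' 13 0 (int c) = (A * C) $$ (j, c)) \<Longrightarrow> R s'"
  shows "runs p exact_com s (300 * (d + k + 1) * (B + 1)) R"
  unfolding exact_com_def
proof (rule runs_lc[where D = "\<lambda>c. (A * C) $$ (j, c)" and rw = "int j" and off = 0 and scr = 0])
  have "(\<Sum>i<d. rarr s 0 (int j) (0 + int i) * rarr s 9 0 (int i)) = (\<Sum>c<k. (\<Sum>l<d. A $$ (j, l) * C $$ (l, c)) * (2 ^ B) ^ c)"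
    unfolding sum_pack[symmetric] by (rule sum.cong) (use rA r9 in simp_all)
  also have "\<dots> = (\<Sum>c<k. (A * C) $$ (j, c) * (2 ^ B) ^ c)"
    by (rule sum.cong) (simp_all add: index_mult_mat_sum[OF A C j] del: index_mult_mat)
  finally show "(\<Sum>i<d. rarr s 0 (int j) (0 + int i) * rarr s 9 0 (int i)) = (\<Sum>c<k. (A * C) $$ (j, c) * (2 ^ B) ^ c)" .
  fix g :: "int \<Rightarrow> int \<Rightarrow> real" assume g: "g 0 1 = 2 ^ B"
  let ?s = "s\<lparr>rarr := (rarr s)(13 := upd_row (rarr s 13) 0 0 k
      (\<lambda>c. of_int (round ((A * C) $$ (j, c) * rarr s 7 0 (int c)))), 5 := g)\<rparr>"
  show "R ?s"
  proof (rule R)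
    show "same {13} s ?s" using g X by (simp add: same_def)
    show "\<forall>c<k. rarr ?s 13 0 (int c) = (A * C) $$ (j, c)"
      using r7 y(1) by (simp add: upd_row_apply0 of_int_round_Ints del: index_mult_mat)
  qed
qed (use iv X r7 y in \<open>simp_all del: index_mult_mat\<close>)

lemma runs_out:
  assumes iv: "ivar s 2 = int k" "ivar s 3 = int j"
    and R: "\<And>s'. same {3} s s' \<Longrightarrow> rarr s' 3 = upd_row (rarr s 3) (int j) 0 k (\<lambda>c. rarr s 13 0 (int c)) \<Longrightarrow> R s'"
  shows "runs p out_com s (20 * k + 9) R"
  unfolding out_com_def
proof (rule runs_map[where y = "int j" and z = 0 and n = k and g = "\<lambda>c. rarr s 13 0 (int c)"])
  show "R (s\<lparr>ivar := (ivar s)(5 := int k), rarr := (rarr s)(3 := upd_row (rarr s 3) (int j) 0 k (\<lambda>c. rarr s 13 0 (int c)))\<rparr>)"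
    by (rule R) (simp_all add: same_def)
qed (use iv in simp_all)

lemma runs_pack':
  assumes dist: "distinct [v, dst, 5]"
    and iv: "ival eL s = int L" "ival erow s = rw" "ival eoff s = off" "ival edst s = di"
    and X: "rarr s 5 0 1 = X"
    and K: "icost eL + icost erow + icost eoff + icost edst \<le> 40"
    and R: "\<And>s'. same {dst} s s' \<Longrightarrow> rarr s' dst = upd2 (rarr s dst) 0 di
        (\<Sum>i<L. rarr s v rw (off + int i) * X ^ i) \<Longrightarrow> R s'"
  shows "runs p (Call pack_proc [eL, erow, eoff, edst] [v, dst, 5]) s (100 * (L + 1)) R"
proof (rule runs_pack[OF dist iv X K])
  fix g :: "int \<Rightarrow> int \<Rightarrow> real" assume g: "g 0 1 = X"
  show "R (s\<lparr>rarr := (rarr s)(dst := upd2 (rarr s dst) 0 di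
        (\<Sum>i<L. rarr s v rw (off + int i) * X ^ i), 5 := g)\<rparr>)"
    by (rule R) (use dist g X in \<open>auto simp: same_def\<close>)
qed

lemma runs_store':
  assumes "ival e s = y" "ival f s = z" "rval u s = c" "1 + icost e + icost f + rcost u \<le> K" "a \<noteq> 5"
    and R: "\<And>s'. same {a} s s' \<Longrightarrow> rarr s' a = upd2 (rarr s a) y z c \<Longrightarrow> R s'"
  shows "runs p (RStore a e f u) s K R"
  by (rule runs_RStore[OF R]) (use assms in \<open>simp_all add: same_def\<close>)

lemma same_rarr: "same As s s' \<Longrightarrow> a \<notin> As \<Longrightarrow> a \<noteq> 5 \<Longrightarrow> rarr s' a = rarr s a"
  by (simp add: same_def)

lemma same_ivar: "same As s s' \<Longrightarrow> x \<noteq> 5 \<Longrightarrow> ivar s' x = ivar s x"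
  by (simp add: same_def)

context product_setting
begin

lemma runs_norm:
  assumes E: "env s" and t: "ivar s 4 = int t" "t \<le> n"
    and f: "\<forall>i<m+t. rarr s 11 0 (int i) = f i" "\<forall>i\<ge>m+t. f i = 0"
    and R: "\<And>s'. same {21} s s' \<Longrightarrow> rarr s' 21 0 0 = ip f f \<Longrightarrow> R s'"
  shows "runs p norm_com s (4 + (29 * (m + t) + 13)) R"
  unfolding norm_com_def
proof (rule runs_Seq', rule runs_store'[where y = 0 and z = 0 and c = 0])
  fix s1 assume s1: "same {21} s s1" "rarr s1 21 = upd2 (rarr s 21) 0 0 0"
  have E1: "env s1" by (rule env_same[OF E s1(1)]) simp
  have iv: "ivar s1 4 = int t" using t same_ivar[OF s1(1)] by simp
  have r11: "rarr s1 11 = rarr s 11" by (rule same_rarr[OF s1(1)]) auto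
  let ?S = "\<Sum>i<m+t. f i * f i"
  have ip: "?S = ip f f"
    unfolding dot_def[symmetric] by (rule dot_mono_neutral[symmetric]) (use t(2) f(2) in auto)
  show "runs p (For 5 (IAdd mE sE)
     (set_cell 21 0 (RAdd (cell 21 0) (RMul (RCell 11 zE (IVar 5)) (RCell 11 zE (IVar 5)))))) s1 (29 * (m + t) + 13) R"
  proof (rule runs_accum[where n = "m + t" and g = "\<lambda>i. f i * f i"])
    fix i w assume "i < m + t"
    then show "rval (RMul (RCell 11 zE (IVar 5)) (RCell 11 zE (IVar 5)))
       (s1\<lparr>ivar := (ivar s1)(5 := int i), rarr := (rarr s1)(21 := upd2 (rarr s1 21) 0 0 w)\<rparr>) = f i * f i"
      using f(1) r11 by simp
  next
    let ?s = "s1\<lparr>ivar := (ivar s1)(5 := int (m + t)), rarr := (rarr s1)(21 := upd2 (rarr s1 21) 0 0 (rarr s1 21 0 0 + ?S))\<rparr>"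
    have "same {21} s1 ?s" by (simp add: same_def)
    from same_trans[OF s1(1) this] have "same {21} s ?s" by simp
    then show "R ?s" by (rule R) (simp add: upd2_apply s1(2) ip)
  qed (use env_ival[OF E1] iv in simp_all)
qed simp_all

lemma runs_predict:
  assumes E: "env s" and F: "dat s t sel b'" and S: "selection j t sel b'" and j: "j < n"
    and f: "\<forall>i<m+t. rarr s 11 0 (int i) = residual j t sel b' i"
    and small: "ip (residual j t sel b') (residual j t sel b') \<le> N\<^sup>2"
    and R: "\<And>s'. same {13} s s' \<Longrightarrow> (\<forall>c<k. rarr s' 13 0 (int c) = (A * C) $$ (j, c)) \<Longrightarrow> R s'"
  shows "runs p predict_com s (300 * (t + k + 1) * (B + 1)) R"
  unfolding predict_com_def
proof -
  let ?f = "residual j t sel b'"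
  let ?D = "\<lambda>c. \<Sum>q<t. ?f (m + q) * (A * C) $$ (sel q, c)"
  have tn: "t \<le> n" using selection_le[OF S] by linarith
  have sel: "sel q < n" if "q < t" for q
    using S that selection_le(3)[OF S] by (auto simp: selection_def)
  have fint: "?f i \<in> \<int>" for i by (rule pass2_int) (auto simp: grid_int)
  have Dint: "?D c \<in> \<int>" if "c < k" for c
    by (intro Ints_sum Ints_mult fint AC_int) (use sel that in auto)
  have fle: "\<bar>?f i\<bar> \<le> N" if "i < m + n" for i
  proof -
    have "(?f i)\<^sup>2 \<le> N\<^sup>2" using coord_le_dot[OF that, of ?f] small by linarith
    then have "\<bar>?f i\<bar> \<le> \<bar>N\<bar>" by (simp only: abs_le_square_iff)
    then show ?thesis using N_pos by simp
  qed
  have Dle: "\<bar>?D c\<bar> \<le> Q ^ 39" if "c < k" for c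
  proof -
    have "\<bar>?D c\<bar> \<le> real t * (N * Q)"
    proof (rule abs_sum_le_card)
      fix q assume "q < t"
      then show "\<bar>?f (m + q) * (A * C) $$ (sel q, c)\<bar> \<le> N * Q"
        unfolding abs_mult using fle[of "m + q"] AC_le[OF sel that] tn N_pos by (intro mult_mono) auto
    qed
    also have "\<dots> \<le> Q * (N * Q)"
      using s_le[OF tn] Q_pos N_pos by (intro mult_right_mono) auto
    also have "\<dots> = Q ^ (1 + 12 + 1)" unfolding power_add N_def by simp
    also have "\<dots> \<le> Q ^ 39" by (rule Q_pow_mono) simp
    finally show ?thesis .
  qed
  show "runs p (Call lc_proc [sE, IVar 2, zE, mE, zE] [11, 17, 8, 13, 5]) s (300 * (t + k + 1) * (B + 1)) R"
  proof (rule runs_lc[where D = ?D and rw = 0 and off = "int m" and scr = 0])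
    show "ival mE s = int m" using env_ival[OF E] by blast
    show "(\<Sum>i<t. rarr s 11 0 (int m + int i) * rarr s 17 0 (int i)) = (\<Sum>c<k. ?D c * (2 ^ B) ^ c)"
      unfolding sum_pack[symmetric]
      by (rule sum.cong) (use F f[rule_format, of "m + _"] in \<open>simp_all add: dat_def del: index_mult_mat\<close>)
    show "\<bar>?D c\<bar> * 4 \<le> 2 ^ B" if "c < k" for c by (rule fits[OF Dle[OF that]])
    show "\<bar>rarr s 8 0 (int c)\<bar> \<le> 1" if "c < k" for c
      using env_scale[OF E, of c] that m by simp
    fix g :: "int \<Rightarrow> int \<Rightarrow> real" assume g: "g 0 1 = 2 ^ B"
    let ?s = "s\<lparr>rarr := (rarr s)(13 := upd_row (rarr s 13) 0 0 k
        (\<lambda>c. of_int (round (?D c * rarr s 8 0 (int c)))), 5 := g)\<rparr>"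
    show "R ?s"
    proof (rule R)
      show "same {13} s ?s" using E g by (simp add: same_def env_def)
      show "\<forall>c<k. rarr ?s 13 0 (int c) = (A * C) $$ (j, c)"
      proof (intro allI impI)
        fix c assume c: "c < k"
        have "rarr ?s 13 0 (int c) = of_int (round (?D c * rarr s 8 0 (int c)))"
          using c by (simp add: upd_row_apply0 del: index_mult_mat)
        also have "rarr s 8 0 (int c) = 1 / N" using env_scale(2)[OF E, of c] c m by simp
        also have "of_int (round (?D c * (1 / N))) = (A * C) $$ (j, c)" by (rule prediction[OF S j c small])
        finally show "rarr ?s 13 0 (int c) = (A * C) $$ (j, c)" .
      qed
    qed
  qed (use E F Dint B_ge in \<open>simp_all add: env_def dat_def del: index_mult_mat\<close>)
qed

lemma runs_append:
  assumes E: "env s" and F: "dat s t sel b'" and S: "selection j t sel b'" and j: "j < n"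
    and y: "\<forall>c<k. rarr s 13 0 (int c) = (A * C) $$ (j, c)"
    and z: "\<forall>l<m. rarr s 10 0 (int l) = grid j l"
    and f: "\<forall>i<m+t. rarr s 11 0 (int i) = f i" "f = residual j t sel b'"
    and F21: "rarr s 21 0 0 = ip f f"
    and R: "\<And>s'. (\<forall>x. x \<notin> {4, 5} \<longrightarrow> ivar s' x = ivar s x) \<Longrightarrow>
      (\<forall>a. a \<notin> {5, 11, 14, 15, 16, 17, 18, 22} \<longrightarrow> rarr s' a = rarr s a) \<Longrightarrow> env s' \<Longrightarrow>
      dat s' (Suc t) (sel(t := j)) (b'(t := f(m + t := - N))) \<Longrightarrow> R s'"
  shows "runs p append_com s (100 * (k + 1) + (100 * (m + 1) + (20 + (100 * (t + 1 + 1) + (40 * (m + t + 1) + 20 + (20 + (10 + 4))))))) R"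
proof -
  define h where "h = f(m + t := - N)"
  let ?X = "(2::real) ^ B"
  have I: "near_orth t (\<lambda>p. grid (sel p)) b'" by (rule selection_near_orth[OF S])
  have tn: "t < n" using selection_le[OF S] j by linarith
  \<comment> \<open>The norm of the new basis vector is read off from the norm already computed for
    the comparison.\<close>
  have nh: "ip h h = ip f f + N\<^sup>2"
    using near_orth_extend(2)[OF I grid_le[OF j] tn] by (simp add: h_def f(2))
  have b0: "b' q (m + t) = 0" if "q < t" for q using I that by (simp add: near_orth_def)
  note iv = env_ival[OF E]
  let ?c8 = "IAssign 4 (IAdd sE (IConst 1))"
  let ?c7 = "Seq (set_cell 22 0 (RMul (cell 22 0) (cell 5 1))) ?c8"
  let ?c6 = "Seq (RStore 18 zE sE (RDiv (cell 6 1) (RAdd (cell 21 0) (RMul (cell 6 1) (cell 6 1))))) ?c7"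
  let ?c5 = "Seq (For 5 (IAdd (IAdd mE sE) (IConst 1)) (RStore 14 zE (IVar 5)
       (RAdd (RCell 14 zE (IVar 5)) (RMul (RCell 11 zE (IVar 5)) (cell 22 0))))) ?c6"
  let ?c4 = "Seq (Call pack_proc [IAdd sE (IConst 1), zE, mE, sE] [11, 15, 5]) ?c5"
  let ?c3 = "Seq (RStore 11 zE (IAdd mE sE) (RSub (RConst 0) (cell 6 1))) ?c4"
  let ?c2 = "Seq (Call pack_proc [mE, zE, zE, sE] [10, 16, 5]) ?c3"
  have t4: "ivar s 4 = int t" using F by (simp add: dat_def)
  show ?thesis
    unfolding append_com_def
  proof (rule runs_Seq', rule runs_pack'[where X = ?X and L = k and rw = 0 and off = 0 and di = "int t"])
    fix s1 assume s1: "same {17} s s1"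
      "rarr s1 17 = upd2 (rarr s 17) 0 (int t) (\<Sum>i<k. rarr s 13 0 (0 + int i) * ?X ^ i)"
    have E1: "env s1" by (rule env_same[OF E s1(1)]) simp
    have t1: "ivar s1 4 = int t" using t4 same_ivar[OF s1(1)] by simp
    show "runs p ?c2 s1 (100 * (m + 1) + (20 + (100 * (t + 1 + 1) + (40 * (m + t + 1) + 20 + (20 + (10 + 4)))))) R"
    proof (rule runs_Seq', rule runs_pack'[where X = ?X and L = m and rw = 0 and off = 0 and di = "int t"])
      fix s2 assume s2: "same {16} s1 s2"
        "rarr s2 16 = upd2 (rarr s1 16) 0 (int t) (\<Sum>i<m. rarr s1 10 0 (0 + int i) * ?X ^ i)"
      have E2: "env s2" by (rule env_same[OF E1 s2(1)]) simp
      have t2: "ivar s2 4 = int t" using t1 same_ivar[OF s2(1)] by simp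
      show "runs p ?c3 s2 (20 + (100 * (t + 1 + 1) + (40 * (m + t + 1) + 20 + (20 + (10 + 4))))) R"
      proof (rule runs_Seq', rule runs_store'[where y = 0 and z = "int (m + t)" and c = "- N"])
        fix s3 assume s3: "same {11} s2 s3" "rarr s3 11 = upd2 (rarr s2 11) 0 (int (m + t)) (- N)"
        have E3: "env s3" by (rule env_same[OF E2 s3(1)]) simp
        have t3: "ivar s3 4 = int t" using t2 same_ivar[OF s3(1)] by simp
        have r11: "rarr s3 11 0 (int i) = h i" if "i < m + t + 1" for i
          using that f(1) s3(2) same_rarr[OF s2(1), of 11] same_rarr[OF s1(1), of 11]
          by (cases "i = m + t") (auto simp: upd2_apply h_def)
        show "runs p ?c4 s3 (100 * (t + 1 + 1) + (40 * (m + t + 1) + 20 + (20 + (10 + 4)))) R"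
        proof (rule runs_Seq', rule runs_pack'[where X = ?X and L = "t + 1" and rw = 0 and off = "int m" and di = "int t"])
          fix s4 assume s4: "same {15} s3 s4"
            "rarr s4 15 = upd2 (rarr s3 15) 0 (int t) (\<Sum>i<t+1. rarr s3 11 0 (int m + int i) * ?X ^ i)"
          have E4: "env s4" by (rule env_same[OF E3 s4(1)]) simp
          have t4': "ivar s4 4 = int t" using t3 same_ivar[OF s4(1)] by simp
          have r14: "rarr s4 14 = rarr s 14" "rarr s4 22 = rarr s 22" "rarr s4 18 = rarr s 18" "rarr s4 21 = rarr s 21"
            using same_rarr[OF s1(1)] same_rarr[OF s2(1)] same_rarr[OF s3(1)] same_rarr[OF s4(1)] by simp_all
          have r11': "rarr s4 11 = rarr s3 11" by (rule same_rarr[OF s4(1)]) auto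
          let ?G = "\<lambda>i. rarr s 14 0 (int i) + h i * ?X ^ t"
          show "runs p ?c5 s4 (40 * (m + t + 1) + 20 + (20 + (10 + 4))) R"
          proof (rule runs_Seq', rule runs_map[where y = 0 and z = 0 and n = "m + t + 1" and g = ?G])
            fix i :: nat and H :: "int \<Rightarrow> int \<Rightarrow> real" assume i: "i < m + t + 1"
              and H: "\<And>j. i \<le> j \<Longrightarrow> H 0 (0 + int j) = rarr s4 14 0 (0 + int j)"
            show "rval (RAdd (RCell 14 zE (IVar 5)) (RMul (RCell 11 zE (IVar 5)) (cell 22 0)))
               (s4\<lparr>ivar := (ivar s4)(5 := int i), rarr := (rarr s4)(14 := H)\<rparr>) = ?G i"
              using r11[OF i] r11' r14 H[of i] F by (simp add: dat_def)
          next
            define s5 where "s5 = s4\<lparr>ivar := (ivar s4)(5 := int (m + t + 1)),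
              rarr := (rarr s4)(14 := upd_row (rarr s4 14) 0 0 (m + t + 1) ?G)\<rparr>"
            have s5: "same {14} s4 s5" "rarr s5 14 = upd_row (rarr s 14) 0 0 (m + t + 1) ?G"
              by (simp_all add: s5_def same_def r14)
            have E5: "env s5" by (rule env_same[OF E4 s5(1)]) simp
            have t5: "ivar s5 4 = int t" using t4' same_ivar[OF s5(1)] by simp
            have "runs p ?c6 s5 (20 + (10 + 4)) R"
            proof (rule runs_Seq', rule runs_store'[where y = 0 and z = "int t" and c = "N / ip h h"])
              show "rval (RDiv (cell 6 1) (RAdd (cell 21 0) (RMul (cell 6 1) (cell 6 1)))) s5 = N / ip h h"
                using E5 F21 r14 same_rarr[OF s5(1), of 21] by (simp add: env_def nh power2_eq_square)
              fix s6 assume s6: "same {18} s5 s6" "rarr s6 18 = upd2 (rarr s5 18) 0 (int t) (N / ip h h)"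
              have E6: "env s6" by (rule env_same[OF E5 s6(1)]) simp
              have t6: "ivar s6 4 = int t" using t5 same_ivar[OF s6(1)] by simp
              have r22: "rarr s6 22 = rarr s 22"
                using same_rarr[OF s6(1), of 22] same_rarr[OF s5(1), of 22] r14 by simp
              show "runs p ?c7 s6 (10 + 4) R"
              proof (rule runs_Seq', rule runs_store'[where y = 0 and z = 0 and c = "?X ^ Suc t"])
                show "rval (RMul (cell 22 0) (cell 5 1)) s6 = ?X ^ Suc t"
                  using E6 F r22 by (simp add: env_def dat_def)
                fix s7 assume s7: "same {22} s6 s7" "rarr s7 22 = upd2 (rarr s6 22) 0 0 (?X ^ Suc t)"
                have E7: "env s7" by (rule env_same[OF E6 s7(1)]) simp
                have t7: "ivar s7 4 = int t" using t6 same_ivar[OF s7(1)] by simp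
                note fr = same_rarr[OF s7(1)] same_rarr[OF s6(1)] same_rarr[OF s5(1)] same_rarr[OF s4(1)]
                  same_rarr[OF s3(1)] same_rarr[OF s2(1)] same_rarr[OF s1(1)]
                note fi = same_ivar[OF s7(1)] same_ivar[OF s6(1)] same_ivar[OF s5(1)] same_ivar[OF s4(1)]
                  same_ivar[OF s3(1)] same_ivar[OF s2(1)] same_ivar[OF s1(1)]
                let ?s8 = "s7\<lparr>ivar := (ivar s7)(4 := int (Suc t))\<rparr>"
                have R8: "R ?s8"
                proof (rule R)
                  show "\<forall>x. x \<notin> {4, 5} \<longrightarrow> ivar ?s8 x = ivar s x" using fi by simp
                  show "\<forall>a. a \<notin> {5, 11, 14, 15, 16, 17, 18, 22} \<longrightarrow> rarr ?s8 a = rarr s a" using fr by simp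
                  show "env ?s8" using E7 by (simp add: env_def)
                  have a17: "rarr ?s8 17 = upd2 (rarr s 17) 0 (int t) (\<Sum>c<k. (A * C) $$ (j, c) * ?X ^ c)"
                    using fr[of 17] s1(2) y by (simp del: index_mult_mat)
                  have a16: "rarr ?s8 16 = upd2 (rarr s 16) 0 (int t) (\<Sum>l<m. grid j l * ?X ^ l)"
                    using fr[of 16] s2(2) z same_rarr[OF s1(1), of 10] by simp
                  have a15: "rarr ?s8 15 = upd2 (rarr s 15) 0 (int t) (\<Sum>p<Suc t. h (m + p) * ?X ^ p)"
                  proof -
                    have "(\<Sum>i<t+1. rarr s3 11 0 (int m + int i) * ?X ^ i) = (\<Sum>p<Suc t. h (m + p) * ?X ^ p)"
                      by (rule sum.cong) (use r11 in \<open>auto simp flip: of_nat_add\<close>)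
                    then show ?thesis using fr[of 15] s4(2) by simp
                  qed
                  have a14: "rarr ?s8 14 = upd_row (rarr s 14) 0 0 (m + t + 1) ?G" using fr[of 14] s5(2) by simp
                  have a18: "rarr ?s8 18 = upd2 (rarr s 18) 0 (int t) (N / ip h h)"
                    using fr[of 18] s6(2) r14 same_rarr[OF s5(1), of 18] by simp
                  have a22: "rarr ?s8 22 0 0 = ?X ^ Suc t" using s7(2) by (simp add: upd2_apply)
                  show "dat ?s8 (Suc t) (sel(t := j)) (b'(t := f(m + t := - N)))"
                    unfolding dat_def h_def[symmetric]
                  proof (intro conjI allI impI)
                    fix i assume i: "i < m + Suc t"
                    have "rarr s 14 0 (int i) = (\<Sum>q<t. b' q i * ?X ^ q)"
                    proof (cases "i < m + t")
                      case False
                      then have "rarr s 14 0 (int i) = 0" using F by (simp add: dat_def)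
                      moreover have "i = m + t" using False i by simp
                      then have "(\<Sum>q<t. b' q i * ?X ^ q) = 0" using b0 by simp
                      ultimately show ?thesis by simp
                    qed (use F in \<open>simp add: dat_def\<close>)
                    then show "rarr ?s8 14 0 (int i) = (\<Sum>q<Suc t. (b'(t := h)) q i * ?X ^ q)"
                      unfolding a14 using i by (simp add: upd_row_apply0)
                  next
                    fix i assume "m + Suc t \<le> i"
                    then show "rarr ?s8 14 0 (int i) = 0"
                      unfolding a14 using F by (simp add: upd_row_def dat_def)
                  next
                    fix q assume "q < Suc t"
                    then show "rarr ?s8 15 0 (int q) = (\<Sum>p<Suc t. (b'(t := h)) q (m + p) * ?X ^ p)"
                      unfolding a15 using F b0 by (cases "q = t") (simp_all add: upd2_apply dat_def)
                  next
                    fix q assume "q < Suc t"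
                    then show "rarr ?s8 16 0 (int q) = (\<Sum>l<m. grid ((sel(t := j)) q) l * ?X ^ l)"
                      unfolding a16 using F by (cases "q = t") (simp_all add: upd2_apply dat_def)
                  next
                    fix q assume "q < Suc t"
                    then show "rarr ?s8 17 0 (int q) = (\<Sum>c<k. (A * C) $$ ((sel(t := j)) q, c) * ?X ^ c)"
                      unfolding a17 using F by (cases "q = t") (simp_all add: upd2_apply dat_def del: index_mult_mat)
                  next
                    fix q assume "q < Suc t"
                    then show "rarr ?s8 18 0 (int q) = N / ip ((b'(t := h)) q) ((b'(t := h)) q)"
                      unfolding a18 using F by (cases "q = t") (simp_all add: upd2_apply dat_def)
                  qed (use a22 in simp_all)
                qed
                show "runs p ?c8 s7 4 R"
                  by (rule runs_IAssign) (use R8 t7 in \<open>simp_all add: add.commute\<close>)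
              qed (use E6 in simp_all)
            qed (use t5 in simp_all)
            then show "runs p ?c6 (s4\<lparr>ivar := (ivar s4)(5 := int (m + t + 1)),
              rarr := (rarr s4)(14 := upd_row (rarr s4 14) 0 0 (m + t + 1) ?G)\<rparr>) (20 + (10 + 4)) R"
              by (simp only: s5_def)
          qed (use env_ival[OF E4] t4' in simp_all)
        qed (use env_ival[OF E3] t3 E3 in \<open>simp_all add: env_def\<close>)
      qed (use env_ival[OF E2] t2 E2 in \<open>simp_all add: env_def\<close>)
    qed (use env_ival[OF E1] t1 E1 in \<open>simp_all add: env_def\<close>)
  qed (use iv t4 E in \<open>simp_all add: env_def\<close>)
qed

end

section \<open>One row, and all rows\<close>

context product_setting
begin

definition rows_done :: "store \<Rightarrow> nat \<Rightarrow> bool" where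
  "rows_done s j \<longleftrightarrow> (\<forall>i<j. \<forall>c<k. rarr s 3 (int i) (int c) = (A * C) $$ (i, c))"

lemma start_as_assemble: "assemble t \<zeta> z (\<lambda>_. 0) = start t \<zeta> z"
  by (simp add: start_def)

lemma runs_residual:
  assumes E: "env s" and F: "dat s t sel b'" and S: "selection j t sel b'" and j: "j < n" "ivar s 3 = int j"
    and U: "m + t \<le> M"
    and R: "\<And>s'. same {10, 11, 12, 13, 21} s s' \<Longrightarrow> (\<forall>l<m. rarr s' 10 0 (int l) = grid j l) \<Longrightarrow>
      (\<forall>i<m+t. rarr s' 11 0 (int i) = residual j t sel b' i) \<Longrightarrow>
      rarr s' 21 0 0 = ip (residual j t sel b') (residual j t sel b') \<Longrightarrow> runs p c s' K R'"
  shows "runs p (Seq zeta_com (Seq clear_com (Seq head_com (Seq tail_com (Seq head_com (Seq tail_com (Seq head_com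
    (Seq norm_com c)))))))) s (5000 * (M + 1) * (B + 1) + K) R'"
proof -
  let ?\<zeta> = "\<lambda>q. grid (sel q)"
  let ?z = "grid j"
  note I = selection_near_orth[OF S]
  have tn: "t \<le> n" using selection_le[OF S] by linarith
  have t4: "ivar s 4 = int t" using F by (simp add: dat_def)
  define f0 where "f0 = start t ?\<zeta> ?z"
  define f1 where "f1 = pass t ?\<zeta> b' ?z f0"
  have f2: "residual j t sel b' = pass t ?\<zeta> b' ?z f1" by (simp add: f1_def f0_def pass2_def)
  have f0i: "\<forall>i. f0 i \<in> \<int>" by (simp add: f0_def start_int grid_int)
  have f1i: "\<forall>i. f1 i \<in> \<int>" unfolding f1_def using f0i by (auto intro: pass_int grid_int)
  have f0b: "\<forall>q<t. \<bar>ip f0 (b' q)\<bar> \<le> 3 * Q ^ 3 * N\<^sup>2"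
    unfolding f0_def using start_ip[OF I _ grid_le[OF j(1)]] by blast
  have f1b: "\<forall>q<t. \<bar>ip f1 (b' q)\<bar> \<le> 3 * Q ^ 3 * N\<^sup>2"
  proof (intro allI impI)
    fix q assume "q < t"
    then have "\<bar>ip f1 (b' q)\<bar> \<le> 1 / (10 * Q\<^sup>2) * N\<^sup>2"
      unfolding f1_def f0_def by (rule first_pass[OF I grid_le[OF j(1)]])
    also have "\<dots> \<le> 3 * Q ^ 3 * N\<^sup>2"
    proof (rule mult_right_mono)
      have "1 \<le> Q\<^sup>2" "1 \<le> Q ^ 3" using Q_ge by (intro one_le_power; simp)+
      then have "1 / (10 * Q\<^sup>2) \<le> 1" "1 \<le> 3 * Q ^ 3" by (simp_all add: divide_le_eq)
      then show "1 / (10 * Q\<^sup>2) \<le> 3 * Q ^ 3" by (rule order_trans)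
    qed simp
    finally show "\<bar>ip f1 (b' q)\<bar> \<le> 3 * Q ^ 3 * N\<^sup>2" .
  qed
  have f0z: "\<forall>i\<ge>m+t. f0 i = 0" by (simp add: f0_def start_apply)
  have f1z: "\<forall>i\<ge>m+t. f1 i = 0" using pass_coherent[of t ?\<zeta> ?z b' f0] by (simp add: coherent_def f1_def)
  have f2z: "\<forall>i\<ge>m+t. residual j t sel b' i = 0" using pass2_coherent[of t ?\<zeta> ?z b'] by (simp add: coherent_def)
  have c0: "\<bar>corr t b' f0 q\<bar> \<le> Q ^ 6 * N + 1" for q by (rule corr_bound(3)[OF I]) (use f0b in blast)
  have c1: "\<bar>corr t b' f1 q\<bar> \<le> Q ^ 6 * N + 1" for q by (rule corr_bound(3)[OF I]) (use f1b in blast)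
  have QN: "2 * (Q ^ 6 * N + 1) \<le> Q ^ 8 * N"
  proof -
    have "1 \<le> Q ^ 6" using Q_ge by (intro one_le_power) simp
    then have "1 * 1 \<le> Q ^ 6 * N" using N_ge1 by (intro mult_mono) auto
    then have "1 \<le> Q ^ 6 * N" unfolding mult_1 .
    moreover have "2 * (x + 1) \<le> 4 * x" if "1 \<le> x" for x :: real using that by simp
    ultimately have "2 * (Q ^ 6 * N + 1) \<le> 4 * (Q ^ 6 * N)" by blast
    also have "\<dots> \<le> Q\<^sup>2 * (Q ^ 6 * N)"
      using Q_ge N_pos self_le_power[of Q 2] by (intro mult_right_mono) auto
    also have "\<dots> = Q ^ 8 * N" by (simp flip: power_add add: mult.assoc[symmetric])
    finally show ?thesis .
  qed
  have QN0: "0 \<le> Q ^ 8 * N" using Q_pos N_pos by simp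
  have QN1: "Q ^ 6 * N + 1 \<le> Q ^ 8 * N"
  proof -
    have "0 \<le> Q ^ 6 * N" using Q_pos N_pos by simp
    moreover have "x + 1 \<le> y" if "0 \<le> x" "2 * (x + 1) \<le> y" for x y :: real using that by simp
    ultimately show ?thesis using QN by blast
  qed
  have QN2: "\<bar>u - v\<bar> \<le> Q ^ 8 * N" if "\<bar>u\<bar> \<le> Q ^ 6 * N + 1" "\<bar>v\<bar> \<le> Q ^ 6 * N + 1" for u v
  proof -
    have "\<bar>u - v\<bar> \<le> y" if "\<bar>u\<bar> \<le> x" "\<bar>v\<bar> \<le> x" "2 * x \<le> y" for x y :: real using that by linarith
    from this[OF that QN] show ?thesis .
  qed
  let ?c7 = "Seq norm_com c"
  let ?c6 = "Seq head_com ?c7"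
  let ?c5 = "Seq tail_com ?c6"
  let ?c4 = "Seq head_com ?c5"
  let ?c3 = "Seq tail_com ?c4"
  let ?c2 = "Seq head_com ?c3"
  let ?c1 = "Seq clear_com ?c2"
  let ?h = "300 * (t + m + 1) * (B + 1) + (40 * m + 11)"
  let ?t = "300 * (m + t + t + 1) * (B + 1) + (300 * (t + t + 1) * (B + 1) + (40 * t + 9))"
  let ?n = "4 + (29 * (m + t) + 13)"
  have "runs p (Seq zeta_com ?c1) s (300 * (1 + m + 1) * (B + 1) + ((20 * t + 9) + (?h + (?t + (?h + (?t + (?h + (?n + K)))))))) R'"
  proof (rule runs_Seq', rule runs_zeta[OF E j])
    fix s1 assume s1: "same {10} s s1" and z1: "\<forall>l<m. rarr s1 10 0 (int l) = grid j l"
    have E1: "env s1" by (rule env_same[OF E s1(1)]) simp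
    have F1: "dat s1 t sel b'" by (rule dat_same[OF F s1(1)]) simp
    have t1: "ivar s1 4 = int t" using F1 by (simp add: dat_def)
    show "runs p ?c1 s1 ((20 * t + 9) + (?h + (?t + (?h + (?t + (?h + (?n + K))))))) R'"
    proof (rule runs_Seq', rule runs_clear[OF E1 t1])
      fix s2 assume s2: "same {11} s1 s2" and x2: "\<forall>q<t. rarr s2 11 0 (int (m + q)) = 0"
      have E2: "env s2" by (rule env_same[OF E1 s2(1)]) simp
      have F2: "dat s2 t sel b'" by (rule dat_same[OF F1 s2(1)]) simp
      have z2: "\<forall>l<m. rarr s2 10 0 (int l) = grid j l" using z1 same_rarr[OF s2, of 10] by simp
      show "runs p ?c2 s2 (?h + (?t + (?h + (?t + (?h + (?n + K)))))) R'"
      proof (rule runs_Seq', rule runs_head[OF E2 F2 S z2, of "\<lambda>_. 0"])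
        fix s3 assume s3: "same {11, 13} s2 s3"
          and a3: "\<forall>i<m+t. rarr s3 11 0 (int i) = assemble t ?\<zeta> ?z (\<lambda>_. 0) i"
        have E3: "env s3" by (rule env_same[OF E2 s3(1)]) simp
        have F3: "dat s3 t sel b'" by (rule dat_same[OF F2 s3(1)]) simp
        have z3: "\<forall>l<m. rarr s3 10 0 (int l) = grid j l" using z2 same_rarr[OF s3, of 10] by simp
        have x3: "\<forall>i<m+t. rarr s3 11 0 (int i) = f0 i" using a3 by (simp add: start_as_assemble f0_def)
        show "runs p ?c3 s3 (?t + (?h + (?t + (?h + (?n + K))))) R'"
        proof (rule runs_Seq', rule runs_tail[OF E3 F3 S x3 f0i f0z f0b])
          fix s4 assume s4: "same {11, 12, 13} s3 s4"
            and x4: "\<forall>q<t. rarr s4 11 0 (int (m + q)) = f0 (m + q) - corr t b' f0 q"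
          have E4: "env s4" by (rule env_same[OF E3 s4(1)]) simp
          have F4: "dat s4 t sel b'" by (rule dat_same[OF F3 s4(1)]) simp
          have z4: "\<forall>l<m. rarr s4 10 0 (int l) = grid j l" using z3 same_rarr[OF s4, of 10] by simp
          have b4: "\<forall>q<t. \<bar>f0 (m + q) - corr t b' f0 q\<bar> \<le> Q ^ 6 * N + 1"
            using c0 by (simp add: f0_def start_apply)
          show "runs p ?c4 s4 (?h + (?t + (?h + (?n + K)))) R'"
          proof (rule runs_Seq', rule runs_head[OF E4 F4 S z4 x4])
            fix s5 assume s5: "same {11, 13} s4 s5"
              and a5: "\<forall>i<m+t. rarr s5 11 0 (int i) = assemble t ?\<zeta> ?z (\<lambda>q. f0 (m + q) - corr t b' f0 q) i"
            have E5: "env s5" by (rule env_same[OF E4 s5(1)]) simp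
            have F5: "dat s5 t sel b'" by (rule dat_same[OF F4 s5(1)]) simp
            have z5: "\<forall>l<m. rarr s5 10 0 (int l) = grid j l" using z4 same_rarr[OF s5, of 10] by simp
            have x5: "\<forall>i<m+t. rarr s5 11 0 (int i) = f1 i" using a5 by (simp add: pass_def f1_def)
            have f1m: "f1 (m + q) = f0 (m + q) - corr t b' f0 q" if "q < t" for q
              using that by (simp add: f1_def pass_def assemble_def)
            show "runs p ?c5 s5 (?t + (?h + (?n + K))) R'"
            proof (rule runs_Seq', rule runs_tail[OF E5 F5 S x5 f1i f1z f1b])
              fix s6 assume s6: "same {11, 12, 13} s5 s6"
                and x6: "\<forall>q<t. rarr s6 11 0 (int (m + q)) = f1 (m + q) - corr t b' f1 q"
              have E6: "env s6" by (rule env_same[OF E5 s6(1)]) simp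
              have F6: "dat s6 t sel b'" by (rule dat_same[OF F5 s6(1)]) simp
              have z6: "\<forall>l<m. rarr s6 10 0 (int l) = grid j l" using z5 same_rarr[OF s6, of 10] by simp
              have b6: "\<forall>q<t. \<bar>f1 (m + q) - corr t b' f1 q\<bar> \<le> Q ^ 8 * N"
              proof (intro allI impI)
                fix q assume q: "q < t"
                have "\<bar>f1 (m + q)\<bar> \<le> Q ^ 6 * N + 1" using b4 f1m[OF q] q by simp
                then show "\<bar>f1 (m + q) - corr t b' f1 q\<bar> \<le> Q ^ 8 * N" using c1[of q] QN2 by blast
              qed
              show "runs p ?c6 s6 (?h + (?n + K)) R'"
              proof (rule runs_Seq', rule runs_head[OF E6 F6 S z6 x6 _ b6])
                fix s7 assume s7: "same {11, 13} s6 s7"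
                  and a7: "\<forall>i<m+t. rarr s7 11 0 (int i) = assemble t ?\<zeta> ?z (\<lambda>q. f1 (m + q) - corr t b' f1 q) i"
                have E7: "env s7" by (rule env_same[OF E6 s7(1)]) simp
                have F7: "dat s7 t sel b'" by (rule dat_same[OF F6 s7(1)]) simp
                have t7: "ivar s7 4 = int t" using F7 by (simp add: dat_def)
                have z7: "\<forall>l<m. rarr s7 10 0 (int l) = grid j l" using z6 same_rarr[OF s7, of 10] by simp
                have x7: "\<forall>i<m+t. rarr s7 11 0 (int i) = residual j t sel b' i"
                  using a7 unfolding f2 by (simp add: pass_def)
                show "runs p ?c7 s7 (?n + K) R'"
                proof (rule runs_Seq', rule runs_norm[OF E7 t7 tn x7 f2z])
                  fix s8 assume s8: "same {21} s7 s8"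
                    and n8: "rarr s8 21 0 0 = ip (residual j t sel b') (residual j t sel b')"
                  show "runs p c s8 K R'"
                  proof (rule R[OF _ _ _ n8])
                    have "same ({10} \<union> {11} \<union> {11, 13} \<union> {11, 12, 13} \<union> {11, 13} \<union> {11, 12, 13} \<union> {11, 13} \<union> {21}) s s8"
                      by (intro same_trans[OF _ s8] same_trans[OF _ s7] same_trans[OF _ s6] same_trans[OF _ s5]
                          same_trans[OF _ s4] same_trans[OF _ s3] same_trans[OF _ s2] s1)
                    then show "same {10, 11, 12, 13, 21} s s8" by (rule same_mono) auto
                    show "\<forall>l<m. rarr s8 10 0 (int l) = grid j l" using z7 same_rarr[OF s8, of 10] by simp
                    show "\<forall>i<m+t. rarr s8 11 0 (int i) = residual j t sel b' i"
                      using x7 same_rarr[OF s8, of 11] by simp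
                  qed
                qed
              qed (use f1i corr_int in \<open>auto intro: Ints_diff\<close>)
            qed
          qed (use f0i corr_int b4 QN1 in \<open>fastforce intro: Ints_diff\<close>)+
        qed
      qed (use x2 QN0 in simp_all)
    qed
  qed
  then show ?thesis
  proof (rule runs_weaken)
    define V where "V = (M + 1) * (B + 1)"
    have V1: "M + 1 \<le> V" by (simp add: V_def)
    have l: "(x + 1) * (B + 1) \<le> 2 * V" if "x \<le> 2 * M" for x
      using mult_le_mono1[of "x + 1" "2 * (M + 1)" "B + 1"] that by (simp add: V_def mult.assoc)
    have "(1 + m + 1) * (B + 1) \<le> 2 * V" using l[of "1 + m"] U by (cases "M = 0") (auto simp: V_def)
    moreover have "(t + m + 1) * (B + 1) \<le> 2 * V" "(m + t + t + 1) * (B + 1) \<le> 2 * V" "(t + t + 1) * (B + 1) \<le> 2 * V"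
      using l U by auto
    moreover have arith: "300 * a + ((20 * t + 9) + ((300 * c + (40 * m + 11)) + ((300 * e + (300 * g + (40 * t + 9))) +
      ((300 * c + (40 * m + 11)) + ((300 * e + (300 * g + (40 * t + 9))) + ((300 * c + (40 * m + 11)) +
      ((4 + (29 * (m + t) + 13)) + K))))))) \<le> 5000 * V + K"
      if "a \<le> 2 * V" "c \<le> 2 * V" "e \<le> 2 * V" "g \<le> 2 * V" "M + 1 \<le> V" "m + t \<le> M"
      for a c e g V m t M K :: nat
    proof -
      have "300 * a + ((20 * t + 9) + ((300 * c + (40 * m + 11)) + ((300 * e + (300 * g + (40 * t + 9))) +
        ((300 * c + (40 * m + 11)) + ((300 * e + (300 * g + (40 * t + 9))) + ((300 * c + (40 * m + 11)) +
        ((4 + (29 * (m + t) + 13)) + K))))))) = 300 * a + 900 * c + 600 * e + 600 * g + 149 * m + 129 * t + 77 + K" by simp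
      then show ?thesis using that by linarith
    qed
    ultimately have "300 * ((1 + m + 1) * (B + 1)) + ((20 * t + 9) + ((300 * ((t + m + 1) * (B + 1)) + (40 * m + 11)) +
      ((300 * ((m + t + t + 1) * (B + 1)) + (300 * ((t + t + 1) * (B + 1)) + (40 * t + 9))) +
      ((300 * ((t + m + 1) * (B + 1)) + (40 * m + 11)) +
      ((300 * ((m + t + t + 1) * (B + 1)) + (300 * ((t + t + 1) * (B + 1)) + (40 * t + 9))) +
      ((300 * ((t + m + 1) * (B + 1)) + (40 * m + 11)) + (?n + K))))))) \<le> 5000 * V + K"
      using V1 U by (intro arith)
    then show "300 * (1 + m + 1) * (B + 1) + ((20 * t + 9) + (?h + (?t + (?h + (?t + (?h + (?n + K))))))) \<le> 5000 * (M + 1) * (B + 1) + K"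
      by (simp only: V_def mult.assoc)
  qed
qed

text \<open>A selected row costs more than a predicted one, by an amount that involves
  \<open>d\<close>. The bound is in the form of a potential proportional to the number of selected
  rows: the increase from \<open>t\<close> to \<open>t'\<close> pays for the surplus.\<close>

lemma runs_row:
  assumes E: "env s" and F: "dat s t sel b'" and S: "selection j t sel b'" and j: "j < n" "ivar s 3 = int j"
    and U: "m + t + k + 1 \<le> M" and D: "rows_done s j"
    and R: "\<And>s' t' sel' b''. env s' \<Longrightarrow> dat s' t' sel' b'' \<Longrightarrow> selection (Suc j) t' sel' b'' \<Longrightarrow> ivar s' 3 = int j \<Longrightarrow>
      rows_done s' (Suc j) \<Longrightarrow> rarr s' 0 = rarr s 0 \<Longrightarrow> rarr s' 1 = rarr s 1 \<Longrightarrow> rarr s' 2 = rarr s 2 \<Longrightarrow> R s' t'"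
  shows "\<exists>t' T s'. exec p row_com s T s' \<and> R s' t' \<and> t \<le> t' \<and>
    T + 1000 * (d + M + 1) * (B + 1) * t \<le> 7000 * (M + 1) * (B + 1) + 1000 * (d + M + 1) * (B + 1) * t'"
proof -
  let ?f = "residual j t sel b'"
  let ?b = "RLe (cell 21 0) (RMul (cell 6 1) (cell 6 1))"
  have B1: "2 \<le> B" by (rule B_ge)
  have km: "k \<le> m" using m by simp
  show ?thesis
  proof (cases "ip ?f ?f \<le> N\<^sup>2")
    case small: True
    have "runs p row_com s (5000 * (M + 1) * (B + 1) + ((12 + 300 * (t + k + 1) * (B + 1)) + (20 * k + 9))) (\<lambda>s'. R s' t)"
      unfolding row_com_def
    proof (rule runs_residual[OF E F S j, where M = M])
      show "m + t \<le> M" using U by simp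
      fix s1 assume s1: "same {10, 11, 12, 13, 21} s s1" and f1: "\<forall>i<m+t. rarr s1 11 0 (int i) = ?f i"
        and n1: "rarr s1 21 0 0 = ip ?f ?f"
      have E1: "env s1" by (rule env_same[OF E s1]) simp
      have F1: "dat s1 t sel b'" by (rule dat_same[OF F s1]) simp
      have b: "bval ?b s1" using small n1 E1 by (simp add: env_def power2_eq_square)
      show "runs p (Seq (If ?b predict_com (Seq exact_com append_com)) out_com) s1
          ((12 + 300 * (t + k + 1) * (B + 1)) + (20 * k + 9)) (\<lambda>s'. R s' t)"
      proof (rule runs_Seq', rule runs_If[where K' = "300 * (t + k + 1) * (B + 1)"])
        show "runs p predict_com s1 (300 * (t + k + 1) * (B + 1)) (\<lambda>s'. runs p out_com s' (20 * k + 9) (\<lambda>s'. R s' t))"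
        proof (rule runs_predict[OF E1 F1 S j(1) f1 small])
          fix s2 assume s2: "same {13} s1 s2" and y2: "\<forall>c<k. rarr s2 13 0 (int c) = (A * C) $$ (j, c)"
          have E2: "env s2" by (rule env_same[OF E1 s2]) simp
          have F2: "dat s2 t sel b'" by (rule dat_same[OF F1 s2]) simp
          have v2: "ivar s2 3 = int j" "ivar s2 2 = int k"
            using j same_ivar[OF s2] same_ivar[OF s1] E2 by (simp_all add: env_def)
          show "runs p out_com s2 (20 * k + 9) (\<lambda>s'. R s' t)"
          proof (rule runs_out[OF v2(2,1)])
            fix s3 assume s3: "same {3} s2 s3"
              and r3: "rarr s3 3 = upd_row (rarr s2 3) (int j) 0 k (\<lambda>c. rarr s2 13 0 (int c))"
            show "R s3 t"
            proof (rule R)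
              show "env s3" by (rule env_same[OF E2 s3]) simp
              show "dat s3 t sel b'" by (rule dat_same[OF F2 s3]) simp
              show "selection (Suc j) t sel b'" by (rule selection_skip[OF S j(1)])
              show "ivar s3 3 = int j" using v2 same_ivar[OF s3] by simp
              show "rows_done s3 (Suc j)"
                using D y2 same_rarr[OF s1, of 3] same_rarr[OF s2, of 3]
                by (auto simp: rows_done_def r3 upd_row_def less_Suc_eq simp del: index_mult_mat)
            qed (use same_rarr[OF s1] same_rarr[OF s2] same_rarr[OF s3] in simp_all)
          qed
        qed
      qed (use b in simp_all)
    qed
    then obtain T s' where e: "exec p row_com s T s'" "R s' t"
      "T \<le> 5000 * (M + 1) * (B + 1) + ((12 + 300 * (t + k + 1) * (B + 1)) + (20 * k + 9))"
      unfolding runs_def by blast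
    have "300 * (t + k + 1) * (B + 1) \<le> 300 * (M + 1) * (B + 1)" using U by (intro mult_le_mono) auto
    moreover have "12 + (20 * k + 9) \<le> 30 * (M + 1)" using U by simp
    moreover have "30 * (M + 1) \<le> 30 * (M + 1) * (B + 1)" by simp
    ultimately have "T \<le> 5000 * (M + 1) * (B + 1) + 300 * (M + 1) * (B + 1) + 30 * (M + 1) * (B + 1)"
      using e(3) by linarith
    also have "\<dots> \<le> 7000 * (M + 1) * (B + 1)"
      unfolding distrib_right[symmetric] by (intro mult_le_mono) auto
    finally show ?thesis using e(1,2) by (intro exI[of _ t] exI[of _ T] exI[of _ s']) simp
  next
    case big: False
    let ?app = "100 * (k + 1) + (100 * (m + 1) + (20 + (100 * (t + 1 + 1) + (40 * (m + t + 1) + 20 + (20 + (10 + 4))))))"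
    let ?ea = "300 * (d + k + 1) * (B + 1) + ?app"
    have "runs p row_com s (5000 * (M + 1) * (B + 1) + ((12 + ?ea) + (20 * k + 9))) (\<lambda>s'. R s' (Suc t))"
      unfolding row_com_def
    proof (rule runs_residual[OF E F S j, where M = M])
      show "m + t \<le> M" using U by simp
      fix s1 assume s1: "same {10, 11, 12, 13, 21} s s1" and z1: "\<forall>l<m. rarr s1 10 0 (int l) = grid j l"
        and f1: "\<forall>i<m+t. rarr s1 11 0 (int i) = ?f i"
        and n1: "rarr s1 21 0 0 = ip ?f ?f"
      have E1: "env s1" by (rule env_same[OF E s1]) simp
      have F1: "dat s1 t sel b'" by (rule dat_same[OF F s1]) simp
      have b: "\<not> bval ?b s1" using big n1 E1 by (simp add: env_def power2_eq_square)
      have v1: "ivar s1 3 = int j" "ivar s1 2 = int k" "ivar s1 1 = int d"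
        using j same_ivar[OF s1] E1 by (simp_all add: env_def)
      show "runs p (Seq (If ?b predict_com (Seq exact_com append_com)) out_com) s1
          ((12 + ?ea) + (20 * k + 9)) (\<lambda>s'. R s' (Suc t))"
      proof (rule runs_Seq', rule runs_If[where K' = ?ea])
        show "runs p (Seq exact_com append_com) s1 ?ea (\<lambda>s'. runs p out_com s' (20 * k + 9) (\<lambda>s'. R s' (Suc t)))"
        proof (rule runs_Seq', rule runs_exact[where n = n and A = A and C = C, OF v1(3,2,1) j(1) A C _ B1])
          fix s2 assume s2: "same {13} s1 s2" and y2: "\<forall>c<k. rarr s2 13 0 (int c) = (A * C) $$ (j, c)"
          have E2: "env s2" by (rule env_same[OF E1 s2]) simp
          have F2: "dat s2 t sel b'" by (rule dat_same[OF F1 s2]) simp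
          have z2: "\<forall>l<m. rarr s2 10 0 (int l) = grid j l" using z1 same_rarr[OF s2, of 10] by simp
          have f2: "\<forall>i<m+t. rarr s2 11 0 (int i) = ?f i" using f1 same_rarr[OF s2, of 11] by simp
          have n2: "rarr s2 21 0 0 = ip ?f ?f" using n1 same_rarr[OF s2, of 21] by simp
          show "runs p append_com s2 ?app (\<lambda>s'. runs p out_com s' (20 * k + 9) (\<lambda>s'. R s' (Suc t)))"
          proof (rule runs_append[OF E2 F2 S j(1) y2 z2 f2 refl n2])
            fix s3 assume i3: "\<forall>x. x \<notin> {4, 5} \<longrightarrow> ivar s3 x = ivar s2 x"
              and r3: "\<forall>a. a \<notin> {5, 11, 14, 15, 16, 17, 18, 22} \<longrightarrow> rarr s3 a = rarr s2 a"
              and E3: "env s3" and F3: "dat s3 (Suc t) (sel(t := j)) (b'(t := ?f(m + t := - N)))"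
            have v3: "ivar s3 3 = int j" "ivar s3 2 = int k"
              using i3 v1 same_ivar[OF s2] by simp_all
            show "runs p out_com s3 (20 * k + 9) (\<lambda>s'. R s' (Suc t))"
            proof (rule runs_out[OF v3(2,1)])
              fix s4 assume s4: "same {3} s3 s4"
                and r4: "rarr s4 3 = upd_row (rarr s3 3) (int j) 0 k (\<lambda>c. rarr s3 13 0 (int c))"
              show "R s4 (Suc t)"
              proof (rule R)
                show "env s4" by (rule env_same[OF E3 s4]) simp
                show "dat s4 (Suc t) (sel(t := j)) (b'(t := ?f(m + t := - N)))" by (rule dat_same[OF F3 s4]) simp
                show "selection (Suc j) (Suc t) (sel(t := j)) (b'(t := ?f(m + t := - N)))"
                  by (rule selection_extend[OF S j(1)]) (use big in simp)
                show "ivar s4 3 = int j" using v3 same_ivar[OF s4] by simp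
                show "rows_done s4 (Suc j)"
                  using D y2 same_rarr[OF s1, of 3] same_rarr[OF s2, of 3] r3
                  by (auto simp: rows_done_def r4 upd_row_def less_Suc_eq simp del: index_mult_mat)
              qed (use same_rarr[OF s1] same_rarr[OF s2] same_rarr[OF s4] r3 in simp_all)
            qed
          qed
        next
          show "\<bar>(A * C) $$ (j, c)\<bar> * 4 \<le> 2 ^ B" if "c < k" for c
          proof (rule fits)
            have "\<bar>(A * C) $$ (j, c)\<bar> \<le> Q ^ 1" using AC_le[OF j(1) that] by simp
            also have "\<dots> \<le> Q ^ 39" by (rule Q_pow_mono) simp
            finally show "\<bar>(A * C) $$ (j, c)\<bar> \<le> Q ^ 39" .
          qed
        qed (use E1 AC_int j km in \<open>simp_all add: env_def del: index_mult_mat\<close>)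
      qed (use b in simp_all)
    qed
    then obtain T s' where e: "exec p row_com s T s'" "R s' (Suc t)"
      "T \<le> 5000 * (M + 1) * (B + 1) + ((12 + ?ea) + (20 * k + 9))"
      unfolding runs_def by blast
    have "300 * (d + k + 1) * (B + 1) \<le> 300 * (d + M + 1) * (B + 1)" using U by (intro mult_le_mono) auto
    moreover have "12 + ?app + (20 * k + 9) \<le> 600 * (M + 1)" using U by simp
    moreover have "600 * (M + 1) \<le> 600 * (M + 1) * (B + 1)" by simp
    ultimately have "T \<le> 5000 * (M + 1) * (B + 1) + 300 * (d + M + 1) * (B + 1) + 600 * (M + 1) * (B + 1)"
      using e(3) by linarith
    also have "\<dots> \<le> 7000 * (M + 1) * (B + 1) + 1000 * (d + M + 1) * (B + 1)"
      by (simp add: algebra_simps)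
    finally show ?thesis using e(1,2)
      by (intro exI[of _ "Suc t"] exI[of _ T] exI[of _ s']) simp
  qed
qed

end

context product_setting
begin

text \<open>\<open>M\<close> bounds the length of every vector handled in a row, as
  \<open>selection_le\<close> keeps the number of selected rows below \<open>8 * b * m\<close>. The
  same lemma bounds the final potential, and with it the total cost of all direct rows.\<close>

lemma runs_rows:
  assumes E: "env s" and s0: "ivar s 4 = 0" "rarr s 22 0 0 = 1" "\<forall>i. rarr s 14 0 (int i) = 0"
    and M: "M = m + 8 * b * m + k + 1"
    and R: "\<And>s'. rows_done s' n \<Longrightarrow> env s' \<Longrightarrow> rarr s' 0 = rarr s 0 \<Longrightarrow> rarr s' 1 = rarr s 1 \<Longrightarrow> rarr s' 2 = rarr s 2 \<Longrightarrow> R s'"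
  shows "runs p (For 3 (IVar 0) row_com) s
    (n * (7000 * (M + 1) * (B + 1) + 10) + 1000 * (d + M + 1) * (B + 1) * (8 * b * m) + 9) R"
proof -
  let ?c = "1000 * (d + M + 1) * (B + 1)"
  define \<Phi> where "\<Phi> s = ?c * nat (ivar s 4)" for s :: store
  define I where "I j s' \<longleftrightarrow> (\<exists>t sel b'. env s' \<and> dat s' t sel b' \<and> selection j t sel b' \<and> rows_done s' j \<and>
    rarr s' 0 = rarr s 0 \<and> rarr s' 1 = rarr s 1 \<and> rarr s' 2 = rarr s 2)" for j and s' :: store
  have upd: "env (s'\<lparr>ivar := (ivar s')(3 := v)\<rparr>) = env s'" "dat (s'\<lparr>ivar := (ivar s')(3 := v)\<rparr>) t sel b' = dat s' t sel b'"
    "rows_done (s'\<lparr>ivar := (ivar s')(3 := v)\<rparr>) j = rows_done s' j" for s' v t sel b' j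
    by (simp_all add: env_def dat_def rows_done_def)
  show ?thesis
  proof (rule runs_For_amortized[where I = I and n = n and \<Phi> = \<Phi> and K = "7000 * (M + 1) * (B + 1)"
        and F = "?c * (8 * b * m)"])
    fix j s' assume j: "j < n" and I: "I j s'" and v: "ivar s' 3 = int j"
    obtain t sel b' where E': "env s'" and F: "dat s' t sel b'" and S: "selection j t sel b'" and D: "rows_done s' j"
      and r: "rarr s' 0 = rarr s 0" "rarr s' 1 = rarr s 1" "rarr s' 2 = rarr s 2" using I unfolding I_def by blast
    have "m + t + k + 1 \<le> M" using selection_le(1)[OF S] M by simp
    from runs_row[OF E' F S j v this D, where R = "\<lambda>s' t'. \<exists>sel b'. env s' \<and> dat s' t' sel b' \<and> selection (Suc j) t' sel b' \<and>
       ivar s' 3 = int j \<and> rows_done s' (Suc j) \<and> rarr s' 0 = rarr s 0 \<and> rarr s' 1 = rarr s 1 \<and> rarr s' 2 = rarr s 2"]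
    obtain t' T s'' sel' b'' where e: "exec p row_com s' T s''" and s'': "env s''" "dat s'' t' sel' b''" "selection (Suc j) t' sel' b''"
       "ivar s'' 3 = int j" "rows_done s'' (Suc j)" "rarr s'' 0 = rarr s 0" "rarr s'' 1 = rarr s 1" "rarr s'' 2 = rarr s 2"
      and T: "T + ?c * t \<le> 7000 * (M + 1) * (B + 1) + ?c * t'"
      using r by (smt (verit, del_insts))
    have "\<Phi> s' = ?c * t" "\<Phi> s'' = ?c * t'" using F s''(2) by (simp_all add: \<Phi>_def dat_def)
    then have "T + \<Phi> s' \<le> 7000 * (M + 1) * (B + 1) + \<Phi> s''" using T by simp
    moreover have "I (Suc j) (s''\<lparr>ivar := (ivar s'')(3 := int (Suc j))\<rparr>)"
      unfolding I_def upd using s'' by auto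
    ultimately show "\<exists>t s''. exec p row_com s' t s'' \<and> t + \<Phi> s' \<le> 7000 * (M + 1) * (B + 1) + \<Phi> s'' \<and>
        ivar s'' 3 = int j \<and> I (Suc j) (s''\<lparr>ivar := (ivar s'')(3 := int (Suc j))\<rparr>)"
      using e s''(4) by blast
  next
    show "\<Phi> (s'\<lparr>ivar := (ivar s')(3 := v)\<rparr>) = \<Phi> s'" for s' v by (simp add: \<Phi>_def)
    show "ival (IVar 0) s' = int n" if "I j s'" for j s' using that env_ival unfolding I_def by blast
    show "I 0 (s\<lparr>ivar := (ivar s)(3 := 0)\<rparr>)"
      unfolding I_def upd using E s0 selection_0
      by (auto simp: dat_def rows_done_def intro!: exI[of _ 0])
  next
    fix s' assume "I n s'"
    then obtain t sel b' where E': "env s'" and F: "dat s' t sel b'" and S: "selection n t sel b'" and D: "rows_done s' n"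
      and r: "rarr s' 0 = rarr s 0" "rarr s' 1 = rarr s 1" "rarr s' 2 = rarr s 2" unfolding I_def by blast
    have "nat (ivar s' 4) \<le> 8 * b * m" using F selection_le(1)[OF S] by (simp add: dat_def)
    then show "R s' \<and> \<Phi> s' \<le> ?c * (8 * b * m)" using R[OF D E' r] by (simp add: \<Phi>_def)
  qed simp
qed

end

section \<open>Precision, tables and the stacked matrix\<close>

primrec rpow :: "rexp \<Rightarrow> nat \<Rightarrow> rexp" where
  "rpow u 0 = RConst 1"
| "rpow u (Suc i) = RMul u (rpow u i)"

lemma rval_rpow: "rval (rpow u i) s = rval u s ^ i"
  by (induction i) auto

lemma rcost_rpow: "rcost (rpow u i) = i * (rcost u + 1) + 1"
  by (induction i) auto

text \<open>\<open>c0\<close> will be sqrt \<Delta>1, a machine constant because \<Delta>1 belongs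
  to the given algorithm, whereas the bound on the entries is read from the input.\<close>

definition weight_exp :: "real \<Rightarrow> rexp" where
  "weight_exp c0 = RMul (RMul (RConst (3 * c0)) (RMul (cell 2 0) (cell 2 0))) (RMul (RInt (IVar 0)) (RInt (IVar 1)))"

text \<open>One number above all the lower bounds that \<open>product_setting\<close> places on
  \<open>Q\<close>; \<open>precision_bounds\<close> derives them from it.\<close>

definition bound_exp :: rexp where
  "bound_exp = RMul (RMul (RConst 100) (RInt (IAdd (IVar 0) (IConst 3))))
     (RMul (RInt (IAdd mE (IConst 2)))
       (RAdd (RConst 1) (RMul (RAdd (RAdd (RInt (IVar 0)) (RMul (RInt (IVar 2)) (cell 6 4))) (RConst 1))
         (RMul (RInt (IVar 1)) (RMul (cell 2 0) (cell 2 0))))))"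

text \<open>Doubling from 1 finds the least power of two above the bound in as many rounds as its
  exponent. The powers 12 and 40 give \<open>N\<close> and the packing base, which is again a power
  of two, as the binary search requires.\<close>

definition scale_com :: "real \<Rightarrow> com" where
  "scale_com c0 =
     Seq (set_cell 6 4 (weight_exp c0))
    (Seq (set_cell 6 5 bound_exp)
    (Seq (set_cell 6 0 (RConst 1))
    (Seq (While (BNot (RLe (cell 6 5) (cell 6 0))) (set_cell 6 0 (RMul (RConst 2) (cell 6 0))))
    (Seq (set_cell 6 1 (rpow (cell 6 0) 12))
    (set_cell 5 1 (rpow (cell 6 0) 40))))))"

definition tables_com :: com where
  "tables_com =
     Seq (For 5 (IAdd (IVar 0) mE) (RStore 7 zE (IVar 5) (RConst 1)))
    (Seq (For 5 (IAdd (IVar 0) mE) (RStore 8 zE (IVar 5) (RDiv (RConst 1) (cell 6 1))))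
    (Seq (For 5 mE (RStore 19 zE (IVar 5) (cell 6 0)))
    (Seq (Call pack_proc [mE, zE, zE, zE] [19, 20, 5])
    (For 6 (IVar 1) (Call pack_proc [IVar 2, IVar 6, zE, IVar 6] [1, 9, 5])))))"

text \<open>During the set-up the packing base is itself being written, so in contrast to
  \<open>same\<close> nothing is claimed about array 5; variable 6 is a second loop counter.\<close>

definition samei :: "nat set \<Rightarrow> store \<Rightarrow> store \<Rightarrow> bool" where
  "samei As s s' \<longleftrightarrow> (\<forall>x. x \<noteq> 5 \<longrightarrow> x \<noteq> 6 \<longrightarrow> ivar s' x = ivar s x) \<and>
    (\<forall>a. a \<notin> As \<longrightarrow> a \<noteq> 5 \<longrightarrow> rarr s' a = rarr s a) \<and> iarr s' = iarr s"

lemma runs_scale: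
  assumes iv: "ivar s 0 = int n" "ivar s 1 = int d" "ivar s 2 = int k" and r2: "rarr s 2 0 0 = \<Delta>"
    and w: "w = 3 * c0 * \<Delta>\<^sup>2 * real n * real d"
    and q0: "q0 = 100 * (real n + 3) * (2 * real k + 2) * (1 + (real n + real k * w + 1) * (real d * \<Delta>\<^sup>2))"
    and b: "q0 \<le> 2 ^ b" "\<And>i. i < b \<Longrightarrow> 2 ^ i < q0"
    and R: "\<And>s'. samei {6} s s' \<Longrightarrow> rarr s' 6 0 0 = 2 ^ b \<Longrightarrow> rarr s' 6 0 1 = (2 ^ b) ^ 12 \<Longrightarrow>
       rarr s' 6 0 4 = w \<Longrightarrow> rarr s' 5 0 1 = (2 ^ b) ^ 40 \<Longrightarrow> ivar s' = ivar s \<Longrightarrow> R s'"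
  shows "runs p (scale_com c0) s (400 + 20 * b) R"
proof -
  define S where "S g = s\<lparr>rarr := (rarr s)(6 := g)\<rparr>" for g
  have st: "runs p (set_cell 6 j u) (S g) K R'"
    if "rval u (S g) = c" "R' (S (upd2 g 0 j c))" "3 + rcost u \<le> K" for j u g c K R'
    using that by (intro runs_RStore) (simp_all add: S_def)
  have s0: "s = S (rarr s 6)" by (simp add: S_def)
  have rw: "rval (weight_exp c0) (S g) = w" for g
    using iv r2 by (simp add: weight_exp_def S_def w power2_eq_square)
  have rq: "rval bound_exp (S g) = q0" if "g 0 4 = w" for g
    using iv r2 that by (simp add: bound_exp_def S_def q0 power2_eq_square algebra_simps)
  let ?c6 = "set_cell 5 1 (rpow (cell 6 0) 40)"
  let ?c5 = "Seq (set_cell 6 1 (rpow (cell 6 0) 12)) ?c6"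
  let ?l = "While (BNot (RLe (cell 6 5) (cell 6 0))) (set_cell 6 0 (RMul (RConst 2) (cell 6 0)))"
  have 6: "runs p ?c6 (S g) 170 R"
    if "g 0 0 = 2 ^ b" "g 0 1 = (2 ^ b) ^ 12" "g 0 4 = w" for g
  proof (rule runs_RStore)
    let ?s = "s\<lparr>rarr := (rarr s)(6 := g, 5 := upd2 (rarr s 5) 0 1 ((2 ^ b) ^ 40))\<rparr>"
    have "R ?s" by (rule R) (use that in \<open>simp_all add: samei_def upd2_apply\<close>)
    then show "R ((S g)\<lparr>rarr := (rarr (S g))(5 := upd2 (rarr (S g) 5) (ival (IConst 0) (S g)) (ival (IConst 1) (S g))
        (rval (rpow (cell 6 0) 40) (S g)))\<rparr>)"
      using that(1) by (simp add: S_def rval_rpow)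
  qed (simp add: rcost_rpow)
  have 5: "runs p ?c5 (S g) (60 + 170) R" if "g 0 0 = 2 ^ b" "g 0 4 = w" for g
    by (rule runs_Seq', rule st[where c = "(2 ^ b) ^ 12"], use that in \<open>simp add: rval_rpow S_def\<close>, rule 6)
      (use that in \<open>auto simp: upd2_apply rcost_rpow\<close>)
  have 4: "runs p (Seq ?l ?c5) (S g) ((b * 17 + 9) + (60 + 170)) R"
    if g0: "g 0 0 = 1" "g 0 4 = w" "g 0 5 = q0" for g
  proof (rule runs_Seq')
    define I where "I i s' \<longleftrightarrow> (\<exists>g. s' = S g \<and> g 0 0 = 2 ^ i \<and> g 0 4 = w \<and> g 0 5 = q0)" for i and s' :: store
    show "runs p ?l (S g) (b * 17 + 9) (\<lambda>s'. runs p ?c5 s' (60 + 170) R)"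
    proof (rule runs_While[where I = I and n = b and K = 8])
      fix i s' assume i: "i < b" and "I i s'"
      then obtain g where s': "s' = S g" and g: "g 0 0 = 2 ^ i" "g 0 4 = w" "g 0 5 = q0" unfolding I_def by blast
      have "bval (BNot (RLe (cell 6 5) (cell 6 0))) s'" using b(2)[OF i] g by (simp add: s' S_def)
      moreover have "runs p (set_cell 6 0 (RMul (RConst 2) (cell 6 0))) s' 8 (I (Suc i))"
        unfolding s' by (rule st[where c = "2 ^ Suc i"])
          (use g in \<open>auto simp: S_def I_def upd2_apply intro!: exI[of _ "upd2 g 0 0 (2 * 2 ^ i)"]\<close>)
      ultimately show "bval (BNot (RLe (cell 6 5) (cell 6 0))) s' \<and>
         runs p (set_cell 6 0 (RMul (RConst 2) (cell 6 0))) s' 8 (I (Suc i))" by blast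
    next
      fix s' assume "I b s'"
      then obtain g where s': "s' = S g" and g: "g 0 0 = 2 ^ b" "g 0 4 = w" "g 0 5 = q0" unfolding I_def by blast
      show "\<not> bval (BNot (RLe (cell 6 5) (cell 6 0))) s' \<and> runs p ?c5 s' (60 + 170) R"
        using 5[of g] g b(1) by (simp add: s') (simp add: S_def)
    qed (use g0 in \<open>auto simp: I_def\<close>)
  qed
  have "runs p (scale_com c0) (S (rarr s 6)) (30 + (60 + (4 + ((b * 17 + 9) + (60 + 170))))) R"
    unfolding scale_com_def
    apply (rule runs_Seq', rule st[OF rw])
     apply (rule runs_Seq', rule st[OF rq])
       apply (simp add: upd2_apply)
      apply (rule runs_Seq', rule st[where c = 1])
        apply simp
       apply (rule 4)
    by (simp_all add: upd2_apply weight_exp_def bound_exp_def)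
  then show ?thesis unfolding s0[symmetric] by (rule runs_weaken) simp
qed

lemma runs_tables:
  assumes iv: "ivar s 0 = int n" "ivar s 1 = int d" "ivar s 2 = int k"
    and r6: "rarr s 6 0 0 = Q" "rarr s 6 0 1 = N" "rarr s 5 0 1 = X"
    and r1: "\<forall>l<d. \<forall>c<k. rarr s 1 (int l) (int c) = C $$ (l, c)"
    and R: "\<And>s'. samei {7, 8, 9, 19, 20} s s' \<Longrightarrow> rarr s' 5 0 1 = X \<Longrightarrow>
       (\<forall>i<n+2*k. rarr s' 7 0 (int i) = 1) \<Longrightarrow> (\<forall>i<n+2*k. rarr s' 8 0 (int i) = 1 / N) \<Longrightarrow>
       rarr s' 20 0 0 = (\<Sum>l<2*k. Q * X ^ l) \<Longrightarrow>
       (\<forall>l<d. rarr s' 9 0 (int l) = (\<Sum>c<k. C $$ (l, c) * X ^ c)) \<Longrightarrow> R s'"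
  shows "runs p tables_com s (200 * (n + 2 * k + 1) + 200 * (d + 1) * (k + 1)) R"
proof -
  have mk: "int k + int k = int (2 * k)" by simp
  let ?c5 = "For 6 (IVar 1) (Call pack_proc [IVar 2, IVar 6, zE, IVar 6] [1, 9, 5])"
  let ?c4 = "Seq (Call pack_proc [mE, zE, zE, zE] [19, 20, 5]) ?c5"
  let ?c3 = "Seq (For 5 mE (RStore 19 zE (IVar 5) (cell 6 0))) ?c4"
  let ?c2 = "Seq (For 5 (IAdd (IVar 0) mE) (RStore 8 zE (IVar 5) (RDiv (RConst 1) (cell 6 1)))) ?c3"
  have "runs p tables_com s ((40 * (n + 2 * k) + 20) + ((40 * (n + 2 * k) + 20) + ((40 * (2 * k) + 20) +
      (100 * (2 * k + 1) + (d * (100 * (k + 1) + 10) + 9))))) R"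
    unfolding tables_com_def
  proof (rule runs_Seq', rule runs_map[where y = 0 and z = 0 and n = "n + 2 * k" and g = "\<lambda>_. 1"])
    define s1 where "s1 = s\<lparr>ivar := (ivar s)(5 := int (n + 2 * k)), rarr := (rarr s)(7 := upd_row (rarr s 7) 0 0 (n + 2 * k) (\<lambda>_. 1))\<rparr>"
    have "runs p ?c2 s1 ((40 * (n + 2 * k) + 20) + ((40 * (2 * k) + 20) + (100 * (2 * k + 1) + (d * (100 * (k + 1) + 10) + 9)))) R"
    proof (rule runs_Seq', rule runs_map[where y = 0 and z = 0 and n = "n + 2 * k" and g = "\<lambda>_. 1 / N"])
      define s2 where "s2 = s1\<lparr>ivar := (ivar s1)(5 := int (n + 2 * k)), rarr := (rarr s1)(8 := upd_row (rarr s1 8) 0 0 (n + 2 * k) (\<lambda>_. 1 / N))\<rparr>"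
      have "runs p ?c3 s2 ((40 * (2 * k) + 20) + (100 * (2 * k + 1) + (d * (100 * (k + 1) + 10) + 9))) R"
      proof (rule runs_Seq', rule runs_map[where y = 0 and z = 0 and n = "2 * k" and g = "\<lambda>_. Q"])
        define s3 where "s3 = s2\<lparr>ivar := (ivar s2)(5 := int (2 * k)), rarr := (rarr s2)(19 := upd_row (rarr s2 19) 0 0 (2 * k) (\<lambda>_. Q))\<rparr>"
        have iv3: "ivar s3 0 = int n" "ivar s3 1 = int d" "ivar s3 2 = int k"
          using iv by (simp_all add: s3_def s2_def s1_def)
        have "runs p ?c4 s3 (100 * (2 * k + 1) + (d * (100 * (k + 1) + 10) + 9)) R"
        proof (rule runs_Seq', rule runs_pack'[where X = X and L = "2 * k" and rw = 0 and off = 0 and di = 0])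
          fix s4 assume s4: "same {20} s3 s4"
            "rarr s4 20 = upd2 (rarr s3 20) 0 0 (\<Sum>i<2*k. rarr s3 19 0 (0 + int i) * X ^ i)"
          define I where "I i s' \<longleftrightarrow> samei {9} s4 s' \<and> rarr s' 5 0 1 = X \<and>
            (\<forall>l<i. rarr s' 9 0 (int l) = (\<Sum>c<k. C $$ (l, c) * X ^ c))" for i and s' :: store
          have x4: "rarr s4 5 0 1 = X" using s4(1) r6 by (simp add: same_def s3_def s2_def s1_def)
          have iv4: "ivar s4 0 = int n" "ivar s4 1 = int d" "ivar s4 2 = int k"
            using iv3 same_ivar[OF s4(1)] by simp_all
          have r1': "rarr s4 1 = rarr s 1" using same_rarr[OF s4(1), of 1] by (simp add: s3_def s2_def s1_def)
          show "runs p ?c5 s4 (d * (100 * (k + 1) + 10) + 9) R"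
          proof (rule runs_For[where I = I and n = d and K = "100 * (k + 1)"])
            fix i s' assume i: "i < d" and I: "I i s'" and v: "ivar s' 6 = int i"
            have r: "rarr s' 1 = rarr s 1" "ivar s' 2 = int k" using I iv4 r1' by (simp_all add: I_def samei_def)
            show "runs p (Call pack_proc [IVar 2, IVar 6, zE, IVar 6] [1, 9, 5]) s' (100 * (k + 1))
              (\<lambda>s'. ivar s' 6 = int i \<and> I (Suc i) (s'\<lparr>ivar := (ivar s')(6 := int (Suc i))\<rparr>))"
            proof (rule runs_pack'[where X = X and L = k and rw = "int i" and off = 0 and di = "int i"])
              fix s'' assume s'': "same {9} s' s''"
                "rarr s'' 9 = upd2 (rarr s' 9) 0 (int i) (\<Sum>c<k. rarr s' 1 (int i) (0 + int c) * X ^ c)"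
              show "ivar s'' 6 = int i \<and> I (Suc i) (s''\<lparr>ivar := (ivar s'')(6 := int (Suc i))\<rparr>)"
                using I s'' v i r r1 by (auto simp: I_def same_def samei_def upd2_apply less_Suc_eq)
            qed (use I v r in \<open>simp_all add: I_def\<close>)
          next
            show "I 0 (s4\<lparr>ivar := (ivar s4)(6 := 0)\<rparr>)" using x4 by (simp add: I_def samei_def)
          next
            show "ival (IVar 1) s' = int d" if "I i s'" for i s' using that iv4 by (simp add: I_def samei_def)
          next
            fix s' assume I: "I d s'"
            show "R s'"
            proof (rule R)
              show "samei {7, 8, 9, 19, 20} s s'"
                using I s4(1) by (simp add: I_def samei_def same_def s3_def s2_def s1_def)
              show "rarr s' 5 0 1 = X" using I by (simp add: I_def)
              have "rarr s' 7 = rarr s3 7" "rarr s' 8 = rarr s3 8" "rarr s' 20 = rarr s4 20"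
                using I s4(1) by (simp_all add: I_def samei_def same_def)
              then show "\<forall>i<n+2*k. rarr s' 7 0 (int i) = 1" "\<forall>i<n+2*k. rarr s' 8 0 (int i) = 1 / N"
                "rarr s' 20 0 0 = (\<Sum>l<2*k. Q * X ^ l)"
                using s4(2) by (simp_all add: s3_def s2_def s1_def upd_row_apply0 upd2_apply)
              show "\<forall>l<d. rarr s' 9 0 (int l) = (\<Sum>c<k. C $$ (l, c) * X ^ c)" using I by (simp add: I_def)
            qed
          qed (simp add: algebra_simps)
        qed (use iv3 r6 in \<open>simp_all add: s3_def s2_def s1_def\<close>)
        then show "runs p ?c4 (s2\<lparr>ivar := (ivar s2)(5 := int (2 * k)), rarr := (rarr s2)(19 := upd_row (rarr s2 19) 0 0 (2 * k) (\<lambda>_. Q))\<rparr>)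
          (100 * (2 * k + 1) + (d * (100 * (k + 1) + 10) + 9)) R" by (simp only: s3_def)
      qed (use iv r6 in \<open>simp_all add: s2_def s1_def mk\<close>)
      then show "runs p ?c3 (s1\<lparr>ivar := (ivar s1)(5 := int (n + 2 * k)), rarr := (rarr s1)(8 := upd_row (rarr s1 8) 0 0 (n + 2 * k) (\<lambda>_. 1 / N))\<rparr>)
        ((40 * (2 * k) + 20) + (100 * (2 * k + 1) + (d * (100 * (k + 1) + 10) + 9))) R" by (simp only: s2_def)
    qed (use iv r6 in \<open>simp_all add: s1_def mk\<close>)
    then show "runs p ?c2 (s\<lparr>ivar := (ivar s)(5 := int (n + 2 * k)), rarr := (rarr s)(7 := upd_row (rarr s 7) 0 0 (n + 2 * k) (\<lambda>_. 1))\<rparr>)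
      ((40 * (n + 2 * k) + 20) + ((40 * (2 * k) + 20) + (100 * (2 * k + 1) + (d * (100 * (k + 1) + 10) + 9)))) R" by (simp only: s1_def)
  qed (use iv in \<open>simp_all add: mk\<close>)
  then show ?thesis
    by (rule runs_weaken) (simp add: algebra_simps)
qed

definition with_rows :: "nat \<Rightarrow> nat \<Rightarrow> real \<Rightarrow> real mat \<Rightarrow> nat \<Rightarrow> (int \<Rightarrow> int \<Rightarrow> real) \<Rightarrow> int \<Rightarrow> int \<Rightarrow> real" where
  "with_rows n d w C i g = (\<lambda>x y. if int n \<le> x \<and> x < int (n + i) \<and> 0 \<le> y \<and> y < int d
     then w * C $$ (nat y, nat x - n) else g x y)"

definition append_rows_com :: com where
  "append_rows_com = For 6 (IVar 2) (For 5 (IVar 1)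
     (RStore 0 (IAdd (IVar 0) (IVar 6)) (IVar 5) (RMul (cell 6 4) (RCell 1 (IVar 5) (IVar 6)))))"

lemma with_rows_Suc:
  "upd_row (with_rows n d w C i g) (int (n + i)) 0 d (\<lambda>l. w * C $$ (l, i)) = with_rows n d w C (Suc i) g"
  by (auto simp: with_rows_def upd_row_def fun_eq_iff nat_int_add)

lemma runs_append_rows:
  assumes iv: "ivar s 0 = int n" "ivar s 1 = int d" "ivar s 2 = int k"
    and w: "rarr s 6 0 4 = w" and r1: "\<forall>l<d. \<forall>c<k. rarr s 1 (int l) (int c) = C $$ (l, c)"
    and R: "\<And>s'. (\<forall>x. x \<noteq> 5 \<longrightarrow> x \<noteq> 6 \<longrightarrow> ivar s' x = ivar s x) \<Longrightarrow> iarr s' = iarr s \<Longrightarrow>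
      rarr s' = (rarr s)(0 := with_rows n d w C k (rarr s 0)) \<Longrightarrow> R s'"
  shows "runs p append_rows_com s (k * (22 * d + 20) + 9) R"
  unfolding append_rows_com_def
proof -
  define I where "I i s' \<longleftrightarrow> (\<forall>x. x \<noteq> 5 \<longrightarrow> x \<noteq> 6 \<longrightarrow> ivar s' x = ivar s x) \<and> iarr s' = iarr s \<and>
    rarr s' = (rarr s)(0 := with_rows n d w C i (rarr s 0))" for i and s' :: store
  show "runs p (For 6 (IVar 2) (For 5 (IVar 1)
     (RStore 0 (IAdd (IVar 0) (IVar 6)) (IVar 5) (RMul (cell 6 4) (RCell 1 (IVar 5) (IVar 6)))))) s
     (k * (22 * d + 20) + 9) R"
  proof (rule runs_For[where I = I and n = k and K = "22 * d + 10"])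
    fix i s' assume i: "i < k" and I: "I i s'" and v: "ivar s' 6 = int i"
    have iv': "ivar s' 0 = int n" "ivar s' 1 = int d" using I iv by (simp_all add: I_def)
    have r: "rarr s' 6 = rarr s 6" "rarr s' 1 = rarr s 1" using I by (simp_all add: I_def)
    show "runs p (For 5 (IVar 1) (RStore 0 (IAdd (IVar 0) (IVar 6)) (IVar 5) (RMul (cell 6 4) (RCell 1 (IVar 5) (IVar 6)))))
       s' (22 * d + 10) (\<lambda>s'. ivar s' 6 = int i \<and> I (Suc i) (s'\<lparr>ivar := (ivar s')(6 := int (Suc i))\<rparr>))"
    proof (rule runs_map[where y = "int (n + i)" and z = 0 and n = d and g = "\<lambda>l. w * C $$ (l, i)"])
      let ?s = "s'\<lparr>ivar := (ivar s')(5 := int d), rarr := (rarr s')(0 := upd_row (rarr s' 0) (int (n + i)) 0 d (\<lambda>l. w * C $$ (l, i)))\<rparr>"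
      have "rarr s' 0 = with_rows n d w C i (rarr s 0)" using I by (simp add: I_def)
      then have "rarr ?s = (rarr s)(0 := with_rows n d w C (Suc i) (rarr s 0))"
        using I by (simp only: with_rows_Suc) (simp add: I_def)
      then show "ivar ?s 6 = int i \<and> I (Suc i) (?s\<lparr>ivar := (ivar ?s)(6 := int (Suc i))\<rparr>)"
        using I v by (simp add: I_def)
    qed (use iv' v r w r1 i in simp_all)
  next
    show "I 0 (s\<lparr>ivar := (ivar s)(6 := 0)\<rparr>)" by (simp add: I_def with_rows_def fun_eq_iff)
  next
    show "ival (IVar 2) s' = int k" if "I i s'" for i s' using that iv by (simp add: I_def)
  next
    show "R s'" if "I k s'" for s' by (rule R) (use that in \<open>simp_all add: I_def\<close>)
  qed simp
qed

lemma runs_direct: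
  assumes iv: "ivar s 0 = int n" "ivar s 1 = int d" "ivar s 2 = int k"
    and A: "A \<in> carrier_mat n d" and C: "C \<in> carrier_mat d k"
    and X: "rarr s 5 0 1 = 2 ^ B" "2 \<le> B"
    and rA: "\<forall>j<n. \<forall>l<d. rarr s 0 (int j) (int l) = A $$ (j, l)"
    and r9: "\<forall>l<d. rarr s 9 0 (int l) = (\<Sum>c<k. C $$ (l, c) * (2 ^ B) ^ c)"
    and r7: "\<forall>c<k. rarr s 7 0 (int c) = 1"
    and y: "\<And>j c. j < n \<Longrightarrow> c < k \<Longrightarrow> (A * C) $$ (j, c) \<in> \<int>" "\<And>j c. j < n \<Longrightarrow> c < k \<Longrightarrow> \<bar>(A * C) $$ (j, c)\<bar> * 4 \<le> 2 ^ B"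
    and R: "\<And>s'. (\<forall>j<n. \<forall>c<k. rarr s' 3 (int j) (int c) = (A * C) $$ (j, c)) \<Longrightarrow>
       rarr s' 0 = rarr s 0 \<Longrightarrow> rarr s' 1 = rarr s 1 \<Longrightarrow> rarr s' 2 = rarr s 2 \<Longrightarrow> R s'"
  shows "runs p (For 3 (IVar 0) (Seq exact_com out_com)) s (n * ((300 * (d + k + 1) * (B + 1) + (20 * k + 9)) + 10) + 9) R"
proof -
  define I where "I j s' \<longleftrightarrow> (\<forall>x. x \<noteq> 3 \<longrightarrow> x \<noteq> 5 \<longrightarrow> ivar s' x = ivar s x) \<and>
    (\<forall>a. a \<noteq> 3 \<longrightarrow> a \<noteq> 13 \<longrightarrow> a \<noteq> 5 \<longrightarrow> rarr s' a = rarr s a) \<and> rarr s' 5 0 1 = 2 ^ B \<and>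
    (\<forall>i<j. \<forall>c<k. rarr s' 3 (int i) (int c) = (A * C) $$ (i, c))" for j and s' :: store
  show ?thesis
  proof (rule runs_For[where I = I and n = n and K = "300 * (d + k + 1) * (B + 1) + (20 * k + 9)"])
    fix j s' assume j: "j < n" and I: "I j s'" and v: "ivar s' 3 = int j"
    have iv': "ivar s' 1 = int d" "ivar s' 2 = int k" using I iv by (simp_all add: I_def)
    have r: "rarr s' 0 = rarr s 0" "rarr s' 9 = rarr s 9" "rarr s' 7 = rarr s 7" "rarr s' 5 0 1 = 2 ^ B"
      using I by (simp_all add: I_def)
    show "runs p (Seq exact_com out_com) s' (300 * (d + k + 1) * (B + 1) + (20 * k + 9))
       (\<lambda>s'. ivar s' 3 = int j \<and> I (Suc j) (s'\<lparr>ivar := (ivar s')(3 := int (Suc j))\<rparr>))"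
    proof (rule runs_Seq', rule runs_exact[OF iv' v j A C r(4) X(2)])
      fix s1 assume s1: "same {13} s' s1" and y1: "\<forall>c<k. rarr s1 13 0 (int c) = (A * C) $$ (j, c)"
      show "runs p out_com s1 (20 * k + 9) (\<lambda>s'. ivar s' 3 = int j \<and> I (Suc j) (s'\<lparr>ivar := (ivar s')(3 := int (Suc j))\<rparr>))"
      proof (rule runs_out)
        fix s2 assume s2: "same {3} s1 s2" "rarr s2 3 = upd_row (rarr s1 3) (int j) 0 k (\<lambda>c. rarr s1 13 0 (int c))"
        have "rarr s2 3 = upd_row (rarr s' 3) (int j) 0 k (\<lambda>c. rarr s1 13 0 (int c))"
          using s2(2) same_rarr[OF s1, of 3] by simp
        then have "\<forall>i<Suc j. \<forall>c<k. rarr s2 3 (int i) (int c) = (A * C) $$ (i, c)"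
          using I y1 by (auto simp: I_def upd_row_def less_Suc_eq simp del: index_mult_mat)
        moreover have "(\<forall>x. x \<noteq> 3 \<longrightarrow> x \<noteq> 5 \<longrightarrow> ivar s2 x = ivar s x)"
          "(\<forall>a. a \<noteq> 3 \<longrightarrow> a \<noteq> 13 \<longrightarrow> a \<noteq> 5 \<longrightarrow> rarr s2 a = rarr s a)" "rarr s2 5 0 1 = 2 ^ B"
          using I s1 s2(1) by (simp_all add: I_def same_def)
        ultimately show "ivar s2 3 = int j \<and> I (Suc j) (s2\<lparr>ivar := (ivar s2)(3 := int (Suc j))\<rparr>)"
          using v same_ivar[OF s1, of 3] same_ivar[OF s2(1), of 3] by (simp add: I_def del: index_mult_mat)
      qed (use iv' v same_ivar[OF s1] in simp_all)
    qed (use j r rA r9 r7 y in \<open>simp_all del: index_mult_mat\<close>)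
  next
    show "I 0 (s\<lparr>ivar := (ivar s)(3 := 0)\<rparr>)" using X by (simp add: I_def)
  next
    show "ival (IVar 0) s' = int n" if "I i s'" for i s' using that iv by (simp add: I_def)
  next
    show "R s'" if "I n s'" for s'
      by (rule R) (use that in \<open>simp_all add: I_def del: index_mult_mat\<close>)
  qed simp
qed

section \<open>The complete program\<close>

text \<open>For \<open>k > n\<close> the rank \<open>2k\<close> is not admissible, but then a direct computation of all rows is cheap enough.\<close>

definition product_program :: "com \<Rightarrow> real \<Rightarrow> com" where
  "product_program \<A> c0 = Seq (scale_com c0) (Seq tables_com (If (ILe (IVar 2) (IVar 0))
     (Seq append_rows_com (Seq (Call \<A> [IAdd (IVar 0) (IVar 2), IVar 1, mE] [0, 4])
       (Seq (set_cell 22 0 (RConst 1)) (For 3 (IVar 0) row_com))))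
     (For 3 (IVar 0) (Seq exact_com out_com))))"

text \<open>In this order: the demand of the locale \<open>gram\<close> on the number of rows, its
  demand on \<open>m = 2 * k\<close>, the size of the entries of A C, and the bound that makes
  rounding Z harmless.\<close>

lemma precision_bounds:
  fixes w D :: real
  assumes w: "0 \<le> w" and D: "0 \<le> D"
    and q0: "q0 = 100 * (real n + 3) * (2 * real k + 2) * (1 + (real n + real k * w + 1) * D)"
  shows "100 * (real n + 2) \<le> q0" "2 * real k + 1 \<le> q0" "D \<le> q0"
    "50 * (2 * real k) * (real n + 3) * ((real n + real k * w) * D) \<le> q0"
proof -
  define E where "E = (real n + real k * w) * D"
  have E: "0 \<le> E" using w D by (simp add: E_def)
  have q: "q0 = (100 * (real n + 3) * (2 * real k + 2)) * (1 + E + D)"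
    unfolding q0 E_def by (simp add: algebra_simps)
  have P: "100 * (real n + 2) \<le> 100 * (real n + 3) * (2 * real k + 2)"
    "2 * real k + 1 \<le> 100 * (real n + 3) * (2 * real k + 2)" "1 \<le> 100 * (real n + 3) * (2 * real k + 2)"
    by (simp_all add: algebra_simps)
  have le: "x \<le> q0" if "x \<le> 100 * (real n + 3) * (2 * real k + 2)" for x
    unfolding q using mult_mono[OF that, of 1 "1 + E + D"] P(3) E D by simp
  show "100 * (real n + 2) \<le> q0" "2 * real k + 1 \<le> q0" using le P by blast+
  have "1 * D \<le> q0" unfolding q by (rule mult_mono[OF P(3)]) (use E D in simp_all)
  then show "D \<le> q0" by simp
  have "(50 * (2 * real k) * (real n + 3)) * E \<le> q0" unfolding q
    by (rule mult_mono) (use E D in \<open>simp_all add: algebra_simps\<close>)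
  then show "50 * (2 * real k) * (real n + 3) * ((real n + real k * w) * D) \<le> q0" by (simp only: E_def)
qed

text \<open>The main terms are \<open>n\<close> rows at cost M B, of order k b^2, and 16 b k direct
  rows at cost (d + M) B. The latter yield d k b^2 and k^2 b^3, and k <= n turns k^2 into n
  k.\<close>

lemma overhead_main:
  fixes n d k b M B :: nat
  assumes p: "1 \<le> n" "1 \<le> d" "1 \<le> k" "1 \<le> b" and kn: "k \<le> n"
    and M: "M = 2 * k + 8 * b * (2 * k) + k + 1" and B: "B = 40 * b"
  shows "(400 + 20 * b) + ((200 * (n + 2 * k + 1) + 200 * (d + 1) * (k + 1)) + (4 + ((k * (22 * d + 20) + 9) + (10 + (4 +
      (n * (7000 * (M + 1) * (B + 1) + 10) + 1000 * (d + M + 1) * (B + 1) * (8 * b * (2 * k)) + 9))))))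
    \<le> 30000000 * ((n + d) * k * b ^ 3)"
proof -
  let ?S = "(n + d) * k * b ^ 3"
  have S: "n * k * b ^ 3 \<le> ?S" "d * k * b ^ 3 \<le> ?S" by (simp_all add: algebra_simps)
  have b: "1 \<le> b ^ 3" "b \<le> b ^ 3" "b * b \<le> b ^ 3" using p
    by (simp_all add: power3_eq_cube)
  have bk: "1 \<le> b * k" "k \<le> b * k" using p by (simp_all)
  have "M + 1 = 16 * (b * k) + 3 * k + 2" by (simp add: M algebra_simps)
  then have M1: "M + 1 \<le> 21 * (b * k)" using bk by linarith
  have B1: "B + 1 \<le> 41 * b" using p unfolding B by simp
  have a: "x * k * y \<le> ?S" if "x \<le> n \<or> x \<le> d" "y \<le> b ^ 3" for x y
    using that by (intro mult_le_mono) auto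
  have "n * (7000 * (M + 1) * (B + 1) + 10) \<le> n * (7000 * (21 * (b * k)) * (41 * b) + 10)"
    using M1 B1 by (intro mult_le_mono add_mono) auto
  also have "\<dots> = 6027000 * (n * k * (b * b)) + 10 * n" by (simp add: algebra_simps)
  finally have 1: "n * (7000 * (M + 1) * (B + 1) + 10) \<le> 6027000 * (n * k * (b * b)) + 10 * n" .
  have "1000 * (d + M + 1) * (B + 1) * (8 * b * (2 * k)) \<le> 1000 * (d + 21 * (b * k)) * (41 * b) * (8 * b * (2 * k))"
    using M1 B1 by (intro mult_le_mono) auto
  also have "\<dots> = 656000 * (d * k * (b * b)) + 13776000 * (k * k * b ^ 3)"
    by (simp add: algebra_simps power3_eq_cube)
  finally have 2: "1000 * (d + M + 1) * (B + 1) * (8 * b * (2 * k)) \<le> 656000 * (d * k * (b * b)) + 13776000 * (k * k * b ^ 3)" .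
  have m: "n * k * (b * b) \<le> ?S" "d * k * (b * b) \<le> ?S" "k * k * b ^ 3 \<le> ?S" "d * k * 1 \<le> ?S" "n * k * 1 \<le> ?S" "1 * k * b \<le> ?S"
    by (rule a; use b kn p in simp)+
  have 3: "n \<le> n * k" "d \<le> d * k" "k \<le> n * k" "b \<le> k * b" "1 \<le> n * k" using p by simp_all
  have 4: "200 * (d + 1) * (k + 1) = 200 * (d * k) + 200 * d + 200 * k + 200" "k * (22 * d + 20) = 22 * (d * k) + 20 * k"
    by (simp_all add: algebra_simps)
  have fin: "(400 + 20 * b) + ((200 * (n + 2 * k + 1) + (200 * dk + 200 * d + 200 * k + 200)) + (4 + ((22 * dk + 20 * k + 9) + (10 + (4 +
      (X + Y + 9)))))) \<le> 30000000 * S"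
    if "X \<le> 6027000 * S + 10 * n" "Y \<le> 656000 * S + 13776000 * S" "n \<le> S" "d \<le> S" "k \<le> S" "b \<le> S" "1 \<le> S" "dk \<le> S"
    for X Y S dk :: nat
  proof -
    have "(400 + 20 * b) + ((200 * (n + 2 * k + 1) + (200 * dk + 200 * d + 200 * k + 200)) + (4 + ((22 * dk + 20 * k + 9) + (10 + (4 +
      (X + Y + 9)))))) = 836 + 20 * b + 200 * n + 620 * k + 222 * dk + 200 * d + X + Y" by simp
    then show ?thesis using that by linarith
  qed
  show ?thesis unfolding 4
  proof (rule fin)
    show "n * (7000 * (M + 1) * (B + 1) + 10) \<le> 6027000 * ?S + 10 * n" using 1 m(1) by linarith
    show "1000 * (d + M + 1) * (B + 1) * (8 * b * (2 * k)) \<le> 656000 * ?S + 13776000 * ?S" using 2 m(2,3) by linarith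
    show "n \<le> ?S" "d \<le> ?S" "k \<le> ?S" "b \<le> ?S" "1 \<le> ?S" "d * k \<le> ?S" using m(4-6) 3 by (simp_all only: mult_1 mult_1_right)
  qed
qed

text \<open>The critical term is n d, from reading \<open>n\<close> rows of length \<open>d\<close>;
  n <= k turns it into d k.\<close>

lemma overhead_direct:
  fixes n d k b B :: nat
  assumes p: "1 \<le> n" "1 \<le> d" "1 \<le> k" "1 \<le> b" and nk: "n \<le> k" and B: "B = 40 * b"
  shows "(400 + 20 * b) + ((200 * (n + 2 * k + 1) + 200 * (d + 1) * (k + 1)) + (4 +
      (n * ((300 * (d + k + 1) * (B + 1) + (20 * k + 9)) + 10) + 9)))
    \<le> 30000000 * ((n + d) * k * b ^ 3)"
proof -
  let ?S = "(n + d) * k * b ^ 3"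
  have b: "1 \<le> b ^ 3" "b \<le> b ^ 3" using p
    by (simp_all add: power3_eq_cube)
  have B1: "B + 1 \<le> 41 * b" using p unfolding B by simp
  have a: "x * k * y \<le> ?S" if "x \<le> n \<or> x \<le> d" "y \<le> b ^ 3" for x y
    using that by (intro mult_le_mono) auto
  have dn: "n * (d + k + 1) \<le> d * k + 2 * (n * k)"
  proof -
    have "n * d \<le> d * k" "n \<le> n * k" using nk p by (simp_all add: mult.commute)
    moreover have "n * (d + k + 1) = n * d + n * k + n" by (simp add: algebra_simps)
    ultimately show ?thesis by linarith
  qed
  have "n * ((300 * (d + k + 1) * (B + 1) + (20 * k + 9)) + 10) = 300 * (n * (d + k + 1)) * (B + 1) + 20 * (n * k) + 19 * n"
    by (simp add: algebra_simps)
  also have "\<dots> \<le> 300 * (d * k + 2 * (n * k)) * (41 * b) + 20 * (n * k) + 19 * n"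
    using dn B1 by (intro add_mono mult_le_mono) auto
  also have "\<dots> = 12300 * (d * k * b) + 24600 * (n * k * b) + 20 * (n * k) + 19 * n" by (simp add: algebra_simps)
  finally have 1: "n * ((300 * (d + k + 1) * (B + 1) + (20 * k + 9)) + 10) \<le> 12300 * (d * k * b) + 24600 * (n * k * b) + 20 * (n * k) + 19 * n" .
  have m: "n * k * b \<le> ?S" "d * k * b \<le> ?S" "d * k * 1 \<le> ?S" "n * k * 1 \<le> ?S" "1 * k * b \<le> ?S"
    by (rule a; use b p in simp)+
  have 3: "n \<le> n * k" "d \<le> d * k" "k \<le> n * k" "b \<le> k * b" "1 \<le> n * k" using p by simp_all
  have 4: "200 * (d + 1) * (k + 1) = 200 * (d * k) + 200 * d + 200 * k + 200"
    by (simp_all add: algebra_simps)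
  have fin: "(400 + 20 * b) + ((200 * (n + 2 * k + 1) + (200 * dk + 200 * d + 200 * k + 200)) + (4 + (X + 9))) \<le> 30000000 * S"
    if "X \<le> 12300 * S + 24600 * S + 20 * S + 19 * n" "n \<le> S" "d \<le> S" "k \<le> S" "b \<le> S" "1 \<le> S" "dk \<le> S"
    for X S dk :: nat
  proof -
    have "(400 + 20 * b) + ((200 * (n + 2 * k + 1) + (200 * dk + 200 * d + 200 * k + 200)) + (4 + (X + 9)))
       = 813 + 20 * b + 200 * n + 600 * k + 200 * dk + 200 * d + X" by simp
    then show ?thesis using that by linarith
  qed
  show ?thesis unfolding 4
  proof (rule fin)
    show "n * ((300 * (d + k + 1) * (B + 1) + (20 * k + 9)) + 10) \<le> 12300 * ?S + 24600 * ?S + 20 * ?S + 19 * n"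
      using 1 m by linarith
    show "n \<le> ?S" "d \<le> ?S" "k \<le> ?S" "b \<le> ?S" "1 \<le> ?S" "d * k \<le> ?S" using m(3-5) 3 by (simp_all only: mult_1 mult_1_right)
  qed
qed

lemma runs_product_program:
  assumes alg: "low_rank_algorithm \<A> T \<Delta>\<^sub>1" and p: "1 \<le> n" "1 \<le> d" "1 \<le> k" "0 \<le> \<Delta>\<^sub>2"
    and A: "A \<in> carrier_mat n d" and C: "C \<in> carrier_mat d k"
    and bA: "\<And>i j. i < n \<Longrightarrow> j < d \<Longrightarrow> A $$ (i, j) \<in> \<int> \<and> \<bar>A $$ (i, j)\<bar> \<le> \<Delta>\<^sub>2"
    and bC: "\<And>i j. i < d \<Longrightarrow> j < k \<Longrightarrow> C $$ (i, j) \<in> \<int> \<and> \<bar>C $$ (i, j)\<bar> \<le> \<Delta>\<^sub>2"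
    and w: "w = 3 * sqrt \<Delta>\<^sub>1 * \<Delta>\<^sub>2\<^sup>2 * real n * real d"
    and q0: "q0 = 100 * (real n + 3) * (2 * real k + 2) * (1 + (real n + real k * w + 1) * (real d * \<Delta>\<^sub>2\<^sup>2))"
    and b: "q0 \<le> 2 ^ b" "\<And>i. i < b \<Longrightarrow> 2 ^ i < q0"
    and M: "S = stack n d k A w C"
  shows "runs p' (product_program \<A> (sqrt \<Delta>\<^sub>1)) (input_store [n, d, k] [A, C, mat 1 1 (\<lambda>_. \<Delta>\<^sub>2)])
    (T S (2 * k) + 30000000 * ((n + d) * k * b ^ 3))
    (\<lambda>s. holds_mat s 0 A \<and> holds_mat s 1 C \<and> holds_mat s 2 (mat 1 1 (\<lambda>_. \<Delta>\<^sub>2)) \<and> holds_mat s 3 (A * C))"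
    (is "runs _ _ ?s0 _ ?R")
proof -
  have \<Delta>1: "0 < \<Delta>\<^sub>1" by (rule low_rank_factor_pos[OF alg])
  have w0: "0 \<le> w" using \<Delta>1 by (simp add: w)
  define D where "D = real d * \<Delta>\<^sub>2\<^sup>2"
  have D0: "0 \<le> D" by (simp add: D_def)
  note qb = precision_bounds[OF w0 D0 q0[folded D_def]]
  have AC: "(A * C) $$ (j, c) = (\<Sum>l<d. A $$ (j, l) * C $$ (l, c))" if "j < n" "c < k" for j c
    by (rule index_mult_mat_sum[OF A C that])
  have AC_int: "(A * C) $$ (j, c) \<in> \<int>" if "j < n" "c < k" for j c
    unfolding AC[OF that] using bA bC that by (intro Ints_sum Ints_mult) auto
  have AC_D: "\<bar>(A * C) $$ (j, c)\<bar> \<le> D" if "j < n" "c < k" for j c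
  proof -
    have "\<bar>A $$ (j, l) * C $$ (l, c)\<bar> \<le> \<Delta>\<^sub>2\<^sup>2" if "l < d" for l
      unfolding abs_mult power2_eq_square using bA[OF \<open>j < n\<close> that] bC[OF that \<open>c < k\<close>] p(4) by (intro mult_mono) auto
    then show ?thesis unfolding AC[OF that] D_def by (rule abs_sum_le_card)
  qed
  have Dle: "D \<le> 2 ^ b" using qb(3) b(1) by simp
  have AC_le: "\<bar>(A * C) $$ (j, c)\<bar> \<le> 2 ^ b" if "j < n" "c < k" for j c
    using AC_D[OF that] Dle by (rule order_trans)
  have b1: "1 \<le> b"
  proof (rule ccontr)
    assume "\<not> 1 \<le> b"
    then have "b = 0" by simp
    then have "q0 \<le> 1" using b(1) by simp
    then show False using qb(1) by simp
  qed
  define B where Bd: "B = 40 * b"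
  have B2: "2 \<le> B" using b1 by (simp add: Bd)
  have X: "(2 ^ b) ^ 40 = (2::real) ^ B" by (simp add: Bd power_mult[symmetric] mult.commute)
  have AC_4: "\<bar>(A * C) $$ (j, c)\<bar> * 4 \<le> 2 ^ B" if "j < n" "c < k" for j c
  proof -
    have "\<bar>(A * C) $$ (j, c)\<bar> * 4 \<le> 2 ^ b * 2 ^ 2" using AC_le[OF that] by simp
    also have "\<dots> \<le> 2 ^ B" unfolding power_add[symmetric] using b1 by (intro power_increasing) (simp_all add: Bd)
    finally show ?thesis .
  qed
  have dims: "dim_row A = n" "dim_col A = d" "dim_row C = d" "dim_col C = k" using A C by auto
  have s0: "ivar ?s0 0 = int n" "ivar ?s0 1 = int d" "ivar ?s0 2 = int k" "rarr ?s0 2 0 0 = \<Delta>\<^sub>2"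
    "rarr ?s0 0 = (\<lambda>x y. if 0 \<le> x \<and> x < int n \<and> 0 \<le> y \<and> y < int d then A $$ (nat x, nat y) else 0)"
    "\<forall>l<d. \<forall>c<k. rarr ?s0 1 (int l) (int c) = C $$ (l, c)"
    "\<And>a. 3 \<le> a \<Longrightarrow> rarr ?s0 a = (\<lambda>_ _. 0)" "iarr ?s0 = (\<lambda>_ _ _. 0)" "ivar ?s0 4 = 0"
    by (auto simp: input_store_def dims nth_Cons' fun_eq_iff)
  have R: "?R s" if "\<forall>j<n. \<forall>l<d. rarr s 0 (int j) (int l) = A $$ (j, l)" "rarr s 1 = rarr ?s0 1" "rarr s 2 = rarr ?s0 2"
    "\<forall>j<n. \<forall>c<k. rarr s 3 (int j) (int c) = (A * C) $$ (j, c)" for s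
    using that s0(4,6) by (auto simp: holds_mat_def dims simp del: index_mult_mat(1))
  let ?main = "Seq append_rows_com (Seq (Call \<A> [IAdd (IVar 0) (IVar 2), IVar 1, mE] [0, 4])
       (Seq (set_cell 22 0 (RConst 1)) (For 3 (IVar 0) row_com)))"
  let ?direct = "For 3 (IVar 0) (Seq exact_com out_com)"
  define Mx where "Mx = 2 * k + 8 * b * (2 * k) + k + 1"
  define cd where "cd = n * ((300 * (d + k + 1) * (B + 1) + (20 * k + 9)) + 10) + 9"
  define cr where "cr = n * (7000 * (Mx + 1) * (B + 1) + 10) + 1000 * (d + Mx + 1) * (B + 1) * (8 * b * (2 * k)) + 9"
  define cm where "cm = (k * (22 * d + 20) + 9) + ((10 + T S (2 * k)) + (4 + cr))"
  define cb where "cb = (if k \<le> n then cm else cd)"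
  have "runs p' (product_program \<A> (sqrt \<Delta>\<^sub>1)) ?s0
     ((400 + 20 * b) + ((200 * (n + 2 * k + 1) + 200 * (d + 1) * (k + 1)) + (4 + cb))) ?R"
    unfolding product_program_def
  proof (rule runs_Seq', rule runs_scale[OF s0(1-4) w q0 b])
    fix s1 assume s1: "samei {6} ?s0 s1" "rarr s1 6 0 0 = 2 ^ b" "rarr s1 6 0 1 = (2 ^ b) ^ 12"
       "rarr s1 6 0 4 = w" "rarr s1 5 0 1 = (2 ^ b) ^ 40" "ivar s1 = ivar ?s0"
    have iv1: "ivar s1 0 = int n" "ivar s1 1 = int d" "ivar s1 2 = int k" using s0 s1(6) by simp_all
    have r1: "\<forall>l<d. \<forall>c<k. rarr s1 1 (int l) (int c) = C $$ (l, c)" using s0(6) s1(1) by (simp add: samei_def)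
    show "runs p' (Seq tables_com (If (ILe (IVar 2) (IVar 0)) ?main ?direct)) s1
       ((200 * (n + 2 * k + 1) + 200 * (d + 1) * (k + 1)) + (4 + cb)) ?R"
    proof (rule runs_Seq', rule runs_tables[OF iv1 s1(2,3,5) r1])
      fix s2 assume s2: "samei {7, 8, 9, 19, 20} s1 s2" "rarr s2 5 0 1 = (2 ^ b) ^ 40"
        "\<forall>i<n+2*k. rarr s2 7 0 (int i) = 1" "\<forall>i<n+2*k. rarr s2 8 0 (int i) = 1 / (2 ^ b) ^ 12"
        "rarr s2 20 0 0 = (\<Sum>l<2*k. 2 ^ b * ((2 ^ b) ^ 40) ^ l)"
        "\<forall>l<d. rarr s2 9 0 (int l) = (\<Sum>c<k. C $$ (l, c) * ((2 ^ b) ^ 40) ^ c)"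
      have iv2: "ivar s2 0 = int n" "ivar s2 1 = int d" "ivar s2 2 = int k" "ivar s2 4 = 0"
        using iv1 s0(9) s1(6) s2(1) by (simp_all add: samei_def)
      have r0: "rarr s2 0 = rarr ?s0 0" "rarr s2 1 = rarr ?s0 1" "rarr s2 2 = rarr ?s0 2" "rarr s2 4 = (\<lambda>_ _. 0)"
        "rarr s2 14 = (\<lambda>_ _. 0)" "rarr s2 6 = rarr s1 6" "iarr s2 = (\<lambda>_ _ _. 0)"
        using s1(1) s2(1) s0(7,8) by (simp_all add: samei_def)
      have rA: "\<forall>j<n. \<forall>l<d. rarr s2 0 (int j) (int l) = A $$ (j, l)" unfolding r0 s0 by simp
      show "runs p' (If (ILe (IVar 2) (IVar 0)) ?main ?direct) s2 (4 + cb) ?R"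
      proof (rule runs_If)
        assume "\<not> bval (ILe (IVar 2) (IVar 0)) s2"
        then have kn: "\<not> k \<le> n" using iv2 by simp
        show "runs p' ?direct s2 cb ?R" unfolding cb_def if_not_P[OF kn] cd_def
        proof (rule runs_direct[OF iv2(1-3) A C _ B2 rA _ _ AC_int AC_4])
          show "rarr s2 5 0 1 = 2 ^ B" using s2(2) by (simp only: X)
          show "\<forall>l<d. rarr s2 9 0 (int l) = (\<Sum>c<k. C $$ (l, c) * (2 ^ B) ^ c)" using s2(6) by (simp only: X)
          show "\<forall>c<k. rarr s2 7 0 (int c) = 1" using s2(3) by simp
        next
          fix s :: store assume "\<forall>j<n. \<forall>c<k. rarr s 3 (int j) (int c) = (A * C) $$ (j, c)"
            "rarr s 0 = rarr s2 0" "rarr s 1 = rarr s2 1" "rarr s 2 = rarr s2 2"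
          then show "?R s" using rA r0 by (intro R) (simp_all del: index_mult_mat)
        qed
      next
        assume "bval (ILe (IVar 2) (IVar 0)) s2"
        then have kn: "k \<le> n" using iv2 by simp
        have Sc: "S \<in> carrier_mat (n + k) d" by (simp add: M stack_def)
        have "1 \<le> d \<and> 1 \<le> 2 * k \<and> 2 * k \<le> n + k" using p kn by simp
        with alg Sc obtain t Z Y where Z: "computes \<A> [n + k, d, 2 * k] [S] t Z" "t \<le> T S (2 * k)"
          "Z \<in> carrier_mat (n + k) (2 * k)" "transpose_mat Z * Z = 1\<^sub>m (2 * k)"
          "best_rank_approx (2 * k) (S * transpose_mat S) Y"
          "(frob_norm (S * transpose_mat S - Z * transpose_mat Z * S * transpose_mat S))\<^sup>2
               \<le> \<Delta>\<^sub>1 * (frob_norm (S * transpose_mat S - Y))\<^sup>2"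
          unfolding low_rank_algorithm_def by metis
        obtain \<alpha> where \<alpha>: "\<And>c. c < k \<Longrightarrow> (\<Sum>j<n. ((A * C) $$ (j, c) - (\<Sum>l<2*k. Z $$ (j, l) * \<alpha> l c))\<^sup>2) \<le> 1/9"
          "\<And>l c. l < 2 * k \<Longrightarrow> c < k \<Longrightarrow> \<bar>\<alpha> l c\<bar> \<le> (real n + real k * w) * (real d * \<Delta>\<^sub>2\<^sup>2)"
          using approx_coefficients[OF p(1,2) \<Delta>1 p(4) A C _ _ w M Z(3-6)] bA bC by blast
        interpret product_setting "2 * k" n "2 ^ b" d k b A C Z \<alpha> "(real n + real k * w) * D"
        proof unfold_locales
          show "100 * (real n + 2) \<le> 2 ^ b" "real (2 * k) + 1 \<le> 2 ^ b" using qb(1,2) b(1) by simp_all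
          show "50 * real (2 * k) * (real n + 3) * ((real n + real k * w) * D) \<le> 2 ^ b" using qb(4) b(1) by simp
          show "\<bar>Z $$ (j, l)\<bar> \<le> 1" if "j < n" "l < 2 * k" for j l
            by (rule orthonormal_entry_le[OF Z(3,4)]) (use that in simp_all)
        qed (use A C AC_int AC_le \<alpha> in \<open>simp_all add: D_def del: index_mult_mat\<close>)
        have BB: "product_setting.B b = B" unfolding Bd by (rule B_def)
        have NN: "gram.N (2 ^ b) = ((2 ^ b) ^ 12 :: real)" by (rule N_def)
        have "runs p' ?main s2 cm ?R" unfolding cm_def
        proof (rule runs_Seq', rule runs_append_rows[OF iv2(1-3)])
          show "rarr s2 6 0 4 = w" using r0(6) s1(4) by simp
          show "\<forall>l<d. \<forall>c<k. rarr s2 1 (int l) (int c) = C $$ (l, c)" using r0(2) s0(6) by simp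
        next
          fix s3 :: store assume s3: "\<forall>x. x \<noteq> 5 \<longrightarrow> x \<noteq> 6 \<longrightarrow> ivar s3 x = ivar s2 x" "iarr s3 = iarr s2"
            "rarr s3 = (rarr s2)(0 := with_rows n d w C k (rarr s2 0))"
          let ?es = "[IAdd (IVar 0) (IVar 2), IVar 1, mE]"
          have iv3: "ivar s3 0 = int n" "ivar s3 1 = int d" "ivar s3 2 = int k" "ivar s3 4 = 0" using s3(1) iv2 by simp_all
          have "rarr s3 0 = (\<lambda>x y. if 0 \<le> x \<and> x < int (n + k) \<and> 0 \<le> y \<and> y < int d then S $$ (nat x, nat y) else 0)"
            unfolding s3(3) r0(1) s0(5) by (auto simp: with_rows_def M stack_def fun_eq_iff)
          moreover have "rarr s3 4 = (\<lambda>_ _. 0)" using s3(3) r0(4) by simp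
          \<comment> \<open>The specification of \<A> speaks of this initial store only, so the
            stores have to be equal: array 0 is zero outside B, array 4 was never written, and the
            integer arrays are zero.\<close>
          ultimately have en: "enter ?es [0, 4] s3 = input_store [n + k, d, 2 * k] [S]"
            using iv3 Sc s3(2) r0(7) by (auto simp: enter_def input_store_def fun_eq_iff nth_Cons' less_Suc_eq)
          obtain sf where sf: "exec \<A> \<A> (input_store [n + k, d, 2 * k] [S]) t sf" "holds_mat sf 0 S" "holds_mat sf 1 Z"
            using Z(1) by (auto simp: computes_def)
          show "runs p' (Seq (Call \<A> ?es [0, 4]) (Seq (set_cell 22 0 (RConst 1)) (For 3 (IVar 0) row_com))) s3
            ((10 + T S (2 * k)) + (4 + cr)) ?R"
          proof (rule runs_Seq', rule runs_Call)
            define s4 where "s4 = leave [0, 4] s3 sf"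
            have iv4: "ivar s4 = ivar s3" by (simp add: s4_def leave_def)
            have r4: "rarr s4 = (rarr s3)(0 := rarr sf 0, 4 := rarr sf 1)"
              by (auto simp: s4_def leave_def fun_eq_iff upt_rec)
            have "runs p' (Seq (set_cell 22 0 (RConst 1)) (For 3 (IVar 0) row_com)) s4 (4 + cr) ?R"
            proof (rule runs_Seq', rule runs_RStore)
              let ?s5 = "s4\<lparr>rarr := (rarr s4)(22 := upd2 (rarr s4 22) (ival (IConst 0) s4) (ival (IConst 0) s4) (rval (RConst 1) s4))\<rparr>"
              have r5: "rarr ?s5 a = rarr s2 a" if "a \<noteq> 0" "a \<noteq> 4" "a \<noteq> 22" for a
                using that by (simp add: r4 s3(3))
              \<comment> \<open>Of array 0 the call preserves at least the entries of B, and the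
                first \<open>n\<close> rows of B are A.\<close>
              have e0: "\<forall>i<n. \<forall>l<d. rarr ?s5 0 (int i) (int l) = A $$ (i, l)"
                using sf(2) Sc by (simp add: r4 holds_mat_def M stack_def)
              have e4: "\<forall>i<n. \<forall>l<2*k. rarr ?s5 4 (int i) (int l) = Z $$ (i, l)"
                using sf(3) Z(3) by (simp add: r4 holds_mat_def)
              have E: "env ?s5" unfolding env_def BB NN
              proof (intro conjI)
                show "ivar ?s5 0 = int n" "ivar ?s5 1 = int d" "ivar ?s5 2 = int k" using iv3 iv4 by simp_all
                show "rarr ?s5 5 0 1 = 2 ^ B" using s2(2) unfolding X by (subst r5) simp_all
                show "rarr ?s5 6 0 1 = (2 ^ b) ^ 12" using r0(6) s1(3) by (subst r5) simp_all
                show "\<forall>i<n+2*k. rarr ?s5 7 0 (int i) = 1" using s2(3) by (subst r5) simp_all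
                show "\<forall>i<n+2*k. rarr ?s5 8 0 (int i) = 1 / (2 ^ b) ^ 12" using s2(4) by (subst r5) simp_all
                show "\<forall>l<d. rarr ?s5 9 0 (int l) = (\<Sum>c<k. C $$ (l, c) * (2 ^ B) ^ c)"
                  using s2(6) unfolding X by (subst r5) simp_all
                show "rarr ?s5 20 0 0 = (\<Sum>l<2*k. 2 ^ b * (2 ^ B) ^ l)" using s2(5) unfolding X by (subst r5) simp_all
              qed (use e0 e4 in blast)+
              have R5: "?R s'" if "rows_done s' n" "rarr s' 0 = rarr ?s5 0" "rarr s' 1 = rarr ?s5 1" "rarr s' 2 = rarr ?s5 2" for s'
                by (rule R) (use that e0 r5[of 1] r5[of 2] r0 in \<open>simp_all add: rows_done_def del: index_mult_mat fun_upd_apply\<close>)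
              show "runs p' (For 3 (IVar 0) row_com) ?s5 cr ?R" unfolding cr_def BB[symmetric]
              proof (rule runs_rows[OF E])
                show "ivar ?s5 4 = 0" using iv3(4) iv4 by simp
                show "rarr ?s5 22 0 0 = 1" by (simp add: upd2_apply)
                show "\<forall>i. rarr ?s5 14 0 (int i) = 0" using r0(5) by (subst r5) simp_all
                show "Mx = 2 * k + 8 * b * (2 * k) + k + 1" by (rule Mx_def)
              qed (use R5 in blast)
            qed simp
            then show "runs \<A> \<A> (enter ?es [0, 4] s3) (T S (2 * k))
              (\<lambda>s'. runs p' (Seq (set_cell 22 0 (RConst 1)) (For 3 (IVar 0) row_com)) (leave [0, 4] s3 s') (4 + cr) ?R)"
              unfolding en by (intro runsI[OF sf(1) Z(2)]) (simp only: s4_def)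
          qed (simp_all add: call_cost_def)
        qed
        then show "runs p' ?main s2 cb ?R" by (simp only: cb_def kn if_True)
      qed simp
    qed
  qed
  moreover have "(400 + 20 * b) + ((200 * (n + 2 * k + 1) + 200 * (d + 1) * (k + 1)) + (4 + cb))
    \<le> T S (2 * k) + 30000000 * ((n + d) * k * b ^ 3)"
  proof (cases "k \<le> n")
    case True
    have r: "x + (y + (z + (u + ((v + t) + q)))) \<le> t + N" if "x + (y + (z + (u + (v + q)))) \<le> N"
      for x y z u v q t N :: nat using that by simp
    show ?thesis unfolding cb_def if_P[OF True] cm_def cr_def
      by (rule r[OF overhead_main[OF p(1-3) b1 True Mx_def Bd]])
  next
    case False
    then have "n \<le> k" by simp
    from overhead_direct[OF p(1-3) b1 this Bd] show ?thesis
      unfolding cb_def if_not_P[OF False] cd_def by (rule trans_le_add2)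
  qed
  ultimately show ?thesis by (rule runs_weaken)
qed

text \<open>Every factor of \<open>q0\<close> is polynomial in \<open>s\<close>: w is O(s^4), the
  last factor O(s^8), and in total q0 <= G s^10. By minimality \<open>b\<close> exceeds the binary
  logarithm of \<open>q0\<close> by less than one. Since s >= 5 gives ln s >= 1, the additive
  constants are absorbed into the factor of ln s.\<close>

lemma precision_exponent:
  fixes \<Delta> c0 w q0 s :: real
  assumes p: "1 \<le> n" "1 \<le> d" "1 \<le> k" "0 \<le> \<Delta>" "0 \<le> c0"
    and w: "w = 3 * c0 * \<Delta>\<^sup>2 * real n * real d"
    and q0: "q0 = 100 * (real n + 3) * (2 * real k + 2) * (1 + (real n + real k * w + 1) * (real d * \<Delta>\<^sup>2))"
    and b: "\<And>i. i < b \<Longrightarrow> 2 ^ i < q0"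
    and s: "s = real n + real d + real k + \<Delta> + 2"
  shows "real b \<le> (1 + (ln (200 * (2 + 3 * c0)) + 10) / ln 2) * ln s"
proof -
  define G where "G = 200 * (2 + 3 * c0)"
  have s5: "5 \<le> s" and le: "real n \<le> s" "real d \<le> s" "real k \<le> s" "\<Delta> \<le> s" "real n + 3 \<le> s" "2 * real k + 2 \<le> 2 * s"
    using p by (simp_all add: s)
  have s1: "1 \<le> s ^ i" for i using s5 by (intro one_le_power) simp
  have w0: "0 \<le> w" using p by (simp add: w)
  have D: "\<Delta>\<^sup>2 \<le> s\<^sup>2" using p le by (intro power_mono) auto
  have "w \<le> 3 * c0 * s\<^sup>2 * s * s" unfolding w using D le p by (intro mult_mono) auto
  then have w4: "w \<le> 3 * c0 * s ^ 4" by (simp add: power2_eq_square power4_eq_xxxx mult.assoc)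
  have "real n + real k * w + 1 \<le> s + s * (3 * c0 * s ^ 4)"
    using le(3) w4 w0 s5 le(5) mult_mono[OF le(3) w4] by simp
  moreover have "s \<le> s * s ^ 4" using s1[of 4] s5 by simp
  moreover have "(1 + 3 * c0) * s ^ 5 = s * s ^ 4 + s * (3 * c0 * s ^ 4)" by (simp add: algebra_simps eval_nat_numeral)
  ultimately have E: "real n + real k * w + 1 \<le> (1 + 3 * c0) * s ^ 5" by linarith
  have "real d * \<Delta>\<^sup>2 \<le> s * s\<^sup>2" using D le by (intro mult_mono) auto
  then have D3: "real d * \<Delta>\<^sup>2 \<le> s ^ 3" by (simp add: power3_eq_cube power2_eq_square)
  have "(real n + real k * w + 1) * (real d * \<Delta>\<^sup>2) \<le> ((1 + 3 * c0) * s ^ 5) * s ^ 3"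
    using p(5) s5 by (intro mult_mono E D3) auto
  also have "\<dots> = (1 + 3 * c0) * s ^ 8" by (simp only: mult.assoc power_add[symmetric]) simp
  finally have F: "1 + (real n + real k * w + 1) * (real d * \<Delta>\<^sup>2) \<le> (2 + 3 * c0) * s ^ 8"
    using s1[of 8] by (simp add: algebra_simps)
  have "q0 \<le> 100 * s * (2 * s) * ((2 + 3 * c0) * s ^ 8)"
    unfolding q0 using le F p w0 s5 by (intro mult_mono) auto
  also have "\<dots> = G * s ^ 10" by (simp add: G_def algebra_simps eval_nat_numeral)
  finally have q: "q0 \<le> G * s ^ 10" .
  have "exp 1 \<le> s" using exp_le s5 by linarith
  then have L1: "1 \<le> ln s" using s5 by (subst ln_ge_iff) auto
  have G1: "1 \<le> G" using p by (simp add: G_def)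
  then have lG: "0 \<le> ln G" by simp
  show ?thesis unfolding G_def[symmetric]
  proof (cases b)
    case 0
    then show "real b \<le> (1 + (ln G + 10) / ln 2) * ln s" using lG L1 by simp
  next
    case (Suc i)
    then have "2 ^ i \<le> G * s ^ 10" using b[of i] q by simp
    then have "ln (2 ^ i) \<le> ln (G * s ^ 10)" using G1 s5 by (subst ln_le_cancel_iff) auto
    then have "real i * ln 2 \<le> ln G + 10 * ln s" using G1 s5 by (simp add: ln_realpow ln_mult)
    also have "\<dots> \<le> (ln G + 10) * ln s" using mult_left_mono[OF L1 lG] by (simp add: algebra_simps)
    finally have "real i \<le> ((ln G + 10) * ln s) / ln 2" by (simp add: pos_le_divide_eq)
    then show "real b \<le> (1 + (ln G + 10) / ln 2) * ln s" using L1 Suc by (simp add: algebra_simps)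
  qed
qed

theorem theorem11:
  fixes \<A> :: com and T :: "real mat \<Rightarrow> nat \<Rightarrow> nat" and \<Delta>\<^sub>1 \<omega> :: real
  assumes "low_rank_algorithm \<A> T \<Delta>\<^sub>1"
    and "matmul_exponent \<omega>"
  shows "\<exists>P (c::real) (e::nat).
    \<forall>(n::nat) (d::nat) (k::nat) (\<Delta>\<^sub>2::real) A C.
      1 \<le> n \<and> 1 \<le> d \<and> 1 \<le> k \<and> 0 \<le> \<Delta>\<^sub>2 \<and>
      A \<in> carrier_mat n d \<and> C \<in> carrier_mat d k \<and>
      (\<forall>i<n. \<forall>j<d. A $$ (i, j) \<in> \<int> \<and> \<bar>A $$ (i, j)\<bar> \<le> \<Delta>\<^sub>2) \<and>
      (\<forall>i<d. \<forall>j<k. C $$ (i, j) \<in> \<int> \<and> \<bar>C $$ (i, j)\<bar> \<le> \<Delta>\<^sub>2) \<longrightarrow>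
      (let w = 3 * sqrt \<Delta>\<^sub>1 * \<Delta>\<^sub>2\<^sup>2 * real n * real d;
           B = transpose_mat (append_cols (transpose_mat A) (w \<cdot>\<^sub>m C))
       in \<exists>t. computes P [n, d, k] [A, C, mat 1 1 (\<lambda>_. \<Delta>\<^sub>2)] t (A * C) \<and>
            real t \<le> real (T B (2 * k)) +
              c * (real n + real d) * real k powr (\<omega> - 1) *
                (ln (real n + real d + real k + \<Delta>\<^sub>2 + 2)) ^ e)"
proof -
  \<comment> \<open>The factor from \<open>precision_exponent\<close>. It depends on \<Delta>1
    alone, so it may enter the constant of the running time; the exponent 3 of the logarithm stems
    from b^3 in the overhead.\<close>
  define K where "K = 1 + (ln (200 * (2 + 3 * sqrt \<Delta>\<^sub>1)) + 10) / ln 2"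
  have c0: "0 \<le> sqrt \<Delta>\<^sub>1" using low_rank_factor_pos[OF assms(1)] by simp
  have \<omega>: "2 \<le> \<omega>" using assms(2) by (simp add: matmul_exponent_def)
  show ?thesis
  proof (intro exI[of _ "product_program \<A> (sqrt \<Delta>\<^sub>1)"] exI[of _ "30000000 * K ^ 3"] exI[of _ 3] allI impI)
    fix n d k :: nat and \<Delta>\<^sub>2 :: real and A C
    assume a: "1 \<le> n \<and> 1 \<le> d \<and> 1 \<le> k \<and> 0 \<le> \<Delta>\<^sub>2 \<and>
      A \<in> carrier_mat n d \<and> C \<in> carrier_mat d k \<and>
      (\<forall>i<n. \<forall>j<d. A $$ (i, j) \<in> \<int> \<and> \<bar>A $$ (i, j)\<bar> \<le> \<Delta>\<^sub>2) \<and>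
      (\<forall>i<d. \<forall>j<k. C $$ (i, j) \<in> \<int> \<and> \<bar>C $$ (i, j)\<bar> \<le> \<Delta>\<^sub>2)"
    define w where "w = 3 * sqrt \<Delta>\<^sub>1 * \<Delta>\<^sub>2\<^sup>2 * real n * real d"
    define S where "S = stack n d k A w C"
    define L where "L = ln (real n + real d + real k + \<Delta>\<^sub>2 + 2)"
    define q0 where "q0 = 100 * (real n + 3) * (2 * real k + 2) * (1 + (real n + real k * w + 1) * (real d * \<Delta>\<^sub>2\<^sup>2))"
    define b where "b = (LEAST b. q0 \<le> 2 ^ b)"
    have "\<exists>b. q0 \<le> 2 ^ b" using real_arch_pow[of 2 q0] by (auto intro: less_imp_le)
    then have b: "q0 \<le> 2 ^ b" unfolding b_def by (rule LeastI_ex)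
    have b': "2 ^ i < q0" if "i < b" for i using not_less_Least[OF that[unfolded b_def]] by simp
    have A: "A \<in> carrier_mat n d" and C: "C \<in> carrier_mat d k" and p: "1 \<le> n" "1 \<le> d" "1 \<le> k" "0 \<le> \<Delta>\<^sub>2"
      using a by auto
    have "runs (product_program \<A> (sqrt \<Delta>\<^sub>1)) (product_program \<A> (sqrt \<Delta>\<^sub>1)) (input_store [n, d, k] [A, C, mat 1 1 (\<lambda>_. \<Delta>\<^sub>2)])
      (T S (2 * k) + 30000000 * ((n + d) * k * b ^ 3))
      (\<lambda>s. holds_mat s 0 A \<and> holds_mat s 1 C \<and> holds_mat s 2 (mat 1 1 (\<lambda>_. \<Delta>\<^sub>2)) \<and> holds_mat s 3 (A * C))"
      by (rule runs_product_program[OF assms(1) p A C _ _ w_def q0_def b b' S_def]) (use a in auto)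
    then obtain t s where t: "exec (product_program \<A> (sqrt \<Delta>\<^sub>1)) (product_program \<A> (sqrt \<Delta>\<^sub>1))
        (input_store [n, d, k] [A, C, mat 1 1 (\<lambda>_. \<Delta>\<^sub>2)]) t s"
      "t \<le> T S (2 * k) + 30000000 * ((n + d) * k * b ^ 3)"
      "holds_mat s 0 A" "holds_mat s 1 C" "holds_mat s 2 (mat 1 1 (\<lambda>_. \<Delta>\<^sub>2))" "holds_mat s 3 (A * C)"
      unfolding runs_def by blast
    have "computes (product_program \<A> (sqrt \<Delta>\<^sub>1)) [n, d, k] [A, C, mat 1 1 (\<lambda>_. \<Delta>\<^sub>2)] t (A * C)"
      unfolding computes_def using t by (auto simp: less_Suc_eq numeral_3_eq_3 numeral_2_eq_2)
    moreover have "real t \<le> real (T S (2 * k)) + 30000000 * K ^ 3 * (real n + real d) * real k powr (\<omega> - 1) * L ^ 3"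
    proof -
      have "real t \<le> real (T S (2 * k) + 30000000 * ((n + d) * k * b ^ 3))" using t(2) by (simp only: of_nat_le_iff)
      also have "\<dots> = real (T S (2 * k)) + 30000000 * ((real n + real d) * real k * real b ^ 3)" by simp
      also have "\<dots> \<le> real (T S (2 * k)) + 30000000 * ((real n + real d) * real k powr (\<omega> - 1) * (K * L) ^ 3)"
      proof (intro add_left_mono mult_left_mono mult_mono power_mono)
        show "real k \<le> real k powr (\<omega> - 1)" using powr_mono[of 1 "\<omega> - 1" "real k"] \<omega> p by simp
        show "real b \<le> K * L" unfolding K_def L_def
          by (rule precision_exponent[OF p c0 w_def q0_def b' refl])
      qed simp_all
      finally show ?thesis by (simp add: power_mult_distrib mult_ac)
    qed
    ultimately show "let w = 3 * sqrt \<Delta>\<^sub>1 * \<Delta>\<^sub>2\<^sup>2 * real n * real d;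
           B = transpose_mat (append_cols (transpose_mat A) (w \<cdot>\<^sub>m C))
       in \<exists>t. computes (product_program \<A> (sqrt \<Delta>\<^sub>1)) [n, d, k] [A, C, mat 1 1 (\<lambda>_. \<Delta>\<^sub>2)] t (A * C) \<and>
            real t \<le> real (T B (2 * k)) +
              30000000 * K ^ 3 * (real n + real d) * real k powr (\<omega> - 1) *
                (ln (real n + real d + real k + \<Delta>\<^sub>2 + 2)) ^ 3"
      unfolding Let_def stack_eq[OF A C] w_def[symmetric] S_def[symmetric] L_def[symmetric] by blast
  qed
qed

end
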